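(* Let $H$ be a finite-dimensional Hopf algebra over a field $\Bbbk$ and $(M,\psi)$ an involutive Hopf bimodule over $H$. The linear maps $\mu(\tau_i)$, $\mu(\sigma)$, $\mu(\mathfrak s_{a,b})$ on $\mathbb M_{\mathcal{RK}}=\bigoplus_{\Gamma\in\mathcal{RK}}\mathbb M_\Gamma$ ($i,a,b\in\mathbb N$, $\sigma\in\mathfrak R_{\mathrm{perm}}$) defined in the context extend to a representation $\mu:\mathfrak G=\mathfrak S\rtimes_\vartheta\mathfrak R\to\mathrm{Aut}_\Bbbk(\mathbb M_{\mathcal{RK}})$. Furthermore, for any $\Gamma\in\mathcal{RK}$ and $x\in\mathfrak G$, setting $\mu(x)_\Gamma:=\mu(x)|_{\mathbb M_\Gamma}:\mathbb M_\Gamma\to\mathbb M_{x\bullet\Gamma}$, the following holds for all $d\in D(\mathbb H_\Gamma)$, $m\in\mathbb M_\Gamma$: $$\mu(x)_\Gamma(d\cdot m)=\widehat\mu(x)_\Gamma(d)\cdot\mu(x)_\Gamma(m),$$ where $\cdot$ denotes the actions of the Drinfeld doubles $D(\mathbb H_\Gamma)$ on $\mathbb M_\Gamma$ and $D(\mathbb H_{x\bullet\Gamma})$ on $\mathbb M_{x\bullet\Gamma}$ corresponding to their left-left Yetter--Drinfeld module structures.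
   Context: **Hopf algebra notation.** $\otimes=\otimes_\Bbbk$; $S$ antipode; Sweedler notation. Left-left Yetter--Drinfeld modules over $H$ ($(h\bullet n)_{|-1|}\otimes(h\bullet n)_{|0|}=h_{(1)}n_{|-1|}S(h_{(3)})\otimes h_{(2)}\bullet n_{|0|}$) are the same as left modules over the Drinfeld double $D(H)$. **Involutive Hopf bimodules.** An $H$-bimodule and $H$-bicomodule $M$ (coactions $m_{[-1]}\otimes m_{[0]}$, $m_{[0]}\otimes m_{[1]}$) with $$(h\triangleright m\triangleleft g)_{[-1]}\otimes(h\triangleright m\triangleleft g)_{[0]}\otimes(h\triangleright m\triangleleft g)_{[1]}=h_{(1)}m_{[-1]}g_{(1)}\otimes h_{(2)}\triangleright m_{[0]}\triangleleft g_{(2)}\otimes h_{(3)}m_{[1]}S^{-2}(g_{(3)}),$$ together with a linear involution $\psi:M\to M$ with $\psi(h\triangleright m)=\psi(m)\triangleleft S(h)$ and $\psi(m)_{[-1]}\otimes\psi(m)_{[0]}=S(m_{[1]})\otimes\psi(m_{[0]})$. **Kitaev graphs.** A ribbon graph $(\Gamma,\iota,\rho)$ is a finite set $\Gamma$ of half-edges with a fixed-point free involution $\iota$ and a permutation $\rho$. Vertices $V_\Gamma$, edges $E_\Gamma$, faces $F_\Gamma$ are the cycles (including those of length one) of $\rho$, $\iota$, $\rho^{-1}\iota$; $v_h,e_h,f_h$ are the ones containing $h\in\Gamma$. It is connected if $\langle\iota,\rho\rangle$ acts transitively. A Kitaev graph is a connected ribbon graph with a subset $C_\Gamma\subset\Gamma$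 of cilia such that $C_\Gamma\to V_\Gamma$, $c\mapsto v_c$, and $C_\Gamma\to F_\Gamma$, $c\mapsto f_{\rho^{-1}(c)}$, are bijective, a distinguished cilium $\mathrm{pt}\in C_\Gamma$, and a total order on $\Gamma$ such that for $e_h\ne e_k$: $h<k$ iff $\iota(h)<\iota(k)$. The source of an edge $\{h,\iota(h)\}$ is $s=\min\{h,\iota(h)\}$, its target is $\iota(s)$. Edges are ordered by their sources, cilia by the order of $\Gamma$. **Reduced presentations.** Let $\kappa_\infty=(1\,2)(3\,4)(5\,6)\cdots\in\mathrm{Sym}(\mathbb N)$, $\mathbb N=\{1,2,\dots\}$, and $S_\infty$ the group of finitely supported permutations of $\mathbb N$. $\mathcal{RK}$ is the set of Kitaev graphs given by triples $(\rho,C,\mathrm{pt})$ with $\rho\in S_\infty$, $C\subset\mathbb N$ finite, $\mathrm{pt}\in C$, whose half-edge set $\Gamma$ is the orbit of $C$ under $\langle\rho,\kappa_\infty\rangle$, with $\iota=\kappa_\infty|_\Gamma$, vertex permutation $\rho|_\Gamma$, cilia $C$, distinguished cilium $\mathrm{pt}$, and order inherited from $\mathbb N$. Triples inducing the same Kitaev graph are identified. **Extended Hilbert space.** $\mathbb M_\Gamma=\bigotimes_{e\in E_\Gamma}M_e$, $M_e=M$. For a half-edge $h$, $a\in H$, $\alpha\in H^*$, the operators $L_h(a),T_h(\alpha)$ on $\mathbb M_\Gamma$ are the identity on all factors except $M_{e_h}$, where $L_h(a)m=a\triangleright m$ if $h$ is a target, $L_h(a)m=m\triangleleft S(a)$ if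 $h$ is a source; $T_h(\alpha)m=\alpha(m_{[-1]})m_{[0]}$ if $h$ is a source, $T_h(\alpha)m=\alpha(S(m_{[1]}))m_{[0]}$ if $h$ is a target. For a cilium $c$ let $v_c=[h_1,\dots,h_i]$ with $h_1=c$, $h_{r+1}=\rho(h_r)$, and $f_{\rho^{-1}(c)}=[k_1,\dots,k_j]$ with $k_1=\rho^{-1}(c)$, $k_{r+1}=\rho^{-1}\iota(k_r)$. The vertex action of $H_c=H$ is $a\bullet_cm=L_{h_i}(a_{(i)})\cdots L_{h_1}(a_{(1)})m$; the face coaction $\delta_c$ of $H_c$ is determined by $(\alpha\otimes\mathrm{id})\delta_c(m)=T_{k_j}(\alpha_{(1)})\cdots T_{k_1}(\alpha_{(j)})m$ for $\alpha\in H^*$. These (co)actions commute for different cilia and turn $\mathbb M_\Gamma$ into a left-left Yetter--Drinfeld module over $\mathbb H_\Gamma=\bigotimes_{c\in C_\Gamma}H_c$. **The group $\mathfrak G$ and its action on $\mathcal{RK}$.** $\mathfrak R=\{\sigma\in S_\infty\mid\sigma\kappa_\infty\sigma^{-1}=\kappa_\infty\}=\mathfrak R_{\mathrm{rev}}\rtimes\mathfrak R_{\mathrm{perm}}$ with $\mathfrak R_{\mathrm{rev}}=\langle\tau_i\mid i\in\mathbb N\rangle$, $\tau_i=(2i-1\;\,2i)$, and $\mathfrak R_{\mathrm{perm}}=\langle(i\;\,i+2)(i+1\;\,i+3)\mid i\text{ odd}\rangle$. It acts by $\sigma\bullet(\rho,C,\mathrm{pt})=(\sigma\rho\sigma^{-1},\sigma(C),\sigma(\mathrm{pt}))$.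 $\mathfrak S$ is the group generated by $\mathfrak s_{a,b}$ ($a,b\in\mathbb N$) with relations $\mathfrak s_{a,b}^2=1$. For $\Gamma=(\rho,C,\mathrm{pt})$ and $t=(\kappa_\infty(a)\;b)$: - Condition 1: $a,b\in\Gamma$, $\rho(a)=b$, $b\notin C$, and $b,\rho(b),\kappa_\infty(a)$ pairwise distinct; then $\mathfrak s_{a,b}\bullet\Gamma=((b\;\rho(b)\;\kappa_\infty(a))\rho,t(C),t(\mathrm{pt}))$. - Condition 2: $a,b\in\Gamma$, $\rho(b)=\kappa_\infty(a)$, $\kappa_\infty(a)\notin C$, and $b,\kappa_\infty(a),\rho(a)$ pairwise distinct; then $\mathfrak s_{a,b}\bullet\Gamma=((b\;\kappa_\infty(a)\;\rho(a))\rho,t(C),t(\mathrm{pt}))$. - Otherwise $\mathfrak s_{a,b}\bullet\Gamma=\Gamma$. $\mathfrak G=\mathfrak S\rtimes_\vartheta\mathfrak R$ with $\vartheta(\sigma)(\mathfrak s_{a,b})=\mathfrak s_{\sigma(a),\sigma(b)}$. Each $x\in\mathfrak G$ induces a bijection $C_\Gamma\to C_{x\bullet\Gamma}$ (given by $\sigma$ for $x=\sigma\in\mathfrak R$; by $t$ for $x=\mathfrak s_{a,b}$ under Conditions 1 or 2; by the identity otherwise), and $\widehat\mu(x)_\Gamma:D(\mathbb H_\Gamma)\to D(\mathbb H_{x\bullet\Gamma})$ is the Hopf algebra isomorphism induced by the corresponding permutation of tensor factors. **The maps $\mu$.** Each is a direct sum over $\Gamma\in\mathcal{RK}$ of maps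 $\mathbb M_\Gamma\to\mathbb M_{x\bullet\Gamma}$: - $\mu(\tau_i)_\Gamma$ applies $\psi$ to the tensor factor of the edge $(2i-1\;\,2i)$ if this is an edge of $\Gamma$, and is the identity otherwise. - For $\sigma\in\mathfrak R_{\mathrm{perm}}$, $\mu(\sigma)_\Gamma$ permutes tensor factors according to the bijection $E_\Gamma\to E_{\sigma\bullet\Gamma}$ induced by $\sigma$. - Let $\{h_i\}$ be a basis of $H$ with dual basis $\{\zeta_i\}$ of $H^*$. $\mu(\mathfrak s_{a,b})_\Gamma=\sum_iL_b(h_i)T_a(\zeta_i)$ under Condition 1, $\mu(\mathfrak s_{a,b})_\Gamma=\sum_iL_b(S^{-1}(h_i))T_a(\zeta_i)$ under Condition 2, and the identity otherwise. *)

theory Defs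
  imports
    Complex_Main
    "HOL-Algebra.Bij"
    "HOL-Algebra.Generated_Groups"
    "HOL-Combinatorics.Orbits"
    "HOL-Combinatorics.Cycles"
    "HOL-Library.Function_Algebras"
begin

section \<open>Tensor products over a field\<close>

text \<open>
  Let \<open>F\<close> be the space of all \<open>k\<close>-valued (bi-, tri-, multi-)linear forms on a set of tuples of
  vectors.  The pure tensor of a tuple \<open>p\<close> is evaluation at \<open>p\<close>, as a functional on \<open>F\<close>, and
  the tensor product is the span of the pure tensors inside the dual space of \<open>F\<close>.  Over a field
  this is a model of the tensor product: a multilinear map \<open>f\<close> with values in an arbitrary vector
  space \<open>U\<close> extends to a unique linear map \<open>lin_ext _ f\<close> on it, see \<open>lin_ext_ptens\<close>,
  \<open>lin_ext_add\<close>, \<open>lin_ext_scale\<close> below.  Functionals are set to 0 outside of \<open>F\<close>, so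
  that equality of tensors is equality of functions.  In this way a Sweedler expression
  \<open>f(h\<^sub>1, h\<^sub>2)\<close> is written as \<open>lin_ext _ (\<lambda>(h1, h2). f (h1, h2)) (\<Delta> h)\<close>.
\<close>

type_synonym ('p, 'k) tensor = "('p \<Rightarrow> 'k) \<Rightarrow> 'k"

definition fscale :: "'k::field \<Rightarrow> ('x \<Rightarrow> 'k) \<Rightarrow> ('x \<Rightarrow> 'k)" where
  "fscale c f = (\<lambda>x. c * f x)"

definition ptens :: "('p \<Rightarrow> 'k::field) set \<Rightarrow> 'p \<Rightarrow> ('p, 'k) tensor" where
  "ptens F p = (\<lambda>\<phi>. if \<phi> \<in> F then \<phi> p else 0)"

definition tensor_space :: "('p \<Rightarrow> 'k::field) set \<Rightarrow> 'p set \<Rightarrow> ('p, 'k) tensor set" where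
  "tensor_space F P = module.span fscale (ptens F ` P)"

definition lin_ext ::
  "('k::field \<Rightarrow> 'u::ab_group_add \<Rightarrow> 'u) \<Rightarrow> ('p \<Rightarrow> 'u) \<Rightarrow> ('p, 'k) tensor \<Rightarrow> 'u" where
  "lin_ext s f t = (THE u. \<forall>g. Vector_Spaces.linear s (*) g \<longrightarrow> g u = t (\<lambda>p. g (f p)))"

text \<open>Forms on subspaces \<open>V\<close>, \<open>W\<close> (with scalar multiplications \<open>s\<close>, \<open>s'\<close>).\<close>

definition linear_form_on ::
  "('k::field \<Rightarrow> 'v::ab_group_add \<Rightarrow> 'v) \<Rightarrow> 'v set \<Rightarrow> ('v \<Rightarrow> 'k) \<Rightarrow> bool" where
  "linear_form_on s V f \<longleftrightarrow>
     (\<forall>x\<in>V. \<forall>y\<in>V. f (x + y) = f x + f y) \<and> (\<forall>c. \<forall>x\<in>V. f (s c x) = c * f x)"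

definition bilinear_forms ::
  "('k::field \<Rightarrow> 'v::ab_group_add \<Rightarrow> 'v) \<Rightarrow> 'v set \<Rightarrow>
   ('k \<Rightarrow> 'w::ab_group_add \<Rightarrow> 'w) \<Rightarrow> 'w set \<Rightarrow> ('v \<times> 'w \<Rightarrow> 'k) set" where
  "bilinear_forms s V s' W = {\<phi>.
     (\<forall>w\<in>W. linear_form_on s V (\<lambda>v. \<phi> (v, w))) \<and>
     (\<forall>v\<in>V. linear_form_on s' W (\<lambda>w. \<phi> (v, w)))}"

definition trilinear_forms ::
  "('k::field \<Rightarrow> 'u::ab_group_add \<Rightarrow> 'u) \<Rightarrow> ('k \<Rightarrow> 'v::ab_group_add \<Rightarrow> 'v) \<Rightarrow>
   ('k \<Rightarrow> 'w::ab_group_add \<Rightarrow> 'w) \<Rightarrow> ('u \<times> 'v \<times> 'w \<Rightarrow> 'k) set" where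
  "trilinear_forms s s' s'' = {\<phi>.
     (\<forall>v w. linear_form_on s UNIV (\<lambda>u. \<phi> (u, v, w))) \<and>
     (\<forall>u w. linear_form_on s' UNIV (\<lambda>v. \<phi> (u, v, w))) \<and>
     (\<forall>u v. linear_form_on s'' UNIV (\<lambda>w. \<phi> (u, v, w)))}"

text \<open>Multilinear forms on families indexed by \<open>I\<close>; entries outside of \<open>I\<close> are irrelevant.\<close>

definition multilinear_forms ::
  "('k::field \<Rightarrow> 'v::ab_group_add \<Rightarrow> 'v) \<Rightarrow> 'i set \<Rightarrow> (('i \<Rightarrow> 'v) \<Rightarrow> 'k) set" where
  "multilinear_forms s I = {\<phi>.
     (\<forall>m m'. (\<forall>i\<in>I. m i = m' i) \<longrightarrow> \<phi> m = \<phi> m') \<and>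
     (\<forall>i\<in>I. \<forall>m. linear_form_on s UNIV (\<lambda>v. \<phi> (m(i := v))))}"

abbreviation bilin ::
  "('k::field \<Rightarrow> 'v::ab_group_add \<Rightarrow> 'v) \<Rightarrow> ('k \<Rightarrow> 'w::ab_group_add \<Rightarrow> 'w) \<Rightarrow>
   ('v \<times> 'w \<Rightarrow> 'k) set" where
  "bilin s s' \<equiv> bilinear_forms s UNIV s' UNIV"

text \<open>The dual of a subspace; its elements are normalised to be 0 outside of the subspace.\<close>

definition dual_on ::
  "('k::field \<Rightarrow> 'v::ab_group_add \<Rightarrow> 'v) \<Rightarrow> 'v set \<Rightarrow> ('v \<Rightarrow> 'k) set" where
  "dual_on s V = {\<alpha>. linear_form_on s V \<alpha> \<and> (\<forall>x. x \<notin> V \<longrightarrow> \<alpha> x = 0)}"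

subsection \<open>The universal property\<close>

lemma vector_space_fscale: "vector_space (fscale :: 'k::field \<Rightarrow> ('x \<Rightarrow> 'k) \<Rightarrow> _)"
  by unfold_locales (auto simp: fscale_def fun_eq_iff algebra_simps)

lemma separating_linear_form:
  assumes "vector_space s" and "u \<noteq> 0"
  shows "\<exists>g. Vector_Spaces.linear s (*) g \<and> g u \<noteq> (0::'k::field)"
proof -
  interpret vector_space_pair s "(*) :: 'k \<Rightarrow> 'k \<Rightarrow> 'k"
    using assms(1) unfolding vector_space_pair_def
    by (auto simp: vector_space_def algebra_simps)
  have ind: "vs1.independent {u}" using assms(2) by simp
  show ?thesis
    using linear_construct[OF ind, of "\<lambda>_. 1"] construct_basis[OF ind, of u "\<lambda>_. 1"] by force
qed

lemma lin_ext_eqI: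
  assumes s: "vector_space s"
    and u: "\<And>g. Vector_Spaces.linear s (*) g \<Longrightarrow> g u = t (\<lambda>p. g (f p))"
  shows "lin_ext s f t = u"
  unfolding lin_ext_def
proof (rule the_equality)
  fix v assume v: "\<forall>g. Vector_Spaces.linear s (*) g \<longrightarrow> g v = t (\<lambda>p. g (f p))"
  show "v = u"
  proof (rule ccontr)
    assume "v \<noteq> u"
    then obtain g where g: "Vector_Spaces.linear s (*) g" "g (v - u) \<noteq> 0"
      using separating_linear_form[OF s, of "v - u"] by auto
    moreover have "g v = g u"
      using u[OF g(1)] v g(1) by metis
    ultimately show False
      using module_hom.diff[OF module_hom_linearI[OF g(1)], of v u] by simp
  qed
qed (use u in blast)

text \<open>Here \<open>lin_form_comp\<close> expresses that \<open>f\<close> is multilinear.\<close>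

lemma lin_ext_ptens:
  assumes "vector_space s"
    and lin_form_comp: "\<And>g. Vector_Spaces.linear s (*) g \<Longrightarrow> (\<lambda>p. g (f p)) \<in> F"
  shows "lin_ext s f (ptens F p) = f p"
  using assms by (intro lin_ext_eqI) (auto simp: ptens_def)

lemma lin_ext_spec:
  fixes t :: "('p, 'k::field) tensor"
  assumes s: "vector_space s"
    and lin_form_comp: "\<And>g. Vector_Spaces.linear s (*) g \<Longrightarrow> (\<lambda>p. g (f p)) \<in> F"
    and t: "t \<in> tensor_space F P"
    and g: "Vector_Spaces.linear s (*) g"
  shows "g (lin_ext s f t) = t (\<lambda>p. g (f p))"
proof -
  interpret fs: vector_space "fscale :: 'k \<Rightarrow> ('p, 'k) tensor \<Rightarrow> _"
    by (rule vector_space_fscale)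
  have "\<exists>u. \<forall>g. Vector_Spaces.linear s (*) g \<longrightarrow> g u = t (\<lambda>p. g (f p))"
    using t unfolding tensor_space_def
  proof (induction rule: fs.span_induct_alt)
    case base
    show ?case
      by (rule exI[of _ 0]) (auto simp: module_hom.zero[OF module_hom_linearI])
  next
    case (step c x y)
    then obtain p u where x: "x = ptens F p"
      and u: "\<forall>g. Vector_Spaces.linear s (*) g \<longrightarrow> g u = y (\<lambda>p. g (f p))"
      by blast
    show ?case
    proof (intro exI[of _ "s c (f p) + u"] allI impI)
      fix g assume g: "Vector_Spaces.linear s (*) g"
      show "g (s c (f p) + u) = (fscale c x + y) (\<lambda>p. g (f p))"
        using u g lin_form_comp[OF g]
        by (simp add: x ptens_def fscale_def module_hom.add[OF module_hom_linearI[OF g]]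
            module_hom.scale[OF module_hom_linearI[OF g]])
    qed
  qed
  then obtain u where u: "\<forall>g. Vector_Spaces.linear s (*) g \<longrightarrow> g u = t (\<lambda>p. g (f p))" by blast
  moreover from this have "lin_ext s f t = u" by (intro lin_ext_eqI s) auto
  ultimately show ?thesis using g by simp
qed

lemma lin_ext_add:
  assumes s: "vector_space s"
    and lin_form_comp: "\<And>g. Vector_Spaces.linear s (*) g \<Longrightarrow> (\<lambda>p. g (f p)) \<in> F"
    and t: "t \<in> tensor_space F P" "t' \<in> tensor_space F P"
  shows "lin_ext s f (t + t') = lin_ext s f t + lin_ext s f t'"
proof (rule lin_ext_eqI[OF s])
  fix g assume g: "Vector_Spaces.linear s (*) g"
  show "g (lin_ext s f t + lin_ext s f t') = (t + t') (\<lambda>p. g (f p))"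
    using lin_ext_spec[where f = f, OF s _ t(1) g] lin_ext_spec[where f = f, OF s _ t(2) g]
      lin_form_comp
    by (simp add: module_hom.add[OF module_hom_linearI[OF g]])
qed

lemma lin_ext_scale:
  assumes s: "vector_space s"
    and lin_form_comp: "\<And>g. Vector_Spaces.linear s (*) g \<Longrightarrow> (\<lambda>p. g (f p)) \<in> F"
    and t: "t \<in> tensor_space F P"
  shows "lin_ext s f (fscale c t) = s c (lin_ext s f t)"
proof (rule lin_ext_eqI[OF s])
  fix g assume g: "Vector_Spaces.linear s (*) g"
  show "g (s c (lin_ext s f t)) = fscale c t (\<lambda>p. g (f p))"
    using lin_ext_spec[where f = f, OF s _ t g] lin_form_comp
    by (simp add: fscale_def module_hom.scale[OF module_hom_linearI[OF g]])
qed


section \<open>Hopf algebras and involutive Hopf bimodules\<close>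

text \<open>
  The ring structure of the Hopf algebra is that of the type \<open>'h\<close>.  The requirement \<open>0 \<noteq> 1\<close> of
  class \<open>ring_1\<close> is automatic, as the counit sends 1 to 1.
\<close>

record ('k, 'h) hopf =
  hscale :: "'k \<Rightarrow> 'h \<Rightarrow> 'h"
  comult :: "'h \<Rightarrow> ('h \<times> 'h, 'k) tensor"
  counit :: "'h \<Rightarrow> 'k"
  antip :: "'h \<Rightarrow> 'h"

definition comult3 :: "('k::field, 'h::ring_1) hopf \<Rightarrow> 'h \<Rightarrow> ('h \<times> 'h \<times> 'h, 'k) tensor" where
  "comult3 H h = lin_ext fscale (\<lambda>(x, h3). lin_ext fscale
       (\<lambda>(h1, h2). ptens (trilinear_forms (hscale H) (hscale H) (hscale H)) (h1, h2, h3))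
     (comult H x)) (comult H h)"

locale hopf_algebra =
  fixes H :: "('k::field, 'h::ring_1) hopf"
  assumes vector_space_H: "vector_space (hscale H)"
    and scale_mult_left: "hscale H c x * y = hscale H c (x * y)"
    and scale_mult_right: "x * hscale H c y = hscale H c (x * y)"
    and comult_in: "comult H h \<in> tensor_space (bilin (hscale H) (hscale H)) UNIV"
    and comult_add: "comult H (h + h') = comult H h + comult H h'"
    and comult_scale: "comult H (hscale H c h) = fscale c (comult H h)"
    and counit_linear: "Vector_Spaces.linear (hscale H) (*) (counit H)"
    and coassoc: "comult3 H h = lin_ext fscale (\<lambda>(h1, x). lin_ext fscale
        (\<lambda>(h2, h3). ptens (trilinear_forms (hscale H) (hscale H) (hscale H)) (h1, h2, h3))
          (comult H x)) (comult H h)"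
    and counit_left: "lin_ext (hscale H) (\<lambda>(h1, h2). hscale H (counit H h1) h2) (comult H h) = h"
    and counit_right: "lin_ext (hscale H) (\<lambda>(h1, h2). hscale H (counit H h2) h1) (comult H h) = h"
    and comult_mult: "comult H (h * g) = lin_ext fscale (\<lambda>(h1, h2). lin_ext fscale
        (\<lambda>(g1, g2). ptens (bilin (hscale H) (hscale H)) (h1 * g1, h2 * g2))
          (comult H g)) (comult H h)"
    and comult_one: "comult H 1 = ptens (bilin (hscale H) (hscale H)) (1, 1)"
    and counit_mult: "counit H (h * g) = counit H h * counit H g"
    and counit_one: "counit H 1 = 1"
    and antip_linear: "Vector_Spaces.linear (hscale H) (hscale H) (antip H)"
    and antip_left:
      "lin_ext (hscale H) (\<lambda>(h1, h2). antip H h1 * h2) (comult H h) = hscale H (counit H h) 1"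
    and antip_right:
      "lin_ext (hscale H) (\<lambda>(h1, h2). h1 * antip H h2) (comult H h) = hscale H (counit H h) 1"

text \<open>
  The antipode of a finite-dimensional Hopf algebra is bijective (Larson--Sweedler).
  \<open>inv_into UNIV\<close> is the inverse function; HOL-Algebra reserves the shorter notation.
\<close>

abbreviation antip_inv :: "('k, 'h) hopf \<Rightarrow> 'h \<Rightarrow> 'h" where
  "antip_inv H \<equiv> inv_into UNIV (antip H)"

record ('k, 'h, 'm) bimod =
  mscale :: "'k \<Rightarrow> 'm \<Rightarrow> 'm"
  lact :: "'h \<Rightarrow> 'm \<Rightarrow> 'm"
  ract :: "'m \<Rightarrow> 'h \<Rightarrow> 'm"
  lcoact :: "'m \<Rightarrow> ('h \<times> 'm, 'k) tensor"
  rcoact :: "'m \<Rightarrow> ('m \<times> 'h, 'k) tensor"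
  invol :: "'m \<Rightarrow> 'm"

text \<open>\<open>m\<^bsub>[-1]\<^esub> \<otimes> m\<^bsub>[0]\<^esub> \<otimes> m\<^bsub>[1]\<^esub>\<close>\<close>

definition bicoact ::
  "('k::field, 'h::ring_1) hopf \<Rightarrow> ('k, 'h, 'm::ab_group_add) bimod \<Rightarrow> 'm \<Rightarrow>
   ('h \<times> 'm \<times> 'h, 'k) tensor" where
  "bicoact H M m = lin_ext fscale (\<lambda>(x, n). lin_ext fscale
       (\<lambda>(n0, y). ptens (trilinear_forms (hscale H) (mscale M) (hscale H)) (x, n0, y))
     (rcoact M n)) (lcoact M m)"

locale involutive_hopf_bimodule = hopf_algebra H
  for H :: "('k::field, 'h::ring_1) hopf" +
  fixes M :: "('k, 'h, 'm::ab_group_add) bimod"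
  assumes vector_space_M: "vector_space (mscale M)"
    and lact_linear: "Vector_Spaces.linear (mscale M) (mscale M) (lact M h)"
    and lact_linear': "Vector_Spaces.linear (hscale H) (mscale M) (\<lambda>h. lact M h m)"
    and lact_mult: "lact M (h * g) m = lact M h (lact M g m)"
    and lact_one: "lact M 1 m = m"
    and ract_linear: "Vector_Spaces.linear (mscale M) (mscale M) (\<lambda>m. ract M m h)"
    and ract_linear': "Vector_Spaces.linear (hscale H) (mscale M) (ract M m)"
    and ract_mult: "ract M m (h * g) = ract M (ract M m h) g"
    and ract_one: "ract M m 1 = m"
    and bimodule: "ract M (lact M h m) g = lact M h (ract M m g)"
    and lcoact_in: "lcoact M m \<in> tensor_space (bilin (hscale H) (mscale M)) UNIV"
    and lcoact_add: "lcoact M (m + m') = lcoact M m + lcoact M m'"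
    and lcoact_scale: "lcoact M (mscale M c m) = fscale c (lcoact M m)"
    and lcoact_coassoc:
      "lin_ext fscale (\<lambda>(x, n). lin_ext fscale
          (\<lambda>(x1, x2). ptens (trilinear_forms (hscale H) (hscale H) (mscale M)) (x1, x2, n))
          (comult H x)) (lcoact M m) =
       lin_ext fscale (\<lambda>(x1, n). lin_ext fscale
          (\<lambda>(x2, n0). ptens (trilinear_forms (hscale H) (hscale H) (mscale M)) (x1, x2, n0))
          (lcoact M n)) (lcoact M m)"
    and lcoact_counit: "lin_ext (mscale M) (\<lambda>(x, n). mscale M (counit H x) n) (lcoact M m) = m"
    and rcoact_in: "rcoact M m \<in> tensor_space (bilin (mscale M) (hscale H)) UNIV"
    and rcoact_add: "rcoact M (m + m') = rcoact M m + rcoact M m'"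
    and rcoact_scale: "rcoact M (mscale M c m) = fscale c (rcoact M m)"
    and rcoact_coassoc:
      "lin_ext fscale (\<lambda>(n, x). lin_ext fscale
          (\<lambda>(x1, x2). ptens (trilinear_forms (mscale M) (hscale H) (hscale H)) (n, x1, x2))
          (comult H x)) (rcoact M m) =
       lin_ext fscale (\<lambda>(n, x2). lin_ext fscale
          (\<lambda>(n0, x1). ptens (trilinear_forms (mscale M) (hscale H) (hscale H)) (n0, x1, x2))
          (rcoact M n)) (rcoact M m)"
    and rcoact_counit: "lin_ext (mscale M) (\<lambda>(n, x). mscale M (counit H x) n) (rcoact M m) = m"
    and bicomodule:
      "bicoact H M m = lin_ext fscale (\<lambda>(n, y). lin_ext fscale
          (\<lambda>(x, n0). ptens (trilinear_forms (hscale H) (mscale M) (hscale H)) (x, n0, y))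
          (lcoact M n)) (rcoact M m)"
    and hopf_bimodule:
      "bicoact H M (ract M (lact M h m) g) =
       lin_ext fscale (\<lambda>(h1, h2, h3). lin_ext fscale (\<lambda>(x, n, y). lin_ext fscale (\<lambda>(g1, g2, g3).
           ptens (trilinear_forms (hscale H) (mscale M) (hscale H))
             (h1 * x * g1, ract M (lact M h2 n) g2, h3 * y * antip_inv H (antip_inv H g3)))
         (comult3 H g)) (bicoact H M m)) (comult3 H h)"
    and invol_linear: "Vector_Spaces.linear (mscale M) (mscale M) (invol M)"
    and invol_invol: "invol M (invol M m) = m"
    and invol_lact: "invol M (lact M h m) = ract M (invol M m) (antip H h)"
    and invol_coact:
      "lcoact M (invol M m) = lin_ext fscale
         (\<lambda>(n, x). ptens (bilin (hscale H) (mscale M)) (antip H x, invol M n)) (rcoact M m)"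


section \<open>Kitaev graphs\<close>

record 'a kitaev =
  half_edges :: "'a set"
  iota :: "'a \<Rightarrow> 'a"
  rho :: "'a \<Rightarrow> 'a"
  cilia :: "'a set"
  base :: "'a"

text \<open>The union of the orbits of the elements of \<open>A\<close> under the group generated by \<open>P\<close>.\<close>

inductive_set group_orbit :: "('a \<Rightarrow> 'a) set \<Rightarrow> 'a set \<Rightarrow> 'a set" for P A where
  start: "x \<in> A \<Longrightarrow> x \<in> group_orbit P A"
| gen: "f \<in> P \<Longrightarrow> x \<in> group_orbit P A \<Longrightarrow> f x \<in> group_orbit P A"
| gen_inv: "f \<in> P \<Longrightarrow> x \<in> group_orbit P A \<Longrightarrow> inv_into UNIV f x \<in> group_orbit P A"

definition face_perm :: "'a kitaev \<Rightarrow> 'a \<Rightarrow> 'a" where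
  "face_perm G = inv_into UNIV (rho G) \<circ> iota G"

text \<open>Cycles are represented by their sets of half-edges.\<close>

definition edge_of :: "'a kitaev \<Rightarrow> 'a \<Rightarrow> 'a set" where
  "edge_of G h = {h, iota G h}"

definition edges :: "'a kitaev \<Rightarrow> 'a set set" where
  "edges G = edge_of G ` half_edges G"

definition vertices :: "'a kitaev \<Rightarrow> 'a set set" where
  "vertices G = orbit (rho G) ` half_edges G"

definition faces :: "'a kitaev \<Rightarrow> 'a set set" where
  "faces G = orbit (face_perm G) ` half_edges G"

definition is_ribbon_graph :: "'a kitaev \<Rightarrow> bool" where
  "is_ribbon_graph G \<longleftrightarrow> finite (half_edges G) \<and>
     iota G permutes half_edges G \<and>
     (\<forall>h\<in>half_edges G. iota G (iota G h) = h \<and> iota G h \<noteq> h) \<and>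
     rho G permutes half_edges G"

definition is_kitaev_graph :: "'a::linorder kitaev \<Rightarrow> bool" where
  "is_kitaev_graph G \<longleftrightarrow> is_ribbon_graph G \<and>
     (\<forall>h\<in>half_edges G. group_orbit {iota G, rho G} {h} = half_edges G) \<and>
     cilia G \<subseteq> half_edges G \<and>
     bij_betw (orbit (rho G)) (cilia G) (vertices G) \<and>
     bij_betw (\<lambda>c. orbit (face_perm G) (inv_into UNIV (rho G) c)) (cilia G) (faces G) \<and>
     base G \<in> cilia G \<and>
     (\<forall>h\<in>half_edges G. \<forall>k\<in>half_edges G. edge_of G h \<noteq> edge_of G k \<longrightarrow>
        (h < k \<longleftrightarrow> iota G h < iota G k))"

definition is_source :: "'a::linorder kitaev \<Rightarrow> 'a \<Rightarrow> bool" where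
  "is_source G h \<longleftrightarrow> h = min h (iota G h)"

subsection \<open>Reduced presentations\<close>

text \<open>The set \<open>{1, 2, \<dots>}\<close> is \<open>{1..} :: nat set\<close>; all permutations fix 0.\<close>

definition kappa :: "nat \<Rightarrow> nat" where
  "kappa n = (if n = 0 then 0 else if odd n then n + 1 else n - 1)"

definition S_inf :: "(nat \<Rightarrow> nat) set" where
  "S_inf = {\<sigma>. \<sigma> permutes {1..} \<and> finite {n. \<sigma> n \<noteq> n}}"

definition induced :: "(nat \<Rightarrow> nat) \<Rightarrow> nat set \<Rightarrow> nat \<Rightarrow> nat kitaev" where
  "induced \<rho> C pt = (let \<Gamma> = group_orbit {\<rho>, kappa} C in
     \<lparr>half_edges = \<Gamma>, iota = perm_restrict kappa \<Gamma>, rho = perm_restrict \<rho> \<Gamma>,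
      cilia = C, base = pt\<rparr>)"

definition RK :: "nat kitaev set" where
  "RK = {induced \<rho> C pt | \<rho> C pt. \<rho> \<in> S_inf \<and> finite C \<and> C \<subseteq> {1..} \<and> pt \<in> C \<and>
           is_kitaev_graph (induced \<rho> C pt)}"


section \<open>The group \<open>\<GG>\<close> and its action\<close>

text \<open>
  For a graph \<open>G\<close> in \<open>RK\<close>, the triple \<open>(rho G, cilia G, base G)\<close> is one of the
  triples that induce it, so that operations on triples are defined on \<open>G\<close> through it.
\<close>

definition relabel :: "(nat \<Rightarrow> nat) \<Rightarrow> nat kitaev \<Rightarrow> nat kitaev" where
  "relabel \<sigma> G = induced (\<sigma> \<circ> rho G \<circ> inv_into UNIV \<sigma>) (\<sigma> ` cilia G) (\<sigma> (base G))"

definition cond1 :: "nat \<Rightarrow> nat \<Rightarrow> nat kitaev \<Rightarrow> bool" where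
  "cond1 a b G \<longleftrightarrow> a \<in> half_edges G \<and> b \<in> half_edges G \<and> rho G a = b \<and> b \<notin> cilia G \<and>
     distinct [b, rho G b, kappa a]"

definition cond2 :: "nat \<Rightarrow> nat \<Rightarrow> nat kitaev \<Rightarrow> bool" where
  "cond2 a b G \<longleftrightarrow> a \<in> half_edges G \<and> b \<in> half_edges G \<and> rho G b = kappa a \<and>
     kappa a \<notin> cilia G \<and> distinct [b, kappa a, rho G a]"

definition slide_cilia :: "nat \<Rightarrow> nat \<Rightarrow> nat kitaev \<Rightarrow> nat \<Rightarrow> nat" where
  "slide_cilia a b G = (if cond1 a b G \<or> cond2 a b G then transpose (kappa a) b else id)"

definition slide :: "nat \<Rightarrow> nat \<Rightarrow> nat kitaev \<Rightarrow> nat kitaev" where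
  "slide a b G = (let t = transpose (kappa a) b in
     if cond1 a b G then
       induced (cycle_of_list [b, rho G b, kappa a] \<circ> rho G) (t ` cilia G) (t (base G))
     else if cond2 a b G then
       induced (cycle_of_list [b, kappa a, rho G a] \<circ> rho G) (t ` cilia G) (t (base G))
     else G)"

definition frakR :: "(nat \<Rightarrow> nat) monoid" where
  "frakR = \<lparr>carrier = {\<sigma> \<in> S_inf. \<sigma> \<circ> kappa \<circ> inv_into UNIV \<sigma> = kappa},
     monoid.mult = (\<circ>), one = id\<rparr>"

definition R_perm :: "(nat \<Rightarrow> nat) set" where
  "R_perm = generate frakR {transpose i (i + 2) \<circ> transpose (i + 1) (i + 3) | i. odd i}"

definition tau :: "nat \<Rightarrow> nat \<Rightarrow> nat" where
  "tau i = transpose (2 * i - 1) (2 * i)"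

text \<open>
  The group \<open>\<SS>\<close> is presented by generators \<open>s\<^bsub>a,b\<^esub>\<close> and relations \<open>s\<^bsub>a,b\<^esub>\<^sup>2 = 1\<close>.  By these
  relations each generator is its own inverse, so the group consists of the classes of words in the
  generators (without inverses) under the congruence generated by the relations.
\<close>

type_synonym word = "(nat \<times> nat) list"

definition words :: "word set" where
  "words = lists ({1..} \<times> {1..})"

inductive word_eq :: "word \<Rightarrow> word \<Rightarrow> bool" where
  cancel: "u @ [s, s] @ v \<in> words \<Longrightarrow> word_eq (u @ [s, s] @ v) (u @ v)"
| refl: "u \<in> words \<Longrightarrow> word_eq u u"
| sym: "word_eq u v \<Longrightarrow> word_eq v u"
| trans: "word_eq u v \<Longrightarrow> word_eq v w \<Longrightarrow> word_eq u w"

definition word_rel :: "(word \<times> word) set" where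
  "word_rel = {(u, v). word_eq u v}"

definition frakS :: "word set monoid" where
  "frakS = \<lparr>carrier = words // word_rel,
     monoid.mult = (\<lambda>X Y. word_rel `` {u @ v | u v. u \<in> X \<and> v \<in> Y}),
     one = word_rel `` {[]}\<rparr>"

definition vartheta :: "(nat \<Rightarrow> nat) \<Rightarrow> word set \<Rightarrow> word set" where
  "vartheta \<sigma> X = map (map_prod \<sigma> \<sigma>) ` X"

definition frakG :: "(word set \<times> (nat \<Rightarrow> nat)) monoid" where
  "frakG = \<lparr>carrier = carrier frakS \<times> carrier frakR,
     monoid.mult = (\<lambda>(X, \<sigma>) (Y, \<tau>). (X \<otimes>\<^bsub>frakS\<^esub> vartheta \<sigma> Y, \<sigma> \<otimes>\<^bsub>frakR\<^esub> \<tau>)),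
     one = (\<one>\<^bsub>frakS\<^esub>, \<one>\<^bsub>frakR\<^esub>)\<rparr>"

definition gen_s :: "nat \<Rightarrow> nat \<Rightarrow> word set \<times> (nat \<Rightarrow> nat)" where
  "gen_s a b = (word_rel `` {[(a, b)]}, id)"

definition gen_R :: "(nat \<Rightarrow> nat) \<Rightarrow> word set \<times> (nat \<Rightarrow> nat)" where
  "gen_R \<sigma> = (\<one>\<^bsub>frakS\<^esub>, \<sigma>)"

text \<open>
  The pair \<open>(x \<bullet> G, f)\<close>, where \<open>f\<close> restricts to the bijection from the cilia of \<open>G\<close> to those of
  \<open>x \<bullet> G\<close>, for \<open>x = s\<^sub>1 \<cdots> s\<^sub>n \<sigma>\<close>.  It does not depend on the word representing
  \<open>s\<^sub>1 \<cdots> s\<^sub>n\<close>: if \<open>a, b\<close> satisfy one of the two conditions for \<open>G\<close>, then they satisfy the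
  other one for \<open>slide a b G\<close>, and \<open>slide a b (slide a b G) = G\<close>.
\<close>

definition transport ::
  "word set \<times> (nat \<Rightarrow> nat) \<Rightarrow> nat kitaev \<Rightarrow> nat kitaev \<times> (nat \<Rightarrow> nat)" where
  "transport x G = the_elem ((\<lambda>w.
     foldr (\<lambda>(a, b) (G', f). (slide a b G', slide_cilia a b G' \<circ> f)) w (relabel (snd x) G, snd x))
     ` fst x)"

definition act :: "word set \<times> (nat \<Rightarrow> nat) \<Rightarrow> nat kitaev \<Rightarrow> nat kitaev" where
  "act x G = fst (transport x G)"

definition cilia_map :: "word set \<times> (nat \<Rightarrow> nat) \<Rightarrow> nat kitaev \<Rightarrow> nat \<Rightarrow> nat" where
  "cilia_map x G = snd (transport x G)"


section \<open>The extended Hilbert space\<close>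

text \<open>Elements of the extended Hilbert space of a graph: the tensor factors are indexed by the edges.\<close>

type_synonym ('m, 'k) mtensor = "(nat set \<Rightarrow> 'm, 'k) tensor"

abbreviation mforms ::
  "('k::field, 'h, 'm::ab_group_add) bimod \<Rightarrow> nat kitaev \<Rightarrow> ((nat set \<Rightarrow> 'm) \<Rightarrow> 'k) set" where
  "mforms M G \<equiv> multilinear_forms (mscale M) (edges G)"

definition hilb ::
  "('k::field, 'h, 'm::ab_group_add) bimod \<Rightarrow> nat kitaev \<Rightarrow> ('m, 'k) mtensor set" where
  "hilb M G = tensor_space (mforms M G) UNIV"

definition on_edge ::
  "('k::field, 'h, 'm::ab_group_add) bimod \<Rightarrow> nat kitaev \<Rightarrow> nat set \<Rightarrow> ('m \<Rightarrow> 'm) \<Rightarrow>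
   ('m, 'k) mtensor \<Rightarrow> ('m, 'k) mtensor" where
  "on_edge M G e f = lin_ext fscale (\<lambda>m. ptens (mforms M G) (m(e := f (m e))))"

definition L_op ::
  "('k::field, 'h::ring_1) hopf \<Rightarrow> ('k, 'h, 'm::ab_group_add) bimod \<Rightarrow> nat kitaev \<Rightarrow> nat \<Rightarrow> 'h \<Rightarrow>
   ('m, 'k) mtensor \<Rightarrow> ('m, 'k) mtensor" where
  "L_op H M G h a = on_edge M G (edge_of G h)
     (\<lambda>m. if is_source G h then ract M m (antip H a) else lact M a m)"

definition T_op ::
  "('k::field, 'h::ring_1) hopf \<Rightarrow> ('k, 'h, 'm::ab_group_add) bimod \<Rightarrow> nat kitaev \<Rightarrow> nat \<Rightarrow>
   ('h \<Rightarrow> 'k) \<Rightarrow> ('m, 'k) mtensor \<Rightarrow> ('m, 'k) mtensor" where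
  "T_op H M G h \<alpha> = on_edge M G (edge_of G h) (\<lambda>m.
     if is_source G h
     then lin_ext (mscale M) (\<lambda>(x, n). mscale M (\<alpha> x) n) (lcoact M m)
     else lin_ext (mscale M) (\<lambda>(n, x). mscale M (\<alpha> (antip H x)) n) (rcoact M m))"

text \<open>\<open>L_prod H M G [h\<^sub>1, \<dots>, h\<^sub>i] a = L\<^bsub>h\<^sub>i\<^esub>(a\<^sub>(\<^sub>i\<^sub>)) \<cdots> L\<^bsub>h\<^sub>1\<^esub>(a\<^sub>(\<^sub>1\<^sub>))\<close>\<close>

primrec L_prod ::
  "('k::field, 'h::ring_1) hopf \<Rightarrow> ('k, 'h, 'm::ab_group_add) bimod \<Rightarrow> nat kitaev \<Rightarrow> nat list \<Rightarrow>
   'h \<Rightarrow> ('m, 'k) mtensor \<Rightarrow> ('m, 'k) mtensor" where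
  "L_prod H M G [] a t = fscale (counit H a) t"
| "L_prod H M G (h # hs) a t =
     lin_ext fscale (\<lambda>(a1, a'). L_prod H M G hs a' (L_op H M G h a1 t)) (comult H a)"

definition dual_basis :: "('k::field, 'h::ring_1) hopf \<Rightarrow> 'h set \<Rightarrow> 'h \<Rightarrow> 'h \<Rightarrow> 'k" where
  "dual_basis H B b = (\<lambda>v. module.representation (hscale H) B v b)"

text \<open>
  \<open>T_prod H B M G [k\<^sub>1, \<dots>, k\<^sub>j] \<alpha> = T\<^bsub>k\<^sub>j\<^esub>(\<alpha>\<^sub>(\<^sub>1\<^sub>)) \<cdots> T\<^bsub>k\<^sub>1\<^esub>(\<alpha>\<^sub>(\<^sub>j\<^sub>))\<close>.  The coproduct of the dual Hopf algebra
  is dual to the multiplication of \<open>H\<close>, hence the iterated coproduct of \<open>\<alpha>\<close> is the sum of the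
  \<open>\<alpha> (b\<^sub>1 \<cdots> b\<^sub>j) \<zeta>\<^bsub>b\<^sub>1\<^esub> \<otimes> \<cdots> \<otimes> \<zeta>\<^bsub>b\<^sub>j\<^esub>\<close> over all \<open>b\<^sub>1, \<dots>, b\<^sub>j\<close> in the basis \<open>B\<close>, with \<open>\<zeta>\<close> the dual basis.
\<close>

definition T_prod ::
  "('k::field, 'h::ring_1) hopf \<Rightarrow> 'h set \<Rightarrow> ('k, 'h, 'm::ab_group_add) bimod \<Rightarrow> nat kitaev \<Rightarrow>
   nat list \<Rightarrow> ('h \<Rightarrow> 'k) \<Rightarrow> ('m, 'k) mtensor \<Rightarrow> ('m, 'k) mtensor" where
  "T_prod H B M G ks \<alpha> t = (\<Sum>bs | set bs \<subseteq> B \<and> length bs = length ks.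
     fscale (\<alpha> (prod_list bs))
       (fold (\<lambda>(k, b). T_op H M G k (dual_basis H B b)) (zip ks (rev bs)) t))"

definition vertex_act ::
  "('k::field, 'h::ring_1) hopf \<Rightarrow> ('k, 'h, 'm::ab_group_add) bimod \<Rightarrow> nat kitaev \<Rightarrow> nat \<Rightarrow>
   'h \<Rightarrow> ('m, 'k) mtensor \<Rightarrow> ('m, 'k) mtensor" where
  "vertex_act H M G c = L_prod H M G (support (rho G) c)"

text \<open>\<open>(\<alpha> \<otimes> id) \<delta>\<^sub>c\<close>\<close>

definition face_coact_by ::
  "('k::field, 'h::ring_1) hopf \<Rightarrow> 'h set \<Rightarrow> ('k, 'h, 'm::ab_group_add) bimod \<Rightarrow> nat kitaev \<Rightarrow>
   nat \<Rightarrow> ('h \<Rightarrow> 'k) \<Rightarrow> ('m, 'k) mtensor \<Rightarrow> ('m, 'k) mtensor" where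
  "face_coact_by H B M G c =
     T_prod H B M G (support (face_perm G) (inv_into UNIV (rho G) c))"


section \<open>The Yetter--Drinfeld module structure and the Drinfeld double\<close>

text \<open>The tensor power of \<open>H\<close>, with tensor factors indexed by the cilia.\<close>

type_synonym ('h, 'k) htensor = "(nat \<Rightarrow> 'h, 'k) tensor"

abbreviation hforms ::
  "('k::field, 'h::ring_1) hopf \<Rightarrow> nat kitaev \<Rightarrow> ((nat \<Rightarrow> 'h) \<Rightarrow> 'k) set" where
  "hforms H G \<equiv> multilinear_forms (hscale H) (cilia G)"

definition gauge :: "('k::field, 'h::ring_1) hopf \<Rightarrow> nat kitaev \<Rightarrow> ('h, 'k) htensor set" where
  "gauge H G = tensor_space (hforms H G) UNIV"

text \<open>
  A pure tensor in this tensor power acts by the composite of the commuting vertex actions.  Likewise the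
  coaction of this tensor power combines the commuting face coactions
  \<open>\<delta>\<^sub>c(t) = \<Sum>\<^bsub>b \<in> B\<^esub> b \<otimes> (\<zeta>\<^sub>b \<otimes> id) \<delta>\<^sub>c(t)\<close>.
\<close>

definition gauge_act ::
  "('k::field, 'h::ring_1) hopf \<Rightarrow> ('k, 'h, 'm::ab_group_add) bimod \<Rightarrow> nat kitaev \<Rightarrow>
   ('h, 'k) htensor \<Rightarrow> ('m, 'k) mtensor \<Rightarrow> ('m, 'k) mtensor" where
  "gauge_act H M G a t = lin_ext fscale
     (\<lambda>x. fold (\<lambda>c. vertex_act H M G c (x c)) (sorted_list_of_set (cilia G)) t) a"

definition gauge_coact ::
  "('k::field, 'h::ring_1) hopf \<Rightarrow> 'h set \<Rightarrow> ('k, 'h, 'm::ab_group_add) bimod \<Rightarrow> nat kitaev \<Rightarrow>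
   ('m, 'k) mtensor \<Rightarrow> (('h, 'k) htensor \<times> ('m, 'k) mtensor, 'k) tensor" where
  "gauge_coact H B M G t = (\<Sum>\<beta> \<in> cilia G \<rightarrow>\<^sub>E B.
     ptens (bilinear_forms fscale (gauge H G) fscale (hilb M G))
       (ptens (hforms H G) \<beta>,
        fold (\<lambda>c. face_coact_by H B M G c (dual_basis H B (\<beta> c)))
          (sorted_list_of_set (cilia G)) t))"

text \<open>
  As a vector space \<open>D(K) = K\<^sup>* \<otimes> K\<close>.  It is an algebra with \<open>K\<close> and the opposite of the convolution
  algebra \<open>K\<^sup>*\<close> as subalgebras, \<open>\<alpha> \<otimes> a = (\<alpha> \<otimes> 1)(\<epsilon> \<otimes> a)\<close>, and
  \<open>(\<epsilon> \<otimes> a)(\<beta> \<otimes> 1) = \<beta>(S(a\<^sub>(\<^sub>1\<^sub>)) _ a\<^sub>(\<^sub>3\<^sub>)) \<otimes> a\<^sub>(\<^sub>2\<^sub>)\<close>.  It acts on a left-left Yetter--Drinfeld module by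
  \<open>(\<alpha> \<otimes> a) \<cdot> m = \<alpha>((a \<bullet> m)\<^bsub>|-1|\<^esub>) (a \<bullet> m)\<^bsub>|0|\<^esub>\<close>.
\<close>

type_synonym ('h, 'k) dtensor = "((('h, 'k) htensor \<Rightarrow> 'k) \<times> ('h, 'k) htensor, 'k) tensor"

abbreviation dforms ::
  "('k::field, 'h::ring_1) hopf \<Rightarrow> nat kitaev \<Rightarrow>
   ((('h, 'k) htensor \<Rightarrow> 'k) \<times> ('h, 'k) htensor \<Rightarrow> 'k) set" where
  "dforms H G \<equiv> bilinear_forms fscale (dual_on fscale (gauge H G)) fscale (gauge H G)"

definition double :: "('k::field, 'h::ring_1) hopf \<Rightarrow> nat kitaev \<Rightarrow> ('h, 'k) dtensor set" where
  "double H G = tensor_space (dforms H G) (dual_on fscale (gauge H G) \<times> gauge H G)"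

definition double_act ::
  "('k::field, 'h::ring_1) hopf \<Rightarrow> 'h set \<Rightarrow> ('k, 'h, 'm::ab_group_add) bimod \<Rightarrow> nat kitaev \<Rightarrow>
   ('h, 'k) dtensor \<Rightarrow> ('m, 'k) mtensor \<Rightarrow> ('m, 'k) mtensor" where
  "double_act H B M G d t = lin_ext fscale (\<lambda>(\<alpha>, a).
     lin_ext fscale (\<lambda>(x, u). fscale (\<alpha> x) u) (gauge_coact H B M G (gauge_act H M G a t))) d"

text \<open>
  For a bijection \<open>f\<close> from the cilia of \<open>G\<close> to those of \<open>G'\<close>: the induced isomorphism of the
  tensor powers, and \<open>\<alpha> \<otimes> a \<mapsto> \<alpha> \<circ> P\<^sup>-\<^sup>1 \<otimes> P a\<close> on the doubles.
\<close>

definition gauge_perm ::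
  "('k::field, 'h::ring_1) hopf \<Rightarrow> nat kitaev \<Rightarrow> nat kitaev \<Rightarrow> (nat \<Rightarrow> nat) \<Rightarrow>
   ('h, 'k) htensor \<Rightarrow> ('h, 'k) htensor" where
  "gauge_perm H G G' f =
     lin_ext fscale (\<lambda>x. ptens (hforms H G') (\<lambda>c. x (inv_into (cilia G) f c)))"

definition double_perm ::
  "('k::field, 'h::ring_1) hopf \<Rightarrow> nat kitaev \<Rightarrow> nat kitaev \<Rightarrow> (nat \<Rightarrow> nat) \<Rightarrow>
   ('h, 'k) dtensor \<Rightarrow> ('h, 'k) dtensor" where
  "double_perm H G G' f = lin_ext fscale (\<lambda>(\<alpha>, a). ptens (dforms H G')
     (\<lambda>y. if y \<in> gauge H G' then \<alpha> (gauge_perm H G' G (inv_into (cilia G) f) y) else 0,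
      gauge_perm H G G' f a))"

definition muhat ::
  "('k::field, 'h::ring_1) hopf \<Rightarrow> word set \<times> (nat \<Rightarrow> nat) \<Rightarrow> nat kitaev \<Rightarrow>
   ('h, 'k) dtensor \<Rightarrow> ('h, 'k) dtensor" where
  "muhat H x G = double_perm H G (act x G) (cilia_map x G)"


section \<open>The direct sum over \<open>RK\<close> and the maps \<open>\<mu>\<close>\<close>

type_synonym ('m, 'k) msum = "nat kitaev \<Rightarrow> ('m, 'k) mtensor"

definition hilb_RK :: "('k::field, 'h, 'm::ab_group_add) bimod \<Rightarrow> ('m, 'k) msum set" where
  "hilb_RK M = {u. (\<forall>G\<in>RK. u G \<in> hilb M G) \<and> (\<forall>G. G \<notin> RK \<longrightarrow> u G = 0) \<and>
     finite {G. u G \<noteq> 0}}"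

definition incl :: "nat kitaev \<Rightarrow> ('m, 'k::field) mtensor \<Rightarrow> ('m, 'k) msum" where
  "incl G t = (\<lambda>G'. if G' = G then t else 0)"

definition Aut_RK ::
  "('k::field, 'h, 'm::ab_group_add) bimod \<Rightarrow> (('m, 'k) msum \<Rightarrow> ('m, 'k) msum) monoid" where
  "Aut_RK M = (BijGroup (hilb_RK M))\<lparr>carrier := {f \<in> Bij (hilb_RK M).
     (\<forall>u\<in>hilb_RK M. \<forall>v\<in>hilb_RK M. f (u + v) = f u + f v) \<and>
     (\<forall>c. \<forall>u\<in>hilb_RK M. f (\<lambda>G. fscale c (u G)) = (\<lambda>G. fscale c (f u G)))}\<rparr>"

text \<open>The direct sum of maps \<open>f G\<close> from the summand of \<open>G\<close> to that of \<open>p G\<close>.\<close>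

definition dsum ::
  "('k::field, 'h, 'm::ab_group_add) bimod \<Rightarrow> (nat kitaev \<Rightarrow> nat kitaev) \<Rightarrow>
   (nat kitaev \<Rightarrow> ('m, 'k) mtensor \<Rightarrow> ('m, 'k) mtensor) \<Rightarrow> ('m, 'k) msum \<Rightarrow> ('m, 'k) msum" where
  "dsum M p f = (\<lambda>u \<in> hilb_RK M. \<lambda>G'. \<Sum>G | u G \<noteq> 0 \<and> p G = G'. f G (u G))"

definition mu_tau ::
  "('k::field, 'h, 'm::ab_group_add) bimod \<Rightarrow> nat \<Rightarrow> ('m, 'k) msum \<Rightarrow> ('m, 'k) msum" where
  "mu_tau M i = dsum M (relabel (tau i)) (\<lambda>G t.
     if {2 * i - 1, 2 * i} \<in> edges G then on_edge M G {2 * i - 1, 2 * i} (invol M) t else t)"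

definition mu_perm ::
  "('k::field, 'h, 'm::ab_group_add) bimod \<Rightarrow> (nat \<Rightarrow> nat) \<Rightarrow> ('m, 'k) msum \<Rightarrow> ('m, 'k) msum"
  where
  "mu_perm M \<sigma> = dsum M (relabel \<sigma>) (\<lambda>G.
     lin_ext fscale (\<lambda>m. ptens (mforms M (relabel \<sigma> G)) (\<lambda>e. m (inv_into UNIV \<sigma> ` e))))"

definition mu_slide ::
  "('k::field, 'h::ring_1) hopf \<Rightarrow> 'h set \<Rightarrow> ('k, 'h, 'm::ab_group_add) bimod \<Rightarrow> nat \<Rightarrow> nat \<Rightarrow>
   ('m, 'k) msum \<Rightarrow> ('m, 'k) msum" where
  "mu_slide H B M a b = dsum M (slide a b) (\<lambda>G t.
     if cond1 a b G then
       \<Sum>h\<in>B. L_op H M G b h (T_op H M G a (dual_basis H B h) t)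
     else if cond2 a b G then
       \<Sum>h\<in>B. L_op H M G b (antip_inv H h) (T_op H M G a (dual_basis H B h) t)
     else t)"

definition component ::
  "(word set \<times> (nat \<Rightarrow> nat) \<Rightarrow> ('m, 'k::field) msum \<Rightarrow> ('m, 'k) msum) \<Rightarrow>
   word set \<times> (nat \<Rightarrow> nat) \<Rightarrow> nat kitaev \<Rightarrow> ('m, 'k) mtensor \<Rightarrow> ('m, 'k) mtensor" where
  "component \<mu> x G m = \<mu> x (incl G m) (act x G)"

end

theory Submission imports Defs begin

text \<open>
  All computations take place with the operators \<open>L\<^sub>h\<close> and \<open>T\<^sub>h\<close> of single half-edges, in
  coordinates with respect to a basis of \<open>H\<close>.  The involution \<open>\<psi>\<close> exchanges the operators of the
  source of an edge with those of its target, so that both kinds satisfy the same relations and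
  \<open>\<psi>\<close> intertwines actions and coactions when an edge is reversed.

  A slide moves \<open>b\<close> from behind \<open>a\<close> to the front of \<open>\<kappa>(a)\<close> in the half-edge lists of the vertices, and
  moves \<open>a\<close> from behind \<open>\<kappa>(b)\<close> to the front of \<open>b\<close> in those of the faces.  The operator
  \<open>\<Sum>\<^sub>i L\<^sub>b(h\<^sub>i) T\<^sub>a(\<zeta>\<^sub>i)\<close> is carried through such a list from one end to the other: it commutes with the
  factors that are not involved, and the Hopf bimodule compatibility of \<open>L\<^sub>a\<close> and \<open>T\<^sub>a\<close> makes it
  absorb the moved factor at its old place and release it at the new one.  Its inverse is obtained
  by replacing \<open>h\<^sub>i\<close> by \<open>S\<^sup>-\<^sup>1(h\<^sub>i)\<close>, and Condition 2 describes the inverse slide.  The antipode is bijective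
  by Larson and Sweedler; this is proved here without integrals.

  The relations of \<open>\<GG>\<close> to be verified are \<open>\<mu>(\<ss>\<^sub>a\<^sub>b)\<^sup>2 = 1\<close> and \<open>\<mu>(\<sigma>) \<mu>(\<ss>\<^sub>a\<^sub>b) \<mu>(\<sigma>)\<^sup>-\<^sup>1 = \<mu>(\<ss>\<^sub>\<sigma>\<^sub>(\<^sub>a\<^sub>)\<^sub>\<sigma>\<^sub>(\<^sub>b\<^sub>))\<close>,
  and compatibility with the Drinfeld doubles follows from compatibility with the vertex actions
  and face coactions of the individual cilia.
\<close>

text \<open>Sweedler expressions are computed as finite sums over the basis \<open>B\<close>:
  \<open>cop s h f\<close> for the coproduct of \<open>h\<close>, and \<open>dco h t f\<close> for
  the coaction of one half-edge on a state \<open>t\<close>, with the rest of the expression as a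
  continuation \<open>f\<close>. Counit, coassociativity, antipode and Hopf compatibility then
  become rewriting rules for nested finite sums. Tensors are functions, so the pointwise rules for
  \<open>+\<close> and \<open>0\<close> are disabled: sums of tensors are to stay sums of vectors.
  As \<open>lin_ext\<close> is controlled only on the span of the pure tensors, linearity is always
  relative to a carrier (\<open>lin_on\<close>), and membership in \<open>hilb M G\<close>
  accompanies every step. The representation is defined on words in the slides. Independence of the
  word reduces to cancelling a repeated letter, and multiplicativity to moving a relabelling past a
  slide.\<close>

declare plus_fun_apply [simp del] zero_fun_apply [simp del]

section \<open>Linear maps on subspaces and multilinear extension\<close>

interpretation fs: vector_space "fscale :: 'k::field \<Rightarrow> ('x \<Rightarrow> 'k) \<Rightarrow> ('x \<Rightarrow> 'k)"
  by (rule vector_space_fscale)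

lemma vector_space_field: "vector_space ((*) :: 'k::field \<Rightarrow> 'k \<Rightarrow> 'k)"
  by (auto simp: vector_space_def algebra_simps)

text \<open>Linearity on a carrier instead of a type, because maps given by \<open>lin_ext\<close>
  are controlled only on the span of the pure tensors. Closure of \<open>W\<close> is supplied
  separately where it matters, as in \<open>lin_on_sum\<close>.\<close>

definition lin_on ::
  "('k::field \<Rightarrow> 'u::ab_group_add \<Rightarrow> 'u) \<Rightarrow> ('k \<Rightarrow> 'v::ab_group_add \<Rightarrow> 'v) \<Rightarrow> 'u set \<Rightarrow>
   ('u \<Rightarrow> 'v) \<Rightarrow> bool" where
  "lin_on s s' W f \<longleftrightarrow>
     (\<forall>x\<in>W. \<forall>y\<in>W. f (x + y) = f x + f y) \<and> (\<forall>c. \<forall>x\<in>W. f (s c x) = s' c (f x))"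

text \<open>
  Here \<open>F\<close> is a space of bilinear, trilinear or multilinear forms, and \<open>f\<close> is accordingly
  bilinear, trilinear or multilinear.
\<close>

definition mlin ::
  "('k::field \<Rightarrow> 'u::ab_group_add \<Rightarrow> 'u) \<Rightarrow> ('p \<Rightarrow> 'k) set \<Rightarrow> ('p \<Rightarrow> 'u) \<Rightarrow> bool" where
  "mlin s F f \<longleftrightarrow> (\<forall>g. Vector_Spaces.linear s (*) g \<longrightarrow> (\<lambda>p. g (f p)) \<in> F)"

lemma lin_onI:
  assumes "\<And>x y. x \<in> W \<Longrightarrow> y \<in> W \<Longrightarrow> f (x + y) = f x + f y"
    and "\<And>c x. x \<in> W \<Longrightarrow> f (s c x) = s' c (f x)"
  shows "lin_on s s' W f"
  using assms by (auto simp: lin_on_def)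

lemma lin_on_add: "lin_on s s' W f \<Longrightarrow> x \<in> W \<Longrightarrow> y \<in> W \<Longrightarrow> f (x + y) = f x + f y"
  by (auto simp: lin_on_def)

lemma lin_on_scale: "lin_on s s' W f \<Longrightarrow> x \<in> W \<Longrightarrow> f (s c x) = s' c (f x)"
  by (auto simp: lin_on_def)

lemma linear_lin_on: "Vector_Spaces.linear s s' f \<Longrightarrow> lin_on s s' W f"
  by (auto simp: lin_on_def module_hom.add[OF module_hom_linearI]
      module_hom.scale[OF module_hom_linearI])

lemma linear_form_on_lin_on: "linear_form_on s V f \<longleftrightarrow> lin_on s (*) V f"
  by (auto simp: linear_form_on_def lin_on_def)

lemma lin_on_zero:
  assumes "vector_space s" "vector_space s'" "lin_on s s' W f" "x \<in> W"
  shows "f 0 = 0"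
proof -
  interpret u: vector_space s by fact
  interpret v: vector_space s' by fact
  show ?thesis using lin_on_scale[OF assms(3,4), of 0] by simp
qed

lemma lin_on_sum:
  assumes "lin_on s s' W f" "f 0 = 0" "finite A" "\<And>i. i \<in> A \<Longrightarrow> x i \<in> W" "0 \<in> W"
    "\<And>u v. u \<in> W \<Longrightarrow> v \<in> W \<Longrightarrow> u + v \<in> W"
  shows "f (\<Sum>i\<in>A. x i) = (\<Sum>i\<in>A. f (x i))"
proof -
  have "(\<Sum>i\<in>A. x i) \<in> W \<and> f (\<Sum>i\<in>A. x i) = (\<Sum>i\<in>A. f (x i))"
    using assms(3,4) by (induction rule: finite_induct) (auto simp: assms lin_on_add[OF assms(1)])
  then show ?thesis by blast
qed

text \<open>Linear forms separate points. This turns an identity in an arbitrary space into scalar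
  identities, which can be read off by evaluating tensors at suitable forms.\<close>

lemma separating_linear_forms:
  assumes "vector_space s" and "\<And>g. Vector_Spaces.linear s (*) g \<Longrightarrow> g u = (g v :: 'k::field)"
  shows "u = v"
proof (rule ccontr)
  assume "u \<noteq> v"
  then obtain g where g: "Vector_Spaces.linear s (*) g" "g (u - v) \<noteq> 0"
    using separating_linear_form[OF assms(1), of "u - v"] by auto
  then show False
    using assms(2)[OF g(1)] module_hom.diff[OF module_hom_linearI[OF g(1)], of u v] by simp
qed

lemma tensor_space_pure: "p \<in> P \<Longrightarrow> ptens F p \<in> tensor_space F P"
  by (auto simp: tensor_space_def intro: fs.span_base)

lemma tensor_space_add [intro]:
  "x \<in> tensor_space F P \<Longrightarrow> y \<in> tensor_space F P \<Longrightarrow> x + y \<in> tensor_space F P"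
  by (auto simp: tensor_space_def intro: fs.span_add)

lemma tensor_space_scale [intro]: "x \<in> tensor_space F P \<Longrightarrow> fscale c x \<in> tensor_space F P"
  by (auto simp: tensor_space_def intro: fs.span_scale)

lemma tensor_space_zero [simp, intro]: "0 \<in> tensor_space F P"
  by (auto simp: tensor_space_def intro: fs.span_zero)

lemma tensor_space_sum [intro]:
  "(\<And>i. i \<in> A \<Longrightarrow> f i \<in> tensor_space F P) \<Longrightarrow> (\<Sum>i\<in>A. f i) \<in> tensor_space F P"
  by (auto simp: tensor_space_def intro: fs.span_sum)

lemma tensor_space_induct [consumes 1, case_names zero pure add scale]:
  assumes "t \<in> tensor_space F P" "Q 0" "\<And>p. p \<in> P \<Longrightarrow> Q (ptens F p)"
    "\<And>x y. x \<in> tensor_space F P \<Longrightarrow> y \<in> tensor_space F P \<Longrightarrow> Q x \<Longrightarrow> Q y \<Longrightarrow> Q (x + y)"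
    "\<And>c x. x \<in> tensor_space F P \<Longrightarrow> Q x \<Longrightarrow> Q (fscale c x)"
  shows "Q t"
proof -
  have "t \<in> tensor_space F P \<and> Q t" using assms(1) unfolding tensor_space_def
  proof (induction rule: fs.span_induct_alt)
    case base
    show ?case by (intro conjI fs.span_zero assms(2))
  next
    case (step c x y)
    then obtain p where p: "p \<in> P" "x = ptens F p" by blast
    show ?case
      unfolding p(2) using step p assms(3-5) tensor_space_pure
      by (metis tensor_space_def tensor_space_add tensor_space_scale)
  qed
  then show ?thesis by blast
qed

text \<open>Pure tensors span. This is the usual way below to compare two operators on a tensor
  power.\<close>

lemma lin_on_tensor_eqI:
  assumes "t \<in> tensor_space F P" "vector_space s"
    and "lin_on fscale s (tensor_space F P) f" "lin_on fscale s (tensor_space F P) g"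
    and "\<And>p. p \<in> P \<Longrightarrow> f (ptens F p) = g (ptens F p)"
  shows "f t = g t"
  using assms(1)
proof (induction rule: tensor_space_induct)
  case zero
  show ?case
    using lin_on_zero[OF vector_space_fscale assms(2,3) tensor_space_zero]
      lin_on_zero[OF vector_space_fscale assms(2,4) tensor_space_zero] by metis
qed (auto simp: assms(5) lin_on_add[OF assms(3)] lin_on_add[OF assms(4)]
    lin_on_scale[OF assms(3)] lin_on_scale[OF assms(4)])

lemma lin_on_tensor_zero:
  assumes "vector_space s" "lin_on fscale s (tensor_space F P) f"
  shows "f 0 = 0"
  using lin_on_zero[OF vector_space_fscale assms tensor_space_zero] .

lemma lin_on_tensor_sum:
  assumes "vector_space s" "lin_on fscale s (tensor_space F P) f"
    "\<And>i. i \<in> A \<Longrightarrow> x i \<in> tensor_space F P"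
  shows "f (\<Sum>i\<in>A. x i) = (\<Sum>i\<in>A. f (x i))"
proof (cases "finite A")
  case True
  then show ?thesis
    by (intro lin_on_sum[where f = f, OF assms(2) lin_on_tensor_zero[OF assms(1,2)]])
      (use assms(3) in auto)
qed (simp add: lin_on_tensor_zero[OF assms(1,2)])

lemma lin_ext_pure:
  assumes "vector_space s" "mlin s F f"
  shows "lin_ext s f (ptens F p) = f p"
  using assms by (intro lin_ext_ptens) (auto simp: mlin_def)

lemma lin_ext_lin_on:
  assumes "vector_space s" "mlin s F f"
  shows "lin_on fscale s (tensor_space F P) (lin_ext s f)"
  using lin_ext_add[OF assms(1), of f F] lin_ext_scale[OF assms(1), of f F] assms(2)
  by (auto simp: lin_on_def mlin_def)

lemma lin_ext_in_tensor_space: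
  assumes t: "t \<in> tensor_space F P" and f: "mlin fscale F f"
    and "\<And>p. p \<in> P \<Longrightarrow> f p \<in> tensor_space F' P'"
  shows "lin_ext fscale f t \<in> tensor_space F' P'"
proof -
  note l = lin_ext_lin_on[OF vector_space_fscale f, of P]
  show ?thesis
    using t
  proof (induction rule: tensor_space_induct)
    case zero
    show ?case using lin_on_tensor_zero[OF vector_space_fscale l] tensor_space_zero by metis
  qed (auto simp: lin_ext_pure[OF vector_space_fscale f] assms(3) lin_on_add[OF l]
      lin_on_scale[OF l])
qed

lemma mlin_bilinearI:
  assumes s: "vector_space s"
    and "\<And>w. w \<in> W \<Longrightarrow> lin_on s1 s V (\<lambda>v. f (v, w))"
    and "\<And>v. v \<in> V \<Longrightarrow> lin_on s2 s W (\<lambda>w. f (v, w))"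
  shows "mlin s (bilinear_forms s1 V s2 W) f"
  using assms
  by (auto simp: mlin_def bilinear_forms_def linear_form_on_lin_on lin_on_def
      module_hom.add[OF module_hom_linearI] module_hom.scale[OF module_hom_linearI])

lemma mlin_trilinearI:
  assumes s: "vector_space s"
    and "\<And>v w. lin_on s1 s UNIV (\<lambda>u. f (u, v, w))"
    and "\<And>u w. lin_on s2 s UNIV (\<lambda>v. f (u, v, w))"
    and "\<And>u v. lin_on s3 s UNIV (\<lambda>w. f (u, v, w))"
  shows "mlin s (trilinear_forms s1 s2 s3) f"
  using assms
  by (auto simp: mlin_def trilinear_forms_def linear_form_on_lin_on lin_on_def
      module_hom.add[OF module_hom_linearI] module_hom.scale[OF module_hom_linearI])

lemma mlin_multilinearI:
  fixes f :: "('i \<Rightarrow> 'v::ab_group_add) \<Rightarrow> 'u::ab_group_add" and s :: "'k::field \<Rightarrow> 'u \<Rightarrow> 'u"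
  assumes s: "vector_space s"
    and "\<And>m m'. (\<And>i. i \<in> I \<Longrightarrow> m i = m' i) \<Longrightarrow> f m = f m'"
    and "\<And>i m. i \<in> I \<Longrightarrow> lin_on s1 s UNIV (\<lambda>v. f (m(i := v)))"
  shows "mlin s (multilinear_forms s1 I) f"
  unfolding mlin_def multilinear_forms_def
proof (intro allI impI CollectI conjI ballI)
  fix g and m m' :: "'i \<Rightarrow> 'v"
  assume "\<forall>i\<in>I. m i = m' i"
  then have "f m = f m'" using assms(2) by blast
  then show "g (f m) = g (f m')" by simp
next
  fix g i m
  assume "Vector_Spaces.linear s (*) g" "i \<in> I"
  then show "linear_form_on s1 UNIV (\<lambda>v. g (f (m(i := v))))"
    using assms(3)[of i m] by (auto simp: linear_form_on_lin_on lin_on_def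
      module_hom.add[OF module_hom_linearI] module_hom.scale[OF module_hom_linearI])
qed

lemma ptens_bilinear_lin_on:
  "w \<in> W \<Longrightarrow> lin_on s1 fscale V (\<lambda>v. ptens (bilinear_forms s1 V s2 W) (v, w))"
  "v \<in> V \<Longrightarrow> lin_on s2 fscale W (\<lambda>w. ptens (bilinear_forms s1 V s2 W) (v, w))"
  by (auto simp: plus_fun_apply lin_on_def ptens_def fscale_def bilinear_forms_def linear_form_on_def fun_eq_iff)

lemma ptens_trilinear_lin_on:
  "lin_on s1 fscale UNIV (\<lambda>u. ptens (trilinear_forms s1 s2 s3) (u, v, w))"
  "lin_on s2 fscale UNIV (\<lambda>v. ptens (trilinear_forms s1 s2 s3) (u, v, w))"
  "lin_on s3 fscale UNIV (\<lambda>w. ptens (trilinear_forms s1 s2 s3) (u, v, w))"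
  by (auto simp: plus_fun_apply lin_on_def ptens_def fscale_def trilinear_forms_def linear_form_on_def fun_eq_iff)

lemma ptens_multilinear_lin_on:
  "i \<in> I \<Longrightarrow> lin_on s fscale UNIV (\<lambda>v. ptens (multilinear_forms s I) (m(i := v)))"
  by (auto simp: plus_fun_apply lin_on_def ptens_def fscale_def multilinear_forms_def linear_form_on_def
      fun_eq_iff)

lemma ptens_multilinear_cong:
  "(\<And>i. i \<in> I \<Longrightarrow> m i = m' i) \<Longrightarrow>
    ptens (multilinear_forms s I) m = ptens (multilinear_forms s I) m'"
  by (auto simp: ptens_def multilinear_forms_def fun_eq_iff)

subsection \<open>Maps of tensor powers that act on each factor\<close>

text \<open>One construction for operators on a single edge, permutations of edges, reversals of
  edges and permutations of the gauge factors. The index map points backwards, from the factors of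
  the image to those of the argument, so that no inverse occurs in the formula.\<close>

definition factorwise ::
  "('k::field \<Rightarrow> 'v::ab_group_add \<Rightarrow> 'v) \<Rightarrow> 'j set \<Rightarrow> ('j \<Rightarrow> 'i) \<Rightarrow> ('j \<Rightarrow> 'v \<Rightarrow> 'v) \<Rightarrow>
   ('i \<Rightarrow> 'v, 'k) tensor \<Rightarrow> ('j \<Rightarrow> 'v, 'k) tensor" where
  "factorwise s J \<pi> f =
     lin_ext fscale (\<lambda>m. ptens (multilinear_forms s J) (\<lambda>j. f j (m (\<pi> j))))"

text \<open>Bijectivity of \<pi> says that every factor of the argument enters exactly once; this
  makes the expression linear in each factor.\<close>

lemma mlin_factorwise:
  fixes s :: "'k::field \<Rightarrow> 'v::ab_group_add \<Rightarrow> 'v" and I :: "'i set" and J :: "'j set"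
  assumes "bij_betw \<pi> J I" "\<And>j. j \<in> J \<Longrightarrow> lin_on s s UNIV (f j)"
  shows "mlin fscale (multilinear_forms s I)
           (\<lambda>m. ptens (multilinear_forms s J) (\<lambda>j. f j (m (\<pi> j))))"
proof (intro mlin_multilinearI vector_space_fscale)
  fix m m' :: "'i \<Rightarrow> 'v"
  assume "\<And>i. i \<in> I \<Longrightarrow> m i = m' i"
  then show "ptens (multilinear_forms s J) (\<lambda>j. f j (m (\<pi> j))) =
      ptens (multilinear_forms s J) (\<lambda>j. f j (m' (\<pi> j)))"
    using bij_betwE[OF assms(1)] by (intro ptens_multilinear_cong) auto
next
  fix i and m :: "'i \<Rightarrow> 'v"
  assume "i \<in> I"
  then obtain j0 where j0: "j0 \<in> J" "\<pi> j0 = i" using assms(1) by (auto simp: bij_betw_def)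
  have "ptens (multilinear_forms s J) (\<lambda>j. f j ((m(i := v)) (\<pi> j))) =
      ptens (multilinear_forms s J) ((\<lambda>j. f j (m (\<pi> j)))(j0 := f j0 v))" for v
    using j0 assms(1) by (intro ptens_multilinear_cong) (auto simp: bij_betw_def inj_on_def)
  then show "lin_on s fscale UNIV
      (\<lambda>v. ptens (multilinear_forms s J) (\<lambda>j. f j ((m(i := v)) (\<pi> j))))"
    using ptens_multilinear_lin_on[OF j0(1), of s "\<lambda>j. f j (m (\<pi> j))"] assms(2)[OF j0(1)]
    by (simp add: lin_on_def)
qed

context
  fixes s :: "'k::field \<Rightarrow> 'v::ab_group_add \<Rightarrow> 'v" and I :: "'i set" and J :: "'j set" and \<pi> f
  assumes bij: "bij_betw \<pi> J I" and lin: "\<And>j. j \<in> J \<Longrightarrow> lin_on s s UNIV (f j)"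
begin

lemma factorwise_pure:
  "factorwise s J \<pi> f (ptens (multilinear_forms s I) m) =
     ptens (multilinear_forms s J) (\<lambda>j. f j (m (\<pi> j)))"
  unfolding factorwise_def
  by (rule lin_ext_pure[OF vector_space_fscale mlin_factorwise]) (use bij lin in auto)

lemma factorwise_lin_on:
  "lin_on fscale fscale (tensor_space (multilinear_forms s I) P) (factorwise s J \<pi> f)"
  unfolding factorwise_def
  by (rule lin_ext_lin_on[OF vector_space_fscale mlin_factorwise]) (use bij lin in auto)

lemma factorwise_in:
  "t \<in> tensor_space (multilinear_forms s I) P \<Longrightarrow>
    factorwise s J \<pi> f t \<in> tensor_space (multilinear_forms s J) UNIV"
  unfolding factorwise_def
  by (rule lin_ext_in_tensor_space[OF _ mlin_factorwise]) (use bij lin in \<open>auto intro!: tensor_space_pure\<close>)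

text \<open>Functoriality. The right-hand side is any description \<open>g\<close>,
  \<open>\<pi>''\<close> that agrees with the composite on \<open>K\<close>, so that two composites
  can be identified by giving them the same description.\<close>

lemma factorwise_comp:
  assumes bij': "bij_betw \<pi>' K J" and lin': "\<And>k. k \<in> K \<Longrightarrow> lin_on s s UNIV (f' k)"
    and t: "t \<in> tensor_space (multilinear_forms s I) UNIV"
    and eq: "\<And>k. k \<in> K \<Longrightarrow> g k = f' k \<circ> f (\<pi>' k)" "\<And>k. k \<in> K \<Longrightarrow> \<pi>'' k = \<pi> (\<pi>' k)"
  shows "factorwise s K \<pi>' f' (factorwise s J \<pi> f t) = factorwise s K \<pi>'' g t"
proof -
  have bij'': "bij_betw \<pi>'' K I"
    using bij_betw_trans[OF bij' bij] bij_betw_cong[of K \<pi>'' "\<pi> \<circ> \<pi>'"] eq(2) by auto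
  have lin'': "lin_on s s UNIV (g k)" if "k \<in> K" for k
    using that lin'[OF that] lin[of "\<pi>' k"] bij' eq(1)
    by (auto simp: lin_on_def bij_betw_def)
  have *: "mlin fscale (multilinear_forms s J)
        (\<lambda>m. ptens (multilinear_forms s K) (\<lambda>j. f' j (m (\<pi>' j))))"
      "mlin fscale (multilinear_forms s I)
        (\<lambda>m. ptens (multilinear_forms s K) (\<lambda>j. g j (m (\<pi>'' j))))"
    using mlin_factorwise bij' lin' bij'' lin'' by blast+
  have l1: "lin_on fscale fscale (tensor_space (multilinear_forms s J) UNIV) (factorwise s K \<pi>' f')"
    and p1: "factorwise s K \<pi>' f' (ptens (multilinear_forms s J) m) =
     ptens (multilinear_forms s K) (\<lambda>j. f' j (m (\<pi>' j)))" for m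
    unfolding factorwise_def
    by (rule lin_ext_lin_on[OF vector_space_fscale *(1)] lin_ext_pure[OF vector_space_fscale *(1)])+
  have l2: "lin_on fscale fscale (tensor_space (multilinear_forms s I) UNIV) (factorwise s K \<pi>'' g)"
    and p2: "factorwise s K \<pi>'' g (ptens (multilinear_forms s I) m) =
     ptens (multilinear_forms s K) (\<lambda>j. g j (m (\<pi>'' j)))" for m
    unfolding factorwise_def
    by (rule lin_ext_lin_on[OF vector_space_fscale *(2)] lin_ext_pure[OF vector_space_fscale *(2)])+
  show ?thesis
  proof (rule lin_on_tensor_eqI[OF t vector_space_fscale _ l2])
    show "lin_on fscale fscale (tensor_space (multilinear_forms s I) UNIV)
        (\<lambda>t. factorwise s K \<pi>' f' (factorwise s J \<pi> f t))"
      using l1 factorwise_lin_on[of UNIV] factorwise_in[of _ UNIV] by (auto simp: lin_on_def)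
  next
    fix m :: "'i \<Rightarrow> 'v"
    show "factorwise s K \<pi>' f' (factorwise s J \<pi> f (ptens (multilinear_forms s I) m)) =
        factorwise s K \<pi>'' g (ptens (multilinear_forms s I) m)"
      unfolding factorwise_pure p1 p2 using eq by (intro ptens_multilinear_cong) auto
  qed
qed

end

lemma factorwise_id:
  assumes "\<And>i. i \<in> I \<Longrightarrow> f i = id" "\<And>i. i \<in> I \<Longrightarrow> \<pi> i = i"
    and t: "t \<in> tensor_space (multilinear_forms s I) UNIV"
  shows "factorwise s I \<pi> f t = t"
proof -
  have b: "bij_betw \<pi> I I" using bij_betw_cong[of I \<pi> id I] assms(2) by auto
  have l: "lin_on s s UNIV (f i)" if "i \<in> I" for i using assms(1)[OF that] by (auto simp: lin_on_def)
  show ?thesis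
  proof (rule lin_on_tensor_eqI[OF t vector_space_fscale factorwise_lin_on[OF b l]])
    fix m
    show "factorwise s I \<pi> f (ptens (multilinear_forms s I) m) = ptens (multilinear_forms s I) m"
      by (subst factorwise_pure[OF b l], assumption, intro ptens_multilinear_cong)
        (auto simp: assms)
  qed (auto simp: lin_on_def)
qed

lemma factorwise_cong:
  assumes "\<And>j. j \<in> J \<Longrightarrow> f j = f' j" "\<And>j. j \<in> J \<Longrightarrow> \<pi> j = \<pi>' j"
  shows "factorwise s J \<pi> f = factorwise s J \<pi>' f'"
  unfolding factorwise_def
  by (intro arg_cong[where f = "lin_ext fscale"] ext ptens_multilinear_cong) (auto simp: assms)

definition at_factor ::
  "('k::field \<Rightarrow> 'v::ab_group_add \<Rightarrow> 'v) \<Rightarrow> 'i set \<Rightarrow> 'i \<Rightarrow> ('v \<Rightarrow> 'v) \<Rightarrow>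
   ('i \<Rightarrow> 'v, 'k) tensor \<Rightarrow> ('i \<Rightarrow> 'v, 'k) tensor" where
  "at_factor s I i f = factorwise s I id (\<lambda>j. if j = i then f else id)"

lemma at_factor_altdef:
  "at_factor s I i f = lin_ext fscale (\<lambda>m. ptens (multilinear_forms s I) (m(i := f (m i))))"
proof -
  have "(\<lambda>j. (if j = i then f else id) (m (id j))) = m(i := f (m i))" for m
    by auto
  then show ?thesis unfolding at_factor_def factorwise_def by presburger
qed

lemma on_edge_at_factor: "on_edge M G e f = at_factor (mscale M) (edges G) e f"
  by (simp add: on_edge_def at_factor_altdef)

lemma lin_on_if: "lin_on s s W f \<Longrightarrow> lin_on s s W (if P then f else id)"
  by (auto simp: lin_on_def)

lemma at_factor_pure:
  assumes "lin_on s s UNIV f"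
  shows "at_factor s I i f (ptens (multilinear_forms s I) m) =
    ptens (multilinear_forms s I) (m(i := f (m i)))"
proof -
  have "at_factor s I i f (ptens (multilinear_forms s I) m) = 
     ptens (multilinear_forms s I) (\<lambda>j. (if j = i then f else id) (m (id j)))"
    unfolding at_factor_def using assms by (intro factorwise_pure) (auto simp: lin_on_def)
  also have "\<dots> = ptens (multilinear_forms s I) (m(i := f (m i)))"
    by (intro ptens_multilinear_cong) auto
  finally show ?thesis .
qed

lemma at_factor_lin_on:
  "lin_on s s UNIV f \<Longrightarrow>
    lin_on fscale fscale (tensor_space (multilinear_forms s I) UNIV) (at_factor s I i f)"
  unfolding at_factor_def by (intro factorwise_lin_on) (auto simp: lin_on_def)

lemma at_factor_in:
  "lin_on s s UNIV f \<Longrightarrow> t \<in> tensor_space (multilinear_forms s I) UNIV \<Longrightarrow>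
    at_factor s I i f t \<in> tensor_space (multilinear_forms s I) UNIV"
  unfolding at_factor_def by (rule factorwise_in) (auto simp: lin_on_def)

lemma at_factor_comp:
  assumes "lin_on s s UNIV f" "lin_on s s UNIV g"
    "t \<in> tensor_space (multilinear_forms s I) UNIV"
  shows "at_factor s I i f (at_factor s I i g t) = at_factor s I i (\<lambda>m. f (g m)) t"
  unfolding at_factor_def using assms
  by (intro factorwise_comp) (auto simp: lin_on_def)

lemma at_factor_commute:
  assumes "lin_on s s UNIV f" "lin_on s s UNIV g" "i \<noteq> j"
    "t \<in> tensor_space (multilinear_forms s I) UNIV"
  shows "at_factor s I i f (at_factor s I j g t) = at_factor s I j g (at_factor s I i f t)"
proof -
  define h where "h = (\<lambda>k. if k = i then f else if k = j then g else id)"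
  have "at_factor s I i f (at_factor s I j g t) = factorwise s I id h t"
    unfolding at_factor_def using assms
    by (intro factorwise_comp) (auto simp: lin_on_def h_def)
  moreover have "at_factor s I j g (at_factor s I i f t) = factorwise s I id h t"
    unfolding at_factor_def using assms
    by (intro factorwise_comp) (auto simp: lin_on_def h_def)
  ultimately show ?thesis by simp
qed

lemma at_factor_id:
  "t \<in> tensor_space (multilinear_forms s I) UNIV \<Longrightarrow> at_factor s I i (\<lambda>m. m) t = t"
  unfolding at_factor_def by (rule factorwise_id) auto

text \<open>The index has to lie in \<open>I\<close>: at any other index \<open>at_factor\<close> is
  the identity for every operator, and additivity in the operator would fail.\<close>

lemma at_factor_add:
  assumes s: "vector_space s" and "i \<in> I" and lin: "lin_on s s UNIV f" "lin_on s s UNIV g"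
    and t: "t \<in> tensor_space (multilinear_forms s I) UNIV"
  shows "at_factor s I i (\<lambda>m. f m + g m) t = at_factor s I i f t + at_factor s I i g t"
proof -
  interpret vector_space s by (rule s)
  have fg: "lin_on s s UNIV (\<lambda>m. f m + g m)"
    using lin by (auto simp: lin_on_def scale_right_distrib)
  show ?thesis
  proof (rule lin_on_tensor_eqI[OF t vector_space_fscale at_factor_lin_on[OF fg]])
    show "lin_on fscale fscale (tensor_space (multilinear_forms s I) UNIV)
        (\<lambda>t. at_factor s I i f t + at_factor s I i g t)"
      using at_factor_lin_on[OF lin(1), of I i] at_factor_lin_on[OF lin(2), of I i]
      by (auto simp: lin_on_def fs.scale_right_distrib)
  next
    fix m
    show "at_factor s I i (\<lambda>m. f m + g m) (ptens (multilinear_forms s I) m) =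
        at_factor s I i f (ptens (multilinear_forms s I) m) +
        at_factor s I i g (ptens (multilinear_forms s I) m)"
      unfolding at_factor_pure[OF fg] at_factor_pure[OF lin(1)] at_factor_pure[OF lin(2)]
      using lin_on_add[OF ptens_multilinear_lin_on[OF assms(2)]] by simp
  qed
qed

lemma at_factor_scale:
  assumes s: "vector_space s" and "i \<in> I" and lin: "lin_on s s UNIV f"
    and t: "t \<in> tensor_space (multilinear_forms s I) UNIV"
  shows "at_factor s I i (\<lambda>m. s c (f m)) t = fscale c (at_factor s I i f t)"
proof -
  interpret vector_space s by (rule s)
  have fg: "lin_on s s UNIV (\<lambda>m. s c (f m))"
    using lin by (auto simp: lin_on_def scale_right_distrib mult.commute)
  show ?thesis
  proof (rule lin_on_tensor_eqI[OF t vector_space_fscale at_factor_lin_on[OF fg]])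
    show "lin_on fscale fscale (tensor_space (multilinear_forms s I) UNIV)
        (\<lambda>t. fscale c (at_factor s I i f t))"
      using at_factor_lin_on[OF lin(1), of I i]
      by (auto simp: lin_on_def fs.scale_right_distrib mult.commute)
  next
    fix m
    show "at_factor s I i (\<lambda>m. s c (f m)) (ptens (multilinear_forms s I) m) =
        fscale c (at_factor s I i f (ptens (multilinear_forms s I) m))"
      unfolding at_factor_pure[OF fg] at_factor_pure[OF lin(1)]
      using lin_on_scale[OF ptens_multilinear_lin_on[OF assms(2)]] by simp
  qed
qed

lemma lin_on_sum_fun:
  assumes "vector_space s'" "\<And>x. x \<in> A \<Longrightarrow> lin_on s s' W (f x)"
  shows "lin_on s s' W (\<lambda>m. \<Sum>x\<in>A. f x m)"
proof -
  interpret vector_space s' by fact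
  show ?thesis using assms(2) by (auto simp: lin_on_def sum.distrib scale_sum_right)
qed

lemma lin_on_scale_fun:
  assumes "vector_space s'" "lin_on s s' W f"
  shows "lin_on s s' W (\<lambda>m. s' c (f m))"
proof -
  interpret vector_space s' by fact
  show ?thesis using assms(2) by (auto simp: lin_on_def scale_right_distrib mult.commute)
qed

lemma at_factor_sum:
  assumes s: "vector_space s" and "i \<in> I" and "finite A"
    and lin: "\<And>x. x \<in> A \<Longrightarrow> lin_on s s UNIV (f x)"
    and t: "t \<in> tensor_space (multilinear_forms s I) UNIV"
  shows "at_factor s I i (\<lambda>m. \<Sum>x\<in>A. s (c x) (f x m)) t =
    (\<Sum>x\<in>A. fscale (c x) (at_factor s I i (f x) t))"
  using \<open>finite A\<close> lin
proof (induction rule: finite_induct)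
  case empty
  interpret vector_space s by fact
  \<comment> \<open>The empty sum is the zero operator, regarded as 0 times the identity so that
    \<open>at_factor_scale\<close> applies.\<close>
  show ?case
    using at_factor_scale[OF s assms(2) _ t, of "\<lambda>m. m" 0] by (simp add: lin_on_def)
next
  case (insert x F)
  have "at_factor s I i (\<lambda>m. s (c x) (f x m) + (\<Sum>x\<in>F. s (c x) (f x m))) t =
    at_factor s I i (\<lambda>m. s (c x) (f x m)) t + at_factor s I i (\<lambda>m. \<Sum>x\<in>F. s (c x) (f x m)) t"
    using insert by (intro at_factor_add[OF s assms(2) _ _ t] lin_on_sum_fun lin_on_scale_fun s) auto
  then show ?case using insert at_factor_scale[OF s assms(2) _ t] by simp
qed

section \<open>Finite-dimensional Hopf algebras\<close>

locale fd_hopf_algebra = hopf_algebra H for H :: "('k::field, 'h::ring_1) hopf" +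
  fixes B :: "'h set"
  assumes fd: "finite_dimensional_vector_space (hscale H) B"
begin

sublocale hs: finite_dimensional_vector_space "hscale H" B
  by (rule fd)

abbreviation zeta :: "'h \<Rightarrow> 'h \<Rightarrow> 'k" where "zeta \<equiv> dual_basis H B"

abbreviation hlin :: "('k \<Rightarrow> 'u::ab_group_add \<Rightarrow> 'u) \<Rightarrow> ('h \<Rightarrow> 'u) \<Rightarrow> bool" where
  "hlin s \<equiv> lin_on (hscale H) s UNIV"

lemma finite_B [simp]: "finite B"
  by (rule hs.finite_Basis)

lemma zeta_add: "zeta x (v + w) = zeta x v + zeta x w"
  unfolding dual_basis_def
  by (subst hs.representation_add) (auto simp: hs.independent_Basis hs.span_Basis)

lemma zeta_scale: "zeta x (hscale H c v) = c * zeta x v"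
  unfolding dual_basis_def
  by (subst hs.representation_scale) (auto simp: hs.independent_Basis hs.span_Basis)

lemma zeta_lin: "hlin (*) (zeta x)"
  by (rule lin_onI) (auto simp: zeta_add zeta_scale)

lemma zeta_expand: "(\<Sum>b\<in>B. hscale H (zeta b v) b) = v"
  unfolding dual_basis_def
  by (rule hs.sum_representation_eq) (auto simp: hs.independent_Basis hs.span_Basis)

lemma hlin_sum:
  assumes "vector_space s" "hlin s f"
  shows "f (\<Sum>i\<in>A. x i) = (\<Sum>i\<in>A. f (x i))"
proof -
  have f0: "f 0 = 0" using lin_on_zero[OF vector_space_H assms, of 0] by simp
  show ?thesis
    by (cases "finite A") (auto intro!: lin_on_sum[OF assms(2)] simp: f0)
qed

lemma hlin_expand:
  assumes "vector_space s" "hlin s f"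
  shows "(\<Sum>b\<in>B. s (zeta b v) (f b)) = f v"
proof -
  have "f v = f (\<Sum>b\<in>B. hscale H (zeta b v) b)" by (simp add: zeta_expand)
  also have "\<dots> = (\<Sum>b\<in>B. s (zeta b v) (f b))"
    using lin_on_scale[OF assms(2)] by (simp add: hlin_sum[OF assms])
  finally show ?thesis by simp
qed

section \<open>Sweedler calculus for the coproduct, in coordinates\<close>

definition blin :: "('k \<Rightarrow> 'u::ab_group_add \<Rightarrow> 'u) \<Rightarrow> ('h \<Rightarrow> 'h \<Rightarrow> 'u) \<Rightarrow> bool" where
  "blin s f \<longleftrightarrow> (\<forall>y. hlin s (\<lambda>x. f x y)) \<and> (\<forall>x. hlin s (f x))"

text \<open>
  The coordinates of \<open>\<Delta> h\<close> with respect to \<open>B\<close>; \<open>cop s h f\<close> is \<open>f(h\<^sub>1, h\<^sub>2)\<close> in Sweedler notation.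
\<close>

definition cc :: "'h \<Rightarrow> 'h \<Rightarrow> 'h \<Rightarrow> 'k" where
  "cc h x y = comult H h (\<lambda>(u, v). zeta x u * zeta y v)"

definition cop :: "('k \<Rightarrow> 'u::ab_group_add \<Rightarrow> 'u) \<Rightarrow> 'h \<Rightarrow> ('h \<Rightarrow> 'h \<Rightarrow> 'u) \<Rightarrow> 'u" where
  "cop s h f = (\<Sum>x\<in>B. \<Sum>y\<in>B. s (cc h x y) (f x y))"

lemma cc_add: "cc (h + g) x y = cc h x y + cc g x y"
  by (simp add: cc_def comult_add plus_fun_apply)

lemma cc_scale: "cc (hscale H c h) x y = c * cc h x y"
  by (simp add: cc_def comult_scale fscale_def)

lemma cop_add: "vector_space s \<Longrightarrow> cop s (h + g) f = cop s h f + cop s g f"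
  by (simp add: cop_def cc_add sum.distrib vector_space.vector_space_assms)

lemma cop_scale:
  assumes "vector_space s" shows "cop s (hscale H c h) f = s c (cop s h f)"
proof -
  interpret vector_space s by fact
  show ?thesis by (simp add: cop_def cc_scale scale_sum_right)
qed

lemma cop_hlin: "vector_space s \<Longrightarrow> hlin s (\<lambda>h. cop s h f)"
  by (simp add: lin_on_def cop_add cop_scale)

lemma cop_add_fun:
  "vector_space s \<Longrightarrow> cop s h (\<lambda>x y. f x y + g x y) = cop s h f + cop s h g"
  by (simp add: cop_def sum.distrib vector_space.vector_space_assms)

lemma cop_scale_fun:
  assumes "vector_space s" shows "cop s h (\<lambda>x y. s c (f x y)) = s c (cop s h f)"
proof -
  interpret vector_space s by fact
  show ?thesis by (simp add: cop_def scale_sum_right mult.commute)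
qed

lemma cop_swap:
  assumes "vector_space s"
  shows "cop s h (\<lambda>x y. cop s g (\<lambda>u v. F x y u v)) = cop s g (\<lambda>u v. cop s h (\<lambda>x y. F x y u v))"
proof -
  interpret vector_space s by fact
  have "cop s h (\<lambda>x y. cop s g (\<lambda>u v. F x y u v)) =
    (\<Sum>(x, y)\<in>B \<times> B. \<Sum>(u, v)\<in>B \<times> B. s (cc h x y * cc g u v) (F x y u v))"
    by (simp add: cop_def scale_sum_right sum.cartesian_product[symmetric])
  also have "\<dots> = (\<Sum>(u, v)\<in>B \<times> B. \<Sum>(x, y)\<in>B \<times> B. s (cc g u v * cc h x y) (F x y u v))"
    unfolding case_prod_unfold by (rule HOL.trans[OF sum.swap]) (simp add: mult.commute)
  also have "\<dots> = cop s g (\<lambda>u v. cop s h (\<lambda>x y. F x y u v))"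
    by (simp add: cop_def scale_sum_right sum.cartesian_product[symmetric])
  finally show ?thesis .
qed

lemma cop_map:
  assumes s: "vector_space s'" "vector_space s" and g: "lin_on s s' W g" "0 \<in> W"
    "\<And>u v. u \<in> W \<Longrightarrow> v \<in> W \<Longrightarrow> u + v \<in> W" "\<And>c u. u \<in> W \<Longrightarrow> s c u \<in> W"
    and f: "\<And>x y. x \<in> B \<Longrightarrow> y \<in> B \<Longrightarrow> f x y \<in> W"
  shows "g (cop s h f) = cop s' h (\<lambda>x y. g (f x y))"
proof -
  have g0: "g 0 = 0" using lin_on_zero[OF s(2,1) g(1,2)] .
  have "g (cop s h f) = g (\<Sum>(x, y)\<in>B \<times> B. s (cc h x y) (f x y))"
    by (simp add: cop_def sum.cartesian_product[symmetric])
  also have "\<dots> = (\<Sum>p\<in>B \<times> B. g (case p of (x, y) \<Rightarrow> s (cc h x y) (f x y)))"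
    by (intro lin_on_sum[OF g(1) g0]) (use g f in auto)
  also have "\<dots> = cop s' h (\<lambda>x y. g (f x y))"
    using f lin_on_scale[OF g(1)]
    by (auto simp: cop_def sum.cartesian_product intro!: sum.cong)
  finally show ?thesis .
qed

lemma cop_map_UNIV:
  assumes "vector_space s'" "vector_space s" "lin_on s s' UNIV g"
  shows "g (cop s h f) = cop s' h (\<lambda>x y. g (f x y))"
  by (rule cop_map[OF assms]) auto

lemma cop_sum:
  "vector_space s \<Longrightarrow> cop s h (\<lambda>x y. \<Sum>i\<in>A. f i x y) = (\<Sum>i\<in>A. cop s h (f i))"
proof -
  assume "vector_space s"
  then interpret vector_space s .
  show ?thesis
    by (induction A rule: infinite_finite_induct) (simp_all add: cop_add_fun[OF vector_space_axioms],
      simp_all add: cop_def)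
qed

lemma cop_cong:
  "(\<And>x y. x \<in> B \<Longrightarrow> y \<in> B \<Longrightarrow> f x y = g x y) \<Longrightarrow> cop s h f = cop s h g"
  by (simp add: cop_def)

lemma cop_in:
  assumes "0 \<in> W" "\<And>u v. u \<in> W \<Longrightarrow> v \<in> W \<Longrightarrow> u + v \<in> W" "\<And>c u. u \<in> W \<Longrightarrow> s c u \<in> W"
    "\<And>x y. x \<in> B \<Longrightarrow> y \<in> B \<Longrightarrow> f x y \<in> W"
  shows "cop s h f \<in> W"
proof -
  have s: "(\<Sum>i\<in>A. k i) \<in> W" if "\<And>i. i \<in> A \<Longrightarrow> k i \<in> W" "finite A" for A :: "'h set" and k
    using that(2,1) by (induction rule: finite_induct) (use assms in auto)
  show ?thesis unfolding cop_def using assms by (intro s) auto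
qed

text \<open>On a pure tensor this is the expansion of both arguments in the basis. Hence a tensor is
  determined by its values at products of coordinate forms, which for \<open>comult H h\<close> are
  the numbers \<open>cc\<close>.\<close>

lemma bilin_tensor_eval:
  assumes "t \<in> tensor_space (bilin (hscale H) (hscale H)) UNIV"
    and "\<phi> \<in> bilin (hscale H) (hscale H)"
  shows "t \<phi> = (\<Sum>x\<in>B. \<Sum>y\<in>B. t (\<lambda>(u, v). zeta x u * zeta y v) * \<phi> (x, y))"
  using assms(1)
proof (induction rule: tensor_space_induct)
  case (pure p)
  obtain u v where p: "p = (u, v)" by (cases p)
  have z: "(\<lambda>(u, v). zeta x u * zeta y v) \<in> bilin (hscale H) (hscale H)" for x y
    by (auto simp: bilinear_forms_def linear_form_on_def zeta_add zeta_scale algebra_simps)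
  have l: "hlin (*) (\<lambda>x. \<phi> (x, y))" "hlin (*) (\<lambda>y. \<phi> (x, y))" for x y
    using assms(2) by (auto simp: bilinear_forms_def linear_form_on_lin_on)
  have "(\<Sum>x\<in>B. \<Sum>y\<in>B. zeta x u * zeta y v * \<phi> (x, y)) =
      (\<Sum>x\<in>B. zeta x u * (\<Sum>y\<in>B. zeta y v * \<phi> (x, y)))"
    by (simp add: sum_distrib_left mult.assoc)
  also have "\<dots> = \<phi> (u, v)"
    by (simp add: hlin_expand[OF vector_space_field l(1)] hlin_expand[OF vector_space_field l(2)])
  finally show ?case using assms(2) by (simp add: ptens_def z p)
qed (simp_all add: zero_fun_apply plus_fun_apply fscale_def distrib_right sum.distrib
    sum_distrib_left mult.assoc)

text \<open>The bridge from the Sweedler expressions in the axioms to finite sums over the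
  basis.\<close>

lemma lin_ext_comult:
  assumes s: "vector_space s" and f: "blin s f"
  shows "lin_ext s (\<lambda>(x, y). f x y) (comult H h) = cop s h f"
proof (rule lin_ext_eqI[OF s])
  fix g assume g: "Vector_Spaces.linear s (*) g"
  have "(\<lambda>p. g (case p of (x, y) \<Rightarrow> f x y)) \<in> bilin (hscale H) (hscale H)"
    using f mlin_bilinearI[OF s, of UNIV "hscale H" UNIV "\<lambda>(x, y). f x y" "hscale H"] g
    by (auto simp: mlin_def blin_def)
  from bilin_tensor_eval[OF comult_in this, of h]
  show "g (cop s h f) = comult H h (\<lambda>p. g (case p of (x, y) \<Rightarrow> f x y))"
    using cop_map_UNIV[OF vector_space_field s linear_lin_on[OF g], of h f]
    by (simp add: cop_def cc_def)
qed

lemma comult3_cop: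
  "comult3 H h = cop fscale h (\<lambda>x h3. cop fscale x (\<lambda>h1 h2.
     ptens (trilinear_forms (hscale H) (hscale H) (hscale H)) (h1, h2, h3)))"
proof -
  let ?p = "ptens (trilinear_forms (hscale H) (hscale H) (hscale H))"
  have 1: "lin_ext fscale (\<lambda>(h1, h2). ?p (h1, h2, h3)) (comult H x) =
      cop fscale x (\<lambda>h1 h2. ?p (h1, h2, h3))" for x h3
    by (intro lin_ext_comult vector_space_fscale) (simp add: blin_def ptens_trilinear_lin_on)
  have "hlin fscale (\<lambda>h3. cop fscale x (\<lambda>h1 h2. ?p (h1, h2, h3)))" for x
    by (rule lin_onI) (simp_all add: lin_on_add[OF ptens_trilinear_lin_on(3)]
      lin_on_scale[OF ptens_trilinear_lin_on(3)] cop_add_fun[OF vector_space_fscale]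
      cop_scale_fun[OF vector_space_fscale])
  then have "blin fscale (\<lambda>x h3. cop fscale x (\<lambda>h1 h2. ?p (h1, h2, h3)))"
    by (simp add: blin_def cop_hlin vector_space_fscale)
  from lin_ext_comult[OF vector_space_fscale this] show ?thesis
    by (simp add: comult3_def 1)
qed

lemma sum_fun_apply: "(\<Sum>i\<in>A. f i) x = (\<Sum>i\<in>A. f i x)"
  by (induction A rule: infinite_finite_induct) (auto simp: zero_fun_apply plus_fun_apply)

lemma cop_fscale_apply: "cop fscale h f \<phi> = cop (*) h (\<lambda>x y. f x y \<phi>)"
  by (simp add: cop_def sum_fun_apply fscale_def)

lemma zeta_basis: "x \<in> B \<Longrightarrow> y \<in> B \<Longrightarrow> zeta x y = (if x = y then 1 else 0)"
  unfolding dual_basis_def by (subst hs.representation_basis) (auto simp: hs.independent_Basis)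

lemma sum_zeta_zeta:
  assumes "x \<in> B" "y \<in> B"
  shows "(\<Sum>u\<in>B. \<Sum>v\<in>B. a u v * (zeta x u * zeta y v)) = a x y"
proof -
  have "(\<Sum>u\<in>B. \<Sum>v\<in>B. a u v * (zeta x u * zeta y v)) =
      (\<Sum>u\<in>B. \<Sum>v\<in>B. if y = v then (if x = u then a u v else 0) else 0)"
    using assms by (intro sum.cong) (auto simp: zeta_basis)
  also have "\<dots> = a x y" using assms by simp
  finally show ?thesis .
qed

text \<open>Both sides of the coassociativity axiom are functionals on trilinear forms; they are
  evaluated at the product of the coordinate forms of \<open>u\<close>, \<open>v\<close> and
  \<open>w\<close>.\<close>

lemma coassoc_cc:
  assumes "u \<in> B" "v \<in> B" "w \<in> B"
  shows "(\<Sum>x\<in>B. cc h x w * cc x u v) = (\<Sum>x\<in>B. cc h u x * cc x v w)"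
proof -
  let ?T = "trilinear_forms (hscale H) (hscale H) (hscale H)"
  define \<phi> where "\<phi> = (\<lambda>(a, b, c). zeta u a * zeta v b * zeta w c)"
  have \<phi>: "\<phi> \<in> ?T"
    by (auto simp: \<phi>_def trilinear_forms_def linear_form_on_def zeta_add zeta_scale algebra_simps)
  have 1: "lin_ext fscale (\<lambda>(h2, h3). ptens ?T (h1, h2, h3)) (comult H x) =
      cop fscale x (\<lambda>h2 h3. ptens ?T (h1, h2, h3))" for x h1
    by (intro lin_ext_comult vector_space_fscale) (simp add: blin_def ptens_trilinear_lin_on)
  have "hlin fscale (\<lambda>h1. cop fscale x (\<lambda>h2 h3. ptens ?T (h1, h2, h3)))" for x
    by (rule lin_onI) (simp_all add: lin_on_add[OF ptens_trilinear_lin_on(1)]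
      lin_on_scale[OF ptens_trilinear_lin_on(1)] cop_add_fun[OF vector_space_fscale]
      cop_scale_fun[OF vector_space_fscale])
  then have "blin fscale (\<lambda>h1 x. cop fscale x (\<lambda>h2 h3. ptens ?T (h1, h2, h3)))"
    by (simp add: blin_def cop_hlin vector_space_fscale)
  from lin_ext_comult[OF vector_space_fscale this]
  have "cop fscale h (\<lambda>x h3. cop fscale x (\<lambda>h1 h2. ptens ?T (h1, h2, h3))) \<phi> =
      cop fscale h (\<lambda>h1 x. cop fscale x (\<lambda>h2 h3. ptens ?T (h1, h2, h3))) \<phi>"
    using coassoc[of h] by (simp add: 1 comult3_cop)
  then have eq: "cop (*) h (\<lambda>x h3. cop (*) x (\<lambda>h1 h2. zeta u h1 * zeta v h2 * zeta w h3)) =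
      cop (*) h (\<lambda>h1 x. cop (*) x (\<lambda>h2 h3. zeta u h1 * zeta v h2 * zeta w h3))"
    using \<phi> by (simp add: cop_fscale_apply ptens_def) (simp add: \<phi>_def)
  have "cop (*) h (\<lambda>x h3. cop (*) x (\<lambda>h1 h2. zeta u h1 * zeta v h2 * zeta w h3)) =
      (\<Sum>x\<in>B. \<Sum>h3\<in>B. if w = h3 then cc h x h3 * cc x u v else 0)"
    unfolding cop_def
  proof (intro sum.cong HOL.refl)
    fix x h3 assume "x \<in> B" "h3 \<in> B"
    have *: "(\<Sum>xa\<in>B. \<Sum>y\<in>B. cc x xa y * (zeta u xa * zeta v y * zeta w h3)) =
        (\<Sum>xa\<in>B. \<Sum>y\<in>B. cc x xa y * (zeta u xa * zeta v y)) * zeta w h3"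
      by (simp add: sum_distrib_right mult.assoc)
    show "cc h x h3 * (\<Sum>xa\<in>B. \<Sum>y\<in>B. cc x xa y * (zeta u xa * zeta v y * zeta w h3)) =
        (if w = h3 then cc h x h3 * cc x u v else 0)"
      unfolding * sum_zeta_zeta[OF assms(1,2)] using assms \<open>h3 \<in> B\<close> by (simp add: zeta_basis)
  qed
  moreover have "cop (*) h (\<lambda>h1 x. cop (*) x (\<lambda>h2 h3. zeta u h1 * zeta v h2 * zeta w h3)) =
      (\<Sum>h1\<in>B. \<Sum>x\<in>B. if u = h1 then cc h h1 x * cc x v w else 0)"
    unfolding cop_def
  proof (intro sum.cong HOL.refl)
    fix h1 x assume "x \<in> B" "h1 \<in> B"
    have *: "(\<Sum>xa\<in>B. \<Sum>y\<in>B. cc x xa y * (zeta u h1 * zeta v xa * zeta w y)) =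
        (\<Sum>xa\<in>B. \<Sum>y\<in>B. cc x xa y * (zeta v xa * zeta w y)) * zeta u h1"
      by (simp add: sum_distrib_left mult_ac)
    show "cc h h1 x * (\<Sum>xa\<in>B. \<Sum>y\<in>B. cc x xa y * (zeta u h1 * zeta v xa * zeta w y)) =
        (if u = h1 then cc h h1 x * cc x v w else 0)"
      unfolding * sum_zeta_zeta[OF assms(2,3)] using assms \<open>h1 \<in> B\<close> by (simp add: zeta_basis)
  qed
  moreover have "(\<Sum>h1\<in>B. \<Sum>x\<in>B. if u = h1 then cc h h1 x * cc x v w else 0) =
      (\<Sum>x\<in>B. cc h u x * cc x v w)"
    by (subst sum.swap) (use assms in simp)
  ultimately show ?thesis using eq assms by simp
qed

text \<open>Both sides are sums over basis elements whose coefficients agree by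
  \<open>coassoc_cc\<close>, so the rule holds for any family \<open>f\<close> of vectors.\<close>

lemma cop_coassoc:
  assumes "vector_space s"
  shows "cop s h (\<lambda>x w. cop s x (\<lambda>u v. f u v w)) = cop s h (\<lambda>u x. cop s x (\<lambda>v w. f u v w))"
proof -
  interpret vector_space s by fact
  have "cop s h (\<lambda>x w. cop s x (\<lambda>u v. f u v w)) =
      (\<Sum>x\<in>B. \<Sum>w\<in>B. \<Sum>u\<in>B. \<Sum>v\<in>B. s (cc h x w * cc x u v) (f u v w))"
    by (simp add: cop_def scale_sum_right)
  \<comment> \<open>The intermediate basis element \<open>x\<close> is moved to the innermost sum,
    where \<open>coassoc_cc\<close> exchanges the two ways of splitting.\<close>
  also have "\<dots> = (\<Sum>w\<in>B. \<Sum>u\<in>B. \<Sum>v\<in>B. \<Sum>x\<in>B. s (cc h x w * cc x u v) (f u v w))"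
    by (rule HOL.trans[OF sum.swap], rule sum.cong[OF HOL.refl], rule HOL.trans[OF sum.swap],
      rule sum.cong[OF HOL.refl], rule sum.swap)
  also have "\<dots> = (\<Sum>w\<in>B. \<Sum>u\<in>B. \<Sum>v\<in>B. s (\<Sum>x\<in>B. cc h x w * cc x u v) (f u v w))"
    by (simp add: scale_sum_left)
  also have "\<dots> = (\<Sum>w\<in>B. \<Sum>u\<in>B. \<Sum>v\<in>B. s (\<Sum>x\<in>B. cc h u x * cc x v w) (f u v w))"
    by (intro sum.cong HOL.refl) (simp add: coassoc_cc)
  also have "\<dots> = (\<Sum>w\<in>B. \<Sum>u\<in>B. \<Sum>v\<in>B. \<Sum>x\<in>B. s (cc h u x * cc x v w) (f u v w))"
    by (simp add: scale_sum_left)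
  also have "\<dots> = (\<Sum>u\<in>B. \<Sum>x\<in>B. \<Sum>v\<in>B. \<Sum>w\<in>B. s (cc h u x * cc x v w) (f u v w))"
  proof -
    have "(\<Sum>w\<in>B. \<Sum>u\<in>B. \<Sum>v\<in>B. \<Sum>x\<in>B. s (cc h u x * cc x v w) (f u v w)) =
      (\<Sum>u\<in>B. \<Sum>w\<in>B. \<Sum>v\<in>B. \<Sum>x\<in>B. s (cc h u x * cc x v w) (f u v w))"
      by (rule sum.swap)
    also have "\<dots> = (\<Sum>u\<in>B. \<Sum>w\<in>B. \<Sum>x\<in>B. \<Sum>v\<in>B. s (cc h u x * cc x v w) (f u v w))"
      by (rule sum.cong[OF HOL.refl], rule sum.cong[OF HOL.refl], rule sum.swap)
    also have "\<dots> = (\<Sum>u\<in>B. \<Sum>x\<in>B. \<Sum>w\<in>B. \<Sum>v\<in>B. s (cc h u x * cc x v w) (f u v w))"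
      by (rule sum.cong[OF HOL.refl], rule sum.swap)
    also have "\<dots> = (\<Sum>u\<in>B. \<Sum>x\<in>B. \<Sum>v\<in>B. \<Sum>w\<in>B. s (cc h u x * cc x v w) (f u v w))"
      by (rule sum.cong[OF HOL.refl], rule sum.cong[OF HOL.refl], rule sum.swap)
    finally show ?thesis .
  qed
  also have "\<dots> = cop s h (\<lambda>u x. cop s x (\<lambda>v w. f u v w))"
    by (simp add: cop_def scale_sum_right)
  finally show ?thesis .
qed

lemma counit_add: "counit H (x + y) = counit H x + counit H y"
  and counit_scale: "counit H (hscale H c x) = c * counit H x"
  using linear_lin_on[OF counit_linear, of UNIV] by (auto simp: lin_on_def)

lemma antip_add: "antip H (x + y) = antip H x + antip H y"
  and antip_scale: "antip H (hscale H c x) = hscale H c (antip H x)"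
  using linear_lin_on[OF antip_linear, of UNIV] by (auto simp: lin_on_def)

lemmas hopf_lin = lin_on_def blin_def counit_add counit_scale antip_add antip_scale
  scale_mult_left scale_mult_right distrib_left distrib_right

lemma cop_counit_left:
  assumes "vector_space s" "hlin s g"
  shows "cop s h (\<lambda>x y. s (counit H x) (g y)) = g h"
proof -
  have "h = cop (hscale H) h (\<lambda>x y. hscale H (counit H x) y)"
    using counit_left[of h]
    by (subst (asm) lin_ext_comult[OF vector_space_H])
      (auto simp: hopf_lin hs.scale_right_distrib hs.scale_left_distrib mult.commute)
  then have "g h = g (cop (hscale H) h (\<lambda>x y. hscale H (counit H x) y))" by simp
  also have "\<dots> = cop s h (\<lambda>x y. s (counit H x) (g y))"
    by (simp add: cop_map_UNIV[OF assms(1) vector_space_H assms(2)] lin_on_scale[OF assms(2)])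
  finally show ?thesis by simp
qed

lemma cop_counit_right:
  assumes "vector_space s" "hlin s g"
  shows "cop s h (\<lambda>x y. s (counit H y) (g x)) = g h"
proof -
  have "h = cop (hscale H) h (\<lambda>x y. hscale H (counit H y) x)"
    using counit_right[of h]
    by (subst (asm) lin_ext_comult[OF vector_space_H])
      (auto simp: hopf_lin hs.scale_right_distrib hs.scale_left_distrib mult.commute)
  then have "g h = g (cop (hscale H) h (\<lambda>x y. hscale H (counit H y) x))" by simp
  also have "\<dots> = cop s h (\<lambda>x y. s (counit H y) (g x))"
    by (simp add: cop_map_UNIV[OF assms(1) vector_space_H assms(2)] lin_on_scale[OF assms(2)])
  finally show ?thesis by simp
qed

lemma cop_eval: "blin (*) f \<Longrightarrow> cop (*) h f = comult H h (\<lambda>(x, y). f x y)"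
  using bilin_tensor_eval[OF comult_in, of "\<lambda>(x, y). f x y" h]
  by (simp add: cop_def cc_def bilinear_forms_def linear_form_on_lin_on blin_def)

text \<open>After a linear form is applied the expression is scalar-valued, and \<open>cop\<close>
  becomes evaluation of the tensor \<open>comult H h\<close> at a bilinear form
  (\<open>cop_eval\<close>).\<close>

lemma cop_eqI:
  assumes s: "vector_space s" and
    "\<And>g. Vector_Spaces.linear s (*) g \<Longrightarrow> cop (*) h (\<lambda>x y. g (f x y)) = g u"
  shows "cop s h f = u"
proof (rule separating_linear_forms[OF s])
  fix g assume g: "Vector_Spaces.linear s (*) g"
  show "g (cop s h f) = g u"
    using cop_map_UNIV[OF vector_space_field s linear_lin_on[OF g], of h f] assms(2)[OF g] by simp
qed

lemma blin_form:
  "blin s f \<Longrightarrow> Vector_Spaces.linear s (*) g \<Longrightarrow> blin (*) (\<lambda>x y. g (f x y))"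
  using linear_lin_on[of s "(*)" g UNIV] by (simp add: blin_def lin_on_def)

lemma cop_mult:
  assumes s: "vector_space s" and f: "blin s f"
  shows "cop s (h * g) f = cop s h (\<lambda>h1 h2. cop s g (\<lambda>g1 g2. f (h1 * g1) (h2 * g2)))"
proof (rule cop_eqI[OF s])
  fix l assume l: "Vector_Spaces.linear s (*) l"
  let ?p = "ptens (bilin (hscale H) (hscale H))"
  have b1: "blin fscale (\<lambda>g1 g2. ?p (h1 * g1, h2 * g2))" for h1 h2
    by (auto simp: hopf_lin lin_on_add[OF ptens_bilinear_lin_on(1)]
      lin_on_scale[OF ptens_bilinear_lin_on(1)]  lin_on_add[OF ptens_bilinear_lin_on(2)]
      lin_on_scale[OF ptens_bilinear_lin_on(2)])
  have b2: "blin fscale (\<lambda>h1 h2. cop fscale g (\<lambda>g1 g2. ?p (h1 * g1, h2 * g2)))"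
    by (auto simp: hopf_lin lin_on_add[OF ptens_bilinear_lin_on(1)]
      lin_on_scale[OF ptens_bilinear_lin_on(1)]  lin_on_add[OF ptens_bilinear_lin_on(2)]
      lin_on_scale[OF ptens_bilinear_lin_on(2)] cop_add_fun[OF vector_space_fscale]
      cop_scale_fun[OF vector_space_fscale])
  have "comult H (h * g) = cop fscale h (\<lambda>h1 h2. cop fscale g (\<lambda>g1 g2. ?p (h1 * g1, h2 * g2)))"
    unfolding comult_mult lin_ext_comult[OF vector_space_fscale b1]
    by (rule lin_ext_comult[OF vector_space_fscale b2])
  then show "cop (*) (h * g) (\<lambda>x y. l (f x y)) =
      l (cop s h (\<lambda>h1 h2. cop s g (\<lambda>g1 g2. f (h1 * g1) (h2 * g2))))"
    using blin_form[OF f l]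
    by (simp add: cop_eval cop_fscale_apply cop_map_UNIV[OF vector_space_field s linear_lin_on[OF l]]
      ptens_def bilinear_forms_def linear_form_on_lin_on) (simp add: blin_def)
qed

lemma cop_one:
  assumes s: "vector_space s" and f: "blin s f"
  shows "cop s 1 f = f 1 1"
proof (rule cop_eqI[OF s])
  fix l assume l: "Vector_Spaces.linear s (*) l"
  show "cop (*) 1 (\<lambda>x y. l (f x y)) = l (f 1 1)"
    using blin_form[OF f l]
    by (simp add: cop_eval comult_one ptens_def bilinear_forms_def linear_form_on_lin_on)
      (simp add: blin_def)
qed

lemma cop_antip_left: "cop (hscale H) h (\<lambda>x y. antip H x * y) = hscale H (counit H h) 1"
  using antip_left[of h]
  by (subst (asm) lin_ext_comult[OF vector_space_H]) (auto simp: hopf_lin)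

lemma cop_antip_right: "cop (hscale H) h (\<lambda>x y. x * antip H y) = hscale H (counit H h) 1"
  using antip_right[of h]
  by (subst (asm) lin_ext_comult[OF vector_space_H]) (auto simp: hopf_lin)

end

context fd_hopf_algebra
begin

subsection \<open>The antipode\<close>

lemmas copH_scale = cop_scale_fun[OF vector_space_H]
  and copH_map = cop_map_UNIV[OF vector_space_H vector_space_H]

lemma copH_mult_left: "x * cop (hscale H) h f = cop (hscale H) h (\<lambda>a b. x * f a b)"
  by (rule copH_map) (auto simp: hopf_lin)

lemma copH_mult_right: "cop (hscale H) h f * x = cop (hscale H) h (\<lambda>a b. f a b * x)"
  by (rule copH_map[where g = "\<lambda>z. z * x"]) (auto simp: hopf_lin)

lemma antip_one: "antip H 1 = 1"
proof -
  have "blin (hscale H) (\<lambda>x y. antip H x * y)" by (auto simp: hopf_lin)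
  then show ?thesis
    using cop_antip_left[of 1] cop_one[OF vector_space_H, of "\<lambda>x y. antip H x * y"]
    by (simp add: counit_one)
qed

lemma counit_antip: "counit H (antip H h) = counit H h"
proof -
  have "counit H (antip H h) = cop (*) h (\<lambda>x y. counit H y * counit H (antip H x))"
    by (subst cop_counit_right[OF vector_space_field]) (auto simp: hopf_lin)
  also have "\<dots> = counit H (cop (hscale H) h (\<lambda>x y. antip H x * y))"
    by (subst cop_map_UNIV[OF vector_space_field vector_space_H linear_lin_on[OF counit_linear]])
      (simp add: counit_mult mult.commute)
  also have "\<dots> = counit H h"
    by (simp add: cop_antip_left counit_scale counit_one)
  finally show ?thesis .
qed

text \<open>Under convolution of maps in two variables, \<open>S(h g)\<close> is a left inverse and
  \<open>S(g) S(h)\<close> a right inverse of the multiplication. \<open>E\<close> is the triple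
  convolution product: contracting its last two factors (\<open>1\<close>, \<open>2\<close>) leaves
  the former, contracting its first two (\<open>3\<close>) the latter.\<close>

lemma antip_mult: "antip H (h * g) = antip H g * antip H h"
proof -
  let ?S = "antip H" and ?c = "cop (hscale H)"
  define K where "K h1 h2 h3 g1 g2 g3 = ?S (h1 * g1) * (h2 * g2) * (?S g3 * ?S h3)"
    for h1 h2 h3 g1 g2 g3
  define E where "E = ?c h (\<lambda>h1 h'. ?c g (\<lambda>g1 g'. ?c h' (\<lambda>h2 h3. ?c g' (\<lambda>g2 g3.
    K h1 h2 h3 g1 g2 g3))))"
  have 1: "?c g' (\<lambda>g2 g3. K h1 h2 h3 g1 g2 g3) =
      hscale H (counit H g') (?S (h1 * g1) * (h2 * ?S h3))" for h1 h2 h3 g1 g'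
  proof -
    have "?c g' (\<lambda>g2 g3. K h1 h2 h3 g1 g2 g3) =
        (?S (h1 * g1) * h2) * ?c g' (\<lambda>g2 g3. g2 * ?S g3) * ?S h3"
      unfolding copH_mult_left copH_mult_right by (simp add: K_def mult.assoc)
    then show ?thesis
      by (simp add: cop_antip_right scale_mult_left scale_mult_right mult.assoc)
  qed
  have 2: "?c h' (\<lambda>h2 h3. hscale H (counit H g') (?S (h1 * g1) * (h2 * ?S h3))) =
      hscale H (counit H g') (hscale H (counit H h') (?S (h1 * g1)))" for h1 h' g1 g'
    by (simp add: copH_scale cop_antip_right scale_mult_right flip: copH_mult_left)
  have "E = ?c h (\<lambda>h1 h'. ?c g (\<lambda>g1 g'.
      hscale H (counit H g') (hscale H (counit H h') (?S (h1 * g1)))))"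
    unfolding E_def 1 2 ..
  also have "\<dots> = ?c h (\<lambda>h1 h'. hscale H (counit H h') (?S (h1 * g)))"
    by (subst cop_counit_right[OF vector_space_H])
      (auto simp: hopf_lin hs.scale_right_distrib mult.commute)
  also have "\<dots> = ?S (h * g)"
    by (rule cop_counit_right[OF vector_space_H]) (auto simp: hopf_lin)
  finally have E1: "E = ?S (h * g)" .
  have 3: "?c z (\<lambda>h1 h2. ?c w (\<lambda>g1 g2. K h1 h2 h3 g1 g2 g3)) =
      hscale H (counit H z) (hscale H (counit H w) (?S g3 * ?S h3))" for z w h3 g3
  proof -
    have "?c z (\<lambda>h1 h2. ?c w (\<lambda>g1 g2. K h1 h2 h3 g1 g2 g3)) =
        ?c z (\<lambda>h1 h2. ?c w (\<lambda>g1 g2. ?S (h1 * g1) * (h2 * g2))) * (?S g3 * ?S h3)"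
      unfolding copH_mult_right K_def ..
    also have "?c z (\<lambda>h1 h2. ?c w (\<lambda>g1 g2. ?S (h1 * g1) * (h2 * g2))) =
        ?c (z * w) (\<lambda>x y. ?S x * y)"
      by (rule cop_mult[OF vector_space_H, symmetric]) (auto simp: hopf_lin)
    finally show ?thesis by (simp add: cop_antip_left counit_mult scale_mult_left)
  qed
  have "E = ?c h (\<lambda>h1 h'. ?c h' (\<lambda>h2 h3. ?c g (\<lambda>g1 g'. ?c g' (\<lambda>g2 g3.
      K h1 h2 h3 g1 g2 g3))))"
    unfolding E_def by (subst cop_swap[OF vector_space_H]) (rule HOL.refl)
  also have "\<dots> = ?c h (\<lambda>z h3. ?c z (\<lambda>h1 h2. ?c g (\<lambda>g1 g'. ?c g' (\<lambda>g2 g3.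
      K h1 h2 h3 g1 g2 g3))))"
    by (rule cop_coassoc[OF vector_space_H, symmetric])
  also have "\<dots> = ?c h (\<lambda>z h3. ?c z (\<lambda>h1 h2. ?c g (\<lambda>w g3. ?c w (\<lambda>g1 g2.
      K h1 h2 h3 g1 g2 g3))))"
    by (subst cop_coassoc[OF vector_space_H, symmetric]) (rule HOL.refl)
  also have "\<dots> = ?c h (\<lambda>z h3. ?c g (\<lambda>w g3. ?c z (\<lambda>h1 h2. ?c w (\<lambda>g1 g2.
      K h1 h2 h3 g1 g2 g3))))"
    by (subst (2) cop_swap[OF vector_space_H]) (rule HOL.refl)
  also have "\<dots> = ?c h (\<lambda>z h3. hscale H (counit H z) (?S g * ?S h3))"
    unfolding 3 copH_scale
    by (subst cop_counit_left[OF vector_space_H]) (auto simp: hopf_lin)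
  also have "\<dots> = ?S g * ?S h"
    by (rule cop_counit_left[OF vector_space_H]) (auto simp: hopf_lin)
  finally show ?thesis using E1 by simp
qed

text \<open>The same argument for maps from H to its tensor square: the coproduct of
  \<open>S(h)\<close> is a left convolution inverse of the coproduct, and
  \<open>S(h_(2)) \<otimes> S(h_(1))\<close> a right inverse. \<open>E\<close> is the triple
  product; \<open>1\<close> contracts its last two factors and \<open>2\<close> its first
  two.\<close>

lemma cop_antip:
  assumes s: "vector_space s" and f: "blin s f"
  shows "cop s (antip H h) f = cop s h (\<lambda>x y. f (antip H y) (antip H x))"
proof -
  interpret s: vector_space s by fact
  let ?S = "antip H" and ?c = "cop s"
  have f1: "hlin s (\<lambda>x. f x y)" and f2: "hlin s (f x)" for x y
    using f by (auto simp: blin_def)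
  note fl = lin_on_add[OF f1] lin_on_add[OF f2] lin_on_scale[OF f1] lin_on_scale[OF f2]
  define R where "R u v p q h'' = ?c h'' (\<lambda>h3 h4. f (u * p * ?S h4) (v * q * ?S h3))"
    for u v p q h''
  define E where "E = ?c h (\<lambda>h1 h'. ?c h' (\<lambda>h2 h''. ?c (?S h1) (\<lambda>u v. ?c h2 (\<lambda>p q.
    R u v p q h''))))"
  have 1: "?c h' (\<lambda>h2 h''. ?c h2 (\<lambda>p q. R u v p q h'')) = s (counit H h') (f u v)" for u v h'
  proof -
    have "?c h' (\<lambda>h2 h''. ?c h2 (\<lambda>p q. R u v p q h'')) =
        ?c h' (\<lambda>p z. ?c z (\<lambda>q h''. R u v p q h''))"
      by (rule cop_coassoc[OF s])
    also have "\<dots> = ?c h' (\<lambda>p z. ?c z (\<lambda>y h4. ?c y (\<lambda>q h3. f (u * p * ?S h4) (v * q * ?S h3))))"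
      unfolding R_def by (subst cop_coassoc[OF s, symmetric]) (rule HOL.refl)
    \<comment> \<open>\<open>q\<close> and \<open>h3\<close> come from adjacent legs and cancel
      first; \<open>p\<close> and \<open>h4\<close> become adjacent only afterwards.\<close>
    also have "\<dots> = ?c h' (\<lambda>p z. ?c z (\<lambda>y h4. s (counit H y) (f (u * p * ?S h4) v)))"
    proof -
      have "?c y (\<lambda>q h3. f a (v * q * ?S h3)) = s (counit H y) (f a v)" for y a
      proof -
        have "?c y (\<lambda>q h3. f a (v * q * ?S h3)) = f a (v * cop (hscale H) y (\<lambda>q h3. q * ?S h3))"
          unfolding copH_mult_left cop_map_UNIV[OF s vector_space_H f2]
          by (simp add: mult.assoc)
        then show ?thesis by (simp add: cop_antip_right scale_mult_right fl)
      qed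
      then show ?thesis by simp
    qed
    also have "\<dots> = ?c h' (\<lambda>p z. f (u * (p * ?S z)) v)"
      by (subst cop_counit_left[OF s]) (auto simp: hopf_lin fl mult.assoc)
    also have "\<dots> = f (u * cop (hscale H) h' (\<lambda>p z. p * ?S z)) v"
      unfolding copH_mult_left cop_map_UNIV[OF s vector_space_H f1] ..
    finally show ?thesis by (simp add: cop_antip_right scale_mult_right fl)
  qed
  have "E = ?c h (\<lambda>h1 h'. ?c (?S h1) (\<lambda>u v. ?c h' (\<lambda>h2 h''. ?c h2 (\<lambda>p q. R u v p q h''))))"
    unfolding E_def by (subst (2) cop_swap[OF s]) (rule HOL.refl)
  also have "\<dots> = ?c h (\<lambda>h1 h'. s (counit H h') (?c (?S h1) f))"
    unfolding 1 cop_scale_fun[OF s] ..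
  also have "\<dots> = ?c (?S h) f"
    by (rule cop_counit_right[OF s])
      (auto simp: hopf_lin cop_add[OF s] cop_scale[OF s])
  finally have E1: "E = ?c (?S h) f" .
  have 2: "?c z (\<lambda>h1 h2. ?c (?S h1) (\<lambda>u v. ?c h2 (\<lambda>p q. R u v p q h''))) =
      s (counit H z) (?c h'' (\<lambda>h3 h4. f (?S h4) (?S h3)))" for z h''
  proof -
    define F where "F a b = ?c h'' (\<lambda>h3 h4. f (a * ?S h4) (b * ?S h3))" for a b
    have F: "blin s F"
      by (auto simp: F_def hopf_lin fl cop_add_fun[OF s] cop_scale_fun[OF s])
    have "?c z (\<lambda>h1 h2. ?c (?S h1) (\<lambda>u v. ?c h2 (\<lambda>p q. R u v p q h''))) =
        ?c z (\<lambda>h1 h2. ?c (?S h1 * h2) F)"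
      by (simp add: cop_mult[OF s F]) (simp add: F_def R_def)
    also have "\<dots> = ?c (cop (hscale H) z (\<lambda>h1 h2. ?S h1 * h2)) F"
      by (subst cop_map_UNIV[OF s vector_space_H cop_hlin[OF s]]) (rule HOL.refl)
    also have "\<dots> = s (counit H z) (F 1 1)"
      by (simp add: cop_antip_left cop_scale[OF s] cop_one[OF s F])
    finally show ?thesis by (simp add: F_def)
  qed
  have "E = ?c h (\<lambda>z h''. ?c z (\<lambda>h1 h2. ?c (?S h1) (\<lambda>u v. ?c h2 (\<lambda>p q. R u v p q h''))))"
    unfolding E_def by (rule cop_coassoc[OF s, symmetric])
  also have "\<dots> = ?c h (\<lambda>h3 h4. f (?S h4) (?S h3))"
    unfolding 2 by (rule cop_counit_left[OF s]) (rule cop_hlin[OF s])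
  finally show ?thesis using E1 by simp
qed

section \<open>Bijectivity of the antipode\<close>

lemma antip_zero: "antip H 0 = 0"
  using antip_scale[of 0 0] by simp

lemma antip_diff: "antip H (x - y) = antip H x - antip H y"
  using antip_add[of "x - y" y] by simp

lemma antip_pow_add: "(antip H ^^ n) (x + y) = (antip H ^^ n) x + (antip H ^^ n) y"
  by (induction n) (auto simp: antip_add)

lemma antip_pow_scale: "(antip H ^^ n) (hscale H c x) = hscale H c ((antip H ^^ n) x)"
  by (induction n) (auto simp: antip_scale)

lemma antip_pow_zero: "(antip H ^^ n) 0 = 0"
  by (induction n) (auto simp: antip_zero)

lemma antip_pow_diff: "(antip H ^^ n) (x - y) = (antip H ^^ n) x - (antip H ^^ n) y"
  by (induction n) (auto simp: antip_diff)

lemma antip_pow_one: "(antip H ^^ n) 1 = 1"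
  by (induction n) (auto simp: antip_one)

lemma antip_pow_mult:
  "(antip H ^^ n) (x * y) = (if even n then (antip H ^^ n) x * (antip H ^^ n) y
     else (antip H ^^ n) y * (antip H ^^ n) x)"
  by (induction n) (auto simp: antip_mult)

lemma antip_pow_map: "(antip H ^^ n) (cop (hscale H) h f) = cop (hscale H) h (\<lambda>x y. (antip H ^^ n) (f x y))"
  by (rule copH_map) (simp add: lin_on_def antip_pow_add antip_pow_scale)

text \<open>
  A linear and multiplicative map \<open>\<rho>\<close> that fixes the image of \<open>S\<^sup>n\<^sup>+\<^sup>1\<close> also fixes the image
  of \<open>S\<^sup>n\<close>, because \<open>S\<^sup>n\<close> and \<open>\<rho> \<circ> S\<^sup>n\<close> are inverse to \<open>S\<^sup>n\<^sup>+\<^sup>1\<close> under convolution (for odd \<open>n\<close>,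
  convolution with respect to the opposite coproduct).
\<close>

lemma multiplicative_fixes_antip_pow:
  assumes lin: "hlin (hscale H) \<rho>" and mult: "\<And>x y. \<rho> (x * y) = \<rho> x * \<rho> y" and one: "\<rho> 1 = 1"
    and fixed: "\<And>x. \<rho> ((antip H ^^ Suc n) x) = (antip H ^^ Suc n) x"
  shows "\<rho> ((antip H ^^ n) h) = (antip H ^^ n) h"
proof -
  let ?F = "antip H ^^ n" and ?G = "antip H ^^ Suc n" and ?c = "cop (hscale H)"
  have FS: "?F (antip H x) = antip H (?F x)" for x by (simp add: funpow_swap1)
  have fx: "\<rho> (antip H (?F x)) = antip H (?F x)" for x using fixed by simp
  have rho_map: "\<rho> (?c h f) = ?c h (\<lambda>x y. \<rho> (f x y))" for h f
    by (rule copH_map[OF lin])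
  have rs: "\<rho> (hscale H c x) = hscale H c (\<rho> x)" for c x using lin_on_scale[OF lin] by simp
  have l: "hlin (hscale H) ?F" by (simp add: lin_on_def antip_pow_add antip_pow_scale)
  have l': "hlin (hscale H) (\<lambda>x. \<rho> (?F x))"
    using lin by (simp add: lin_on_def antip_pow_add antip_pow_scale)
  show ?thesis
  proof (cases "even n")
    case True
    have 1: "?c h (\<lambda>x y. ?G x * ?F y) = hscale H (counit H h) 1" for h
      using antip_pow_map[of n h "\<lambda>x y. antip H x * y"] True
      by (simp add: antip_pow_mult FS cop_antip_left antip_pow_scale antip_pow_one)
    have 2: "?c h (\<lambda>x y. \<rho> (?F x) * ?G y) = hscale H (counit H h) 1" for h
    proof -
      have "?c h (\<lambda>x y. \<rho> (?F x) * ?G y) = \<rho> (?F (?c h (\<lambda>x y. x * antip H y)))"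
        by (simp add: antip_pow_map rho_map antip_pow_mult True mult fx FS)
      then show ?thesis by (simp add: cop_antip_right antip_pow_scale antip_pow_one rs one)
    qed
    have "\<rho> (?F h) = ?c h (\<lambda>x y. hscale H (counit H y) (\<rho> (?F x)))"
      by (rule cop_counit_right[OF vector_space_H l', symmetric])
    also have "\<dots> = ?c h (\<lambda>x y. \<rho> (?F x) * hscale H (counit H y) 1)"
      by (simp add: scale_mult_right)
    also have "\<dots> = ?c h (\<lambda>x y. ?c y (\<lambda>u v. \<rho> (?F x) * (?G u * ?F v)))"
      unfolding 1[symmetric] copH_mult_left ..
    also have "\<dots> = ?c h (\<lambda>y v. ?c y (\<lambda>x u. \<rho> (?F x) * (?G u * ?F v)))"
      by (rule cop_coassoc[OF vector_space_H, symmetric])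
    also have "\<dots> = ?c h (\<lambda>y v. hscale H (counit H y) 1 * ?F v)"
      unfolding 2[symmetric] copH_mult_right by (simp add: mult.assoc)
    also have "\<dots> = ?F h"
      unfolding scale_mult_left mult_1 by (rule cop_counit_left[OF vector_space_H l])
    finally show ?thesis .
  next
    case False
    have 1: "?c h (\<lambda>x y. ?G y * ?F x) = hscale H (counit H h) 1" for h
      using antip_pow_map[of n h "\<lambda>x y. x * antip H y"] False
      by (simp add: antip_pow_mult FS cop_antip_right antip_pow_scale antip_pow_one)
    have 2: "?c h (\<lambda>x y. \<rho> (?F y) * ?G x) = hscale H (counit H h) 1" for h
    proof -
      have "?c h (\<lambda>x y. \<rho> (?F y) * ?G x) = \<rho> (?F (?c h (\<lambda>x y. antip H x * y)))"
        by (simp add: antip_pow_map rho_map antip_pow_mult False mult fx FS)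
      then show ?thesis by (simp add: cop_antip_left antip_pow_scale antip_pow_one rs one)
    qed
    have "\<rho> (?F h) = ?c h (\<lambda>x y. hscale H (counit H x) (\<rho> (?F y)))"
      by (rule cop_counit_left[OF vector_space_H l', symmetric])
    also have "\<dots> = ?c h (\<lambda>x y. \<rho> (?F y) * hscale H (counit H x) 1)"
      by (simp add: scale_mult_right)
    also have "\<dots> = ?c h (\<lambda>x y. ?c x (\<lambda>u v. \<rho> (?F y) * (?G v * ?F u)))"
      unfolding 1[symmetric] copH_mult_left ..
    also have "\<dots> = ?c h (\<lambda>u x. ?c x (\<lambda>v y. \<rho> (?F y) * (?G v * ?F u)))"
      by (rule cop_coassoc[OF vector_space_H])
    also have "\<dots> = ?c h (\<lambda>u x. hscale H (counit H x) 1 * ?F u)"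
      unfolding 2[symmetric] copH_mult_right by (simp add: mult.assoc)
    also have "\<dots> = ?F h"
      unfolding scale_mult_left mult_1 by (rule cop_counit_right[OF vector_space_H l])
    finally show ?thesis .
  qed
qed

text \<open>The exponent is lowered one by one until the power of S is the identity.\<close>

lemma multiplicative_fixing_antip_pow_eq_id:
  assumes "hlin (hscale H) \<rho>" "\<And>x y. \<rho> (x * y) = \<rho> x * \<rho> y" "\<rho> 1 = 1"
    and "\<And>x. \<rho> ((antip H ^^ n) x) = (antip H ^^ n) x"
  shows "\<rho> x = x"
  using assms(4)
proof (induction n arbitrary: x)
  case 0
  then show ?case by simp
next
  case (Suc n)
  show ?case by (rule Suc.IH) (rule multiplicative_fixes_antip_pow[OF assms(1-3) Suc.prems])
qed

text \<open>A strict inclusion changes the dimension by at least one, and dimensions are bounded.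
  Increasing chains are used for the kernels of the powers of S, decreasing ones for their
  images.\<close>

lemma subspace_chain_stabilizes:
  assumes sub: "\<And>i::nat. hs.subspace (V i)"
    and mono: "(\<forall>i. V i \<subseteq> V (Suc i)) \<or> (\<forall>i. V (Suc i) \<subseteq> V i)"
  shows "\<exists>i. V (Suc i) = V i"
proof (rule ccontr)
  assume neq: "\<nexists>i. V (Suc i) = V i"
  have strict: "hs.dim U < hs.dim W"
    if "hs.subspace U" "hs.subspace W" "U \<subseteq> W" "U \<noteq> W" for U W
    using hs.subspace_dim_equal[OF that(1-3)] that(4) by force
  from mono show False
  proof
    assume m: "\<forall>i. V i \<subseteq> V (Suc i)"
    have "i \<le> hs.dim (V i)" for i
    proof (induction i)
      case (Suc i)
      have "hs.dim (V i) < hs.dim (V (Suc i))"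
        using strict[OF sub sub] m neq by metis
      then show ?case using Suc by simp
    qed simp
    from this[of "Suc hs.dimension"] hs.dim_subset_UNIV[of "V (Suc hs.dimension)"] show False
      by simp
  next
    assume m: "\<forall>i. V (Suc i) \<subseteq> V i"
    have "hs.dim (V i) + i \<le> hs.dim (V 0)" for i
    proof (induction i)
      case (Suc i)
      have "hs.dim (V (Suc i)) < hs.dim (V i)"
        using strict[OF sub sub] m neq by metis
      then show ?case using Suc by simp
    qed simp
    from this[of "Suc (hs.dim (V 0))"] show False by simp
  qed
qed

lemma antip_pow_Suc': "(antip H ^^ Suc n) x = (antip H ^^ n) (antip H x)"
  by (simp add: funpow_swap1)

text \<open>
  Larson--Sweedler.  For large even \<open>n\<close> the map \<open>S\<^sup>n\<close> is bijective on its image, and the projection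
  onto this image along the kernel of \<open>S\<^sup>n\<close> is multiplicative.
\<close>

lemma bij_antip: "bij (antip H)"
proof -
  have "\<exists>i. {x. (antip H ^^ Suc i) x = 0} = {x. (antip H ^^ i) x = 0}"
  proof (rule subspace_chain_stabilizes)
    show "hs.subspace {x. (antip H ^^ i) x = 0}" for i
      by (rule hs.subspaceI) (auto simp: antip_pow_add antip_pow_scale antip_pow_zero)
  qed (auto simp: antip_zero)
  then obtain i where i: "\<And>x. (antip H ^^ Suc i) x = 0 \<Longrightarrow> (antip H ^^ i) x = 0"
    by blast
  have "\<exists>i. range (antip H ^^ Suc i) = range (antip H ^^ i)"
  proof (rule subspace_chain_stabilizes)
    show "hs.subspace (range (antip H ^^ i))" for i
      by (rule hs.subspaceI) (auto simp: image_iff intro: exI[of _ 0] antip_pow_zero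
        antip_pow_add[symmetric] antip_pow_scale[symmetric])
    show "(\<forall>i. range (antip H ^^ i) \<subseteq> range (antip H ^^ Suc i)) \<or>
        (\<forall>i. range (antip H ^^ Suc i) \<subseteq> range (antip H ^^ i))"
      by (auto simp: antip_pow_Suc' simp del: funpow.simps)
  qed
  then obtain j where j: "\<And>x. \<exists>y. (antip H ^^ j) x = (antip H ^^ Suc j) y"
    by (metis rangeE rangeI)
  \<comment> \<open>Large enough for both chains to have become stationary, and even, so that the
    power of S preserves the order of products.\<close>
  define n where "n = 2 * (i + j)"
  have ev: "even n" and ij: "i \<le> n" "j \<le> n" by (auto simp: n_def)
  have kers: "(antip H ^^ n) x = 0" if "(antip H ^^ (n + k)) x = 0" for k x
    using that
  proof (induction k)
    case (Suc k)
    define l where "l = n + k - i"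
    have "antip H ^^ (n + Suc k) = antip H ^^ (Suc i + l)"
      "antip H ^^ (n + k) = antip H ^^ (i + l)"
      using ij by (auto simp: l_def)
    then have *: "(antip H ^^ (n + Suc k)) x = (antip H ^^ Suc i) ((antip H ^^ l) x)"
      "(antip H ^^ (n + k)) x = (antip H ^^ i) ((antip H ^^ l) x)"
      by (simp_all only: funpow_add o_apply)
    from Suc.prems have "(antip H ^^ (n + k)) x = 0" unfolding * by (rule i)
    then show ?case by (rule Suc.IH)
  qed simp
  have rng: "\<exists>y. (antip H ^^ n) x = (antip H ^^ (n + k)) y" for k x
  proof (induction k)
    case (Suc k)
    then obtain y where y: "(antip H ^^ n) x = (antip H ^^ (n + k)) y" by blast
    define l where "l = n + k - j"
    obtain z where z: "(antip H ^^ j) y = (antip H ^^ Suc j) z" using j by blast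
    have "antip H ^^ (n + Suc k) = antip H ^^ (l + Suc j)"
      "antip H ^^ (n + k) = antip H ^^ (l + j)"
      using ij by (auto simp: l_def)
    then have "(antip H ^^ (n + Suc k)) z = (antip H ^^ l) ((antip H ^^ Suc j) z)"
      "(antip H ^^ (n + k)) y = (antip H ^^ l) ((antip H ^^ j) y)"
      by (simp_all only: funpow_add o_apply)
    then show ?case using y z by metis
  qed (auto)
  let ?F = "antip H ^^ n"
  have uniq: "u = v" if "?F u = ?F v" "u \<in> range ?F" "v \<in> range ?F" for u v
  proof -
    from that obtain a b where ab: "u = ?F a" "v = ?F b" by blast
    have "(antip H ^^ (n + n)) (a - b) = 0"
      using that(1) by (simp add: antip_pow_diff ab funpow_add)
    then have "?F (a - b) = 0" by (rule kers)
    then show ?thesis by (simp add: ab antip_pow_diff)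
  qed
  \<comment> \<open>The projection of the Fitting decomposition. A suitable \<open>z\<close> exists
    because the n-th and the 2n-th power of S have the same image (\<open>rng\<close>), and it is
    unique because their kernels agree (\<open>uniq\<close>).\<close>
  define \<rho> where "\<rho> x = (SOME z. z \<in> range ?F \<and> ?F z = ?F x)" for x
  have rho: "\<rho> x \<in> range ?F" "?F (\<rho> x) = ?F x" for x
  proof -
    obtain y where "?F x = (antip H ^^ (n + n)) y" using rng by blast
    then have "?F y \<in> range ?F \<and> ?F (?F y) = ?F x" by (simp add: funpow_add)
    then show "\<rho> x \<in> range ?F" "?F (\<rho> x) = ?F x"
      unfolding \<rho>_def by (metis (mono_tags, lifting) someI_ex)+
  qed
  have rhoI: "\<rho> x = z" if "z \<in> range ?F" "?F z = ?F x" for x z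
    using uniq rho that by metis
  have "\<rho> x = x" for x
  proof (rule multiplicative_fixing_antip_pow_eq_id[where n = n])
    show "hlin (hscale H) \<rho>"
    proof (rule lin_onI)
      fix x y
      obtain a b where "\<rho> x = ?F a" "\<rho> y = ?F b" using rho(1) by blast
      then have "\<rho> x + \<rho> y = ?F (a + b)" by (simp add: antip_pow_add)
      then have "\<rho> x + \<rho> y \<in> range ?F" by blast
      then show "\<rho> (x + y) = \<rho> x + \<rho> y" by (rule rhoI) (simp add: antip_pow_add rho)
    next
      fix c x
      obtain a where "\<rho> x = ?F a" using rho(1) by blast
      then have "hscale H c (\<rho> x) = ?F (hscale H c a)" by (simp add: antip_pow_scale)
      then have "hscale H c (\<rho> x) \<in> range ?F" by blast
      then show "\<rho> (hscale H c x) = hscale H c (\<rho> x)" by (rule rhoI) (simp add: antip_pow_scale rho)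
    qed
    show "\<rho> (x * y) = \<rho> x * \<rho> y" for x y
    proof (rule rhoI)
      obtain a b where "\<rho> x = ?F a" "\<rho> y = ?F b" using rho(1) by blast
      then have "\<rho> x * \<rho> y = ?F (a * b)" using ev by (simp add: antip_pow_mult)
      then show "\<rho> x * \<rho> y \<in> range ?F" by simp
    qed (use ev in \<open>simp add: antip_pow_mult rho\<close>)
    show "\<rho> 1 = 1"
      by (rule rhoI) (auto simp: antip_pow_one image_iff intro: exI[of _ 1])
    show "\<rho> (?F x) = ?F x" for x
      by (rule rhoI) auto
  qed
  \<comment> \<open>A projection that is the identity has full image. So the n-th power of S is
    surjective, and by \<open>uniq\<close> it is injective.\<close>
  then have fixed: "x \<in> range ?F" for x using rho(1)[of x] by simp
  have "inj ?F"
  proof (rule injI)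
    fix x y assume "?F x = ?F y"
    then show "x = y" by (rule uniq[OF _ fixed fixed])
  qed
  have "inj (antip H)"
  proof (rule injI)
    fix x y assume "antip H x = antip H y"
    then have "(antip H ^^ Suc n) x = (antip H ^^ Suc n) y"
      unfolding antip_pow_Suc' by simp
    then have "antip H (?F x) = antip H (?F y)" by simp
    then have "(antip H ^^ (n + 1)) (x - y) = 0" by (simp add: antip_pow_diff antip_diff)
    then have "?F (x - y) = 0" by (rule kers)
    then have "?F x = ?F y" by (simp add: antip_pow_diff)
    then show "x = y" using \<open>inj ?F\<close> by (simp add: inj_eq)
  qed
  then show ?thesis
    using hs.linear_inj_imp_surj[OF antip_linear] by (simp add: bij_def)
qed

lemma antip_inv_right [simp]: "antip H (antip_inv H x) = x"
  using bij_antip by (simp add: bij_is_surj surj_f_inv_f)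

lemma antip_eqD: "antip H x = antip H y \<Longrightarrow> x = y"
  using bij_antip by (simp add: bij_is_inj inj_eq)

lemma antip_inv_add: "antip_inv H (x + y) = antip_inv H x + antip_inv H y"
  and antip_inv_scale: "antip_inv H (hscale H c x) = hscale H c (antip_inv H x)"
  by (rule antip_eqD, simp add: antip_add antip_scale)+

lemma counit_antip_inv: "counit H (antip_inv H x) = counit H x"
  using counit_antip[of "antip_inv H x"] by simp

lemma antip_cop: "antip H (cop (hscale H) h f) = cop (hscale H) h (\<lambda>x y. antip H (f x y))"
  by (rule copH_map) (auto simp: hopf_lin)

text \<open>Applying S reverses the product and yields the antipode axiom; injectivity of S removes
  it again. This identity and the next one are what makes the inverse slide operator an
  inverse.\<close>

lemma cop_antip_inv_left:
  "cop (hscale H) h (\<lambda>x y. antip_inv H y * x) = hscale H (counit H h) 1"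
  by (rule antip_eqD) (simp add: antip_cop antip_mult cop_antip_left antip_scale antip_one)

lemma cop_antip_inv_right:
  "cop (hscale H) h (\<lambda>x y. y * antip_inv H x) = hscale H (counit H h) 1"
  by (rule antip_eqD) (simp add: antip_cop antip_mult cop_antip_right antip_scale antip_one)

end

section \<open>Involutive Hopf bimodules over finite-dimensional Hopf algebras\<close>

locale fd_involutive_hopf_bimodule = involutive_hopf_bimodule H M + fd_hopf_algebra H B
  for H :: "('k::field, 'h::ring_1) hopf" and M :: "('k, 'h, 'm::ab_group_add) bimod" and B
begin

sublocale ms: vector_space "mscale M"
  by (rule vector_space_M)

abbreviation mlinear :: "('m \<Rightarrow> 'm) \<Rightarrow> bool" where
  "mlinear \<equiv> lin_on (mscale M) (mscale M) UNIV"

section \<open>Coordinates of the two coactions of M\<close>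

definition lco :: "'h \<Rightarrow> 'm \<Rightarrow> 'm" where
  "lco x m = lin_ext (mscale M) (\<lambda>(y, n). mscale M (zeta x y) n) (lcoact M m)"

definition rco :: "'h \<Rightarrow> 'm \<Rightarrow> 'm" where
  "rco x m = lin_ext (mscale M) (\<lambda>(n, y). mscale M (zeta x y) n) (rcoact M m)"

lemma mlin_lco: "mlin (mscale M) (bilin (hscale H) (mscale M)) (\<lambda>(y, n). mscale M (zeta x y) n)"
  by (intro mlin_bilinearI vector_space_M)
    (auto simp: lin_on_def zeta_add zeta_scale ms.scale_left_distrib ms.scale_right_distrib mult.commute)

lemma mlin_rco: "mlin (mscale M) (bilin (mscale M) (hscale H)) (\<lambda>(n, y). mscale M (zeta x y) n)"
  by (intro mlin_bilinearI vector_space_M)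
    (auto simp: lin_on_def zeta_add zeta_scale ms.scale_left_distrib ms.scale_right_distrib mult.commute)

lemma mlinear_lco: "mlinear (lco x)"
  unfolding lco_def
  using lin_ext_lin_on[OF vector_space_M mlin_lco, of UNIV x]
  by (auto simp: lin_on_def lcoact_add lcoact_scale lcoact_in)

lemma mlinear_rco: "mlinear (rco x)"
  unfolding rco_def
  using lin_ext_lin_on[OF vector_space_M mlin_rco, of UNIV x]
  by (auto simp: lin_on_def rcoact_add rcoact_scale rcoact_in)

text \<open>The expansion holds for every tensor of H with M, \<open>p x\<close> being the
  contraction of the first factor with \<open>zeta x\<close>; on a pure tensor it is the basis
  expansion of that factor.\<close>

lemma lcoact_expand: "lcoact M m = (\<Sum>x\<in>B. ptens (bilin (hscale H) (mscale M)) (x, lco x m))"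
proof -
  let ?F = "bilin (hscale H) (mscale M)"
  define p where "p x = lin_ext (mscale M) (\<lambda>(y, n). mscale M (zeta x y) n)" for x
  have l: "lin_on fscale (mscale M) (tensor_space ?F UNIV) (p x)" for x
    unfolding p_def by (rule lin_ext_lin_on[OF vector_space_M mlin_lco])
  have l2: "lin_on (mscale M) fscale UNIV (\<lambda>w. ptens ?F (x, w))" for x
    by (rule ptens_bilinear_lin_on) simp
  have l1: "hlin fscale (\<lambda>x. ptens ?F (x, w))" for w
    by (rule ptens_bilinear_lin_on) simp
  have "t = (\<Sum>x\<in>B. ptens ?F (x, p x t))" if "t \<in> tensor_space ?F UNIV" for t
  proof (rule lin_on_tensor_eqI[OF that vector_space_fscale])
    show "lin_on fscale fscale (tensor_space ?F UNIV) (\<lambda>t. \<Sum>x\<in>B. ptens ?F (x, p x t))"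
      by (intro lin_onI) (simp_all add: lin_on_add[OF l] lin_on_scale[OF l] lin_on_add[OF l2]
        lin_on_scale[OF l2] sum.distrib fs.scale_sum_right)
  next
    fix q :: "'h \<times> 'm"
    obtain y n where q: "q = (y, n)" by (cases q)
    have "p x (ptens ?F (y, n)) = mscale M (zeta x y) n" for x
      unfolding p_def by (subst lin_ext_pure[OF vector_space_M mlin_lco]) simp
    then show "ptens ?F q = (\<Sum>x\<in>B. ptens ?F (x, p x (ptens ?F q)))"
      using hlin_expand[OF vector_space_fscale l1, of y n] by (simp add: q lin_on_scale[OF l2])
  qed (simp add: lin_on_def)
  from this[OF lcoact_in, of m] show ?thesis unfolding p_def lco_def .
qed

lemma rcoact_expand: "rcoact M m = (\<Sum>x\<in>B. ptens (bilin (mscale M) (hscale H)) (rco x m, x))"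
proof -
  let ?F = "bilin (mscale M) (hscale H)"
  define p where "p x = lin_ext (mscale M) (\<lambda>(n, y). mscale M (zeta x y) n)" for x
  have l: "lin_on fscale (mscale M) (tensor_space ?F UNIV) (p x)" for x
    unfolding p_def by (rule lin_ext_lin_on[OF vector_space_M mlin_rco])
  have l2: "lin_on (mscale M) fscale UNIV (\<lambda>w. ptens ?F (w, x))" for x
    by (rule ptens_bilinear_lin_on) simp
  have l1: "hlin fscale (\<lambda>x. ptens ?F (w, x))" for w
    by (rule ptens_bilinear_lin_on) simp
  have "t = (\<Sum>x\<in>B. ptens ?F (p x t, x))" if "t \<in> tensor_space ?F UNIV" for t
  proof (rule lin_on_tensor_eqI[OF that vector_space_fscale])
    show "lin_on fscale fscale (tensor_space ?F UNIV) (\<lambda>t. \<Sum>x\<in>B. ptens ?F (p x t, x))"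
      by (intro lin_onI) (simp_all add: lin_on_add[OF l] lin_on_scale[OF l] lin_on_add[OF l2]
        lin_on_scale[OF l2] sum.distrib fs.scale_sum_right)
  next
    fix q :: "'m \<times> 'h"
    obtain n y where q: "q = (n, y)" by (cases q)
    have "p x (ptens ?F (n, y)) = mscale M (zeta x y) n" for x
      unfolding p_def by (subst lin_ext_pure[OF vector_space_M mlin_rco]) simp
    then show "ptens ?F q = (\<Sum>x\<in>B. ptens ?F (p x (ptens ?F q), x))"
      using hlin_expand[OF vector_space_fscale l1, of y n] by (simp add: q lin_on_scale[OF l2])
  qed (simp add: lin_on_def)
  from this[OF rcoact_in, of m] show ?thesis unfolding p_def rco_def .
qed

lemma lin_ext_lcoact:
  assumes "vector_space s" "\<And>n. hlin s (\<lambda>x. f (x, n))" "\<And>x. lin_on (mscale M) s UNIV (\<lambda>n. f (x, n))"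
  shows "lin_ext s f (lcoact M m) = (\<Sum>x\<in>B. f (x, lco x m))"
proof -
  have f: "mlin s (bilin (hscale H) (mscale M)) f" using assms by (intro mlin_bilinearI) auto
  show ?thesis
    unfolding lcoact_expand
    by (subst lin_on_tensor_sum[OF assms(1) lin_ext_lin_on[OF assms(1) f]])
      (auto intro!: tensor_space_pure simp: lin_ext_pure[OF assms(1) f])
qed

lemma lin_ext_rcoact:
  assumes "vector_space s" "\<And>n. hlin s (\<lambda>x. f (n, x))" "\<And>x. lin_on (mscale M) s UNIV (\<lambda>n. f (n, x))"
  shows "lin_ext s f (rcoact M m) = (\<Sum>x\<in>B. f (rco x m, x))"
proof -
  have f: "mlin s (bilin (mscale M) (hscale H)) f" using assms by (intro mlin_bilinearI) auto
  show ?thesis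
    unfolding rcoact_expand
    by (subst lin_on_tensor_sum[OF assms(1) lin_ext_lin_on[OF assms(1) f]])
      (auto intro!: tensor_space_pure simp: lin_ext_pure[OF assms(1) f])
qed

lemma lco_counit: "(\<Sum>x\<in>B. mscale M (counit H x) (lco x m)) = m"
  using lcoact_counit[of m]
  by (subst (asm) lin_ext_lcoact) (auto simp: vector_space_M hopf_lin ms.scale_left_distrib
      ms.scale_right_distrib mult.commute)

lemma rco_counit: "(\<Sum>x\<in>B. mscale M (counit H x) (rco x m)) = m"
  using rcoact_counit[of m]
  by (subst (asm) lin_ext_rcoact) (auto simp: vector_space_M hopf_lin ms.scale_left_distrib
      ms.scale_right_distrib mult.commute)

lemma mlinear_eqs:
  assumes "mlinear f"
  shows "f (x + y) = f x + f y" "f (mscale M c x) = mscale M c (f x)" "f 0 = 0"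
    "f (\<Sum>i\<in>A. g i) = (\<Sum>i\<in>A. f (g i))"
proof -
  show f0: "f 0 = 0" using lin_on_zero[OF vector_space_M vector_space_M assms, of 0] by simp
  show "f (\<Sum>i\<in>A. g i) = (\<Sum>i\<in>A. f (g i))"
    by (cases "finite A") (auto intro!: lin_on_sum[OF assms] simp: f0)
qed (use assms in \<open>auto simp: lin_on_def\<close>)

lemma sum_if_basis: "u \<in> B \<Longrightarrow> (\<Sum>x\<in>B. zeta u x * a x) = (a u :: 'k)"
proof -
  assume "u \<in> B"
  then have "(\<Sum>x\<in>B. zeta u x * a x) = (\<Sum>x\<in>B. if u = x then a x else 0)"
    by (intro sum.cong) (auto simp: zeta_basis)
  then show ?thesis using \<open>u \<in> B\<close> by simp
qed

lemma cop_zeta_zeta: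
  "u \<in> B \<Longrightarrow> v \<in> B \<Longrightarrow> cop (*) h (\<lambda>x y. zeta u x * (zeta v y * c)) = cc h u v * c"
  using sum_zeta_zeta[of u v "cc h"]
  by (simp add: cop_def sum_distrib_right[symmetric] mult.assoc[symmetric])

lemma lin_on_trilinear_forms:
  assumes "lin_on s1 (*) UNIV f" "lin_on s2 (*) UNIV g" "lin_on s3 (*) UNIV k"
  shows "(\<lambda>(x, y, z). f x * (g y * k z)) \<in> trilinear_forms s1 s2 s3"
  using assms by (auto simp: trilinear_forms_def linear_form_on_def lin_on_def algebra_simps)

text \<open>Coassociativity is evaluated at the product of \<open>zeta u\<close>,
  \<open>zeta v\<close> and a linear form on M. The second coaction is applied to the module factor
  of the first, so the first leg \<open>u\<close> belongs to the operator applied first.\<close>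

lemma lco_coassoc:
  assumes "u \<in> B" "v \<in> B"
  shows "lco v (lco u m) = (\<Sum>x\<in>B. mscale M (cc x u v) (lco x m))"
proof (rule separating_linear_forms[OF vector_space_M])
  fix g assume g: "Vector_Spaces.linear (mscale M) (*) g"
  note gl = linear_lin_on[OF g, of UNIV]
  let ?p = "ptens (trilinear_forms (hscale H) (hscale H) (mscale M))"
  define \<phi> where "\<phi> = (\<lambda>(x, y, n). zeta u x * (zeta v y * g n))"
  have phi: "\<phi> \<in> trilinear_forms (hscale H) (hscale H) (mscale M)"
    unfolding \<phi>_def by (intro lin_on_trilinear_forms zeta_lin gl)
  have 1: "lin_ext fscale (\<lambda>(x1, x2). ?p (x1, x2, n)) (comult H x) =
      cop fscale x (\<lambda>x1 x2. ?p (x1, x2, n))" for x n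
    by (intro lin_ext_comult vector_space_fscale) (simp add: blin_def ptens_trilinear_lin_on)
  have 2: "lin_ext fscale (\<lambda>(x, n). lin_ext fscale (\<lambda>(x1, x2). ?p (x1, x2, n)) (comult H x))
        (lcoact M m) = (\<Sum>x\<in>B. cop fscale x (\<lambda>x1 x2. ?p (x1, x2, lco x m)))"
    unfolding 1 by (subst lin_ext_lcoact[OF vector_space_fscale])
      (auto simp: cop_add[OF vector_space_fscale] cop_scale[OF vector_space_fscale] lin_on_def lin_on_add[OF ptens_trilinear_lin_on(3)]
      lin_on_scale[OF ptens_trilinear_lin_on(3)] cop_add_fun[OF vector_space_fscale]
      cop_scale_fun[OF vector_space_fscale])
  have 3: "lin_ext fscale (\<lambda>(x2, n0). ?p (x1, x2, n0)) (lcoact M n) =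
      (\<Sum>x2\<in>B. ?p (x1, x2, lco x2 n))" for n x1
    by (subst lin_ext_lcoact[OF vector_space_fscale]) (auto simp: ptens_trilinear_lin_on)
  have 4: "lin_ext fscale (\<lambda>(x1, n). lin_ext fscale (\<lambda>(x2, n0). ?p (x1, x2, n0)) (lcoact M n))
        (lcoact M m) = (\<Sum>x1\<in>B. \<Sum>x2\<in>B. ?p (x1, x2, lco x2 (lco x1 m)))"
    unfolding 3 by (subst lin_ext_lcoact[OF vector_space_fscale])
      (auto simp: lin_on_def lin_on_add[OF ptens_trilinear_lin_on(3)] lin_on_add[OF ptens_trilinear_lin_on(1)]
      lin_on_scale[OF ptens_trilinear_lin_on(3)] lin_on_scale[OF ptens_trilinear_lin_on(1)]
      sum.distrib fs.scale_sum_right mlinear_eqs[OF mlinear_lco])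
  have pp: "?p (x, y, n) \<phi> = zeta u x * (zeta v y * g n)" for x y n
    using phi by (simp add: ptens_def) (simp add: \<phi>_def)
  have "(\<Sum>x\<in>B. cop fscale x (\<lambda>x1 x2. ?p (x1, x2, lco x m))) \<phi> =
      (\<Sum>x1\<in>B. \<Sum>x2\<in>B. ?p (x1, x2, lco x2 (lco x1 m))) \<phi>"
    using lcoact_coassoc[of m] unfolding 2 4 by simp
  then have "(\<Sum>x\<in>B. cc x u v * g (lco x m)) = g (lco v (lco u m))"
    using assms by (simp add: sum_fun_apply cop_fscale_apply pp cop_zeta_zeta sum_if_basis
      flip: sum_distrib_left)
  then show "g (lco v (lco u m)) = g (\<Sum>x\<in>B. mscale M (cc x u v) (lco x m))"
    by (simp add: module_hom.sum[OF module_hom_linearI[OF g]]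
        module_hom.scale[OF module_hom_linearI[OF g]])
qed

lemma bicoact_expand: "bicoact H M m = (\<Sum>x\<in>B. \<Sum>y\<in>B.
    ptens (trilinear_forms (hscale H) (mscale M) (hscale H)) (x, rco y (lco x m), y))"
proof -
  let ?p = "ptens (trilinear_forms (hscale H) (mscale M) (hscale H))"
  have 1: "lin_ext fscale (\<lambda>(n0, y). ?p (x, n0, y)) (rcoact M n) = (\<Sum>y\<in>B. ?p (x, rco y n, y))"
    for x n
    by (subst lin_ext_rcoact[OF vector_space_fscale]) (auto simp: ptens_trilinear_lin_on)
  show ?thesis
    unfolding bicoact_def 1 by (subst lin_ext_lcoact[OF vector_space_fscale])
      (auto simp: lin_on_def lin_on_add[OF ptens_trilinear_lin_on(2)] lin_on_add[OF ptens_trilinear_lin_on(1)]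
      lin_on_scale[OF ptens_trilinear_lin_on(2)] lin_on_scale[OF ptens_trilinear_lin_on(1)]
      sum.distrib fs.scale_sum_right mlinear_eqs[OF mlinear_rco])
qed

lemma lco_rco:
  assumes "u \<in> B" "v \<in> B"
  shows "lco u (rco v m) = rco v (lco u m)"
proof (rule separating_linear_forms[OF vector_space_M])
  fix g assume g: "Vector_Spaces.linear (mscale M) (*) g"
  note gl = linear_lin_on[OF g, of UNIV]
  let ?p = "ptens (trilinear_forms (hscale H) (mscale M) (hscale H))"
  define \<phi> where "\<phi> = (\<lambda>(x, n, y). zeta u x * (g n * zeta v y))"
  have phi: "\<phi> \<in> trilinear_forms (hscale H) (mscale M) (hscale H)"
    unfolding \<phi>_def by (intro lin_on_trilinear_forms zeta_lin gl)
  have pp: "?p (x, n, y) \<phi> = zeta u x * (zeta v y * g n)" for x y n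
    using phi by (simp add: ptens_def) (simp add: \<phi>_def)
  have 1: "lin_ext fscale (\<lambda>(x, n0). ?p (x, n0, y)) (lcoact M n) = (\<Sum>x\<in>B. ?p (x, lco x n, y))"
    for y n
    by (subst lin_ext_lcoact[OF vector_space_fscale]) (auto simp: ptens_trilinear_lin_on)
  have "bicoact H M m = (\<Sum>y\<in>B. \<Sum>x\<in>B. ?p (x, lco x (rco y m), y))"
    unfolding bicomodule 1 by (subst lin_ext_rcoact[OF vector_space_fscale])
      (auto simp: lin_on_def lin_on_add[OF ptens_trilinear_lin_on(2)] lin_on_add[OF ptens_trilinear_lin_on(3)]
      lin_on_scale[OF ptens_trilinear_lin_on(2)] lin_on_scale[OF ptens_trilinear_lin_on(3)]
      sum.distrib fs.scale_sum_right mlinear_eqs[OF mlinear_lco])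
  then have "(\<Sum>x\<in>B. \<Sum>y\<in>B. ?p (x, rco y (lco x m), y)) \<phi> = (\<Sum>y\<in>B. \<Sum>x\<in>B. ?p (x, lco x (rco y m), y)) \<phi>"
    unfolding bicoact_expand by simp
  then show "g (lco u (rco v m)) = g (rco v (lco u m))"
    using assms by (simp add: sum_fun_apply pp sum_if_basis flip: sum_distrib_left)
qed

section \<open>The Hopf bimodule axiom in coordinates\<close>

lemma lin_ext_comult3:
  assumes s: "vector_space s" and f: "mlin s (trilinear_forms (hscale H) (hscale H) (hscale H)) f"
  shows "lin_ext s f (comult3 H h) = cop s h (\<lambda>x h3. cop s x (\<lambda>h1 h2. f (h1, h2, h3)))"
proof -
  let ?T = "trilinear_forms (hscale H) (hscale H) (hscale H)"
  note l = lin_ext_lin_on[OF s f, of UNIV]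
  have c: "lin_ext s f (cop fscale x g) = cop s x (\<lambda>u v. lin_ext s f (g u v))"
    if "\<And>u v. g u v \<in> tensor_space ?T UNIV" for x g
    by (rule cop_map[OF s vector_space_fscale l]) (use that in auto)
  have i: "cop fscale x (\<lambda>u v. ptens ?T (u, v, w)) \<in> tensor_space ?T UNIV" for x w
    by (rule cop_in) (auto intro: tensor_space_pure)
  show ?thesis unfolding comult3_cop
    by (simp add: c i tensor_space_pure lin_ext_pure[OF s f])
qed

lemma lact_eqs: "lact M (a + b) m = lact M a m + lact M b m"
    "lact M (hscale H c a) m = mscale M c (lact M a m)"
    "lact M a (m + n) = lact M a m + lact M a n" "lact M a (mscale M c m) = mscale M c (lact M a m)"
  using linear_lin_on[OF lact_linear, of UNIV a] linear_lin_on[OF lact_linear', of UNIV m]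
  by (auto simp: lin_on_def)

lemma ract_eqs: "ract M m (a + b) = ract M m a + ract M m b"
    "ract M m (hscale H c a) = mscale M c (ract M m a)"
    "ract M (m + n) a = ract M m a + ract M n a" "ract M (mscale M c m) a = mscale M c (ract M m a)"
  using linear_lin_on[OF ract_linear, of UNIV a] linear_lin_on[OF ract_linear', of UNIV m]
  by (auto simp: lin_on_def)

text \<open>The Hopf bimodule axiom with the counit applied to its third tensor factor. The counit
  is multiplicative and unchanged by the inverse antipode, so the third legs of \<open>h\<close>,
  \<open>m\<close> and \<open>g\<close> contribute only counits and are then removed by counitality.
  The behaviour of the right coaction is later obtained from this through \<psi>.\<close>

lemma lco_act:
  assumes u: "u \<in> B"
  shows "lco u (ract M (lact M h m) g) = cop (mscale M) h (\<lambda>h1 h2. \<Sum>x\<in>B. cop (mscale M) g (\<lambda>g1 g2.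
    mscale M (zeta u (h1 * x * g1)) (ract M (lact M h2 (lco x m)) g2)))"
proof (rule separating_linear_forms[OF vector_space_M])
  fix \<gamma> assume g: "Vector_Spaces.linear (mscale M) (*) \<gamma>"
  note gl = linear_lin_on[OF g, of UNIV]
  let ?F = "trilinear_forms (hscale H) (mscale M) (hscale H)"
  define \<phi> where "\<phi> = (\<lambda>(x, n, y). zeta u x * (\<gamma> n * counit H y))"
  have phi: "\<phi> \<in> ?F"
    unfolding \<phi>_def by (intro lin_on_trilinear_forms zeta_lin gl linear_lin_on[OF counit_linear])
  have pp: "ptens ?F (x, n, y) \<phi> = zeta u x * (\<gamma> n * counit H y)" for x y n
    using phi by (simp add: ptens_def) (simp add: \<phi>_def)
  let ?i = "\<lambda>y. antip_inv H (antip_inv H y)"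
  define P where "P h1 h2 h3 x n y g1 g2 g3 = ptens ?F
    (h1 * x * g1, ract M (lact M h2 n) g2, h3 * y * ?i g3)" for h1 h2 h3 x n y g1 g2 g3
  note tri = lin_on_add[OF ptens_trilinear_lin_on(1)] lin_on_add[OF ptens_trilinear_lin_on(2)]
    lin_on_add[OF ptens_trilinear_lin_on(3)] lin_on_scale[OF ptens_trilinear_lin_on(1)]
    lin_on_scale[OF ptens_trilinear_lin_on(2)] lin_on_scale[OF ptens_trilinear_lin_on(3)]
  note lins = lin_on_def P_def hopf_lin antip_inv_add antip_inv_scale lact_eqs ract_eqs
    tri cop_add_fun[OF vector_space_fscale] cop_scale_fun[OF vector_space_fscale]
    sum.distrib fs.scale_sum_right
  define P1 where "P1 h1 h2 h3 x n y = cop fscale g (\<lambda>q g3. cop fscale q (\<lambda>g1 g2.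
    P h1 h2 h3 x n y g1 g2 g3))" for h1 h2 h3 x n y
  have 1: "lin_ext fscale (\<lambda>(g1, g2, g3). P h1 h2 h3 x n y g1 g2 g3) (comult3 H g) =
      P1 h1 h2 h3 x n y" for h1 h2 h3 x n y
    unfolding P1_def
    by (subst lin_ext_comult3[OF vector_space_fscale])
      (auto intro!: mlin_trilinearI vector_space_fscale simp: lins)
  define P2 where "P2 h1 h2 h3 = (\<Sum>x\<in>B. \<Sum>y\<in>B. P1 h1 h2 h3 x (rco y (lco x m)) y)" for h1 h2 h3
  have ml2: "mlin fscale ?F (\<lambda>(x, n, y). P1 h1 h2 h3 x n y)" for h1 h2 h3
    unfolding P1_def by (intro mlin_trilinearI vector_space_fscale) (auto simp: lins)
  have 2: "lin_ext fscale (\<lambda>(x, n, y). P1 h1 h2 h3 x n y) (bicoact H M m) = P2 h1 h2 h3"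
    for h1 h2 h3
    unfolding bicoact_expand P2_def
    by (subst lin_on_tensor_sum[OF vector_space_fscale lin_ext_lin_on[OF vector_space_fscale ml2]],
      (auto intro!: tensor_space_pure)[1])+
      (simp add: lin_ext_pure[OF vector_space_fscale ml2])
  have 3: "bicoact H M (ract M (lact M h m) g) = cop fscale h (\<lambda>p h3. cop fscale p (\<lambda>h1 h2. P2 h1 h2 h3))"
  proof -
    have "bicoact H M (ract M (lact M h m) g) = lin_ext fscale (\<lambda>(h1, h2, h3). P2 h1 h2 h3) (comult3 H h)"
      unfolding hopf_bimodule P_def[symmetric] 1 2 ..
    also have "\<dots> = cop fscale h (\<lambda>p h3. cop fscale p (\<lambda>h1 h2. P2 h1 h2 h3))"
      by (subst lin_ext_comult3[OF vector_space_fscale])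
        (auto intro!: mlin_trilinearI vector_space_fscale simp: P2_def P1_def lins)
    finally show ?thesis .
  qed
  have 4: "bicoact H M m' \<phi> = \<gamma> (lco u m')" for m'
  proof -
    have "bicoact H M m' \<phi> = (\<Sum>y\<in>B. \<gamma> (rco y (lco u m')) * counit H y)"
      unfolding bicoact_expand
      using u by (simp add: sum_fun_apply pp sum_if_basis flip: sum_distrib_left)
    also have "\<dots> = \<gamma> (\<Sum>y\<in>B. mscale M (counit H y) (rco y (lco u m')))"
      by (simp add: mult.commute module_hom.sum[OF module_hom_linearI[OF g]]
          module_hom.scale[OF module_hom_linearI[OF g]])
    finally show ?thesis by (simp add: rco_counit)
  qed
  define Q where "Q h1 h2 x n = cop (*) g (\<lambda>g1 g2. zeta u (h1 * x * g1) * \<gamma> (ract M (lact M h2 n) g2))"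
    for h1 h2 x n
  have gs: "\<gamma> (m + n) = \<gamma> m + \<gamma> n" "\<gamma> (mscale M c m) = c * \<gamma> m" for m n c
    using gl by (auto simp: lin_on_def)
  have 5: "P1 h1 h2 h3 x n y \<phi> = counit H h3 * (counit H y * Q h1 h2 x n)" for h1 h2 h3 x n y
  proof -
    have "P1 h1 h2 h3 x n y \<phi> = cop (*) g (\<lambda>q g3. cop (*) q (\<lambda>g1 g2.
        (counit H h3 * counit H y * counit H g3) *
         (zeta u (h1 * x * g1) * \<gamma> (ract M (lact M h2 n) g2))))"
      by (simp add: P1_def P_def cop_fscale_apply pp counit_mult counit_antip_inv mult_ac)
    also have "\<dots> = cop (*) g (\<lambda>q g3. counit H g3 * (counit H h3 * counit H y * cop (*) q (\<lambda>g1 g2.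
         (zeta u (h1 * x * g1) * \<gamma> (ract M (lact M h2 n) g2)))))"
      unfolding cop_scale_fun[OF vector_space_field] by (simp add: mult_ac)
    also have "\<dots> = counit H h3 * counit H y * Q h1 h2 x n"
      unfolding Q_def
      by (rule cop_counit_right[OF vector_space_field])
        (auto simp: lin_on_def cop_add[OF vector_space_field] cop_scale[OF vector_space_field] algebra_simps)
    finally show ?thesis by (simp add: mult.assoc)
  qed
  have Ql: "lin_on (mscale M) (*) UNIV (Q h1 h2 x)" for h1 h2 x
    unfolding Q_def by (auto simp: lin_on_def lact_eqs ract_eqs gs distrib_left cop_add_fun[OF vector_space_field]
      mult.left_commute cop_scale_fun[OF vector_space_field])
  have 6: "P2 h1 h2 h3 \<phi> = counit H h3 * (\<Sum>x\<in>B. Q h1 h2 x (lco x m))" for h1 h2 h3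
  proof -
    have "(\<Sum>y\<in>B. counit H y * Q h1 h2 x (rco y n)) = Q h1 h2 x (\<Sum>y\<in>B. mscale M (counit H y) (rco y n))"
      for x n
      using lin_on_zero[OF vector_space_M vector_space_field Ql, of 0]
      by (subst lin_on_sum[OF Ql]) (auto simp: lin_on_scale[OF Ql])
    then show ?thesis
      by (simp add: P2_def sum_fun_apply 5 rco_counit flip: sum_distrib_left)
  qed
  have "\<gamma> (lco u (ract M (lact M h m) g)) = cop (*) h (\<lambda>p h3. counit H h3 * cop (*) p (\<lambda>h1 h2. (\<Sum>x\<in>B. Q h1 h2 x (lco x m))))"
    unfolding 4[symmetric] 3 cop_fscale_apply 6 cop_scale_fun[OF vector_space_field] ..
  also have "\<dots> = cop (*) h (\<lambda>h1 h2. (\<Sum>x\<in>B. Q h1 h2 x (lco x m)))"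
    by (rule cop_counit_right[OF vector_space_field]) (rule cop_hlin[OF vector_space_field])
  also have "\<dots> = \<gamma> (cop (mscale M) h (\<lambda>h1 h2. \<Sum>x\<in>B. cop (mscale M) g (\<lambda>g1 g2.
    mscale M (zeta u (h1 * x * g1)) (ract M (lact M h2 (lco x m)) g2))))"
    by (simp add: cop_map_UNIV[OF vector_space_field vector_space_M gl] gs Q_def
      module_hom.sum[OF module_hom_linearI[OF g]])
  finally show "\<gamma> (lco u (ract M (lact M h m) g)) = \<dots>" .
qed

subsection \<open>The operators of a half-edge\<close>

text \<open>The parameter \<open>s\<close> tells whether the half-edge is the source of its edge.\<close>

definition hact :: "bool \<Rightarrow> 'h \<Rightarrow> 'm \<Rightarrow> 'm" where
  "hact s a m = (if s then ract M m (antip H a) else lact M a m)"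

definition hco :: "bool \<Rightarrow> 'h \<Rightarrow> 'm \<Rightarrow> 'm" where
  "hco s x m = (if s then lco x m else \<Sum>y\<in>B. mscale M (zeta x (antip H y)) (rco y m))"

lemma hact_eqs:
  "hact s (a + b) m = hact s a m + hact s b m" "hact s (hscale H c a) m = mscale M c (hact s a m)"
  "hact s a (m + n) = hact s a m + hact s a n" "hact s a (mscale M c m) = mscale M c (hact s a m)"
  by (auto simp: hact_def lact_eqs ract_eqs antip_add antip_scale)

lemma mlinear_hact: "mlinear (hact s a)"
  by (auto simp: lin_on_def hact_eqs)

lemma mlinear_hco: "mlinear (hco s x)"
  unfolding hco_def
  by (cases s) (auto simp: mlinear_lco intro!: lin_on_sum_fun lin_on_scale_fun vector_space_M mlinear_rco)

lemma mlinear_invol: "mlinear (invol M)"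
  by (rule linear_lin_on[OF invol_linear])

lemma hact_invol: "hact s a (invol M m) = invol M (hact (\<not> s) a m)"
proof (cases s)
  case False
  have "lact M a (invol M m) = invol M (invol M (lact M a (invol M m)))" by (simp add: invol_invol)
  then show ?thesis by (simp add: hact_def False invol_lact invol_invol)
qed (simp add: hact_def invol_lact)

text \<open>The compatibility of \<psi> with the coactions, read in coordinates. The antipode in the
  operator \<open>T\<close> of a target is the one that occurs in this axiom.\<close>

lemma lco_invol: "lco x (invol M m) = invol M (hco False x m)"
proof -
  let ?p = "ptens (bilin (hscale H) (mscale M))"
  have "lcoact M (invol M m) = (\<Sum>y\<in>B. ?p (antip H y, invol M (rco y m)))"
    unfolding invol_coact
    by (subst lin_ext_rcoact[OF vector_space_fscale])
      (auto simp: lin_on_def antip_add antip_scale mlinear_eqs[OF mlinear_invol]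
      lin_on_add[OF ptens_bilinear_lin_on(1)] lin_on_add[OF ptens_bilinear_lin_on(2)]
      lin_on_scale[OF ptens_bilinear_lin_on(1)] lin_on_scale[OF ptens_bilinear_lin_on(2)])
  then have "lco x (invol M m) = (\<Sum>y\<in>B. mscale M (zeta x (antip H y)) (invol M (rco y m)))"
    unfolding lco_def
    by (simp add: lin_on_tensor_sum[OF vector_space_M
        lin_ext_lin_on[OF vector_space_M mlin_lco, where P = UNIV]]
      lin_ext_pure[OF vector_space_M mlin_lco] tensor_space_pure)
  then show ?thesis by (simp add: hco_def mlinear_eqs[OF mlinear_invol])
qed

lemma hco_invol: "hco s x (invol M m) = invol M (hco (\<not> s) x m)"
proof (cases s)
  case False
  have "hco False x (invol M m) = invol M (lco x (invol M (invol M m)))"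
    unfolding lco_invol by (simp add: invol_invol)
  then show ?thesis by (simp add: False invol_invol hco_def)
qed (simp add: hco_def lco_invol[unfolded hco_def])

lemma hact_conj: "hact s a m = invol M (hact (\<not> s) a (invol M m))"
  by (simp add: hact_invol invol_invol)

lemma hco_conj: "hco s a m = invol M (hco (\<not> s) a (invol M m))"
  by (simp add: hco_invol invol_invol)

lemma hact_mult: "hact s (a * b) m = hact s a (hact s b m)"
proof (cases s)
  case True
  have "hact True (a * b) m = invol M (hact False a (hact False b (invol M m)))"
    unfolding hact_conj[of True] by (simp add: hact_def lact_mult)
  also have "\<dots> = hact True a (hact True b m)"
    by (simp add: hact_invol invol_invol)
  finally show ?thesis by (simp add: True)
qed (simp add: hact_def lact_mult)

lemma hact_one: "hact s 1 m = m"
  by (simp add: hact_def antip_one ract_one lact_one)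

lemma hact_commute: "hact s a (hact (\<not> s) b m) = hact (\<not> s) b (hact s a m)"
  by (simp add: hact_def bimodule)

lemma hco_commute:
  assumes "x \<in> B" "y \<in> B"
  shows "hco s x (hco (\<not> s) y m) = hco (\<not> s) y (hco s x m)"
  using assms by (simp add: hco_def mlinear_eqs[OF mlinear_lco] lco_rco)

lemma hco_counit: "(\<Sum>x\<in>B. mscale M (counit H x) (hco s x m)) = m"
proof (cases s)
  case False
  have "(\<Sum>x\<in>B. mscale M (counit H x) (hco False x m)) =
      invol M (\<Sum>x\<in>B. mscale M (counit H x) (hco True x (invol M m)))"
    by (simp add: mlinear_eqs[OF mlinear_invol] hco_conj[of False])
  then show ?thesis using lco_counit by (simp add: False hco_def invol_invol)
qed (simp add: hco_def lco_counit)

lemma hco_coassoc: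
  assumes "u \<in> B" "v \<in> B"
  shows "hco s v (hco s u m) = (\<Sum>x\<in>B. mscale M (cc x u v) (hco s x m))"
proof (cases s)
  case False
  have "hco False v (hco False u m) = invol M (hco True v (hco True u (invol M m)))"
    by (simp add: hco_invol invol_invol)
  then show ?thesis using lco_coassoc[OF assms]
    by (simp add: False hco_def[of True] mlinear_eqs[OF mlinear_invol]) (simp add: lco_invol invol_invol)
qed (simp add: hco_def lco_coassoc assms)

lemma invol_cop: "invol M (cop (mscale M) h f) = cop (mscale M) h (\<lambda>x y. invol M (f x y))"
  by (rule cop_map_UNIV[OF vector_space_M vector_space_M mlinear_invol])

text \<open>If a target acts and the source of its edge coacts, this is \<open>lco_act\<close> with
  trivial right action: the coefficient is multiplied by \<open>a1\<close> from the left.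
  Conjugation by \<psi> gives the other case.\<close>

lemma hco_hact_opposite:
  assumes x: "x \<in> B"
  shows "hco (\<not> s) x (hact s a m) = cop (mscale M) a (\<lambda>a1 a2.
     \<Sum>y\<in>B. mscale M (zeta x (a1 * y)) (hact s a2 (hco (\<not> s) y m)))"
proof -
  have A: "hco True x (hact False a m) = cop (mscale M) a (\<lambda>a1 a2.
     \<Sum>y\<in>B. mscale M (zeta x (a1 * y)) (hact False a2 (hco True y m)))" for m
  proof -
    have b: "blin (mscale M) (\<lambda>g1 g2. mscale M (zeta x (h1 * y * g1)) (ract M n g2))" for h1 y n
      by (auto simp: hopf_lin zeta_add zeta_scale ract_eqs ms.scale_left_distrib ms.scale_right_distrib
        mult.commute)
    show ?thesis
      using lco_act[OF x, of a m 1]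
      by (simp add: ract_one hco_def hact_def cop_one[OF vector_space_M b])
  qed
  show ?thesis
  proof (cases s)
    case True
    have "hco False x (hact True a m) = invol M (hco True x (hact False a (invol M m)))"
      by (simp add: hco_invol hact_invol invol_invol)
    then show ?thesis
      unfolding A by (simp add: True invol_cop mlinear_eqs[OF mlinear_invol] hco_invol hact_invol invol_invol)
  qed (use A in simp)
qed

text \<open>If a source acts and coacts, this is \<open>lco_act\<close> with trivial left action and
  \<open>g = S(a)\<close>; \<open>cop_antip\<close> exchanges the two legs of \<open>a\<close>, so
  the coefficient receives \<open>S(a2)\<close> on the right. Conjugation by \<psi> gives the other
  case.\<close>

lemma hco_hact_same:
  assumes x: "x \<in> B"
  shows "hco s x (hact s a m) = cop (mscale M) a (\<lambda>a1 a2.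
     \<Sum>y\<in>B. mscale M (zeta x (y * antip H a2)) (hact s a1 (hco s y m)))"
proof -
  have A: "hco True x (hact True a m) = cop (mscale M) a (\<lambda>a1 a2.
     \<Sum>y\<in>B. mscale M (zeta x (y * antip H a2)) (hact True a1 (hco True y m)))" for m
  proof -
    have b: "blin (mscale M) (\<lambda>h1 h2. \<Sum>y\<in>B. cop (mscale M) g (\<lambda>g1 g2.
        mscale M (zeta x (h1 * y * g1)) (ract M (lact M h2 (lco y m)) g2)))" for g
      by (auto simp: hopf_lin zeta_add zeta_scale ract_eqs lact_eqs ms.scale_left_distrib
        ms.scale_right_distrib sum.distrib ms.scale_sum_right
        cop_add_fun[OF vector_space_M] cop_scale_fun[OF vector_space_M]
        simp flip: cop_scale_fun[OF vector_space_M] intro!: sum.cong) (simp_all add: mult.commute)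
    have b2: "blin (mscale M) (\<lambda>g1 g2. mscale M (zeta x (y * g1)) (ract M n g2))" for y n
      by (auto simp: hopf_lin zeta_add zeta_scale ract_eqs ms.scale_left_distrib ms.scale_right_distrib
        mult.commute)
    show ?thesis
      using lco_act[OF x, of 1 m "antip H a"]
      unfolding cop_one[OF vector_space_M b]
      unfolding lact_one mult_1 cop_antip[OF vector_space_M b2]
      by (simp add: hco_def hact_def cop_sum[OF vector_space_M])
  qed
  show ?thesis
  proof (cases s)
    case False
    have "hco False x (hact False a m) = invol M (hco True x (hact True a (invol M m)))"
      by (simp add: hco_invol hact_invol invol_invol)
    then show ?thesis
      unfolding A by (simp add: False invol_cop mlinear_eqs[OF mlinear_invol] hco_invol hact_invol invol_invol)
  qed (use A in simp)
qed

end

section \<open>Kitaev graphs\<close>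

subsection \<open>Cycles of permutations as lists\<close>

text \<open>A segment of an orbit, with \<open>z\<close> the point reached after its last entry.
  Keeping the end point as a separate argument allows induction over segments; a full cycle has
  \<open>z = hd xs\<close>.\<close>

primrec chain :: "('a \<Rightarrow> 'a) \<Rightarrow> 'a list \<Rightarrow> 'a \<Rightarrow> bool" where
  "chain f [] z \<longleftrightarrow> True"
| "chain f (x # xs) z \<longleftrightarrow> f x = hd (xs @ [z]) \<and> chain f xs z"

lemma chain_iff_nth: "chain f xs z \<longleftrightarrow> (\<forall>i<length xs. f (xs ! i) = (xs @ [z]) ! Suc i)"
proof (induction xs)
  case (Cons x xs)
  have "(\<forall>i<length (x # xs). f ((x # xs) ! i) = ((x # xs) @ [z]) ! Suc i) \<longleftrightarrow>
      f x = (xs @ [z]) ! 0 \<and> (\<forall>i<length xs. f (xs ! i) = (xs @ [z]) ! Suc i)"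
    by (auto simp: less_Suc_eq_0_disj)
  then show ?case using Cons by (cases xs) auto
qed simp

text \<open>Following \<open>f\<close> from the head runs through the list and returns after
  \<open>length xs\<close> steps; an earlier return would repeat an entry.\<close>

lemma support_eqI:
  assumes "xs \<noteq> []" "distinct xs" "chain f xs (hd xs)"
  shows "support f (hd xs) = xs"
proof -
  have step: "f (xs ! i) = (xs @ [hd xs]) ! Suc i" if "i < length xs" for i
    using assms(3) that by (simp add: chain_iff_nth)
  have pow: "(f ^^ i) (hd xs) = (xs @ [hd xs]) ! i" if "i \<le> length xs" for i
    using that
  proof (induction i)
    case 0
    then show ?case using assms(1) by (cases xs) auto
  next
    case (Suc i)
    then show ?case using step[of i] by (simp add: nth_append)
  qed
  have "least_power f (hd xs) = length xs"
    unfolding least_power_def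
  proof (rule Least_equality)
    show "(f ^^ length xs) (hd xs) = hd xs \<and> 0 < length xs"
      using pow[of "length xs"] assms(1) by simp
  next
    fix n assume n: "(f ^^ n) (hd xs) = hd xs \<and> 0 < n"
    show "length xs \<le> n"
    proof (rule ccontr)
      assume "\<not> length xs \<le> n"
      then have "xs ! n = xs ! 0"
        using pow[of n] n assms(1) by (simp add: nth_append hd_conv_nth)
      then show False
        using nth_eq_iff_index_eq[OF assms(2), of n 0] assms(1) n \<open>\<not> length xs \<le> n\<close> by simp
    qed
  qed
  then show ?thesis
    by (intro nth_equalityI) (auto simp: pow nth_append)
qed

lemma support_props:
  assumes "permutation f"
  shows "support f c \<noteq> []" "hd (support f c) = c" "distinct (support f c)"
    "chain f (support f c) c" "set (support f c) = orbit f c"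
proof -
  let ?n = "least_power f c"
  have n: "0 < ?n" "(f ^^ ?n) c = c"
    using least_power_of_permutation[OF assms] by auto
  show ne: "support f c \<noteq> []" using n by simp
  show "hd (support f c) = c" using n by (simp add: hd_map hd_upt)
  show "distinct (support f c)" using cycle_of_permutation[OF assms] by simp
  show "chain f (support f c) c"
    unfolding chain_iff_nth
  proof (intro allI impI)
    fix i assume i: "i < length (support f c)"
    show "f (support f c ! i) = (support f c @ [c]) ! Suc i"
    proof (cases "Suc i = ?n")
      case True
      then show ?thesis using i n(2) by (simp add: nth_append) (metis funpow.simps(2) o_apply)
    qed (use i in \<open>auto simp: nth_append\<close>)
  qed
  show "set (support f c) = orbit f c"
    unfolding support_set[OF assms] orbit_altdef_permutation[OF assms] by auto
qed

lemma support_conj: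
  assumes "bij \<sigma>"
  shows "support (\<sigma> \<circ> f \<circ> inv_into UNIV \<sigma>) (\<sigma> c) = map \<sigma> (support f c)"
proof -
  have pow: "((\<sigma> \<circ> f \<circ> inv_into UNIV \<sigma>) ^^ i) (\<sigma> c) = \<sigma> ((f ^^ i) c)" for i
    by (induction i) (auto simp: bij_is_inj[OF assms])
  then have "least_power (\<sigma> \<circ> f \<circ> inv_into UNIV \<sigma>) (\<sigma> c) = least_power f c"
    by (simp add: least_power_def bij_is_inj[OF assms] inj_eq)
  then show ?thesis by (simp add: pow)
qed

text \<open>
  Removing \<open>q\<close> from its position behind \<open>p\<close> and inserting it before \<open>r\<close>.  Both the effect of
  a slide on vertices and that on faces have this form.
\<close>

inductive move :: "'a \<Rightarrow> 'a \<Rightarrow> 'a \<Rightarrow> 'a list \<Rightarrow> 'a list \<Rightarrow> bool" for p q r where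
  Nil: "move p q r [] []"
| keep: "k \<notin> {p, q, r} \<Longrightarrow> move p q r xs ys \<Longrightarrow> move p q r (k # xs) (k # ys)"
| remove: "move p q r xs ys \<Longrightarrow> move p q r (p # q # xs) (p # ys)"
| insert: "move p q r xs ys \<Longrightarrow> move p q r (r # xs) (q # r # ys)"

lemma move_set:
  assumes "move p q r xs ys" "distinct [p, q, r]"
  shows "set ys = (set xs - {q}) \<union> (if r \<in> set xs then {q} else {})"
  using assms by (induction rule: move.induct) auto

lemma move_distinct:
  assumes "move p q r xs ys" "distinct [p, q, r]" "distinct xs"
  shows "distinct ys"
  using assms
  by (induction rule: move.induct) (auto simp: move_set)

text \<open>The permutation behind \<open>move\<close>: in cycle notation \<open>q\<close> is cut
  out between \<open>p\<close> and \<open>f q\<close> and put in front of \<open>r\<close>. The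
  condition \<open>f q \<noteq> r\<close> excludes that \<open>q\<close> already stands
  there.\<close>

definition moves_to :: "'a \<Rightarrow> 'a \<Rightarrow> 'a \<Rightarrow> ('a \<Rightarrow> 'a) \<Rightarrow> ('a \<Rightarrow> 'a) \<Rightarrow> bool" where
  "moves_to p q r f f' \<longleftrightarrow> distinct [p, q, r] \<and> f p = q \<and> f q \<noteq> q \<and> f q \<noteq> r \<and>
     f' p = f q \<and> f' q = r \<and> (\<forall>k. k \<noteq> p \<longrightarrow> k \<noteq> q \<longrightarrow> f' k = transpose r q (f k))"

text \<open>Neither the first point nor the end point may be \<open>q\<close>, so a segment never
  cuts between \<open>p\<close> and \<open>q\<close>. Removal then consumes both entries at once,
  hence the induction on length. A segment that starts or ends at \<open>r\<close> afterwards starts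
  or ends at \<open>q\<close>, whence the transposition.\<close>

lemma move_exists:
  assumes m: "moves_to p q r f f'" and inj: "inj f"
    and "chain f xs z" "z \<noteq> q" "hd (xs @ [z]) \<noteq> q"
  shows "\<exists>ys. move p q r xs ys \<and> chain f' ys (transpose r q z) \<and>
    hd (ys @ [transpose r q z]) = transpose r q (hd (xs @ [z])) \<and> (xs \<noteq> [] \<longrightarrow> ys \<noteq> [])"
  using assms(3-5)
proof (induction xs rule: length_induct)
  case (1 xs)
  let ?t = "transpose r q"
  note m' = m[unfolded moves_to_def]
  have pqr: "p \<noteq> q" "p \<noteq> r" "q \<noteq> r" using m' by auto
  have q: "f x = q \<Longrightarrow> x = p" for x using m' inj by (metis injD)
  show ?case
  proof (cases xs)
    case Nil
    then show ?thesis by (auto intro: move.Nil)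
  next
    case (Cons x xs')
    consider "x = p" | "x = r" | "x \<notin> {p, q, r}" using 1(4) Cons by auto
    then show ?thesis
    proof cases
      case 1
      then have "hd (xs' @ [z]) = q" using "1.prems" Cons m' by simp
      then obtain xs'' where x2: "xs' = q # xs''" using "1.prems"(2) by (cases xs') auto
      have "\<exists>ys. move p q r xs'' ys \<and> chain f' ys (?t z) \<and>
          hd (ys @ [?t z]) = ?t (hd (xs'' @ [z])) \<and> (xs'' \<noteq> [] \<longrightarrow> ys \<noteq> [])"
        by (rule "1.IH"[rule_format]) (use "1.prems" Cons x2 m' in auto)
      then obtain ys where ys: "move p q r xs'' ys" "chain f' ys (?t z)"
        "hd (ys @ [?t z]) = ?t (hd (xs'' @ [z]))" by blast
      have fq: "hd (xs'' @ [z]) = f q" using "1.prems" Cons x2 by simp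
      have "move p q r xs (p # ys)" unfolding Cons x2 1 by (rule move.remove[OF ys(1)])
      moreover have "chain f' (p # ys) (?t z)" using ys fq m' by (simp add: transpose_def)
      ultimately show ?thesis using Cons 1 m' by (intro exI[of _ "p # ys"]) (auto simp: transpose_def)
    next
      case 2
      have "f x \<noteq> q" using q[of x] pqr 2 by blast
      then have "hd (xs' @ [z]) \<noteq> q" using "1.prems" Cons by simp
      then have "\<exists>ys. move p q r xs' ys \<and> chain f' ys (?t z) \<and>
          hd (ys @ [?t z]) = ?t (hd (xs' @ [z])) \<and> (xs' \<noteq> [] \<longrightarrow> ys \<noteq> [])"
        by (intro "1.IH"[rule_format]) (use "1.prems" Cons in auto)
      then obtain ys where ys: "move p q r xs' ys" "chain f' ys (?t z)"
        "hd (ys @ [?t z]) = ?t (hd (xs' @ [z]))" by blast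
      have "f' r = ?t (f r)" using m' by auto
      then have "chain f' (q # r # ys) (?t z)" using ys m' "1.prems" Cons 2 by simp
      moreover have "move p q r xs (q # r # ys)" unfolding Cons 2 by (rule move.insert[OF ys(1)])
      ultimately show ?thesis using Cons 2 by (intro exI[of _ "q # r # ys"]) auto
    next
      case 3
      have "f x \<noteq> q" using q[of x] pqr 3 by blast
      then have "hd (xs' @ [z]) \<noteq> q" using "1.prems" Cons by simp
      then have "\<exists>ys. move p q r xs' ys \<and> chain f' ys (?t z) \<and>
          hd (ys @ [?t z]) = ?t (hd (xs' @ [z])) \<and> (xs' \<noteq> [] \<longrightarrow> ys \<noteq> [])"
        by (intro "1.IH"[rule_format]) (use "1.prems" Cons in auto)
      then obtain ys where ys: "move p q r xs' ys" "chain f' ys (?t z)"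
        "hd (ys @ [?t z]) = ?t (hd (xs' @ [z]))" by blast
      have "chain f' (x # ys) (?t z)" using ys m' "1.prems" Cons 3 by simp
      moreover have "move p q r xs (x # ys)" unfolding Cons by (rule move.keep[OF 3 ys(1)])
      ultimately show ?thesis using Cons 3 by (intro exI[of _ "x # ys"]) (auto simp: transpose_def)
    qed
  qed
qed

text \<open>If the cycle starts at \<open>r\<close>, then \<open>q\<close> is put in front of its
  first entry and becomes the new starting point. This is the origin of the transposition
  \<open>t\<close> by which a slide acts on cilia.\<close>

lemma support_move:
  assumes m: "moves_to p q r f f'" and f: "permutation f" and c: "c \<noteq> q"
  shows "move p q r (support f c) (support f' (transpose r q c))"
proof -
  let ?t = "transpose r q"
  note s = support_props[OF f, of c]
  have "hd (support f c @ [c]) \<noteq> q" using s(1,2) c by (simp add: hd_append)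
  from move_exists[OF m bij_is_inj[OF permutation_bijective[OF f]] s(4) c this]
  obtain ys where ys: "move p q r (support f c) ys" "chain f' ys (?t c)"
    "hd (ys @ [?t c]) = ?t (hd (support f c @ [c]))" "ys \<noteq> []"
    using s(1) by blast
  have hd: "hd ys = ?t c" using ys(3,4) s(1,2) by (simp add: hd_append)
  have "distinct ys" using move_distinct[OF ys(1) _ s(3)] m by (simp add: moves_to_def)
  from support_eqI[OF ys(4) this] ys(1,2) hd show ?thesis by simp
qed

section \<open>Cilia as representatives of cycles\<close>

definition transversal :: "('a \<Rightarrow> 'a) \<Rightarrow> 'a set \<Rightarrow> 'a set \<Rightarrow> bool" where
  "transversal f S \<Gamma> \<longleftrightarrow> (\<forall>h\<in>\<Gamma>. \<exists>!s. s \<in> S \<and> h \<in> orbit f s)"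

lemma ex1_involution:
  assumes "\<And>x. t (t x) = x"
  shows "(\<exists>!x. Q (t x)) \<longleftrightarrow> (\<exists>!x. Q x)"
proof
  assume "\<exists>!x. Q (t x)"
  then obtain x where x: "Q (t x)" "\<And>y. Q (t y) \<Longrightarrow> y = x" by blast
  have "y = t x" if "Q y" for y using x(2)[of "t y"] that assms by force
  then show "\<exists>!x. Q x" using x(1) by blast
next
  assume "\<exists>!x. Q x"
  then obtain x where x: "Q x" "\<And>y. Q y \<Longrightarrow> y = x" by blast
  have "y = t x" if "Q (t y)" for y using x(2)[OF that] assms by force
  then show "\<exists>!x. Q (t x)" using x(1) assms by (metis (no_types))
qed

text \<open>Cycles change only by \<open>q\<close>, which leaves the cycle of \<open>p\<close> and
  joins that of \<open>r\<close>. For \<open>h \<noteq> q\<close> the representatives correspond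
  under the transposition. At \<open>q\<close> the condition after the move is the old one at
  \<open>r\<close>, and the condition before the move is the one at \<open>p\<close>.\<close>

lemma transversal_move:
  assumes m: "moves_to p q r f f'" and f: "permutation f" "permutation f'" and q: "q \<notin> S"
    and in_\<Gamma>: "p \<in> \<Gamma>" "q \<in> \<Gamma>" "r \<in> \<Gamma>"
  shows "transversal f' (transpose r q ` S) \<Gamma> \<longleftrightarrow> transversal f S \<Gamma>"
proof -
  let ?t = "transpose r q"
  have d: "distinct [p, q, r]" using m by (simp add: moves_to_def)
  have orb: "orbit f' (?t s) = (orbit f s - {q}) \<union> (if r \<in> orbit f s then {q} else {})"
    if "s \<in> S" for s
  proof -
    have "s \<noteq> q" using q that by blast
    from move_set[OF support_move[OF m f(1) this] d] show ?thesis
      by (simp only: support_props(5)[OF f(1)] support_props(5)[OF f(2)])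
  qed
  have pq: "q \<in> orbit f s \<longleftrightarrow> p \<in> orbit f s" for s
  proof
    assume "p \<in> orbit f s"
    then show "q \<in> orbit f s" using m orbit.step[of p f s] by (simp add: moves_to_def)
  next
    assume "q \<in> orbit f s"
    moreover have "q \<in> orbit f p" using m orbit.base[of f p] by (simp add: moves_to_def)
    then have "p \<in> orbit f q" by (rule orbit_swap[OF permutation_self_in_orbit[OF f(1)]])
    ultimately show "p \<in> orbit f s" by (rule orbit_trans[rotated])
  qed
  have ex1: "(\<exists>!s'. s' \<in> ?t ` S \<and> P s') \<longleftrightarrow> (\<exists>!s. s \<in> S \<and> P (?t s))" for P
  proof -
    have "s' \<in> ?t ` S \<longleftrightarrow> ?t s' \<in> S" for s'
      by (metis image_iff transpose_involutory)
    then show ?thesis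
      using ex1_involution[of ?t "\<lambda>s. s \<in> S \<and> P (?t s)"] by simp
  qed
  have cong: "(\<exists>!s. s \<in> S \<and> P s) \<longleftrightarrow> (\<exists>!s. s \<in> S \<and> Q s)"
    if "\<And>s. s \<in> S \<Longrightarrow> P s \<longleftrightarrow> Q s" for P Q
  proof -
    have "(\<lambda>s. s \<in> S \<and> P s) = (\<lambda>s. s \<in> S \<and> Q s)" using that by auto
    then show ?thesis by (rule arg_cong)
  qed
  have 1: "(\<exists>!s. s \<in> S \<and> h \<in> orbit f' (?t s)) \<longleftrightarrow> (\<exists>!s. s \<in> S \<and> h \<in> orbit f s)" if "h \<noteq> q" for h
    by (rule cong) (use orb that in auto)
  have 2: "(\<exists>!s. s \<in> S \<and> q \<in> orbit f' (?t s)) \<longleftrightarrow> (\<exists>!s. s \<in> S \<and> r \<in> orbit f s)"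
    by (rule cong) (use orb in auto)
  have 3: "(\<exists>!s. s \<in> S \<and> q \<in> orbit f s) \<longleftrightarrow> (\<exists>!s. s \<in> S \<and> p \<in> orbit f s)"
    by (simp add: pq)
  show ?thesis
    unfolding transversal_def ex1
  proof
    assume t: "\<forall>h\<in>\<Gamma>. \<exists>!s. s \<in> S \<and> h \<in> orbit f' (?t s)"
    show "\<forall>h\<in>\<Gamma>. \<exists>!s. s \<in> S \<and> h \<in> orbit f s"
    proof
      fix h assume h: "h \<in> \<Gamma>"
      show "\<exists>!s. s \<in> S \<and> h \<in> orbit f s"
      proof (cases "h = q")
        case True
        have "\<exists>!s. s \<in> S \<and> p \<in> orbit f s"
          using 1[of p] t in_\<Gamma>(1) d by simp
        then show ?thesis unfolding True 3 .
      next
        case False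
        from 1[OF this] t h show ?thesis by blast
      qed
    qed
  next
    assume t: "\<forall>h\<in>\<Gamma>. \<exists>!s. s \<in> S \<and> h \<in> orbit f s"
    show "\<forall>h\<in>\<Gamma>. \<exists>!s. s \<in> S \<and> h \<in> orbit f' (?t s)"
    proof
      fix h assume h: "h \<in> \<Gamma>"
      show "\<exists>!s. s \<in> S \<and> h \<in> orbit f' (?t s)"
      proof (cases "h = q")
        case True
        show ?thesis unfolding True 2 using t in_\<Gamma>(3) by blast
      next
        case False
        from 1[OF this] t h show ?thesis by blast
      qed
    qed
  qed
qed

lemma orbit_conj:
  assumes "bij \<sigma>" "permutation f" "permutation (\<sigma> \<circ> f \<circ> inv_into UNIV \<sigma>)"
  shows "orbit (\<sigma> \<circ> f \<circ> inv_into UNIV \<sigma>) (\<sigma> c) = \<sigma> ` orbit f c"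
proof -
  have "orbit (\<sigma> \<circ> f \<circ> inv_into UNIV \<sigma>) (\<sigma> c) = set (map \<sigma> (support f c))"
    unfolding support_conj[OF assms(1), symmetric] by (rule support_props(5)[OF assms(3), symmetric])
  also have "\<dots> = \<sigma> ` orbit f c"
    unfolding set_map support_props(5)[OF assms(2), symmetric] ..
  finally show ?thesis .
qed

lemma transversal_conj:
  assumes \<sigma>: "bij \<sigma>" and f: "permutation f" "permutation (\<sigma> \<circ> f \<circ> inv_into UNIV \<sigma>)"
    and t: "transversal f S \<Gamma>"
  shows "transversal (\<sigma> \<circ> f \<circ> inv_into UNIV \<sigma>) (\<sigma> ` S) (\<sigma> ` \<Gamma>)"
  unfolding transversal_def
proof
  fix h' assume "h' \<in> \<sigma> ` \<Gamma>"
  then obtain h where h: "h \<in> \<Gamma>" "h' = \<sigma> h" by blast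
  have "(s \<in> \<sigma> ` S \<and> h' \<in> orbit (\<sigma> \<circ> f \<circ> inv_into UNIV \<sigma>) s) \<longleftrightarrow>
      (\<exists>u. s = \<sigma> u \<and> u \<in> S \<and> h \<in> orbit f u)" for s
    using orbit_conj[OF \<sigma> f] h(2) bij_is_inj[OF \<sigma>] by (auto simp: inj_image_mem_iff)
  then show "\<exists>!s. s \<in> \<sigma> ` S \<and> h' \<in> orbit (\<sigma> \<circ> f \<circ> inv_into UNIV \<sigma>) s"
    using t h(1) unfolding transversal_def by metis
qed

text \<open>Cycles of a permutation are equal or disjoint, so membership of \<open>h\<close> in the
  cycle of \<open>s\<close> means equality of the two cycles.\<close>

lemma bij_betw_orbit_iff:
  assumes "permutation f" "S \<subseteq> \<Gamma>"
  shows "bij_betw (orbit f) S (orbit f ` \<Gamma>) \<longleftrightarrow> transversal f S \<Gamma>"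
proof -
  have eq: "h \<in> orbit f s \<longleftrightarrow> orbit f s = orbit f h" for h s
    using orbit_cyclic_eq3[OF cyclic_on_orbit'[OF assms(1)], of h s]
      permutation_self_in_orbit[OF assms(1), of h] by auto
  show ?thesis
  proof
    assume b: "bij_betw (orbit f) S (orbit f ` \<Gamma>)"
    show "transversal f S \<Gamma>"
      unfolding transversal_def eq
    proof
      fix h assume "h \<in> \<Gamma>"
      then have "orbit f h \<in> orbit f ` S" using b by (simp add: bij_betw_def)
      then obtain s where "s \<in> S" "orbit f s = orbit f h" by auto
      then show "\<exists>!s. s \<in> S \<and> orbit f s = orbit f h"
        using b by (intro ex1I[of _ s]) (auto simp: bij_betw_def inj_on_def)
    qed
  next
    assume t: "transversal f S \<Gamma>"
    show "bij_betw (orbit f) S (orbit f ` \<Gamma>)"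
    proof (rule bij_betw_imageI)
      show "inj_on (orbit f) S"
      proof (rule inj_onI)
        fix s s' assume s: "s \<in> S" "s' \<in> S" "orbit f s = orbit f s'"
        then have "\<exists>!u. u \<in> S \<and> orbit f u = orbit f s'"
          using t assms(2) unfolding transversal_def eq by blast
        then show "s = s'" using s by blast
      qed
      show "orbit f ` S = orbit f ` \<Gamma>"
      proof (intro equalityI subsetI)
        fix X assume "X \<in> orbit f ` \<Gamma>"
        then obtain h where "h \<in> \<Gamma>" "X = orbit f h" by blast
        then have "\<exists>!u. u \<in> S \<and> orbit f u = X" using t unfolding transversal_def eq by blast
        then show "X \<in> orbit f ` S" by blast
      qed (use assms(2) in blast)
    qed
  qed
qed

subsection \<open>Reduced presentations\<close>

lemma kappa_kappa [simp]: "kappa (kappa n) = n"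
  by (auto simp: kappa_def)

lemma kappa_neq: "n \<ge> 1 \<Longrightarrow> kappa n \<noteq> n"
  by (auto simp: kappa_def)

lemma kappa_ge: "n \<ge> 1 \<Longrightarrow> kappa n \<ge> 1"
  by (auto simp: kappa_def elim!: evenE)

lemma bij_kappa: "bij kappa"
  by (rule o_bij[of kappa]) auto

lemma inv_kappa: "inv_into UNIV kappa = kappa"
  by (rule inv_equality) auto

text \<open>The pairs of \<kappa> are the blocks {2i - 1, 2i}; numbers from different blocks compare
  like their blocks.\<close>

lemma kappa_order:
  assumes "h \<ge> 1" "k \<ge> 1" "{h, kappa h} \<noteq> {k, kappa k}"
  shows "h < k \<longleftrightarrow> kappa h < kappa k"
proof -
  have "h \<noteq> k" "h \<noteq> kappa k" using assms(3) by auto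
  then show ?thesis using assms(1,2)
    unfolding kappa_def by (cases "even h"; cases "even k"; simp; presburger)
qed

lemma odd_kappa: "n \<ge> 1 \<Longrightarrow> odd (kappa n) \<longleftrightarrow> even n"
  by (auto simp: kappa_def)

text \<open>Transitivity as the absence of proper invariant subsets. On a finite set, invariance
  under an injective map already implies invariance under its inverse
  (\<open>inv_image_closed\<close>).\<close>

definition connected_by :: "(nat \<Rightarrow> nat) \<Rightarrow> nat set \<Rightarrow> bool" where
  "connected_by \<rho> \<Gamma> \<longleftrightarrow>
     (\<forall>A\<subseteq>\<Gamma>. A \<noteq> {} \<longrightarrow> kappa ` A \<subseteq> A \<longrightarrow> \<rho> ` A \<subseteq> A \<longrightarrow> A = \<Gamma>)"

text \<open>
  The axioms of a Kitaev graph in a form that does not mention sets of cycles: the cilia are a set of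
  representatives for the vertices, and their images under \<open>\<rho>\<^sup>-\<^sup>1\<close> one for the faces.
\<close>

definition good :: "nat set \<Rightarrow> (nat \<Rightarrow> nat) \<Rightarrow> nat set \<Rightarrow> nat \<Rightarrow> bool" where
  "good \<Gamma> \<rho> C pt \<longleftrightarrow> finite \<Gamma> \<and> \<Gamma> \<subseteq> {1..} \<and> kappa ` \<Gamma> \<subseteq> \<Gamma> \<and> \<rho> permutes \<Gamma> \<and>
     C \<subseteq> \<Gamma> \<and> pt \<in> C \<and> connected_by \<rho> \<Gamma> \<and> transversal \<rho> C \<Gamma> \<and>
     transversal (inv_into UNIV \<rho> \<circ> perm_restrict kappa \<Gamma>) (inv_into UNIV \<rho> ` C) \<Gamma>"

definition kgraph :: "nat set \<Rightarrow> (nat \<Rightarrow> nat) \<Rightarrow> nat set \<Rightarrow> nat \<Rightarrow> nat kitaev" where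
  "kgraph \<Gamma> \<rho> C pt = \<lparr>half_edges = \<Gamma>, iota = perm_restrict kappa \<Gamma>, rho = \<rho>,
     cilia = C, base = pt\<rparr>"

lemma kgraph_sel [simp]:
  "half_edges (kgraph \<Gamma> \<rho> C pt) = \<Gamma>" "iota (kgraph \<Gamma> \<rho> C pt) = perm_restrict kappa \<Gamma>"
  "rho (kgraph \<Gamma> \<rho> C pt) = \<rho>" "cilia (kgraph \<Gamma> \<rho> C pt) = C" "base (kgraph \<Gamma> \<rho> C pt) = pt"
  by (simp_all add: kgraph_def)

lemma inv_image_closed:
  assumes "finite A" "inj f" "f ` A \<subseteq> A"
  shows "inv_into UNIV f ` A \<subseteq> A"
proof
  fix y assume "y \<in> inv_into UNIV f ` A"
  then obtain x where x: "x \<in> A" "y = inv_into UNIV f x" by blast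
  have "f ` A = A" using endo_inj_surj[OF assms(1,3)] assms(2) inj_on_subset by blast
  then obtain z where "z \<in> A" "x = f z" using x(1) by blast
  then show "y \<in> A" using x(2) assms(2) by simp
qed

lemma kappa_restrict_permutes:
  assumes "kappa ` \<Gamma> \<subseteq> \<Gamma>"
  shows "perm_restrict kappa \<Gamma> permutes \<Gamma>"
proof (rule bij_imp_permutes)
  show "bij_betw (perm_restrict kappa \<Gamma>) \<Gamma> \<Gamma>"
    by (rule bij_betw_byWitness[where f' = kappa]) (use assms in \<open>auto simp: perm_restrict_def\<close>)
qed (simp add: perm_restrict_def)

lemma group_orbit_closed:
  assumes "\<And>f. f \<in> P \<Longrightarrow> inj f \<and> f ` X \<subseteq> X" "finite X" "A \<subseteq> X"
  shows "group_orbit P A \<subseteq> X"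
proof
  fix x assume "x \<in> group_orbit P A"
  then show "x \<in> X"
  proof induction
    case (gen_inv f x)
    then show ?case using inv_image_closed[OF assms(2), of f] assms(1)[of f] by blast
  qed (use assms in blast)+
qed

lemma connected_by_iff:
  assumes "finite \<Gamma>" "kappa ` \<Gamma> \<subseteq> \<Gamma>" "\<rho> permutes \<Gamma>"
  shows "(\<forall>h\<in>\<Gamma>. group_orbit {perm_restrict kappa \<Gamma>, \<rho>} {h} = \<Gamma>) \<longleftrightarrow> connected_by \<rho> \<Gamma>"
proof -
  let ?P = "{perm_restrict kappa \<Gamma>, \<rho>}"
  have inj: "inj f" if "f \<in> ?P" for f
    using that assms kappa_restrict_permutes permutes_inj by blast
  show ?thesis
  proof
    assume c: "\<forall>h\<in>\<Gamma>. group_orbit ?P {h} = \<Gamma>"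
    show "connected_by \<rho> \<Gamma>"
      unfolding connected_by_def
    proof (intro allI impI)
      fix A assume A: "A \<subseteq> \<Gamma>" "A \<noteq> {}" "kappa ` A \<subseteq> A" "\<rho> ` A \<subseteq> A"
      then obtain h where h: "h \<in> A" by blast
      have "group_orbit ?P {h} \<subseteq> A"
        by (rule group_orbit_closed)
          (use A h inj finite_subset[OF A(1) assms(1)] in \<open>auto simp: perm_restrict_def split: if_splits\<close>)
      then show "A = \<Gamma>" using c h A(1) by blast
    qed
  next
    assume c: "connected_by \<rho> \<Gamma>"
    show "\<forall>h\<in>\<Gamma>. group_orbit ?P {h} = \<Gamma>"
    proof
      fix h assume h: "h \<in> \<Gamma>"
      let ?A = "group_orbit ?P {h}"
      have sub: "?A \<subseteq> \<Gamma>"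
        by (rule group_orbit_closed)
          (use assms h inj kappa_restrict_permutes[OF assms(2)] in \<open>auto simp: permutes_in_image\<close>)
      have "perm_restrict kappa \<Gamma> x \<in> ?A" "\<rho> x \<in> ?A" if "x \<in> ?A" for x
        using that by (auto intro: group_orbit.gen)
      moreover have "perm_restrict kappa \<Gamma> x = kappa x" if "x \<in> ?A" for x
        using that sub by (auto simp: perm_restrict_def)
      ultimately have "kappa ` ?A \<subseteq> ?A" "\<rho> ` ?A \<subseteq> ?A" by auto
      moreover have "h \<in> ?A" by (rule group_orbit.start) simp
      ultimately show "?A = \<Gamma>" using c sub unfolding connected_by_def by blast
    qed
  qed
qed

lemma good_permutations:
  assumes "finite \<Gamma>" "kappa ` \<Gamma> \<subseteq> \<Gamma>" "\<rho> permutes \<Gamma>"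
  shows "permutation \<rho>" "permutation (inv_into UNIV \<rho> \<circ> perm_restrict kappa \<Gamma>)"
    "inv_into UNIV \<rho> \<circ> perm_restrict kappa \<Gamma> permutes \<Gamma>"
proof -
  show p: "inv_into UNIV \<rho> \<circ> perm_restrict kappa \<Gamma> permutes \<Gamma>"
    by (intro permutes_compose permutes_inv kappa_restrict_permutes assms)
  show "permutation \<rho>" "permutation (inv_into UNIV \<rho> \<circ> perm_restrict kappa \<Gamma>)"
    unfolding permutation_permutes using assms p by blast+
qed

text \<open>The order axiom of a Kitaev graph holds by \<open>kappa_order\<close>; the other axioms
  are matched one by one, the bijections with vertices and faces through
  \<open>bij_betw_orbit_iff\<close>.\<close>

lemma good_iff_kitaev:
  assumes "\<Gamma> \<subseteq> {1..}"
  shows "good \<Gamma> \<rho> C pt \<longleftrightarrow> is_kitaev_graph (kgraph \<Gamma> \<rho> C pt)"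
proof (cases "finite \<Gamma> \<and> kappa ` \<Gamma> \<subseteq> \<Gamma> \<and> \<rho> permutes \<Gamma> \<and> C \<subseteq> \<Gamma>")
  case True
  let ?\<phi> = "inv_into UNIV \<rho> \<circ> perm_restrict kappa \<Gamma>"
  note perms = good_permutations[of \<Gamma> \<rho>]
  have inj: "inj (inv_into UNIV \<rho>)"
    using True permutes_inv permutes_inj by blast
  have sub: "inv_into UNIV \<rho> ` C \<subseteq> \<Gamma>"
    using True permutes_inv[of \<rho> \<Gamma>] by (auto simp: permutes_in_image)
  have 1: "is_ribbon_graph (kgraph \<Gamma> \<rho> C pt)"
    using True assms kappa_restrict_permutes[of \<Gamma>] kappa_neq
    by (auto simp: is_ribbon_graph_def perm_restrict_def)
  have 2: "bij_betw (orbit \<rho>) C (vertices (kgraph \<Gamma> \<rho> C pt)) \<longleftrightarrow> transversal \<rho> C \<Gamma>"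
    unfolding vertices_def kgraph_sel by (rule bij_betw_orbit_iff) (use True perms in auto)
  have "bij_betw (\<lambda>c. orbit ?\<phi> (inv_into UNIV \<rho> c)) C (orbit ?\<phi> ` \<Gamma>) \<longleftrightarrow>
      bij_betw (orbit ?\<phi>) (inv_into UNIV \<rho> ` C) (orbit ?\<phi> ` \<Gamma>)"
    using bij_betw_comp_iff[of "inv_into UNIV \<rho>" C "inv_into UNIV \<rho> ` C" "orbit ?\<phi>" "orbit ?\<phi> ` \<Gamma>"]
      inj_on_subset[OF inj, of C] by (simp add: bij_betw_def o_def)
  also have "\<dots> \<longleftrightarrow> transversal ?\<phi> (inv_into UNIV \<rho> ` C) \<Gamma>"
    by (rule bij_betw_orbit_iff) (use True perms sub in auto)
  finally have 3: "bij_betw (\<lambda>c. orbit (face_perm (kgraph \<Gamma> \<rho> C pt)) (inv_into UNIV \<rho> c)) C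
      (faces (kgraph \<Gamma> \<rho> C pt)) \<longleftrightarrow> transversal ?\<phi> (inv_into UNIV \<rho> ` C) \<Gamma>"
    by (simp add: faces_def face_perm_def)
  have 4: "\<forall>h\<in>\<Gamma>. \<forall>k\<in>\<Gamma>. edge_of (kgraph \<Gamma> \<rho> C pt) h \<noteq> edge_of (kgraph \<Gamma> \<rho> C pt) k \<longrightarrow>
      (h < k \<longleftrightarrow> perm_restrict kappa \<Gamma> h < perm_restrict kappa \<Gamma> k)"
  proof (intro ballI impI)
    fix h k assume hk: "h \<in> \<Gamma>" "k \<in> \<Gamma>"
      "edge_of (kgraph \<Gamma> \<rho> C pt) h \<noteq> edge_of (kgraph \<Gamma> \<rho> C pt) k"
    then have "h \<ge> 1" "k \<ge> 1" "{h, kappa h} \<noteq> {k, kappa k}"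
      using assms by (auto simp: edge_of_def perm_restrict_def)
    from kappa_order[OF this] show "h < k \<longleftrightarrow> perm_restrict kappa \<Gamma> h < perm_restrict kappa \<Gamma> k"
      using hk by (simp add: perm_restrict_def)
  qed
  show ?thesis
    unfolding good_def is_kitaev_graph_def kgraph_sel 2 3
    using True 1 4 assms connected_by_iff[of \<Gamma> \<rho>] by auto
next
  case False
  have "kappa ` \<Gamma> \<subseteq> \<Gamma>" if "perm_restrict kappa \<Gamma> permutes \<Gamma>"
    using permutes_in_image[OF that] by (metis image_subsetI perm_restrict_simps(1))
  then have "\<not> is_kitaev_graph (kgraph \<Gamma> \<rho> C pt)"
    using False unfolding is_kitaev_graph_def is_ribbon_graph_def kgraph_sel by blast
  then show ?thesis using False unfolding good_def by blast
qed

text \<open>The orbit of the cilia is invariant and contains \<open>pt\<close>, hence is all of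
  \<Gamma> by connectedness. Restricting \<rho> to \<Gamma> changes nothing, as \<rho> fixes the
  complement.\<close>

lemma induced_eq:
  assumes "good \<Gamma> \<rho> C pt"
  shows "induced \<rho> C pt = kgraph \<Gamma> \<rho> C pt"
proof -
  note g = assms[unfolded good_def]
  let ?A = "group_orbit {\<rho>, kappa} C"
  have sub: "?A \<subseteq> \<Gamma>"
  proof (rule group_orbit_closed)
    show "inj f \<and> f ` \<Gamma> \<subseteq> \<Gamma>" if "f \<in> {\<rho>, kappa}" for f
      using that g bij_is_inj[OF bij_kappa] permutes_inj[of \<rho> \<Gamma>] by (auto simp: permutes_in_image)
  qed (use g in auto)
  have "pt \<in> ?A" using g by (intro group_orbit.start) simp
  moreover have "kappa ` ?A \<subseteq> ?A" "\<rho> ` ?A \<subseteq> ?A" by (auto intro: group_orbit.gen)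
  ultimately have "?A = \<Gamma>" using g sub unfolding connected_by_def by blast
  moreover have "perm_restrict \<rho> \<Gamma> = \<rho>"
    using g by (auto simp: perm_restrict_def fun_eq_iff permutes_not_in)
  ultimately show ?thesis by (simp add: induced_def kgraph_def)
qed

text \<open>Graphs are normalised here: the permutation is restricted to the half-edge set, where
  triples inducing the same graph agree.\<close>

lemma RK_iff: "G \<in> RK \<longleftrightarrow> (\<exists>\<Gamma> \<rho> C pt. G = kgraph \<Gamma> \<rho> C pt \<and> good \<Gamma> \<rho> C pt)"
proof
  assume "G \<in> RK"
  then obtain \<rho> C pt where G: "G = induced \<rho> C pt" and \<rho>: "\<rho> \<in> S_inf" and C: "C \<subseteq> {1..}"
    and k: "is_kitaev_graph (induced \<rho> C pt)" by (auto simp: RK_def)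
  define \<Gamma> where "\<Gamma> = group_orbit {\<rho>, kappa} C"
  have G': "induced \<rho> C pt = kgraph \<Gamma> (perm_restrict \<rho> \<Gamma>) C pt"
    by (simp add: induced_def kgraph_def \<Gamma>_def Let_def)
  have "\<rho> permutes {1..}" using \<rho> by (simp add: S_inf_def)
  then have "\<rho> x \<in> {1..}" "inv_into UNIV \<rho> x \<in> {1..}" if "x \<in> {1..}" for x
    using that permutes_in_image[of \<rho> "{1..}"] permutes_in_image[OF permutes_inv, of \<rho> "{1..}"]
    by blast+
  moreover have "kappa x \<in> {1..}" if "x \<in> {1..}" for x using that kappa_ge by auto
  ultimately have closed: "f x \<in> {1..}" "inv_into UNIV f x \<in> {1..}"
    if "x \<in> {1..}" "f \<in> {\<rho>, kappa}" for f x
    using that by (metis (no_types) insertE inv_kappa singletonD)+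
  have "x \<in> {1..}" if "x \<in> \<Gamma>" for x
    using that unfolding \<Gamma>_def
  proof (induction rule: group_orbit.induct)
    case (start x)
    then show ?case using C by blast
  next
    case (gen f x)
    show ?case by (rule closed(1)[OF gen.IH gen.hyps(1)])
  next
    case (gen_inv f x)
    show ?case by (rule closed(2)[OF gen_inv.IH gen_inv.hyps(1)])
  qed
  then have "\<Gamma> \<subseteq> {1..}" by blast
  from good_iff_kitaev[OF this] have "good \<Gamma> (perm_restrict \<rho> \<Gamma>) C pt" using k G' by simp
  then show "\<exists>\<Gamma> \<rho> C pt. G = kgraph \<Gamma> \<rho> C pt \<and> good \<Gamma> \<rho> C pt" using G G' by blast
next
  assume "\<exists>\<Gamma> \<rho> C pt. G = kgraph \<Gamma> \<rho> C pt \<and> good \<Gamma> \<rho> C pt"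
  then obtain \<Gamma> \<rho> C pt where G: "G = kgraph \<Gamma> \<rho> C pt" and g: "good \<Gamma> \<rho> C pt" by blast
  have p: "\<rho> permutes \<Gamma>" "\<Gamma> \<subseteq> {1..}" "finite \<Gamma>" "C \<subseteq> \<Gamma>" "pt \<in> C" using g by (auto simp: good_def)
  have "finite {n. \<rho> n \<noteq> n}"
    by (rule finite_subset[OF _ p(3)]) (use p(1) in \<open>auto simp: permutes_def\<close>)
  then have "\<rho> \<in> S_inf" using permutes_subset[OF p(1,2)] by (simp add: S_inf_def)
  moreover have "finite C" "C \<subseteq> {1..}" using p finite_subset by blast+
  moreover have "is_kitaev_graph (induced \<rho> C pt)"
    using g good_iff_kitaev[OF p(2)] by (simp add: induced_eq[OF g])
  moreover have "G = induced \<rho> C pt" using induced_eq[OF g] G by simp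
  ultimately show "G \<in> RK"
    unfolding RK_def using p(5) by blast
qed

subsection \<open>Slides\<close>

lemma cycle_of_list_3:
  "cycle_of_list [x, y, z] = transpose x y \<circ> transpose y z"
  by simp

text \<open>After \<rho> the three-cycle sends \<open>a\<close> to \<open>\<rho> b\<close>,
  \<open>b\<close> to \<open>r\<close> and the predecessor of \<open>r\<close> to \<open>b\<close>,
  which is the effect of cutting out \<open>b\<close> and inserting it before
  \<open>r\<close>.\<close>

lemma moves_to_cycle1:
  assumes "inj \<rho>" "\<rho> a = b" "distinct [b, \<rho> b, r]" "a \<noteq> r"
  shows "moves_to a b r \<rho> (cycle_of_list [b, \<rho> b, r] \<circ> \<rho>)"
proof -
  have n: "\<rho> k \<noteq> b" "\<rho> k \<noteq> \<rho> b" if "k \<noteq> a" "k \<noteq> b" for k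
    using that assms(1,2) injD by metis+
  have d: "b \<noteq> \<rho> b" "\<rho> b \<noteq> b" "b \<noteq> r" "r \<noteq> b" "\<rho> b \<noteq> r" "r \<noteq> \<rho> b" "a \<noteq> b"
    using assms by auto
  show ?thesis
    unfolding moves_to_def cycle_of_list_3 by (simp add: transpose_def assms(2,4) d n)
qed

text \<open>The three-cycle of Condition 2 undoes a move: \<open>a\<close> is sent to
  \<open>b\<close> again, \<open>b\<close> to the old successor of \<open>a\<close>, and the
  predecessor of \<open>b\<close> to \<open>r\<close>. So the given permutation is the result of the
  move, not its origin.\<close>

lemma moves_to_cycle2:
  assumes "inj \<rho>'" "\<rho>' b = r" "distinct [b, r, \<rho>' a]" "a \<noteq> r"
  shows "moves_to a b r (cycle_of_list [b, r, \<rho>' a] \<circ> \<rho>') \<rho>'"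
proof -
  have n: "\<rho>' k \<noteq> r" "\<rho>' k \<noteq> \<rho>' a" if "k \<noteq> a" "k \<noteq> b" for k
    using that assms(1,2) injD by metis+
  have d: "b \<noteq> r" "r \<noteq> b" "b \<noteq> \<rho>' a" "\<rho>' a \<noteq> b" "r \<noteq> \<rho>' a" "\<rho>' a \<noteq> r" "a \<noteq> b"
    using assms by auto
  show ?thesis
    unfolding moves_to_def cycle_of_list_3 by (simp add: transpose_def assms(2,4) d n)
qed

lemma moves_to_unique1: "moves_to p q r f f' \<Longrightarrow> moves_to p q r f f'' \<Longrightarrow> f' = f''"
  by (rule ext) (metis moves_to_def)

lemma moves_to_unique2:
  assumes "moves_to p q r f f'" "moves_to p q r g f'"
  shows "f = g"
proof
  fix k
  note m = assms[unfolded moves_to_def]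
  have "transpose r q (f k) = transpose r q (g k)" if "k \<noteq> p" "k \<noteq> q"
    using m that by simp
  then have "f k = g k" if "k \<noteq> p" "k \<noteq> q" using that by (metis transpose_involutory)
  then show "f k = g k" using m by (cases "k = p \<or> k = q") auto
qed

text \<open>The face belonging to a cilium \<open>c\<close> starts at \<open>\<rho>^-1(c)\<close>.
  These formulas give the face permutation after the slide and the new starting points of the
  faces.\<close>

lemma moves_to_inv:
  assumes m: "moves_to a b r \<rho> \<rho>'" and bij: "bij \<rho>" "bij \<rho>'"
  shows "inv_into UNIV \<rho>' b = inv_into UNIV \<rho> r" "inv_into UNIV \<rho>' r = b"
    "k \<noteq> b \<Longrightarrow> k \<noteq> r \<Longrightarrow> inv_into UNIV \<rho>' k = transpose b a (inv_into UNIV \<rho> k)"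
    "inv_into UNIV \<rho> b = a" "inv_into UNIV \<rho> r \<noteq> a" "inv_into UNIV \<rho> r \<noteq> b"
proof -
  note m' = m[unfolded moves_to_def]
  have eqI: "inv_into UNIV \<rho>' y = x" if "\<rho>' x = y" for x y
    using that bij_is_inj[OF bij(2)] by auto
  have r: "\<rho> (inv_into UNIV \<rho> y) = y" for y
    using bij(1) by (simp add: bij_is_surj surj_f_inv_f)
  show ab: "inv_into UNIV \<rho> b = a" using m' bij_is_inj[OF bij(1)] by (metis inv_f_f)
  have "\<rho> a \<noteq> r" "\<rho> b \<noteq> r" using m' by auto
  then show n1: "inv_into UNIV \<rho> r \<noteq> a" and n2: "inv_into UNIV \<rho> r \<noteq> b" using r[of r] by metis+
  have m3: "\<rho>' k = transpose r b (\<rho> k)" if "k \<noteq> a" "k \<noteq> b" for k using m' that by blast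
  show "inv_into UNIV \<rho>' b = inv_into UNIV \<rho> r"
    by (rule eqI) (simp add: m3[OF n1 n2] r)
  show "inv_into UNIV \<rho>' r = b" by (rule eqI) (use m' in blast)
  assume k: "k \<noteq> b" "k \<noteq> r"
  show "inv_into UNIV \<rho>' k = transpose b a (inv_into UNIV \<rho> k)"
  proof (rule eqI)
    have na: "inv_into UNIV \<rho> k \<noteq> a" using k m' r by metis
    show "\<rho>' (transpose b a (inv_into UNIV \<rho> k)) = k"
    proof (cases "inv_into UNIV \<rho> k = b")
      case True
      then have "\<rho> b = k" using r[of k] by simp
      then show ?thesis using True m' by (metis transpose_apply_first)
    next
      case False
      then show ?thesis using na k by (simp add: transpose_apply_other m3 r)
    qed
  qed
qed

text \<open>For the face permutation \<phi> one has
  \<open>\<phi>(\<kappa>(b)) = \<rho>^-1(b) = a\<close> and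
  \<open>\<phi>(a) = \<rho>^-1(\<kappa>(a))\<close>. After the slide \<kappa>(b) is sent to the
  latter point, and \<open>a\<close> to \<open>b\<close>.\<close>

lemma face_moves_to:
  assumes m: "moves_to a b (kappa a) \<rho> \<rho>'" and perm: "\<rho> permutes \<Gamma>" "\<rho>' permutes \<Gamma>"
    and \<Gamma>: "a \<in> \<Gamma>" "b \<in> \<Gamma>" "kappa ` \<Gamma> \<subseteq> \<Gamma>" "\<Gamma> \<subseteq> {1..}"
  shows "moves_to (kappa b) a b (inv_into UNIV \<rho> \<circ> perm_restrict kappa \<Gamma>)
    (inv_into UNIV \<rho>' \<circ> perm_restrict kappa \<Gamma>)"
proof -
  note i = moves_to_inv[OF m permutes_bij[OF perm(1)] permutes_bij[OF perm(2)]]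
  have d: "distinct [a, b, kappa a]" using m by (simp add: moves_to_def)
  have ka: "kappa a \<in> \<Gamma>" "kappa b \<in> \<Gamma>" using \<Gamma> by auto
  have kb: "kappa b \<noteq> a" "kappa b \<noteq> b" using d \<Gamma> kappa_neq[of b] by auto
  have pr: "perm_restrict kappa \<Gamma> k \<noteq> b" if "k \<noteq> kappa b" for k
    using that \<Gamma>(2,3) ka by (auto simp: perm_restrict_def)
  have pr': "perm_restrict kappa \<Gamma> k \<noteq> kappa a" if "k \<noteq> a" for k
    using that \<Gamma>(1,3) ka by (metis kappa_kappa perm_restrict_simps)
  show ?thesis
    unfolding moves_to_def
    using d ka kb i \<Gamma>(1,2) pr pr' by (auto simp: perm_restrict_simps)
qed

text \<open>Stated as an equivalence since Condition 1 uses it forwards and Condition 2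
  backwards.\<close>

lemma good_move:
  assumes m: "moves_to a b (kappa a) \<rho> \<rho>'" and perm: "\<rho> permutes \<Gamma>" "\<rho>' permutes \<Gamma>"
    and ab: "a \<in> \<Gamma>" "b \<in> \<Gamma>" and b: "b \<notin> C"
  shows "good \<Gamma> \<rho>' (transpose (kappa a) b ` C) (transpose (kappa a) b pt) \<longleftrightarrow> good \<Gamma> \<rho> C pt"
proof (cases "finite \<Gamma> \<and> \<Gamma> \<subseteq> {1..} \<and> kappa ` \<Gamma> \<subseteq> \<Gamma>")
  case True
  let ?t = "transpose (kappa a) b" and ?i = "inv_into UNIV \<rho>" and ?i' = "inv_into UNIV \<rho>'"
    and ?\<kappa> = "perm_restrict kappa \<Gamma>"
  note m' = m[unfolded moves_to_def]
  note i = moves_to_inv[OF m permutes_bij[OF perm(1)] permutes_bij[OF perm(2)]]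
  have ka: "kappa a \<in> \<Gamma>" "kappa b \<in> \<Gamma>" using ab True by auto
  note perms = good_permutations[of \<Gamma> \<rho>] good_permutations[of \<Gamma> \<rho>']
  have t1: "transversal \<rho>' (?t ` C) \<Gamma> \<longleftrightarrow> transversal \<rho> C \<Gamma>"
    by (rule transversal_move[OF m]) (use perms perm True ab ka b in auto)
  \<comment> \<open>The starting points of the faces are moved by the transposition of
    \<open>b\<close> and \<open>a\<close>, which belongs to the move of the face permutation. Since
    \<open>\<rho> a = b\<close> is no cilium, \<open>a\<close> is no starting point, as
    \<open>transversal_move\<close> demands.\<close>
  have img: "?i' (?t c) = transpose b a (?i c)" if "c \<in> C" for c
  proof (cases "c = kappa a")
    case True
    then show ?thesis using i by (simp add: transpose_def)
  next
    case False
    moreover have "c \<noteq> b" using that b by blast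
    ultimately show ?thesis using i by (simp add: transpose_def)
  qed
  then have "?i' ` ?t ` C = transpose b a ` ?i ` C"
    by (auto simp: image_image intro!: image_cong)
  moreover have "a \<notin> ?i ` C"
    using b m' permutes_bij[OF perm(1)] by (metis bij_is_surj imageE surj_f_inv_f)
  ultimately have t2: "transversal (?i' \<circ> ?\<kappa>) (?i' ` ?t ` C) \<Gamma> \<longleftrightarrow> transversal (?i \<circ> ?\<kappa>) (?i ` C) \<Gamma>"
    using transversal_move[OF face_moves_to[OF m perm ab], of "?i ` C" \<Gamma>] perms perm True ab ka
    by auto
  \<comment> \<open>For a \<kappa>-invariant subset, invariance under either permutation forces
    \<open>a\<close> and \<open>b\<close> to lie in it together, because \<open>\<rho> a = b\<close>
    and \<open>\<rho>' b = \<kappa>(a)\<close>. Hence the two permutations have the same invariant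
    subsets, and connectedness is preserved.\<close>
  have closed: "\<rho>' ` A \<subseteq> A \<longleftrightarrow> \<rho> ` A \<subseteq> A" if A: "A \<subseteq> \<Gamma>" "kappa ` A \<subseteq> A" for A
  proof -
    have fin: "finite A" using A True finite_subset by blast
    have kk: "kappa x \<in> A \<longleftrightarrow> x \<in> A" for x using A(2) by (metis image_subset_iff kappa_kappa)
    show ?thesis
    proof
      assume c: "\<rho>' ` A \<subseteq> A"
      have ci: "\<rho>' x \<in> A \<longleftrightarrow> x \<in> A" for x
        using c inv_image_closed[OF fin permutes_inj[OF perm(2)] c] permutes_inj[OF perm(2)]
        by (metis image_subset_iff inv_f_f)
      have ba: "b \<in> A \<longleftrightarrow> a \<in> A" using ci[of b] kk[of a] m' by simp
      show "\<rho> ` A \<subseteq> A"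
      proof
        fix y assume "y \<in> \<rho> ` A"
        then obtain x where x: "x \<in> A" "y = \<rho> x" by blast
        consider "x = a" | "x = b" | "x \<noteq> a" "x \<noteq> b" by blast
        then show "y \<in> A"
        proof cases
          case 3
          then have "\<rho>' x = ?t y" using m' x by simp
          then have "?t y \<in> A" using ci x by metis
          then show ?thesis using ba kk[of a] by (auto simp: transpose_def split: if_splits)
        next
          case 2
          then have "\<rho>' a = y" using m' x by simp
          then show ?thesis using ci ba x 2 by metis
        qed (use ba m' x in simp)
      qed
    next
      assume c: "\<rho> ` A \<subseteq> A"
      have ci: "\<rho> x \<in> A \<longleftrightarrow> x \<in> A" for x
        using c inv_image_closed[OF fin permutes_inj[OF perm(1)] c] permutes_inj[OF perm(1)]
        by (metis image_subset_iff inv_f_f)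
      have ba: "b \<in> A \<longleftrightarrow> a \<in> A" using ci[of a] m' by simp
      show "\<rho>' ` A \<subseteq> A"
      proof
        fix y assume "y \<in> \<rho>' ` A"
        then obtain x where x: "x \<in> A" "y = \<rho>' x" by blast
        consider "x = a" | "x = b" | "x \<noteq> a" "x \<noteq> b" by blast
        then show "y \<in> A"
        proof cases
          case 3
          then have "y = ?t (\<rho> x)" using m' x by simp
          moreover have "\<rho> x \<in> A" using ci x by blast
          ultimately show ?thesis using ba kk[of a] by (auto simp: transpose_def)
        next
          case 1
          then have "y = \<rho> b" using m' x by simp
          then show ?thesis using ci ba x 1 by metis
        qed (use ba kk[of a] m' x in simp)
      qed
    qed
  qed
  have t3: "connected_by \<rho>' \<Gamma> \<longleftrightarrow> connected_by \<rho> \<Gamma>"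
    unfolding connected_by_def using closed by (intro all_cong imp_cong) simp_all
  have "?t x \<in> \<Gamma> \<longleftrightarrow> x \<in> \<Gamma>" for x using ka ab by (auto simp: transpose_def)
  then have t4: "?t ` C \<subseteq> \<Gamma> \<longleftrightarrow> C \<subseteq> \<Gamma>" by (simp add: image_subset_iff) blast
  have t5: "?t pt \<in> ?t ` C \<longleftrightarrow> pt \<in> C" by (rule inj_image_mem_iff) simp
  show ?thesis
    unfolding good_def t1 t2 t3 t4 t5 using perm by blast
qed (auto simp: good_def)

text \<open>
  Condition 1 holds for \<open>G\<close> and yields \<open>G'\<close>; equivalently, Condition 2 holds for \<open>G'\<close> and yields \<open>G\<close>.
\<close>

definition slid :: "nat \<Rightarrow> nat \<Rightarrow> nat kitaev \<Rightarrow> nat kitaev \<Rightarrow> bool" where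
  "slid a b G G' \<longleftrightarrow> G \<in> RK \<and> G' \<in> RK \<and> half_edges G' = half_edges G \<and>
     a \<in> half_edges G \<and> b \<in> half_edges G \<and> b \<notin> cilia G \<and>
     moves_to a b (kappa a) (rho G) (rho G') \<and>
     cilia G' = transpose (kappa a) b ` cilia G \<and> base G' = transpose (kappa a) b (base G)"

lemma RK_E:
  assumes "G \<in> RK"
  shows "G = kgraph (half_edges G) (rho G) (cilia G) (base G)"
    "good (half_edges G) (rho G) (cilia G) (base G)"
  using assms unfolding RK_iff by auto

lemma slid_cond1:
  assumes "G \<in> RK" "cond1 a b G"
  shows "slid a b G (slide a b G)"
proof -
  note G = RK_E[OF assms(1)]
  note g = G(2)[unfolded good_def] and c = assms(2)[unfolded cond1_def]
  let ?\<rho> = "rho G" and ?\<Gamma> = "half_edges G" and ?t = "transpose (kappa a) b"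
  let ?\<rho>' = "cycle_of_list [b, ?\<rho> b, kappa a] \<circ> ?\<rho>"
  have a1: "a \<in> ?\<Gamma>" "b \<in> ?\<Gamma>" "?\<rho> b \<in> ?\<Gamma>" "kappa a \<in> ?\<Gamma>"
    using c g by (auto simp: permutes_in_image)
  have p: "?\<rho>' permutes ?\<Gamma>"
    unfolding cycle_of_list_3 using g a1
    by (intro permutes_compose) (auto intro: permutes_swap_id)
  have ne: "a \<noteq> kappa a" using kappa_neq[of a] g a1 by force
  have m: "moves_to a b (kappa a) ?\<rho> ?\<rho>'"
    by (rule moves_to_cycle1) (use g c ne permutes_inj in auto)
  have good': "good ?\<Gamma> ?\<rho>' (?t ` cilia G) (?t (base G))"
    using good_move[OF m _ p a1(1,2)] g c G(2) by blast
  have "slide a b G = kgraph ?\<Gamma> ?\<rho>' (?t ` cilia G) (?t (base G))"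
    using assms(2) induced_eq[OF good'] by (simp add: slide_def Let_def)
  then show ?thesis
    unfolding slid_def using assms(1) a1 c m good' RK_iff by auto
qed

lemma slid_cond2:
  assumes "G \<in> RK" "cond2 a b G"
  shows "slid a b (slide a b G) G"
proof -
  note G = RK_E[OF assms(1)]
  note g = G(2)[unfolded good_def] and c = assms(2)[unfolded cond2_def]
  let ?\<rho> = "rho G" and ?\<Gamma> = "half_edges G" and ?t = "transpose (kappa a) b"
  let ?\<rho>' = "cycle_of_list [b, kappa a, ?\<rho> a] \<circ> ?\<rho>"
  have a1: "a \<in> ?\<Gamma>" "b \<in> ?\<Gamma>" "?\<rho> a \<in> ?\<Gamma>" "kappa a \<in> ?\<Gamma>"
    using c g by (auto simp: permutes_in_image)
  have p: "?\<rho>' permutes ?\<Gamma>"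
    unfolding cycle_of_list_3 using g a1
    by (intro permutes_compose) (auto intro: permutes_swap_id)
  have ne: "a \<noteq> kappa a" using kappa_neq[of a] g a1 by force
  have m: "moves_to a b (kappa a) ?\<rho>' ?\<rho>"
    by (rule moves_to_cycle2) (use g c ne permutes_inj in auto)
  have b: "b \<notin> ?t ` cilia G"
  proof
    assume "b \<in> ?t ` cilia G"
    then obtain x where "x \<in> cilia G" "b = ?t x" by blast
    then show False using c by (auto simp: transpose_def split: if_splits)
  qed
  have good': "good ?\<Gamma> ?\<rho>' (?t ` cilia G) (?t (base G))"
    using good_move[OF m p _ a1(1,2) b, of "?t (base G)"] g G(2) by (simp add: image_image)
  have "\<not> cond1 a b G" using c by (auto simp: cond1_def)
  then have "slide a b G = kgraph ?\<Gamma> ?\<rho>' (?t ` cilia G) (?t (base G))"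
    using assms(2) induced_eq[OF good'] by (simp add: slide_def Let_def)
  then show ?thesis
    unfolding slid_def using assms(1) a1 b m good' RK_iff by (auto simp: image_image)
qed

lemma slid_conds:
  assumes "slid a b G G'"
  shows "cond1 a b G" "cond2 a b G'" "\<not> cond1 a b G'" "slide a b G = G'" "slide a b G' = G"
proof -
  note s = assms[unfolded slid_def]
  note m = s[unfolded moves_to_def]
  note g = RK_E(2)[of G, unfolded good_def]
  let ?t = "transpose (kappa a) b"
  show c1: "cond1 a b G" using m by (auto simp: cond1_def)
  have "kappa a \<notin> cilia G'"
  proof
    assume "kappa a \<in> cilia G'"
    then obtain x where "x \<in> cilia G" "kappa a = ?t x" using s by auto
    then show False using s by (auto simp: transpose_def split: if_splits)
  qed
  then show c2: "cond2 a b G'" using m by (auto simp: cond2_def)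
  show "\<not> cond1 a b G'" using m by (auto simp: cond1_def)
  have eqI: "G1 = G2" if "G1 \<in> RK" "G2 \<in> RK" "half_edges G1 = half_edges G2" "rho G1 = rho G2"
    "cilia G1 = cilia G2" "base G1 = base G2" for G1 G2
    using that RK_E(1) by metis
  show "slide a b G = G'"
    using slid_cond1[OF _ c1] s
    by (intro eqI) (auto simp: slid_def dest: moves_to_unique1)
  show "slide a b G' = G"
  proof (rule eqI)
    note s2 = slid_cond2[OF _ c2, unfolded slid_def]
    have G': "G' \<in> RK" using s by blast
    show "slide a b G' \<in> RK" "G \<in> RK" "half_edges (slide a b G') = half_edges G"
      using s s2[OF G'] by auto
    show "rho (slide a b G') = rho G" using s s2[OF G'] moves_to_unique2 by metis
    have "?t ` cilia (slide a b G') = ?t ` cilia G" "?t (base (slide a b G')) = ?t (base G)"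
      using s s2[OF G'] by auto
    then show "cilia (slide a b G') = cilia G" "base (slide a b G') = base G"
      by (metis inj_image_eq_iff inj_transpose, metis transpose_involutory)
  qed
qed

lemma slide_neither: "\<not> cond1 a b G \<Longrightarrow> \<not> cond2 a b G \<Longrightarrow> slide a b G = G"
  by (simp add: slide_def)

lemma slide_cases:
  assumes "G \<in> RK"
  obtains "slid a b G (slide a b G)" "cond1 a b G" | "slid a b (slide a b G) G" "cond2 a b G" "\<not> cond1 a b G"
  | "slide a b G = G" "\<not> cond1 a b G" "\<not> cond2 a b G"
  using slid_cond1[OF assms] slid_cond2[OF assms] slide_neither by blast

lemma slide_RK: "G \<in> RK \<Longrightarrow> slide a b G \<in> RK"
  by (cases rule: slide_cases[of G a b]) (auto simp: slid_def)

lemma slide_slide: "G \<in> RK \<Longrightarrow> slide a b (slide a b G) = G"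
  by (cases rule: slide_cases[of G a b]) (auto dest: slid_conds)

lemma slide_cilia_slide:
  assumes "G \<in> RK"
  shows "slide_cilia a b (slide a b G) = slide_cilia a b G"
proof (cases rule: slide_cases[OF assms, of a b])
  case 1
  from slid_conds[OF 1(1)] show ?thesis by (simp add: slide_cilia_def)
next
  case 2
  from slid_conds[OF 2(1)] show ?thesis by (simp add: slide_cilia_def)
qed simp

subsection \<open>Relabelling\<close>

lemma frakR_iff: "\<sigma> \<in> carrier frakR \<longleftrightarrow> \<sigma> \<in> S_inf \<and> (\<forall>x. \<sigma> (kappa x) = kappa (\<sigma> x))"
proof -
  have "(\<sigma> \<circ> kappa \<circ> inv_into UNIV \<sigma> = kappa) \<longleftrightarrow> (\<forall>x. \<sigma> (kappa x) = kappa (\<sigma> x))"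
    if "\<sigma> \<in> S_inf"
  proof -
    have "bij \<sigma>" using that permutes_bij by (auto simp: S_inf_def)
    then show ?thesis by (auto simp: fun_eq_iff bij_is_surj surj_f_inv_f) (metis bij_inv_eq_iff)
  qed
  then show ?thesis by (auto simp: frakR_def)
qed

lemma frakR_bij: "\<sigma> \<in> carrier frakR \<Longrightarrow> bij \<sigma>"
  using permutes_bij by (auto simp: frakR_iff S_inf_def)

lemma frakR_kappa: "\<sigma> \<in> carrier frakR \<Longrightarrow> \<sigma> (kappa x) = kappa (\<sigma> x)"
  by (simp add: frakR_iff)

lemma frakR_ge: "\<sigma> \<in> carrier frakR \<Longrightarrow> \<sigma> x \<ge> 1 \<longleftrightarrow> x \<ge> 1"
  using permutes_in_image[of \<sigma> "{1..}" x] by (auto simp: frakR_iff S_inf_def)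

text \<open>Everything is conjugated by \<sigma>. For the face permutation this uses that \<sigma>
  commutes with \<kappa> (\<open>face\<close>).\<close>

lemma relabel_RK:
  assumes \<sigma>: "\<sigma> \<in> carrier frakR" and G: "G \<in> RK"
  shows "relabel \<sigma> G = kgraph (\<sigma> ` half_edges G) (\<sigma> \<circ> rho G \<circ> inv_into UNIV \<sigma>) (\<sigma> ` cilia G) (\<sigma> (base G))"
    and "relabel \<sigma> G \<in> RK"
proof -
  let ?\<Gamma> = "half_edges G" and ?\<rho> = "rho G" and ?i = "inv_into UNIV \<sigma>" and ?j = "inv_into UNIV (rho G)"
  let ?\<rho>' = "\<sigma> \<circ> ?\<rho> \<circ> ?i"
  note g = RK_E(2)[OF G, unfolded good_def]
  note bij = frakR_bij[OF \<sigma>]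
  have ii: "?i (\<sigma> x) = x" "\<sigma> (?i x) = x" for x
    using bij by (simp_all add: bij_is_inj bij_is_surj surj_f_inv_f)
  have k: "kappa ` \<sigma> ` ?\<Gamma> \<subseteq> \<sigma> ` ?\<Gamma>"
    using g frakR_kappa[OF \<sigma>] by (auto simp: image_iff) (metis image_eqI subsetD)
  have p: "?\<rho>' permutes \<sigma> ` ?\<Gamma>"
  proof (rule bij_imp_permutes)
    show "bij_betw ?\<rho>' (\<sigma> ` ?\<Gamma>) (\<sigma> ` ?\<Gamma>)"
      by (rule bij_betw_byWitness[where f' = "\<sigma> \<circ> ?j \<circ> ?i"])
        (use g ii in \<open>auto simp: permutes_inverses permutes_in_image permutes_in_image[OF permutes_inv]\<close>)
    show "?\<rho>' x = x" if "x \<notin> \<sigma> ` ?\<Gamma>" for x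
      using that g ii by (metis comp_apply image_eqI permutes_not_in)
  qed
  have inv\<rho>': "inv_into UNIV ?\<rho>' = \<sigma> \<circ> ?j \<circ> ?i"
    by (rule inv_equality) (use g ii in \<open>auto simp: permutes_inverses\<close>)
  have face: "inv_into UNIV ?\<rho>' \<circ> perm_restrict kappa (\<sigma> ` ?\<Gamma>) =
      \<sigma> \<circ> (?j \<circ> perm_restrict kappa ?\<Gamma>) \<circ> ?i"
  proof
    fix x
    have "x \<in> \<sigma> ` ?\<Gamma> \<longleftrightarrow> ?i x \<in> ?\<Gamma>" using ii by (metis image_iff)
    moreover have "?i (kappa x) = kappa (?i x)" using frakR_kappa[OF \<sigma>] ii by metis
    ultimately show "(inv_into UNIV ?\<rho>' \<circ> perm_restrict kappa (\<sigma> ` ?\<Gamma>)) x =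
        (\<sigma> \<circ> (?j \<circ> perm_restrict kappa ?\<Gamma>) \<circ> ?i) x"
      unfolding inv\<rho>' by (simp add: perm_restrict_def)
  qed
  note perms = good_permutations[of ?\<Gamma> ?\<rho>] good_permutations[of "\<sigma> ` ?\<Gamma>" ?\<rho>', OF _ k p]
  have fin: "finite (\<sigma> ` ?\<Gamma>)" using g by simp
  have t1: "transversal ?\<rho>' (\<sigma> ` cilia G) (\<sigma> ` ?\<Gamma>)"
    by (rule transversal_conj[OF bij]) (use g perms fin in auto)
  have im: "inv_into UNIV ?\<rho>' ` \<sigma> ` cilia G = \<sigma> ` ?j ` cilia G"
    unfolding inv\<rho>' using ii by (auto simp: image_image)
  have t2: "transversal (inv_into UNIV ?\<rho>' \<circ> perm_restrict kappa (\<sigma> ` ?\<Gamma>))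
      (inv_into UNIV ?\<rho>' ` \<sigma> ` cilia G) (\<sigma> ` ?\<Gamma>)"
    unfolding im unfolding face
    by (rule transversal_conj[OF bij]) (use g perms fin in \<open>auto simp: face\<close>)
  have "connected_by ?\<rho>' (\<sigma> ` ?\<Gamma>)"
    unfolding connected_by_def
  proof (intro allI impI)
    fix A assume A: "A \<subseteq> \<sigma> ` ?\<Gamma>" "A \<noteq> {}" "kappa ` A \<subseteq> A" "?\<rho>' ` A \<subseteq> A"
    have "?i ` A = ?\<Gamma>"
    proof -
      have "?i ` A \<subseteq> ?\<Gamma>" using A(1) ii by (auto simp: image_iff)
      moreover have "?i ` A \<noteq> {}" using A(2) by simp
      moreover have "kappa ` ?i ` A \<subseteq> ?i ` A"
      proof -
        have "kappa (?i x) = ?i (kappa x)" for x using frakR_kappa[OF \<sigma>] ii by metis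
        then show ?thesis using A(3) by (auto simp: image_iff)
      qed
      moreover have "?\<rho> ` ?i ` A \<subseteq> ?i ` A"
      proof
        fix y assume "y \<in> ?\<rho> ` ?i ` A"
        then obtain x where x: "x \<in> A" "y = ?\<rho> (?i x)" by blast
        have "y = ?i (?\<rho>' x)" using x(2) ii by simp
        moreover have "?\<rho>' x \<in> A" using A(4) x(1) by blast
        ultimately show "y \<in> ?i ` A" by blast
      qed
      ultimately show ?thesis using g unfolding connected_by_def by blast
    qed
    then have "\<sigma> ` ?i ` A = \<sigma> ` ?\<Gamma>" by simp
    then show "A = \<sigma> ` ?\<Gamma>" using ii by (simp add: image_image)
  qed
  then have good': "good (\<sigma> ` ?\<Gamma>) ?\<rho>' (\<sigma> ` cilia G) (\<sigma> (base G))"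
    unfolding good_def using fin k p t1 t2 g frakR_ge[OF \<sigma>] by auto
  show eq: "relabel \<sigma> G = kgraph (\<sigma> ` ?\<Gamma>) ?\<rho>' (\<sigma> ` cilia G) (\<sigma> (base G))"
    unfolding relabel_def by (rule induced_eq[OF good'])
  show "relabel \<sigma> G \<in> RK" unfolding eq RK_iff using good' by blast
qed

lemma relabel_relabel:
  assumes "\<sigma> \<in> carrier frakR" "\<tau> \<in> carrier frakR" "\<sigma> \<circ> \<tau> \<in> carrier frakR" "G \<in> RK"
  shows "relabel \<sigma> (relabel \<tau> G) = relabel (\<sigma> \<circ> \<tau>) G"
  using relabel_RK[OF assms(2,4)] relabel_RK[OF assms(3,4)] relabel_RK[OF assms(1) relabel_RK(2)[OF assms(2,4)]]
    o_inv_distrib[OF frakR_bij[OF assms(1)] frakR_bij[OF assms(2)]]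
  by (simp add: image_comp o_assoc)

lemma relabel_id: "G \<in> RK \<Longrightarrow> relabel id G = G"
  using RK_E induced_eq by (metis comp_id id_apply id_comp image_id inv_id relabel_def)

lemma moves_to_conj:
  fixes \<sigma> :: "'a \<Rightarrow> 'a"
  assumes "bij \<sigma>" "moves_to p q r f f'"
  shows "moves_to (\<sigma> p) (\<sigma> q) (\<sigma> r) (\<sigma> \<circ> f \<circ> inv_into UNIV \<sigma>) (\<sigma> \<circ> f' \<circ> inv_into UNIV \<sigma>)"
proof -
  have ii: "inv_into UNIV \<sigma> (\<sigma> x) = x" "\<sigma> (inv_into UNIV \<sigma> x) = x" "\<sigma> x = \<sigma> y \<longleftrightarrow> x = y" for x y
    using assms(1) by (simp_all add: bij_is_inj bij_is_surj surj_f_inv_f inj_eq)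
  have t: "transpose (\<sigma> r) (\<sigma> q) (\<sigma> x) = \<sigma> (transpose r q x)" for x
    using ii by (simp add: transpose_def)
  have n: "inv_into UNIV \<sigma> k \<noteq> x" if "k \<noteq> \<sigma> x" for k x using ii that by metis
  show ?thesis
    using assms(2) ii n unfolding moves_to_def by (simp add: t)
qed

text \<open>The conditions and the relation \<open>slid\<close> are expressed through data that
  \<sigma> transports, including \<kappa>; the slid graph is therefore transported too.\<close>

lemma relabel_slide:
  assumes \<sigma>: "\<sigma> \<in> carrier frakR" and G: "G \<in> RK"
  shows "relabel \<sigma> (slide a b G) = slide (\<sigma> a) (\<sigma> b) (relabel \<sigma> G)"
    and "cond1 (\<sigma> a) (\<sigma> b) (relabel \<sigma> G) \<longleftrightarrow> cond1 a b G"
    and "cond2 (\<sigma> a) (\<sigma> b) (relabel \<sigma> G) \<longleftrightarrow> cond2 a b G"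
proof -
  note bij = frakR_bij[OF \<sigma>]
  have ii: "inv_into UNIV \<sigma> (\<sigma> x) = x" "\<sigma> (inv_into UNIV \<sigma> x) = x" "\<sigma> x = \<sigma> y \<longleftrightarrow> x = y" for x y
    using bij by (simp_all add: bij_is_inj bij_is_surj surj_f_inv_f inj_eq)
  have im: "\<sigma> x \<in> \<sigma> ` A \<longleftrightarrow> x \<in> A" for x A using bij by (simp add: bij_is_inj inj_image_mem_iff)
  have k: "kappa (\<sigma> x) = \<sigma> (kappa x)" for x using frakR_kappa[OF \<sigma>] by simp
  show c1: "cond1 (\<sigma> a) (\<sigma> b) (relabel \<sigma> G) \<longleftrightarrow> cond1 a b G"
    unfolding cond1_def relabel_RK(1)[OF \<sigma> G] k by (simp add: ii im)
  show c2: "cond2 (\<sigma> a) (\<sigma> b) (relabel \<sigma> G) \<longleftrightarrow> cond2 a b G"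
    unfolding cond2_def relabel_RK(1)[OF \<sigma> G] k by (simp add: ii im)
  have s: "slid (\<sigma> a) (\<sigma> b) (relabel \<sigma> G1) (relabel \<sigma> G2)" if s: "slid a b G1 G2" for G1 G2
  proof -
    have G12: "G1 \<in> RK" "G2 \<in> RK" using s by (auto simp: slid_def)
    have t: "transpose (\<sigma> (kappa a)) (\<sigma> b) (\<sigma> x) = \<sigma> (transpose (kappa a) b x)" for x
      using ii by (simp add: transpose_def)
    show ?thesis
      using s moves_to_conj[OF bij, of a b "kappa a" "rho G1" "rho G2"]
        relabel_RK(2)[OF \<sigma> G12(1)] relabel_RK(2)[OF \<sigma> G12(2)]
      unfolding slid_def relabel_RK(1)[OF \<sigma> G12(1)] relabel_RK(1)[OF \<sigma> G12(2)] k
      by (simp add: im image_image t)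
  qed
  show "relabel \<sigma> (slide a b G) = slide (\<sigma> a) (\<sigma> b) (relabel \<sigma> G)"
  proof (cases rule: slide_cases[OF G, of a b])
    case 1
    from slid_conds(4)[OF s[OF 1(1)]] show ?thesis ..
  next
    case 2
    from slid_conds(5)[OF s[OF 2(1)]] show ?thesis ..
  next
    case 3
    then show ?thesis using c1 c2 by (simp add: slide_neither)
  qed
qed

section \<open>Operators on the extended Hilbert space\<close>

lemma RK_facts:
  assumes "G \<in> RK"
  shows "finite (half_edges G)" "\<And>h. h \<in> half_edges G \<Longrightarrow> h \<ge> 1"
    "\<And>h. h \<in> half_edges G \<Longrightarrow> kappa h \<in> half_edges G"
    "\<And>h. h \<in> half_edges G \<Longrightarrow> iota G h = kappa h"
    "rho G permutes half_edges G" "cilia G \<subseteq> half_edges G" "base G \<in> cilia G"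
    "permutation (rho G)" "permutation (face_perm G)" "face_perm G permutes half_edges G"
    "transversal (rho G) (cilia G) (half_edges G)"
    "transversal (face_perm G) (inv_into UNIV (rho G) ` cilia G) (half_edges G)"
    "iota G = perm_restrict kappa (half_edges G)"
proof -
  note g = RK_E(2)[OF assms, unfolded good_def]
  show i: "iota G = perm_restrict kappa (half_edges G)"
    by (subst RK_E(1)[OF assms]) simp
  have f: "face_perm G = inv_into UNIV (rho G) \<circ> perm_restrict kappa (half_edges G)"
    by (simp add: face_perm_def i)
  show "permutation (rho G)" "permutation (face_perm G)" "face_perm G permutes half_edges G"
    unfolding f using good_permutations[of "half_edges G" "rho G"] g by auto
  show "transversal (face_perm G) (inv_into UNIV (rho G) ` cilia G) (half_edges G)"
    unfolding f using g by blast
  show "iota G h = kappa h" if "h \<in> half_edges G" for h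
    using that by (simp add: i perm_restrict_def)
  show "h \<ge> 1" if "h \<in> half_edges G" for h using that g by auto
  show "kappa h \<in> half_edges G" if "h \<in> half_edges G" for h using that g by blast
  show "finite (half_edges G)" "rho G permutes half_edges G" "cilia G \<subseteq> half_edges G"
    "base G \<in> cilia G" "transversal (rho G) (cilia G) (half_edges G)"
    using g by blast+
qed

lemma edge_of_RK: "G \<in> RK \<Longrightarrow> h \<in> half_edges G \<Longrightarrow> edge_of G h = {h, kappa h}"
  by (simp add: edge_of_def RK_facts(4))

lemma edge_in_edges: "G \<in> RK \<Longrightarrow> h \<in> half_edges G \<Longrightarrow> {h, kappa h} \<in> edges G"
  unfolding edges_def using edge_of_RK by blast

text \<open>In each pair {2i - 1, 2i} the smaller half-edge is the odd one, so orientation becomes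
  parity.\<close>

lemma is_source_RK: "G \<in> RK \<Longrightarrow> h \<in> half_edges G \<Longrightarrow> is_source G h \<longleftrightarrow> odd h"
  using RK_facts(2)[of G h] by (auto simp: is_source_def RK_facts(4) min_def kappa_def)

context fd_involutive_hopf_bimodule
begin

lemma at_factor_cop:
  assumes "i \<in> I" "\<And>p q. mlinear (f p q)" "t \<in> tensor_space (multilinear_forms (mscale M) I) UNIV"
  shows "at_factor (mscale M) I i (\<lambda>m. cop (mscale M) a (\<lambda>p q. f p q m)) t =
    cop fscale a (\<lambda>p q. at_factor (mscale M) I i (f p q) t)"
proof -
  have "cop (mscale M) a (\<lambda>p q. f p q m) = (\<Sum>x\<in>B \<times> B. mscale M (cc a (fst x) (snd x)) (f (fst x) (snd x) m))"
    for m by (simp add: cop_def sum.cartesian_product case_prod_unfold)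
  moreover have "cop fscale a (\<lambda>p q. at_factor (mscale M) I i (f p q) t) =
      (\<Sum>x\<in>B \<times> B. fscale (cc a (fst x) (snd x)) (at_factor (mscale M) I i (f (fst x) (snd x)) t))"
    by (simp add: cop_def sum.cartesian_product case_prod_unfold)
  ultimately show ?thesis
    by (simp add: at_factor_sum[OF vector_space_M assms(1) _ assms(2,3)])
qed

lemma L_op_eq:
  assumes "G \<in> RK" "h \<in> half_edges G"
  shows "L_op H M G h a = at_factor (mscale M) (edges G) {h, kappa h} (hact (odd h) a)"
proof -
  have "(\<lambda>m. if is_source G h then ract M m (antip H a) else lact M a m) = hact (odd h) a"
    using is_source_RK[OF assms] by (auto simp: hact_def)
  then show ?thesis unfolding L_op_def on_edge_at_factor edge_of_RK[OF assms] by simp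
qed

lemma T_op_eq:
  assumes "G \<in> RK" "h \<in> half_edges G"
  shows "T_op H M G h (zeta x) = at_factor (mscale M) (edges G) {h, kappa h} (hco (odd h) x)"
proof -
  have "lin_ext (mscale M) (\<lambda>(n, y). mscale M (zeta x (antip H y)) n) (rcoact M m) =
      (\<Sum>y\<in>B. mscale M (zeta x (antip H y)) (rco y m))" for m
    by (subst lin_ext_rcoact[OF vector_space_M])
      (auto simp: hopf_lin zeta_add zeta_scale ms.scale_left_distrib ms.scale_right_distrib mult.commute)
  then have "(\<lambda>m. if is_source G h
     then lin_ext (mscale M) (\<lambda>(y, n). mscale M (zeta x y) n) (lcoact M m)
     else lin_ext (mscale M) (\<lambda>(n, y). mscale M (zeta x (antip H y)) n) (rcoact M m)) = hco (odd h) x"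
    using is_source_RK[OF assms] by (auto simp: hco_def lco_def)
  then show ?thesis unfolding T_op_def on_edge_at_factor edge_of_RK[OF assms] by simp
qed

end

locale graph_hilbert = fd_involutive_hopf_bimodule H M B
  for H :: "('k::field, 'h::ring_1) hopf" and M :: "('k, 'h, 'm::ab_group_add) bimod" and B +
  fixes G :: "nat kitaev"
  assumes G: "G \<in> RK"
begin

abbreviation "W \<equiv> hilb M G"
abbreviation "L \<equiv> L_op H M G"
abbreviation "T h x \<equiv> T_op H M G h (zeta x)"
abbreviation "half \<equiv> half_edges G"
abbreviation "wlin \<equiv> lin_on fscale fscale (hilb M G)"

lemmas Geq = L_op_eq[OF G] T_op_eq[OF G]
lemmas kappa_half = RK_facts(3)[OF G]

lemma odd_kappa_half: "h \<in> half \<Longrightarrow> odd (kappa h) \<longleftrightarrow> even h"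
  using odd_kappa RK_facts(2)[OF G] by blast

lemma L_in [simp]: "h \<in> half \<Longrightarrow> t \<in> W \<Longrightarrow> L h a t \<in> W"
  unfolding hilb_def by (simp add: Geq at_factor_in mlinear_hact)

lemma T_in [simp]: "h \<in> half \<Longrightarrow> t \<in> W \<Longrightarrow> T h x t \<in> W"
  unfolding hilb_def by (simp add: Geq at_factor_in mlinear_hco)

lemma W_closed [simp]:
  "0 \<in> W" "s \<in> W \<Longrightarrow> t \<in> W \<Longrightarrow> s + t \<in> W" "t \<in> W \<Longrightarrow> fscale c t \<in> W"
  "(\<And>i. i \<in> A \<Longrightarrow> f i \<in> W) \<Longrightarrow> (\<Sum>i\<in>A. f i) \<in> W"
  unfolding hilb_def by auto

lemma cop_W [simp]: "(\<And>x y. x \<in> B \<Longrightarrow> y \<in> B \<Longrightarrow> f x y \<in> W) \<Longrightarrow> cop fscale a f \<in> W"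
  by (rule cop_in) auto

lemma L_wlin: "h \<in> half \<Longrightarrow> wlin (L h a)"
  unfolding hilb_def by (simp add: Geq at_factor_lin_on mlinear_hact)

lemma T_wlin: "h \<in> half \<Longrightarrow> wlin (T h x)"
  unfolding hilb_def by (simp add: Geq at_factor_lin_on mlinear_hco)

lemma L_eqs:
  assumes "h \<in> half" "t \<in> W"
  shows "s \<in> W \<Longrightarrow> L h a (t + s) = L h a t + L h a s" "L h a (fscale c t) = fscale c (L h a t)"
    "L h (a + b) t = L h a t + L h b t" "L h (hscale H c a) t = fscale c (L h a t)"
    "L h (a * b) t = L h a (L h b t)" "L h 1 t = t"
proof -
  have t: "t \<in> tensor_space (mforms M G) UNIV" using assms(2) by (simp add: hilb_def)
  note e = edge_in_edges[OF G assms(1)]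
  have "hact s (a + b) = (\<lambda>m. hact s a m + hact s b m)" for s by (simp add: hact_eqs fun_eq_iff)
  then show "L h (a + b) t = L h a t + L h b t"
    using at_factor_add[OF vector_space_M e mlinear_hact mlinear_hact t] by (simp add: Geq assms)
  have "hact s (hscale H c a) = (\<lambda>m. mscale M c (hact s a m))" for s by (simp add: hact_eqs fun_eq_iff)
  then show "L h (hscale H c a) t = fscale c (L h a t)"
    using at_factor_scale[OF vector_space_M e mlinear_hact t] by (simp add: Geq assms)
  have "hact s (a * b) = (\<lambda>m. hact s a (hact s b m))" for s by (simp add: hact_mult fun_eq_iff)
  then show "L h (a * b) t = L h a (L h b t)"
    by (simp add: Geq assms at_factor_comp[OF mlinear_hact mlinear_hact t])
  have "hact s 1 = (\<lambda>m. m)" for s by (simp add: hact_one fun_eq_iff)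
  then show "L h 1 t = t" using at_factor_id[OF t] by (simp add: Geq assms)
qed (use assms lin_on_add[OF L_wlin] lin_on_scale[OF L_wlin] in auto)

lemma T_eqs:
  assumes "h \<in> half" "t \<in> W"
  shows "s \<in> W \<Longrightarrow> T h x (t + s) = T h x t + T h x s" "T h x (fscale c t) = fscale c (T h x t)"
  using assms lin_on_add[OF T_wlin] lin_on_scale[OF T_wlin] by auto

lemma L_hlin: "h \<in> half \<Longrightarrow> t \<in> W \<Longrightarrow> hlin fscale (\<lambda>a. L h a t)"
  by (simp add: lin_on_def L_eqs)

lemma other_edge:
  assumes "k \<notin> {h, kappa h}" shows "{h, kappa h} \<noteq> {k, kappa k}"
  using assms by auto

text \<open>The two ends of one edge act through the left and the right module structure, which
  commute; half-edges of different edges act on different tensor factors.\<close>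

lemma L_L:
  assumes "h \<in> half" "k \<in> half" "h \<noteq> k" "t \<in> W"
  shows "L h a (L k b t) = L k b (L h a t)"
proof -
  have t: "t \<in> tensor_space (mforms M G) UNIV" using assms(4) by (simp add: hilb_def)
  show ?thesis
  proof (cases "k = kappa h")
    case True
    have "(\<lambda>m. hact (odd h) a (hact (even h) b m)) = (\<lambda>m. hact (even h) b (hact (odd h) a m))"
      using hact_commute[of "odd h" a b] by auto
    then show ?thesis
      using True assms odd_kappa_half[OF assms(1)]
      by (simp add: Geq insert_commute[of "kappa h" h] at_factor_comp[OF mlinear_hact mlinear_hact t])
  next
    case False
    then have "{h, kappa h} \<noteq> {k, kappa k}" using assms by (intro other_edge) auto
    from at_factor_commute[OF mlinear_hact mlinear_hact this t] show ?thesis using assms by (simp add: Geq)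
  qed
qed

lemma T_T:
  assumes "h \<in> half" "k \<in> half" "h \<noteq> k" "t \<in> W" "x \<in> B" "y \<in> B"
  shows "T h x (T k y t) = T k y (T h x t)"
proof -
  have t: "t \<in> tensor_space (mforms M G) UNIV" using assms(4) by (simp add: hilb_def)
  show ?thesis
  proof (cases "k = kappa h")
    case True
    have "(\<lambda>m. hco (odd h) x (hco (even h) y m)) = (\<lambda>m. hco (even h) y (hco (odd h) x m))"
      using hco_commute[OF assms(5,6), of "odd h"] by auto
    then show ?thesis
      using True assms odd_kappa_half[OF assms(1)]
      by (simp add: Geq insert_commute[of "kappa h" h] at_factor_comp[OF mlinear_hco mlinear_hco t])
  next
    case False
    then have "{h, kappa h} \<noteq> {k, kappa k}" using assms by (intro other_edge) auto
    from at_factor_commute[OF mlinear_hco mlinear_hco this t] show ?thesis using assms by (simp add: Geq)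
  qed
qed

lemma T_L:
  assumes "h \<in> half" "k \<in> half" "k \<notin> {h, kappa h}" "t \<in> W"
  shows "T k x (L h a t) = L h a (T k x t)"
proof -
  have t: "t \<in> tensor_space (mforms M G) UNIV" using assms(4) by (simp add: hilb_def)
  from at_factor_commute[OF mlinear_hact mlinear_hco other_edge[OF assms(3)] t]
  show ?thesis using assms by (simp add: Geq)
qed

lemma T_counit:
  assumes "h \<in> half" "t \<in> W"
  shows "(\<Sum>x\<in>B. fscale (counit H x) (T h x t)) = t"
proof -
  have t: "t \<in> tensor_space (mforms M G) UNIV" using assms(2) by (simp add: hilb_def)
  show ?thesis
    using at_factor_sum[OF vector_space_M edge_in_edges[OF G assms(1)] finite_B _ t,
        where c = "counit H" and f = "hco (odd h)"] assms(1)
    by (simp add: Geq mlinear_hco hco_counit at_factor_id[OF t])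
qed

lemma T_coassoc:
  assumes "h \<in> half" "t \<in> W" "u \<in> B" "v \<in> B"
  shows "T h v (T h u t) = (\<Sum>x\<in>B. fscale (cc x u v) (T h x t))"
proof -
  have t: "t \<in> tensor_space (mforms M G) UNIV" using assms(2) by (simp add: hilb_def)
  show ?thesis
    using at_factor_sum[OF vector_space_M edge_in_edges[OF G assms(1)] finite_B _ t,
        where c = "\<lambda>x. cc x u v" and f = "hco (odd h)"] assms
    by (simp add: Geq mlinear_hco at_factor_comp[OF mlinear_hco mlinear_hco t] hco_coassoc)
qed

lemma at_factor_cop_sum:
  assumes "e \<in> edges G" "\<And>p q y. mlinear (f p q y)" "t \<in> W"
  shows "at_factor (mscale M) (edges G) e (\<lambda>m. cop (mscale M) a (\<lambda>p q. \<Sum>y\<in>B. mscale M (c p q y) (f p q y m))) t =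
    cop fscale a (\<lambda>p q. \<Sum>y\<in>B. fscale (c p q y) (at_factor (mscale M) (edges G) e (f p q y) t))"
proof -
  have t: "t \<in> tensor_space (mforms M G) UNIV" using assms(3) by (simp add: hilb_def)
  show ?thesis
    by (subst at_factor_cop[OF assms(1) _ t])
      (auto intro!: lin_on_sum_fun lin_on_scale_fun vector_space_M assms cop_cong
        at_factor_sum[OF vector_space_M assms(1) finite_B _ t])
qed

lemma mlinear_hact_hco: "mlinear (\<lambda>m. hact s a (hco s' y m))"
  using mlinear_hact mlinear_hco by (auto simp: lin_on_def)

lemma T_L_opposite:
  assumes h: "h \<in> half" and t: "t \<in> W" and x: "x \<in> B"
  shows "T (kappa h) x (L h a t) = cop fscale a (\<lambda>a1 a2. \<Sum>y\<in>B.
    fscale (zeta x (a1 * y)) (L h a2 (T (kappa h) y t)))"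
proof -
  have t': "t \<in> tensor_space (mforms M G) UNIV" using t by (simp add: hilb_def)
  note e = edge_in_edges[OF G h]
  have "T (kappa h) x (L h a t) =
      at_factor (mscale M) (edges G) {h, kappa h} (\<lambda>m. hco (\<not> odd h) x (hact (odd h) a m)) t"
    using odd_kappa_half[OF h] kappa_half[OF h] h
    by (simp add: Geq insert_commute[of "kappa h" h] at_factor_comp[OF mlinear_hco mlinear_hact t'])
  also have "\<dots> = cop fscale a (\<lambda>a1 a2. \<Sum>y\<in>B. fscale (zeta x (a1 * y))
      (at_factor (mscale M) (edges G) {h, kappa h} (\<lambda>m. hact (odd h) a2 (hco (\<not> odd h) y m)) t))"
    unfolding hco_hact_opposite[OF x] by (rule at_factor_cop_sum[OF e mlinear_hact_hco t])
  also have "\<dots> = cop fscale a (\<lambda>a1 a2. \<Sum>y\<in>B. fscale (zeta x (a1 * y)) (L h a2 (T (kappa h) y t)))"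
    using odd_kappa_half[OF h] kappa_half[OF h] h
    by (simp add: Geq insert_commute[of "kappa h" h] at_factor_comp[OF mlinear_hact mlinear_hco t'])
  finally show ?thesis .
qed

lemma T_L_same:
  assumes h: "h \<in> half" and t: "t \<in> W" and x: "x \<in> B"
  shows "T h x (L h a t) = cop fscale a (\<lambda>a1 a2. \<Sum>y\<in>B.
    fscale (zeta x (y * antip H a2)) (L h a1 (T h y t)))"
proof -
  have t': "t \<in> tensor_space (mforms M G) UNIV" using t by (simp add: hilb_def)
  note e = edge_in_edges[OF G h]
  have "T h x (L h a t) =
      at_factor (mscale M) (edges G) {h, kappa h} (\<lambda>m. hco (odd h) x (hact (odd h) a m)) t"
    using h by (simp add: Geq at_factor_comp[OF mlinear_hco mlinear_hact t'])
  also have "\<dots> = cop fscale a (\<lambda>a1 a2. \<Sum>y\<in>B. fscale (zeta x (y * antip H a2))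
      (at_factor (mscale M) (edges G) {h, kappa h} (\<lambda>m. hact (odd h) a1 (hco (odd h) y m)) t))"
    unfolding hco_hact_same[OF x] by (rule at_factor_cop_sum[OF e mlinear_hact_hco t])
  also have "\<dots> = cop fscale a (\<lambda>a1 a2. \<Sum>y\<in>B. fscale (zeta x (y * antip H a2)) (L h a1 (T h y t)))"
    using h by (simp add: Geq at_factor_comp[OF mlinear_hact mlinear_hco t'])
  finally show ?thesis .
qed

subsection \<open>Sweedler notation for the coaction of a half-edge\<close>

text \<open>The coaction of a half-edge in Sweedler form: the continuation \<open>f\<close> receives
  the coefficient in H and the remaining state. With continuations, coactions and actions can be
  nested freely.\<close>

definition dco :: "nat \<Rightarrow> ('m, 'k) mtensor \<Rightarrow> ('h \<Rightarrow> ('m, 'k) mtensor \<Rightarrow> ('m, 'k) mtensor) \<Rightarrow> ('m, 'k) mtensor"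
  where "dco h t f = (\<Sum>x\<in>B. f x (T h x t))"

definition dlin :: "('h \<Rightarrow> ('m, 'k) mtensor \<Rightarrow> ('m, 'k) mtensor) \<Rightarrow> bool" where
  "dlin f \<longleftrightarrow> (\<forall>x. wlin (f x)) \<and> (\<forall>t\<in>W. hlin fscale (\<lambda>x. f x t))"

lemma dlin_eqs:
  assumes "dlin f" "t \<in> W"
  shows "s \<in> W \<Longrightarrow> f x (t + s) = f x t + f x s" "f x (fscale c t) = fscale c (f x t)"
    "f (x + y) t = f x t + f y t" "f (hscale H c x) t = fscale c (f x t)"
  using assms by (auto simp: dlin_def lin_on_def)

lemma dlin_wlin: "dlin f \<Longrightarrow> wlin (f x)"
  by (simp add: dlin_def)

lemma dlinI:
  assumes "\<And>x s t. s \<in> W \<Longrightarrow> t \<in> W \<Longrightarrow> f x (s + t) = f x s + f x t"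
    "\<And>x c t. t \<in> W \<Longrightarrow> f x (fscale c t) = fscale c (f x t)"
    "\<And>x y t. t \<in> W \<Longrightarrow> f (x + y) t = f x t + f y t"
    "\<And>c x t. t \<in> W \<Longrightarrow> f (hscale H c x) t = fscale c (f x t)"
  shows "dlin f"
  using assms by (simp add: dlin_def lin_on_def)

lemma wlin_0: "wlin g \<Longrightarrow> g 0 = 0"
  using lin_on_zero[OF vector_space_fscale vector_space_fscale, of W g 0] by simp

lemma wlin_sum:
  assumes "wlin g" "\<And>i. i \<in> A \<Longrightarrow> x i \<in> W" shows "g (\<Sum>i\<in>A. x i) = (\<Sum>i\<in>A. g (x i))"
  by (cases "finite A") (auto intro!: lin_on_sum[OF assms(1)] simp: wlin_0[OF assms(1)] assms(2))

lemma wlin_cop: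
  assumes "wlin g" "\<And>x y. x \<in> B \<Longrightarrow> y \<in> B \<Longrightarrow> f x y \<in> W"
  shows "g (cop fscale a f) = cop fscale a (\<lambda>x y. g (f x y))"
  by (rule cop_map[OF vector_space_fscale vector_space_fscale assms(1)]) (use assms(2) in auto)

lemma dco_in [simp]:
  "h \<in> half \<Longrightarrow> t \<in> W \<Longrightarrow> (\<And>x s. x \<in> B \<Longrightarrow> s \<in> W \<Longrightarrow> f x s \<in> W) \<Longrightarrow> dco h t f \<in> W"
  by (simp add: dco_def)

lemma dco_cong:
  "h \<in> half \<Longrightarrow> t \<in> W \<Longrightarrow> (\<And>x s. x \<in> B \<Longrightarrow> s \<in> W \<Longrightarrow> f x s = g x s) \<Longrightarrow> dco h t f = dco h t g"
  by (simp add: dco_def)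

lemma dco_map:
  assumes "wlin g" "h \<in> half" "t \<in> W" "\<And>x s. x \<in> B \<Longrightarrow> s \<in> W \<Longrightarrow> f x s \<in> W"
  shows "g (dco h t f) = dco h t (\<lambda>x s. g (f x s))"
  using assms by (simp add: dco_def wlin_sum)

lemma dco_wlin:
  assumes "h \<in> half" "\<And>x. wlin (f x)" shows "wlin (\<lambda>t. dco h t f)"
  unfolding dco_def using lin_on_add[OF assms(2)] lin_on_scale[OF assms(2)] assms(1)
  by (intro lin_onI) (simp_all add: T_eqs sum.distrib fs.scale_sum_right)

text \<open>\<open>T_L_opposite\<close> in a form without coordinates: linearity of \<open>f\<close>
  in the coefficient contracts the sum over \<open>x\<close> of \<open>zeta x (a1 * y)\<close> with
  \<open>f x\<close> to \<open>f (a1 * y)\<close>.\<close>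

lemma dco_opposite:
  assumes f: "dlin f" and h: "h \<in> half" and t: "t \<in> W"
  shows "dco (kappa h) (L h a t) f = cop fscale a (\<lambda>a1 a2. dco (kappa h) t (\<lambda>y s. f (a1 * y) (L h a2 s)))"
proof -
  note k = kappa_half[OF h]
  have "dco (kappa h) (L h a t) f = (\<Sum>x\<in>B. cop fscale a (\<lambda>a1 a2. \<Sum>y\<in>B.
    fscale (zeta x (a1 * y)) (f x (L h a2 (T (kappa h) y t)))))"
    unfolding dco_def using h t k
    by (intro sum.cong HOL.refl) (simp add: T_L_opposite wlin_cop[OF dlin_wlin[OF f]] wlin_sum[OF dlin_wlin[OF f]]
      lin_on_scale[OF dlin_wlin[OF f]])
  also have "\<dots> = cop fscale a (\<lambda>a1 a2. \<Sum>y\<in>B. \<Sum>x\<in>B. fscale (zeta x (a1 * y)) (f x (L h a2 (T (kappa h) y t))))"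
    unfolding cop_sum[OF vector_space_fscale, symmetric]
    by (intro cop_cong) (rule sum.swap)
  also have "\<dots> = cop fscale a (\<lambda>a1 a2. dco (kappa h) t (\<lambda>y s. f (a1 * y) (L h a2 s)))"
    unfolding dco_def using f h t k
    by (intro cop_cong sum.cong HOL.refl hlin_expand[OF vector_space_fscale]) (auto simp: dlin_def)
  finally show ?thesis .
qed

lemma dco_same:
  assumes f: "dlin f" and h: "h \<in> half" and t: "t \<in> W"
  shows "dco h (L h a t) f = cop fscale a (\<lambda>a1 a2. dco h t (\<lambda>y s. f (y * antip H a2) (L h a1 s)))"
proof -
  have "dco h (L h a t) f = (\<Sum>x\<in>B. cop fscale a (\<lambda>a1 a2. \<Sum>y\<in>B.
    fscale (zeta x (y * antip H a2)) (f x (L h a1 (T h y t)))))"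
    unfolding dco_def using h t
    by (intro sum.cong HOL.refl) (simp add: T_L_same wlin_cop[OF dlin_wlin[OF f]] wlin_sum[OF dlin_wlin[OF f]]
      lin_on_scale[OF dlin_wlin[OF f]])
  also have "\<dots> = cop fscale a (\<lambda>a1 a2. \<Sum>y\<in>B. \<Sum>x\<in>B. fscale (zeta x (y * antip H a2)) (f x (L h a1 (T h y t))))"
    unfolding cop_sum[OF vector_space_fscale, symmetric]
    by (intro cop_cong) (rule sum.swap)
  also have "\<dots> = cop fscale a (\<lambda>a1 a2. dco h t (\<lambda>y s. f (y * antip H a2) (L h a1 s)))"
    unfolding dco_def using f h t
    by (intro cop_cong sum.cong HOL.refl hlin_expand[OF vector_space_fscale]) (auto simp: dlin_def)
  finally show ?thesis .
qed

lemma dco_L: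
  assumes "h \<in> half" "k \<in> half" "k \<notin> {h, kappa h}" "t \<in> W"
  shows "dco k (L h a t) f = dco k t (\<lambda>x s. f x (L h a s))"
  using assms by (simp add: dco_def T_L)

text \<open>Coassociativity of the coaction: two successive coactions of one half-edge split a
  single coefficient, the earlier one taking its first leg.\<close>

lemma dco_dco:
  assumes h: "h \<in> half" and t: "t \<in> W" and f: "\<And>u v. wlin (f u v)"
  shows "dco h t (\<lambda>u s. dco h s (\<lambda>v r. f u v r)) = dco h t (\<lambda>x s. cop fscale x (\<lambda>u v. f u v s))"
proof -
  have "dco h t (\<lambda>u s. dco h s (\<lambda>v r. f u v r)) =
      (\<Sum>u\<in>B. \<Sum>v\<in>B. \<Sum>x\<in>B. fscale (cc x u v) (f u v (T h x t)))"
    unfolding dco_def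
    by (intro sum.cong HOL.refl) (use h t in \<open>simp add: T_coassoc wlin_sum[OF f] lin_on_scale[OF f]\<close>)
  also have "\<dots> = (\<Sum>x\<in>B. \<Sum>u\<in>B. \<Sum>v\<in>B. fscale (cc x u v) (f u v (T h x t)))"
    by (subst sum.swap, subst (2) sum.swap) (rule HOL.refl)
  finally show ?thesis by (simp add: dco_def cop_def)
qed

lemma dco_counit:
  assumes "h \<in> half" "t \<in> W" "wlin g"
  shows "dco h t (\<lambda>x s. fscale (counit H x) (g s)) = g t"
proof -
  have "dco h t (\<lambda>x s. fscale (counit H x) (g s)) = g (\<Sum>x\<in>B. fscale (counit H x) (T h x t))"
    using assms by (simp add: dco_def wlin_sum lin_on_scale)
  then show ?thesis by (simp add: T_counit assms)
qed

lemma dco_commute: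
  assumes "h \<in> half" "k \<in> half" "h \<noteq> k" "t \<in> W"
  shows "dco h t (\<lambda>x s. dco k s (\<lambda>y r. f x y r)) = dco k t (\<lambda>y s. dco h s (\<lambda>x r. f x y r))"
proof -
  have "dco h t (\<lambda>x s. dco k s (\<lambda>y r. f x y r)) = (\<Sum>x\<in>B. \<Sum>y\<in>B. f x y (T h x (T k y t)))"
    unfolding dco_def by (intro sum.cong HOL.refl) (simp add: T_T[OF assms])
  also have "\<dots> = (\<Sum>y\<in>B. \<Sum>x\<in>B. f x y (T h x (T k y t)))" by (rule sum.swap)
  finally show ?thesis by (simp add: dco_def)
qed

lemma L_cop:
  "h \<in> half \<Longrightarrow> t \<in> W \<Longrightarrow> L h (cop (hscale H) a f) t = cop fscale a (\<lambda>x y. L h (f x y) t)"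
  by (rule cop_map_UNIV[OF vector_space_fscale vector_space_H L_hlin])

lemma dco_cop_fun:
  assumes "h \<in> half" "t \<in> W"
  shows "dco h t (\<lambda>x s. cop fscale a (\<lambda>u v. f u v x s)) = cop fscale a (\<lambda>u v. dco h t (f u v))"
  unfolding dco_def by (rule cop_sum[OF vector_space_fscale, symmetric])

lemma dco_scale_fun: "dco h t (\<lambda>x s. fscale c (f x s)) = fscale c (dco h t f)"
  by (simp add: dco_def fs.scale_sum_right)

end

section \<open>Slides intertwine the vertex actions and the face coactions\<close>

context graph_hilbert
begin

lemmas wl = L_wlin T_wlin

lemma wlin_add: "wlin f \<Longrightarrow> s \<in> W \<Longrightarrow> t \<in> W \<Longrightarrow> f (s + t) = f s + f t"
  and wlin_scale: "wlin f \<Longrightarrow> t \<in> W \<Longrightarrow> f (fscale c t) = fscale c (f t)"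
  by (auto simp: lin_on_def)

context
  fixes a b :: nat
  assumes ab: "a \<in> half" "b \<in> half" "a \<noteq> b" "kappa a \<noteq> b"
begin

lemma ab_distinct:
  "b \<noteq> a" "kappa b \<noteq> a" "a \<noteq> kappa b" "kappa a \<noteq> a" "a \<noteq> kappa a" "kappa b \<noteq> b" "b \<noteq> kappa b" "b \<noteq> kappa a"
  "kappa a \<in> half" "kappa b \<in> half"
proof -
  have k: "kappa a \<noteq> a" "kappa b \<noteq> b" using ab RK_facts(2)[OF G] by (simp_all add: kappa_neq)
  have "kappa b \<noteq> a" using ab(4) kappa_kappa[of b] by blast
  with k ab kappa_half show "b \<noteq> a" "kappa b \<noteq> a" "a \<noteq> kappa b" "kappa a \<noteq> a" "a \<noteq> kappa a"
    "kappa b \<noteq> b" "b \<noteq> kappa b" "b \<noteq> kappa a" "kappa a \<in> half" "kappa b \<in> half"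
    by (simp_all add: eq_commute)
qed

definition N :: "('m, 'k) mtensor \<Rightarrow> ('m, 'k) mtensor" where
  "N t = dco a t (L b)"

definition N' :: "('m, 'k) mtensor \<Rightarrow> ('m, 'k) mtensor" where
  "N' t = dco a t (\<lambda>x. L b (antip_inv H x))"

lemmas abd = ab ab_distinct

lemma dlin_L: "k \<in> half \<Longrightarrow> dlin (L k)"
  by (intro dlinI) (auto simp: L_eqs)

lemma N_wlin: "wlin N"
  unfolding N_def by (intro dco_wlin wl abd)

lemma N_in [simp]: "t \<in> W \<Longrightarrow> N t \<in> W"
  unfolding N_def by (simp add: abd)

lemma N'_in [simp]: "t \<in> W \<Longrightarrow> N' t \<in> W"
  unfolding N'_def by (simp add: abd)

lemma N_L_other:
  assumes "k \<in> half" "k \<notin> {a, kappa a, b}" "t \<in> W"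
  shows "N (L k x t) = L k x (N t)"
proof -
  have "a \<notin> {k, kappa k}" using assms(2) kappa_kappa[of k] by auto
  then have "N (L k x t) = dco a t (\<lambda>y s. L b y (L k x s))"
    unfolding N_def using assms \<open>a \<notin> {k, kappa k}\<close> by (intro dco_L) (simp_all add: abd)
  also have "\<dots> = dco a t (\<lambda>y s. L k x (L b y s))"
    using assms by (intro dco_cong) (auto simp: abd intro: L_L)
  also have "\<dots> = L k x (N t)"
    unfolding N_def using assms by (intro dco_map[symmetric] wl) (simp_all add: abd)
  finally show ?thesis .
qed

lemma N_L_b:
  assumes "t \<in> W"
  shows "N (L b x t) = dco a t (\<lambda>u r. L b (u * x) r)"
proof -
  have "N (L b x t) = dco a t (\<lambda>u r. L b u (L b x r))"
    unfolding N_def using assms by (intro dco_L) (simp_all add: abd)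
  also have "\<dots> = dco a t (\<lambda>u r. L b (u * x) r)"
    using assms by (intro dco_cong) (simp_all add: abd L_eqs)
  finally show ?thesis .
qed

text \<open>Absorption at the old place of \<open>b\<close> in its vertex. Passing the action of
  \<open>a\<close> through its coaction multiplies the coefficient by the antipode of a leg on the
  right; this cancels against the leg with which \<open>b\<close> acts.\<close>

lemma N_L_a_b:
  assumes t: "t \<in> W"
  shows "cop fscale y (\<lambda>x1 x2. N (L b x2 (L a x1 t))) = L a y (N t)"
proof -
  have d: "dlin (\<lambda>u r. L b (u * x) r)" for x
    by (intro dlinI) (simp_all add: abd L_eqs distrib_right scale_mult_left)
  have d2: "dlin (\<lambda>u s. L b u (L a x s))" for x
    by (intro dlinI) (simp_all add: abd L_eqs)
  have "cop fscale y (\<lambda>x1 x2. N (L b x2 (L a x1 t))) =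
      cop fscale y (\<lambda>x1 x2. cop fscale x1 (\<lambda>p q. dco a t (\<lambda>u s. L b (u * antip H q * x2) (L a p s))))"
    using t by (simp add: abd N_L_b dco_same[OF d])
  also have "\<dots> = cop fscale y (\<lambda>p z. cop fscale z (\<lambda>q x2. dco a t (\<lambda>u s. L b (u * antip H q * x2) (L a p s))))"
    by (rule cop_coassoc[OF vector_space_fscale])
  also have "\<dots> = cop fscale y (\<lambda>p z. fscale (counit H z) (dco a t (\<lambda>u s. L b u (L a p s))))"
  proof (rule cop_cong)
    fix p z
    have "cop fscale z (\<lambda>q x2. dco a t (\<lambda>u s. L b (u * antip H q * x2) (L a p s))) =
        dco a t (\<lambda>u s. cop fscale z (\<lambda>q x2. L b (u * antip H q * x2) (L a p s)))"
      by (rule dco_cop_fun[symmetric]) (use t in \<open>simp_all add: abd\<close>)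
    also have "\<dots> = dco a t (\<lambda>u s. fscale (counit H z) (L b u (L a p s)))"
    proof (rule dco_cong)
      fix u s assume s: "s \<in> W"
      have "cop fscale z (\<lambda>q x2. L b (u * antip H q * x2) (L a p s)) =
          L b (u * cop (hscale H) z (\<lambda>q x2. antip H q * x2)) (L a p s)"
        using s by (simp add: abd copH_mult_left L_cop mult.assoc)
      then show "cop fscale z (\<lambda>q x2. L b (u * antip H q * x2) (L a p s)) = fscale (counit H z) (L b u (L a p s))"
        using s by (simp add: abd cop_antip_left scale_mult_right L_eqs(4))
    qed (use t in \<open>simp_all add: abd\<close>)
    finally show "cop fscale z (\<lambda>q x2. dco a t (\<lambda>u s. L b (u * antip H q * x2) (L a p s))) =
        fscale (counit H z) (dco a t (\<lambda>u s. L b u (L a p s)))"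
      by (simp add: dco_scale_fun)
  qed
  also have "\<dots> = dco a t (\<lambda>u s. L b u (L a y s))"
  proof (rule cop_counit_right[OF vector_space_fscale])
    show "hlin fscale (\<lambda>p. dco a t (\<lambda>u s. L b u (L a p s)))"
      unfolding dco_def using t by (intro lin_onI) (simp_all add: abd L_eqs sum.distrib fs.scale_sum_right)
  qed
  also have "\<dots> = dco a t (\<lambda>u s. L a y (L b u s))"
    using t by (intro dco_cong) (auto simp: abd intro: L_L)
  also have "\<dots> = L a y (N t)"
    unfolding N_def using t by (intro dco_map[symmetric] wl) (simp_all add: abd)
  finally show ?thesis .
qed

text \<open>Release at the new place of \<open>b\<close>. The action of \<kappa>(a) multiplies the
  coefficient of the coaction of \<open>a\<close> by \<open>x1\<close> from the left, and
  multiplicativity of \<open>L b\<close> splits this off as a separate action of \<open>b\<close>,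
  performed before that of \<kappa>(a).\<close>

lemma N_L_kappa_a:
  assumes t: "t \<in> W"
  shows "N (L (kappa a) y t) = cop fscale y (\<lambda>x1 x2. L (kappa a) x2 (L b x1 (N t)))"
proof -
  have "N (L (kappa a) y t) = cop fscale y (\<lambda>x1 x2. dco a t (\<lambda>u s. L b (x1 * u) (L (kappa a) x2 s)))"
    using dco_opposite[OF dlin_L[of b], of "kappa a" t y] t by (simp add: abd N_def)
  also have "\<dots> = cop fscale y (\<lambda>x1 x2. dco a t (\<lambda>u s. L (kappa a) x2 (L b x1 (L b u s))))"
  proof (intro cop_cong dco_cong)
    fix x1 x2 u s assume s: "s \<in> W"
    have "L b (x1 * u) (L (kappa a) x2 s) = L (kappa a) x2 (L b (x1 * u) s)"
      using s by (intro L_L) (simp_all add: abd)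
    then show "L b (x1 * u) (L (kappa a) x2 s) = L (kappa a) x2 (L b x1 (L b u s))"
      using s by (simp add: abd L_eqs(5))
  qed (use t in \<open>simp_all add: abd\<close>)
  also have "\<dots> = cop fscale y (\<lambda>x1 x2. L (kappa a) x2 (L b x1 (N t)))"
  proof (intro cop_cong)
    fix x1 x2
    have "wlin (\<lambda>s. L (kappa a) x2 (L b x1 s))"
      by (simp_all add: abd lin_on_def L_eqs)
    from dco_map[OF this abd(1) t, of "L b"] abd
    show "dco a t (\<lambda>u s. L (kappa a) x2 (L b x1 (L b u s))) = L (kappa a) x2 (L b x1 (N t))"
      by (simp add: N_def)
  qed
  finally show ?thesis .
qed

lemma N_T_other:
  assumes k: "k \<in> half" "k \<notin> {a, b, kappa b}" and t: "t \<in> W" and x: "x \<in> B"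
  shows "N (T k x t) = T k x (N t)"
proof -
  have "N (T k x t) = dco a t (\<lambda>y s. T k x (L b y s))"
    unfolding N_def dco_def using k t x
    by (intro sum.cong HOL.refl) (simp add: abd T_T[of a k] T_L)
  also have "\<dots> = T k x (N t)"
    unfolding N_def using t k by (intro dco_map[symmetric] wl) (simp_all add: abd)
  finally show ?thesis .
qed

lemma dco_N_other:
  assumes "k \<in> half" "k \<notin> {a, b, kappa b}" "t \<in> W"
  shows "dco k (N t) f = dco k t (\<lambda>x s. f x (N s))"
  using assms by (simp add: dco_def N_T_other)

lemma dlin_left: "dlin f \<Longrightarrow> dlin (\<lambda>y. f (y * x))"
  by (rule dlinI; simp add: dlin_eqs distrib_right scale_mult_left)

lemma dco_N:
  assumes "\<And>x. wlin (g x)" "k \<in> half" "t \<in> W"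
  shows "dco k (N t) g = dco a t (\<lambda>u s. dco k (L b u s) g)"
  using dco_map[OF dco_wlin[OF assms(2,1)] ab(1) assms(3), of "L b"] assms by (simp add: abd N_def)

text \<open>Absorption at the old place of \<open>a\<close> in its face. The half-edges
  \<open>b\<close> and \<kappa>(b) are opposite ends of an edge, so one leg of the coefficient in
  \<open>N\<close> goes to the coaction of \<kappa>(b) and the other stays with \<open>L b\<close>.
  Coassociativity turns this splitting into a further coaction of \<open>a\<close>.\<close>

lemma dco_N_kappa_b:
  assumes f: "dlin f" and t: "t \<in> W"
  shows "dco (kappa b) (N t) f = dco (kappa b) t (\<lambda>x s. dco a s (\<lambda>y r. f (y * x) (N r)))"
proof -
  note fl = dlin_wlin[OF f]
  have w: "wlin (\<lambda>s. dco (kappa b) s (\<lambda>x r. f (p * x) (L b q r)))" for p q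
    by (intro dco_wlin) (simp_all add: abd lin_on_def L_eqs wlin_add[OF fl] wlin_scale[OF fl])
  have "dco (kappa b) (N t) f = dco a t (\<lambda>u s. dco (kappa b) (L b u s) f)"
    by (rule dco_N[OF fl _ t]) (simp_all add: abd)
  also have "\<dots> = dco a t (\<lambda>u s. cop fscale u (\<lambda>p q. dco (kappa b) s (\<lambda>x r. f (p * x) (L b q r))))"
    using t by (intro dco_cong dco_opposite[OF f]) (simp_all add: abd)
  also have "\<dots> = dco a t (\<lambda>p s. dco a s (\<lambda>q r. dco (kappa b) r (\<lambda>x v. f (p * x) (L b q v))))"
    using t by (intro dco_dco[symmetric] w) (simp_all add: abd)
  also have "\<dots> = dco a t (\<lambda>p s. dco (kappa b) s (\<lambda>x r. dco a r (\<lambda>q v. f (p * x) (L b q v))))"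
    using t by (intro dco_cong dco_commute) (simp_all add: abd)
  also have "\<dots> = dco (kappa b) t (\<lambda>x s. dco a s (\<lambda>p r. dco a r (\<lambda>q v. f (p * x) (L b q v))))"
    using t by (intro dco_commute) (simp_all add: abd)
  also have "\<dots> = dco (kappa b) t (\<lambda>x s. dco a s (\<lambda>y r. f (y * x) (N r)))"
    unfolding N_def using t by (intro dco_cong dco_map[symmetric] fl) (simp_all add: abd)
  finally show ?thesis .
qed

text \<open>The coaction in \<open>N\<close> and the one following it are both those of
  \<open>a\<close>, so they share one coefficient: its first leg acts by \<open>L b\<close>, its
  second goes to \<open>g\<close>.\<close>

lemma dco_N_a_L:
  assumes g: "\<And>x. wlin (g x)" and t: "t \<in> W"
  shows "dco a (N t) g = dco a t (\<lambda>z s. cop fscale z (\<lambda>w u. g u (L b w s)))"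
proof -
  have "dco a (N t) g = dco a t (\<lambda>w s. dco a (L b w s) g)"
    by (rule dco_N[OF g _ t]) (simp_all add: abd)
  also have "\<dots> = dco a t (\<lambda>w s. dco a s (\<lambda>u r. g u (L b w r)))"
    using t by (intro dco_cong dco_L) (simp_all add: abd)
  also have "\<dots> = dco a t (\<lambda>z s. cop fscale z (\<lambda>w u. g u (L b w s)))"
    using t by (intro dco_dco) (simp_all add: abd lin_on_def L_eqs wlin_add[OF g] wlin_scale[OF g])
  finally show ?thesis .
qed

text \<open>The face counterpart at the new place of \<open>a\<close>. Moving the coaction of
  \<open>b\<close> past \<open>L b\<close> yields an antipode factor on the right, which cancels the
  coefficient of the coaction of \<open>a\<close>; only the coaction of \<open>b\<close> before the
  slide remains.\<close>

lemma dco_N_a_b: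
  assumes f: "dlin f" and t: "t \<in> W"
  shows "dco a (N t) (\<lambda>u s. dco b s (\<lambda>v r. f (v * u) r)) = dco b t (\<lambda>y s. f y (N s))"
proof -
  note fl = dlin_wlin[OF f]
  have w: "wlin (\<lambda>s. dco b s (\<lambda>v r. f (v * u) r))" for u
    by (intro dco_wlin fl) (simp_all add: abd)
  have "dco a (N t) (\<lambda>u s. dco b s (\<lambda>v r. f (v * u) r)) =
      dco a t (\<lambda>z s. cop fscale z (\<lambda>w u. dco b (L b w s) (\<lambda>v r. f (v * u) r)))"
    by (rule dco_N_a_L[OF w t])
  also have "\<dots> = dco a t (\<lambda>z s. dco b s (\<lambda>y r. f y (L b z r)))"
  proof (rule dco_cong)
    fix z s assume s: "s \<in> W"
    have "cop fscale z (\<lambda>w u. dco b (L b w s) (\<lambda>v r. f (v * u) r)) =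
        cop fscale z (\<lambda>w u. cop fscale w (\<lambda>p q. dco b s (\<lambda>y r. f (y * antip H q * u) (L b p r))))"
      using s by (intro cop_cong dco_same dlin_left f) (simp_all add: abd)
    also have "\<dots> = cop fscale z (\<lambda>p z'. cop fscale z' (\<lambda>q u. dco b s (\<lambda>y r. f (y * antip H q * u) (L b p r))))"
      by (rule cop_coassoc[OF vector_space_fscale])
    also have "\<dots> = cop fscale z (\<lambda>p z'. fscale (counit H z') (dco b s (\<lambda>y r. f y (L b p r))))"
    proof (rule cop_cong)
      fix p z'
      have "cop fscale z' (\<lambda>q u. dco b s (\<lambda>y r. f (y * antip H q * u) (L b p r))) =
          dco b s (\<lambda>y r. cop fscale z' (\<lambda>q u. f (y * antip H q * u) (L b p r)))"
        by (rule dco_cop_fun[symmetric]) (use s in \<open>simp_all add: abd\<close>)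
      also have "\<dots> = dco b s (\<lambda>y r. fscale (counit H z') (f y (L b p r)))"
      proof (rule dco_cong)
        fix y r assume r: "r \<in> W"
        have h: "hlin fscale (\<lambda>x. f x (L b p r))" using f r by (simp add: abd dlin_def)
        have "cop fscale z' (\<lambda>q u. f (y * antip H q * u) (L b p r)) =
            f (y * cop (hscale H) z' (\<lambda>q u. antip H q * u)) (L b p r)"
          unfolding copH_mult_left cop_map_UNIV[OF vector_space_fscale vector_space_H h]
          by (simp add: mult.assoc)
        then show "cop fscale z' (\<lambda>q u. f (y * antip H q * u) (L b p r)) = fscale (counit H z') (f y (L b p r))"
          using r by (simp add: abd cop_antip_left scale_mult_right dlin_eqs[OF f])
      qed (use s in \<open>simp_all add: abd\<close>)
      finally show "cop fscale z' (\<lambda>q u. dco b s (\<lambda>y r. f (y * antip H q * u) (L b p r))) =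
          fscale (counit H z') (dco b s (\<lambda>y r. f y (L b p r)))"
        by (simp add: dco_scale_fun)
    qed
    also have "\<dots> = dco b s (\<lambda>y r. f y (L b z r))"
    proof (rule cop_counit_right[OF vector_space_fscale])
      show "hlin fscale (\<lambda>p. dco b s (\<lambda>y r. f y (L b p r)))"
        unfolding dco_def using s         by (intro lin_onI) (simp_all add: abd L_eqs dlin_eqs[OF f] sum.distrib fs.scale_sum_right)
    qed
    finally show "cop fscale z (\<lambda>w u. dco b (L b w s) (\<lambda>v r. f (v * u) r)) = dco b s (\<lambda>y r. f y (L b z r))" .
  qed (use t in \<open>simp_all add: abd\<close>)
  also have "\<dots> = dco b t (\<lambda>y s. dco a s (\<lambda>z r. f y (L b z r)))"
    using t by (intro dco_commute) (simp_all add: abd)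
  also have "\<dots> = dco b t (\<lambda>y s. f y (N s))"
    unfolding N_def using t by (intro dco_cong dco_map[symmetric] fl) (simp_all add: abd)
  finally show ?thesis .
qed

text \<open>The two coactions of \<open>a\<close> split one coefficient \<open>z\<close>, and
  \<open>S^-1(z_(2)) z_(1)\<close> is a scalar by \<open>cop_antip_inv_left\<close>.\<close>

lemma N'_N:
  assumes t: "t \<in> W"
  shows "N' (N t) = t"
proof -
  have "N' (N t) = dco a t (\<lambda>z s. cop fscale z (\<lambda>w u. L b (antip_inv H u) (L b w s)))"
    unfolding N'_def by (rule dco_N_a_L[OF _ t]) (use wl in \<open>simp_all add: abd\<close>)
  also have "\<dots> = dco a t (\<lambda>z s. fscale (counit H z) s)"
  proof (rule dco_cong)
    fix z s assume s: "s \<in> W"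
    have "cop fscale z (\<lambda>w u. L b (antip_inv H u) (L b w s)) = L b (cop (hscale H) z (\<lambda>w u. antip_inv H u * w)) s"
      using s by (simp add: abd L_cop L_eqs(5))
    then show "cop fscale z (\<lambda>w u. L b (antip_inv H u) (L b w s)) = fscale (counit H z) s"
      using s by (simp add: abd cop_antip_inv_left L_eqs)
  qed (use t in \<open>simp_all add: abd\<close>)
  also have "\<dots> = t"
    by (rule dco_counit[where g = "\<lambda>s. s"]) (use t in \<open>simp_all add: abd lin_on_def\<close>)
  finally show ?thesis .
qed

text \<open>As before, with \<open>z_(2) S^-1(z_(1))\<close> and
  \<open>cop_antip_inv_right\<close>.\<close>

lemma N_N':
  assumes t: "t \<in> W"
  shows "N (N' t) = t"
proof -
  have "N (N' t) = dco a t (\<lambda>w s. N (L b (antip_inv H w) s))"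
    unfolding N'_def using dco_map[OF N_wlin ab(1) t, of "\<lambda>x. L b (antip_inv H x)"] t by (simp add: abd)
  also have "\<dots> = dco a t (\<lambda>w s. dco a s (\<lambda>u r. L b u (L b (antip_inv H w) r)))"
    unfolding N_def using t by (intro dco_cong dco_L) (simp_all add: abd)
  also have "\<dots> = dco a t (\<lambda>z s. cop fscale z (\<lambda>w u. L b u (L b (antip_inv H w) s)))"
    using t by (intro dco_dco) (simp_all add: abd lin_on_def L_eqs)
  also have "\<dots> = dco a t (\<lambda>z s. fscale (counit H z) s)"
  proof (rule dco_cong)
    fix z s assume s: "s \<in> W"
    have "cop fscale z (\<lambda>w u. L b u (L b (antip_inv H w) s)) = L b (cop (hscale H) z (\<lambda>w u. u * antip_inv H w)) s"
      using s by (simp add: abd L_cop L_eqs(5))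
    then show "cop fscale z (\<lambda>w u. L b u (L b (antip_inv H w) s)) = fscale (counit H z) s"
      using s by (simp add: abd cop_antip_inv_right L_eqs)
  qed (use t in \<open>simp_all add: abd\<close>)
  also have "\<dots> = t"
    by (rule dco_counit[where g = "\<lambda>s. s"]) (use t in \<open>simp_all add: abd lin_on_def\<close>)
  finally show ?thesis .
qed

end

subsection \<open>Iterated actions and coactions along lists of half-edges\<close>

abbreviation "LP \<equiv> L_prod H M G"

declare L_prod.simps(2) [simp del]

text \<open>One common induction: the recursive equation of \<open>L_prod\<close> is a
  \<open>lin_ext\<close>, which can be evaluated only once the tail is known to be linear in both
  the state and the algebra element.\<close>

lemma LP_props:
  assumes "set hs \<subseteq> half"
  shows "t \<in> W \<Longrightarrow> LP hs a t \<in> W" "wlin (LP hs a)" "t \<in> W \<Longrightarrow> hlin fscale (\<lambda>a. LP hs a t)"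
    "t \<in> W \<Longrightarrow> hs = h # hs' \<Longrightarrow> LP hs a t = cop fscale a (\<lambda>a1 a'. LP hs' a' (L h a1 t))"
proof -
  have "(\<forall>a. \<forall>t\<in>W. LP hs a t \<in> W) \<and> (\<forall>a. wlin (LP hs a)) \<and> (\<forall>t\<in>W. hlin fscale (\<lambda>a. LP hs a t)) \<and>
    (\<forall>h hs' a. \<forall>t\<in>W. hs = h # hs' \<longrightarrow> LP hs a t = cop fscale a (\<lambda>a1 a'. LP hs' a' (L h a1 t)))"
    using assms
  proof (induction hs)
    case Nil
    then show ?case
      by (auto simp: lin_on_def fs.scale_right_distrib fs.scale_left_distrib counit_add counit_scale mult.commute)
  next
    case (Cons h hs)
    then have h: "h \<in> half" and IH: "\<And>a t. t \<in> W \<Longrightarrow> LP hs a t \<in> W" "\<And>a. wlin (LP hs a)"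
      "\<And>t. t \<in> W \<Longrightarrow> hlin fscale (\<lambda>a. LP hs a t)" by auto
    note e = wlin_add[OF IH(2)] wlin_scale[OF IH(2)] lin_on_add[OF IH(3)] lin_on_scale[OF IH(3)]
    have eq: "LP (h # hs) a t = cop fscale a (\<lambda>a1 a'. LP hs a' (L h a1 t))" if "t \<in> W" for a t
    proof -
      have "blin fscale (\<lambda>a1 a'. LP hs a' (L h a1 t))"
        using that h by (auto simp: blin_def lin_on_def e L_eqs)
      from lin_ext_comult[OF vector_space_fscale this] show ?thesis by (simp add: L_prod.simps(2))
    qed
    have "LP (h # hs) a t \<in> W" if "t \<in> W" for a t
      unfolding eq[OF that] using that h IH(1) by simp
    moreover have "wlin (LP (h # hs) a)" for a
      using h by (intro lin_onI) (simp_all add: eq L_eqs e cop_add_fun[OF vector_space_fscale]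
        cop_scale_fun[OF vector_space_fscale])
    moreover have "hlin fscale (\<lambda>a. LP (h # hs) a t)" if "t \<in> W" for t
      unfolding eq[OF that] by (rule cop_hlin[OF vector_space_fscale])
    ultimately show ?case using eq by simp
  qed
  then show "t \<in> W \<Longrightarrow> LP hs a t \<in> W" "wlin (LP hs a)" "t \<in> W \<Longrightarrow> hlin fscale (\<lambda>a. LP hs a t)"
    "t \<in> W \<Longrightarrow> hs = h # hs' \<Longrightarrow> LP hs a t = cop fscale a (\<lambda>a1 a'. LP hs' a' (L h a1 t))"
    by blast+
qed

lemmas LP_Cons = LP_props(4)[OF _ _ HOL.refl]

lemma LP_commute:
  assumes "set hs \<subseteq> half" "set ks \<subseteq> half" "set hs \<inter> set ks = {}" "t \<in> W"
  shows "LP hs a (LP ks b t) = LP ks b (LP hs a t)"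
proof -
  have 1: "LP ks b (L h a t) = L h a (LP ks b t)" if "h \<in> half" "h \<notin> set ks" "t \<in> W" for h a b t
    using assms(2) that
  proof (induction ks arbitrary: b t)
    case Nil
    then show ?case by (simp add: L_eqs)
  next
    case (Cons k ks)
    have "LP (k # ks) b (L h a t) = cop fscale b (\<lambda>b1 b'. LP ks b' (L k b1 (L h a t)))"
      using Cons.prems by (intro LP_Cons) auto
    also have "\<dots> = cop fscale b (\<lambda>b1 b'. L h a (LP ks b' (L k b1 t)))"
      using Cons.prems by (intro cop_cong) (simp add: L_L[of k h] Cons.IH)
    also have "\<dots> = L h a (cop fscale b (\<lambda>b1 b'. LP ks b' (L k b1 t)))"
      using Cons.prems LP_props(1)[of ks] by (intro wlin_cop[symmetric] L_wlin) auto
    also have "cop fscale b (\<lambda>b1 b'. LP ks b' (L k b1 t)) = LP (k # ks) b t"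
      using Cons.prems by (intro LP_Cons[symmetric]) auto
    finally show ?case .
  qed
  show ?thesis
    using assms
  proof (induction hs arbitrary: a t)
    case Nil
    then show ?case using wlin_scale[OF LP_props(2)[of ks]] by simp
  next
    case (Cons h hs)
    note p = LP_props[of ks] LP_props[of hs]
    have "LP (h # hs) a (LP ks b t) = cop fscale a (\<lambda>a1 a'. LP hs a' (L h a1 (LP ks b t)))"
      using Cons.prems p by (intro LP_Cons) auto
    also have "\<dots> = cop fscale a (\<lambda>a1 a'. LP ks b (LP hs a' (L h a1 t)))"
      using Cons.prems by (intro cop_cong) (simp add: 1[symmetric] Cons.IH)
    also have "\<dots> = LP ks b (cop fscale a (\<lambda>a1 a'. LP hs a' (L h a1 t)))"
      using Cons.prems p by (intro wlin_cop[symmetric]) auto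
    also have "cop fscale a (\<lambda>a1 a'. LP hs a' (L h a1 t)) = LP (h # hs) a t"
      using Cons.prems by (intro LP_Cons[symmetric]) auto
    finally show ?case .
  qed
qed

text \<open>
  The coaction components multiply in reverse order, since \<open>T\<^bsub>k\<^sub>1\<^esub>\<close> in a face coaction receives the last
  factor \<open>\<alpha>\<^sub>(\<^sub>j\<^sub>)\<close>.
\<close>

primrec TL ::
  "nat list \<Rightarrow> ('m, 'k) mtensor \<Rightarrow> ('h \<Rightarrow> ('m, 'k) mtensor \<Rightarrow> ('m, 'k) mtensor) \<Rightarrow>
   ('m, 'k) mtensor" where
  "TL [] t f = f 1 t"
| "TL (k # ks) t f = dco k t (\<lambda>x s. TL ks s (\<lambda>y r. f (y * x) r))"

text \<open>\<open>T_prod\<close> pairs the half-edges with the reversed word of basis elements. The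
  first half-edge thus takes the last letter \<open>x\<close>, and the rest is the same expression
  for the functional \<open>y \<mapsto> \<alpha>(y x)\<close>.\<close>

lemma T_prod_TL: "T_prod H B M G ks \<alpha> t = TL ks t (\<lambda>y r. fscale (\<alpha> y) r)"
proof (induction ks arbitrary: \<alpha> t)
  case Nil
  have "{bs. set bs \<subseteq> B \<and> length bs = 0} = {[]}" by auto
  then show ?case by (simp add: T_prod_def)
next
  case (Cons k ks)
  let ?A = "{bs. set bs \<subseteq> B \<and> length bs = length ks}"
  let ?F = "\<lambda>bs s. fold (\<lambda>(k, b). T_op H M G k (zeta b)) (zip ks (rev bs)) s"
  have bij: "bij_betw (\<lambda>(x, bs). bs @ [x]) (B \<times> ?A) {bs. set bs \<subseteq> B \<and> length bs = length (k # ks)}"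
  proof (rule bij_betw_imageI)
    show "inj_on (\<lambda>(x, bs). bs @ [x]) (B \<times> ?A)" by (auto simp: inj_on_def)
    show "(\<lambda>(x, bs). bs @ [x]) ` (B \<times> ?A) = {bs. set bs \<subseteq> B \<and> length bs = length (k # ks)}"
    proof (intro equalityI subsetI)
      fix bs assume bs: "bs \<in> {bs. set bs \<subseteq> B \<and> length bs = length (k # ks)}"
      then have "bs \<noteq> []" by auto
      then obtain ys y where "bs = ys @ [y]" by (metis rev_exhaust)
      then show "bs \<in> (\<lambda>(x, bs). bs @ [x]) ` (B \<times> ?A)"
        using bs by (intro image_eqI[of _ _ "(y, ys)"]) auto
    qed auto
  qed
  have "T_prod H B M G (k # ks) \<alpha> t = (\<Sum>(x, bs)\<in>B \<times> ?A. fscale (\<alpha> (prod_list (bs @ [x])))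
      (fold (\<lambda>(k, b). T_op H M G k (zeta b)) (zip (k # ks) (rev (bs @ [x]))) t))"
    unfolding T_prod_def sum.reindex_bij_betw[OF bij, symmetric] by (simp only: case_prod_unfold)
  also have "\<dots> = (\<Sum>x\<in>B. \<Sum>bs\<in>?A. fscale (\<alpha> (prod_list bs * x)) (?F bs (T k x t)))"
    unfolding sum.cartesian_product[symmetric] by simp
  also have "\<dots> = (\<Sum>x\<in>B. T_prod H B M G ks (\<lambda>y. \<alpha> (y * x)) (T k x t))"
    by (simp add: T_prod_def)
  also have "\<dots> = TL (k # ks) t (\<lambda>y r. fscale (\<alpha> y) r)"
    by (simp add: Cons.IH dco_def)
  finally show ?case .
qed

lemma TL_cong:
  assumes "set ks \<subseteq> half" "t \<in> W" "\<And>y r. r \<in> W \<Longrightarrow> f y r = g y r"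
  shows "TL ks t f = TL ks t g"
  using assms
proof (induction ks arbitrary: t f g)
  case (Cons k ks)
  have "TL ks s (\<lambda>y r. f (y * x) r) = TL ks s (\<lambda>y r. g (y * x) r)" if "s \<in> W" for s x
    by (rule Cons.IH) (use Cons.prems that in simp_all)
  then show ?case using Cons.prems by (simp add: dco_def)
qed simp

lemma TL_in:
  assumes "set ks \<subseteq> half" "t \<in> W" "\<And>y r. r \<in> W \<Longrightarrow> f y r \<in> W"
  shows "TL ks t f \<in> W"
  using assms
proof (induction ks arbitrary: t f)
  case (Cons k ks)
  have "TL ks s (\<lambda>y r. f (y * x) r) \<in> W" if "s \<in> W" for s x
    by (rule Cons.IH) (use Cons.prems that in simp_all)
  then show ?case using Cons.prems by simp
qed simp

lemma TL_wlin:
  assumes "set ks \<subseteq> half" "\<And>y. wlin (f y)"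
  shows "wlin (\<lambda>t. TL ks t f)"
  using assms
proof (induction ks arbitrary: f)
  case (Cons k ks)
  have "wlin (\<lambda>s. TL ks s (\<lambda>y r. f (y * x) r))" for x
    by (rule Cons.IH) (use Cons.prems in simp_all)
  then show ?case unfolding TL.simps using Cons.prems(1) by (intro dco_wlin) simp_all
qed simp

lemma TL_add_fun: "TL ks t (\<lambda>y r. f y r + g y r) = TL ks t f + TL ks t g"
  by (induction ks arbitrary: t f g) (auto simp: dco_def sum.distrib)

lemma TL_scale_fun: "TL ks t (\<lambda>y r. fscale c (f y r)) = fscale c (TL ks t f)"
  by (induction ks arbitrary: t f) (auto simp: dco_def fs.scale_sum_right)

lemma TL_map:
  assumes "set ks \<subseteq> half" "t \<in> W" "wlin g" "\<And>y r. r \<in> W \<Longrightarrow> f y r \<in> W"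
  shows "g (TL ks t f) = TL ks t (\<lambda>y r. g (f y r))"
  using assms(1,2,4)
proof (induction ks arbitrary: t f)
  case (Cons k ks)
  have "g (TL ks s (\<lambda>y r. f (y * x) r)) = TL ks s (\<lambda>y r. g (f (y * x) r))" if "s \<in> W" for s x
    by (rule Cons.IH) (use Cons.prems that in simp_all)
  moreover have "TL ks s (\<lambda>y r. f (y * x) r) \<in> W" if "s \<in> W" for s x
    by (rule TL_in) (use Cons.prems that in simp_all)
  ultimately show ?case
    using Cons.prems dco_map[OF assms(3), of k t "\<lambda>x s. TL ks s (\<lambda>y r. f (y * x) r)"]
    by (simp add: dco_def)
qed simp

lemma TL_dlin:
  assumes "set ks \<subseteq> half" "dlin f"
  shows "dlin (\<lambda>x t. TL ks t (\<lambda>y r. f (y * x) r))"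
proof (rule dlinI)
  have w: "wlin (\<lambda>t. TL ks t (\<lambda>y. f (y * x)))" for x
    by (rule TL_wlin[OF assms(1)]) (rule dlin_wlin[OF assms(2)])
  fix x s t assume "s \<in> W" "t \<in> W"
  then show "TL ks (s + t) (\<lambda>y. f (y * x)) = TL ks s (\<lambda>y. f (y * x)) + TL ks t (\<lambda>y. f (y * x))"
    by (rule wlin_add[OF w])
next
  have w: "wlin (\<lambda>t. TL ks t (\<lambda>y. f (y * x)))" for x
    by (rule TL_wlin[OF assms(1)]) (rule dlin_wlin[OF assms(2)])
  fix x c t assume "t \<in> W"
  then show "TL ks (fscale c t) (\<lambda>y. f (y * x)) = fscale c (TL ks t (\<lambda>y. f (y * x)))"
    by (rule wlin_scale[OF w])
next
  fix x y t assume t: "t \<in> W"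
  have "TL ks t (\<lambda>z r. f (z * (x + y)) r) = TL ks t (\<lambda>z r. f (z * x) r + f (z * y) r)"
    by (rule TL_cong[OF assms(1) t]) (simp add: distrib_left dlin_eqs[OF assms(2)])
  then show "TL ks t (\<lambda>z r. f (z * (x + y)) r) = TL ks t (\<lambda>z r. f (z * x) r) + TL ks t (\<lambda>z r. f (z * y) r)"
    by (simp add: TL_add_fun)
next
  fix x c t assume t: "t \<in> W"
  have "TL ks t (\<lambda>z r. f (z * hscale H c x) r) = TL ks t (\<lambda>z r. fscale c (f (z * x) r))"
    by (rule TL_cong[OF assms(1) t]) (simp add: scale_mult_right dlin_eqs[OF assms(2)])
  then show "TL ks t (\<lambda>z r. f (z * hscale H c x) r) = fscale c (TL ks t (\<lambda>z r. f (z * x) r))"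
    by (simp add: TL_scale_fun)
qed

lemma dlin_fscale: "hlin (*) \<alpha> \<Longrightarrow> dlin (\<lambda>y r. fscale (\<alpha> y) r)"
  by (rule dlinI) (auto simp: lin_on_def fs.scale_right_distrib fs.scale_left_distrib mult.commute)

lemma TL_commute:
  assumes "set ks \<subseteq> half" "set ls \<subseteq> half" "set ks \<inter> set ls = {}" "t \<in> W"
  shows "TL ks t (\<lambda>y r. TL ls r (\<lambda>z s. f y z s)) = TL ls t (\<lambda>z r. TL ks r (\<lambda>y s. f y z s))"
proof -
  have 1: "dco k t (\<lambda>x s. TL ls s (\<lambda>z r. f x z r)) = TL ls t (\<lambda>z r. dco k r (\<lambda>x s. f x z s))"
    if "k \<in> half" "k \<notin> set ls" "t \<in> W" for k t f
    using assms(2) that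
  proof (induction ls arbitrary: t f)
    case (Cons l ls)
    have "dco k t (\<lambda>x s. TL (l # ls) s (\<lambda>z r. f x z r)) =
        dco l t (\<lambda>w s. dco k s (\<lambda>x r. TL ls r (\<lambda>z q. f x (z * w) q)))"
      unfolding TL.simps using Cons.prems by (intro dco_commute) auto
    also have "\<dots> = dco l t (\<lambda>w s. TL ls s (\<lambda>z r. dco k r (\<lambda>x q. f x (z * w) q)))"
      using Cons.prems by (intro dco_cong Cons.IH) auto
    finally show ?case by simp
  qed simp
  show ?thesis
    using assms
  proof (induction ks arbitrary: t f)
    case (Cons k ks)
    have "TL (k # ks) t (\<lambda>y r. TL ls r (\<lambda>z s. f y z s)) =
        dco k t (\<lambda>x s. TL ls s (\<lambda>z r. TL ks r (\<lambda>y q. f (y * x) z q)))"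
      unfolding TL.simps using Cons.prems by (intro dco_cong Cons.IH) auto
    also have "\<dots> = TL ls t (\<lambda>z r. dco k r (\<lambda>x s. TL ks s (\<lambda>y q. f (y * x) z q)))"
      using Cons.prems by (intro 1) auto
    finally show ?case by simp
  qed simp
qed

context
  fixes a b :: nat
  assumes ab: "a \<in> half" "b \<in> half" "a \<noteq> b" "kappa a \<noteq> b"
begin

lemmas abd' = ab ab_distinct[OF ab]

text \<open>Induction along \<open>move\<close>, with one exchange rule per case:
  \<open>N_L_other\<close> for a kept half-edge, \<open>N_L_a_b\<close> for the removal of
  \<open>b\<close>, \<open>N_L_kappa_a\<close> for its insertion.\<close>

lemma N_LP:
  assumes "move a b (kappa a) xs ys" "set xs \<subseteq> half" "t \<in> W"
  shows "N a b (LP xs x t) = LP ys x (N a b t)"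
proof -
  note Nw = N_wlin[OF ab] and Nin = N_in[OF ab]
  have sub: "set ys \<subseteq> half" if "move a b (kappa a) xs ys" "set xs \<subseteq> half" for xs ys
    using move_set[OF that(1)] that(2) by (auto simp: abd' split: if_splits)
  show ?thesis
    using assms
  proof (induction arbitrary: x t rule: move.induct)
    case Nil
    then show ?case using wlin_scale[OF Nw] by simp
  next
    case (keep k xs ys)
    note p = LP_props[of xs] LP_props[OF sub[OF keep.hyps(2)]] sub[OF keep.hyps(2)]
    have "N a b (LP (k # xs) x t) = cop fscale x (\<lambda>x1 x2. N a b (LP xs x2 (L k x1 t)))"
      using keep.prems p by (subst LP_Cons) (auto intro!: wlin_cop Nw)
    also have "\<dots> = cop fscale x (\<lambda>x1 x2. LP ys x2 (L k x1 (N a b t)))"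
      using keep by (intro cop_cong) (auto simp: N_L_other[OF ab])
    also have "\<dots> = LP (k # ys) x (N a b t)"
      using keep.prems p by (intro LP_Cons[symmetric]) (auto simp: Nin)
    finally show ?case .
  next
    case (insert xs ys)
    note p = LP_props[of xs] LP_props[OF sub[OF insert.hyps(1)]] sub[OF insert.hyps(1)]
    have s: "set xs \<subseteq> half" "set ys \<subseteq> half" using insert.prems p by auto
    have "N a b (LP (kappa a # xs) x t) = cop fscale x (\<lambda>x1 x2. N a b (LP xs x2 (L (kappa a) x1 t)))"
      using insert.prems p by (subst LP_Cons) (auto intro!: wlin_cop Nw)
    also have "\<dots> = cop fscale x (\<lambda>x1 x2. LP ys x2 (cop fscale x1 (\<lambda>p q. L (kappa a) q (L b p (N a b t)))))"
      using insert by (intro cop_cong) (auto simp: N_L_kappa_a[OF ab])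
    also have "\<dots> = cop fscale x (\<lambda>x1 x2. cop fscale x1 (\<lambda>p q. LP ys x2 (L (kappa a) q (L b p (N a b t)))))"
      using insert.prems s by (intro cop_cong wlin_cop LP_props(2)) (simp_all add: abd' Nin)
    also have "\<dots> = cop fscale x (\<lambda>p z. cop fscale z (\<lambda>q x2. LP ys x2 (L (kappa a) q (L b p (N a b t)))))"
      by (rule cop_coassoc[OF vector_space_fscale])
    also have "\<dots> = cop fscale x (\<lambda>p z. LP (kappa a # ys) z (L b p (N a b t)))"
      using insert.prems s by (intro cop_cong LP_Cons[symmetric]) (simp_all add: abd' Nin)
    also have "\<dots> = LP (b # kappa a # ys) x (N a b t)"
      using insert.prems s by (intro LP_Cons[symmetric]) (simp_all add: abd' Nin)
    finally show ?case .
  next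
    case (remove xs ys)
    note p = sub[OF remove.hyps(1)]
    have s: "set xs \<subseteq> half" "set ys \<subseteq> half" using remove.prems p by auto
    have "LP (a # b # xs) x t = cop fscale x (\<lambda>x1 y. cop fscale y (\<lambda>x2 x3. LP xs x3 (L b x2 (L a x1 t))))"
      using remove.prems s by (subst LP_Cons) (auto intro!: cop_cong LP_Cons)
    \<comment> \<open>Regrouped so that the neighbours \<open>a\<close> and \<open>b\<close> share
      one leg \<open>y\<close>, as \<open>N_L_a_b\<close> requires.\<close>
    also have "\<dots> = cop fscale x (\<lambda>y x3. cop fscale y (\<lambda>x1 x2. LP xs x3 (L b x2 (L a x1 t))))"
      by (rule cop_coassoc[OF vector_space_fscale, symmetric])
    finally have eq: "LP (a # b # xs) x t = \<dots>" .
    have "N a b (LP (a # b # xs) x t) = cop fscale x (\<lambda>y x3. N a b (cop fscale y (\<lambda>x1 x2. LP xs x3 (L b x2 (L a x1 t)))))"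
      unfolding eq using remove.prems by (intro wlin_cop[OF Nw] cop_W) (simp_all add: abd' LP_props(1)[OF s(1)])
    also have "\<dots> = cop fscale x (\<lambda>y x3. cop fscale y (\<lambda>x1 x2. N a b (LP xs x3 (L b x2 (L a x1 t)))))"
      using remove.prems by (intro cop_cong wlin_cop[OF Nw]) (simp_all add: abd' LP_props(1)[OF s(1)])
    also have "\<dots> = cop fscale x (\<lambda>y x3. cop fscale y (\<lambda>x1 x2. LP ys x3 (N a b (L b x2 (L a x1 t)))))"
      using remove.prems s by (intro cop_cong remove.IH) (simp_all add: abd')
    also have "\<dots> = cop fscale x (\<lambda>y x3. LP ys x3 (cop fscale y (\<lambda>x1 x2. N a b (L b x2 (L a x1 t)))))"
      using remove.prems s by (intro cop_cong wlin_cop[symmetric] LP_props(2)) (simp_all add: abd' Nin)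
    also have "\<dots> = cop fscale x (\<lambda>y x3. LP ys x3 (L a y (N a b t)))"
      using remove.prems by (simp add: N_L_a_b[OF ab])
    also have "\<dots> = LP (a # ys) x (N a b t)"
      using remove.prems s by (intro LP_Cons[symmetric]) (simp_all add: abd' Nin)
    finally show ?case .
  qed
qed

text \<open>The face version of \<open>N_LP\<close>. The rules are read in the other direction:
  coactions taken after \<open>N\<close> on the new list are those on the old list, with
  \<open>N\<close> passed on to the continuation.\<close>

lemma N_TL:
  assumes "move (kappa b) a b xs ys" "set xs \<subseteq> half" "t \<in> W" "dlin f"
  shows "TL ys (N a b t) f = TL xs t (\<lambda>y r. f y (N a b r))"
proof -
  note Nw = N_wlin[OF ab] and Nin = N_in[OF ab]
  have sub: "set ys \<subseteq> half" if "move (kappa b) a b xs ys" "set xs \<subseteq> half" for xs ys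
    using move_set[OF that(1)] that(2) by (auto simp: abd' split: if_splits)
  show ?thesis
    using assms
  proof (induction arbitrary: t f rule: move.induct)
    case (keep k xs ys)
    have s: "set xs \<subseteq> half" "set ys \<subseteq> half" "k \<in> half" using keep.prems sub[OF keep.hyps(2)] by auto
    have "TL (k # ys) (N a b t) f = dco k t (\<lambda>x s. TL ys (N a b s) (\<lambda>y r. f (y * x) r))"
      using keep.hyps keep.prems s by (simp, intro dco_N_other[OF ab]) auto
    also have "\<dots> = dco k t (\<lambda>x s. TL xs s (\<lambda>y r. f (y * x) (N a b r)))"
      using keep s by (intro dco_cong keep.IH dlin_left[OF ab]) auto
    finally show ?case by simp
  next
    case (remove xs ys)
    have s: "set xs \<subseteq> half" "set ys \<subseteq> half" using remove.prems sub[OF remove.hyps(1)] by auto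
    have "TL (kappa b # ys) (N a b t) f =
        dco (kappa b) t (\<lambda>x s. dco a s (\<lambda>y r. TL ys (N a b r) (\<lambda>z q. f (z * (y * x)) q)))"
      using dco_N_kappa_b[OF ab TL_dlin[OF s(2) remove.prems(3)] remove.prems(2)] by simp
    also have "\<dots> = dco (kappa b) t (\<lambda>x s. dco a s (\<lambda>y r. TL xs r (\<lambda>z q. f (z * (y * x)) (N a b q))))"
      using remove.prems s by (intro dco_cong remove.IH dlin_left[OF ab]) (simp_all add: abd')
    finally show ?case by (simp add: mult.assoc)
  next
    case (insert xs ys)
    have s: "set xs \<subseteq> half" "set ys \<subseteq> half" using insert.prems sub[OF insert.hyps(1)] by auto
    have "TL (a # b # ys) (N a b t) f = dco b t (\<lambda>x s. TL ys (N a b s) (\<lambda>y q. f (y * x) q))"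
      using dco_N_a_b[OF ab TL_dlin[OF s(2) insert.prems(3)] insert.prems(2)] by (simp add: mult.assoc)
    also have "\<dots> = dco b t (\<lambda>x s. TL xs s (\<lambda>y q. f (y * x) (N a b q)))"
      using insert.prems s by (intro dco_cong insert.IH dlin_left[OF ab]) (simp_all add: abd')
    finally show ?case by simp
  qed simp
qed

end

end

section \<open>Modules over the Drinfeld double\<close>

text \<open>The operators preserve \<open>W\<close> and commute on it. Replacing them by the
  identity off \<open>W\<close> makes them commute everywhere, so that the order of composition can
  be changed.\<close>

lemma fold_commuting_permute:
  assumes A: "\<And>c t. c \<in> set xs \<Longrightarrow> t \<in> W \<Longrightarrow> A c t \<in> W"
    and comm: "\<And>c c' t. c \<in> set xs \<Longrightarrow> c' \<in> set xs \<Longrightarrow> t \<in> W \<Longrightarrow> A c (A c' t) = A c' (A c t)"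
    and mset: "mset xs = mset ys" and t: "t \<in> W"
  shows "fold A xs t = fold A ys t"
proof -
  define A' where "A' c t = (if t \<in> W then A c t else t)" for c t
  have "fold A zs t = fold A' zs t" if "set zs \<subseteq> set xs" for zs
    using that t
  proof (induction zs arbitrary: t)
    case (Cons z zs)
    then show ?case using A[of z t] by (simp add: A'_def)
  qed simp
  moreover have "fold A' xs = fold A' ys"
  proof (rule fold_multiset_equiv[OF _ mset])
    fix c c' assume c: "c \<in> set xs" "c' \<in> set xs"
    show "A' c \<circ> A' c' = A' c' \<circ> A' c"
    proof
      fix t show "(A' c \<circ> A' c') t = (A' c' \<circ> A' c) t"
        using A[OF c(1)] A[OF c(2)] comm[OF c] by (simp add: A'_def)
    qed
  qed
  ultimately show ?thesis using mset_eq_setD[OF mset] by simp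
qed

lemma fold_in: "(\<And>c t. c \<in> set xs \<Longrightarrow> t \<in> W \<Longrightarrow> A c t \<in> W) \<Longrightarrow> t \<in> W \<Longrightarrow> fold A xs t \<in> W"
  by (induction xs arbitrary: t) auto

lemma fold_lin_on:
  assumes "\<And>c t. c \<in> set xs \<Longrightarrow> t \<in> W \<Longrightarrow> A c t \<in> W" "\<And>c. c \<in> set xs \<Longrightarrow> lin_on s s W (A c)"
  shows "lin_on s s W (fold A xs)"
  using assms
proof (induction xs)
  case (Cons c xs)
  have "lin_on s s W (fold A xs)" by (rule Cons.IH) (use Cons.prems in simp_all)
  moreover have "lin_on s s W (A c)" "\<And>t. t \<in> W \<Longrightarrow> A c t \<in> W" using Cons.prems by simp_all
  ultimately show ?case by (simp add: lin_on_def)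
qed (simp add: lin_on_def)

context graph_hilbert
begin

section \<open>Vertex actions and face coactions of single cilia\<close>

abbreviation "V \<equiv> vertex_act H M G"
abbreviation "F c x \<equiv> face_coact_by H B M G c (zeta x)"
abbreviation "start c \<equiv> inv_into UNIV (rho G) c"

lemma finite_cilia: "finite (cilia G)"
  using RK_facts(1,6)[OF G] finite_subset by blast

lemma start_half: "c \<in> cilia G \<Longrightarrow> start c \<in> half"
  using RK_facts(6)[OF G] permutes_in_image[OF permutes_inv[OF RK_facts(5)[OF G]]] by blast

lemma vertex_subset: "c \<in> cilia G \<Longrightarrow> set (support (rho G) c) \<subseteq> half"
  unfolding support_props(5)[OF RK_facts(8)[OF G]]
  using permutes_orbit_subset[OF RK_facts(5)[OF G]] RK_facts(6)[OF G] by blast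

lemma face_subset: "c \<in> cilia G \<Longrightarrow> set (support (face_perm G) (start c)) \<subseteq> half"
  unfolding support_props(5)[OF RK_facts(9)[OF G]]
  using permutes_orbit_subset[OF RK_facts(10)[OF G]] start_half by blast

lemma vertex_disjoint:
  assumes "c \<in> cilia G" "c' \<in> cilia G" "c \<noteq> c'"
  shows "set (support (rho G) c) \<inter> set (support (rho G) c') = {}"
proof (rule ccontr)
  assume "set (support (rho G) c) \<inter> set (support (rho G) c') \<noteq> {}"
  then obtain h where h: "h \<in> orbit (rho G) c" "h \<in> orbit (rho G) c'"
    unfolding support_props(5)[OF RK_facts(8)[OF G]] by blast
  then have "h \<in> half"
    using vertex_subset[OF assms(1)] unfolding support_props(5)[OF RK_facts(8)[OF G]] by blast
  then have "\<exists>!s. s \<in> cilia G \<and> h \<in> orbit (rho G) s"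
    using RK_facts(11)[OF G] by (simp add: transversal_def)
  then show False using assms h by blast
qed

lemma face_disjoint:
  assumes "c \<in> cilia G" "c' \<in> cilia G" "c \<noteq> c'"
  shows "set (support (face_perm G) (start c)) \<inter> set (support (face_perm G) (start c')) = {}"
proof (rule ccontr)
  have ne: "start c \<noteq> start c'"
    using assms(3) permutes_inj[OF permutes_inv[OF RK_facts(5)[OF G]]] by (auto dest: injD)
  assume "set (support (face_perm G) (start c)) \<inter> set (support (face_perm G) (start c')) \<noteq> {}"
  then obtain h where h: "h \<in> orbit (face_perm G) (start c)" "h \<in> orbit (face_perm G) (start c')"
    unfolding support_props(5)[OF RK_facts(9)[OF G]] by blast
  then have "h \<in> half"
    using face_subset[OF assms(1)] unfolding support_props(5)[OF RK_facts(9)[OF G]] by blast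
  then have "\<exists>!s. s \<in> inv_into UNIV (rho G) ` cilia G \<and> h \<in> orbit (face_perm G) s"
    using RK_facts(12)[OF G] by (simp add: transversal_def)
  then show False using assms h ne by blast
qed

lemma V_eq: "V c = LP (support (rho G) c)"
  by (simp add: vertex_act_def fun_eq_iff)

lemma V_props:
  assumes "c \<in> cilia G"
  shows "t \<in> W \<Longrightarrow> V c x t \<in> W" "wlin (V c x)" "t \<in> W \<Longrightarrow> hlin fscale (\<lambda>x. V c x t)"
  unfolding V_eq using LP_props(1-3)[OF vertex_subset[OF assms]] by blast+

lemma V_commute:
  assumes "c \<in> cilia G" "c' \<in> cilia G" "c \<noteq> c'" "t \<in> W"
  shows "V c x (V c' y t) = V c' y (V c x t)"
  unfolding V_eq by (rule LP_commute) (use assms vertex_subset vertex_disjoint in blast)+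

lemma F_eq: "F c x t = TL (support (face_perm G) (start c)) t (\<lambda>y r. fscale (zeta x y) r)"
  by (simp add: face_coact_by_def T_prod_TL)

lemma wlin_fscale: "wlin (\<lambda>r. fscale c r)"
  by (simp add: lin_on_def fs.scale_right_distrib mult.commute)

lemma F_props:
  assumes "c \<in> cilia G"
  shows "t \<in> W \<Longrightarrow> F c x t \<in> W" "wlin (F c x)"
proof -
  show "wlin (F c x)"
    unfolding F_eq by (rule TL_wlin[OF face_subset[OF assms]]) (rule wlin_fscale)
  assume t: "t \<in> W"
  show "F c x t \<in> W"
    unfolding F_eq by (rule TL_in[OF face_subset[OF assms] t]) simp
qed

lemma F_commute:
  assumes c: "c \<in> cilia G" "c' \<in> cilia G" "c \<noteq> c'" and t: "t \<in> W"
  shows "F c x (F c' y t) = F c' y (F c x t)"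
proof -
  have 1: "F c x (F c' y t) = TL (support (face_perm G) (start c')) t (\<lambda>z r.
      TL (support (face_perm G) (start c)) r (\<lambda>w s. fscale (zeta y z) (fscale (zeta x w) s)))"
    if "c \<in> cilia G" "c' \<in> cilia G" "t \<in> W" for c c' x y t
  proof -
    note s = face_subset[OF that(1)] and s' = face_subset[OF that(2)]
    have "F c x (F c' y t) = TL (support (face_perm G) (start c')) t (\<lambda>z r. F c x (fscale (zeta y z) r))"
      unfolding F_eq[of c'] by (rule TL_map[OF s' that(3) F_props(2)[OF that(1)]]) simp
    also have "\<dots> = TL (support (face_perm G) (start c')) t (\<lambda>z r. fscale (zeta y z) (F c x r))"
      by (rule TL_cong[OF s' that(3)]) (rule wlin_scale[OF F_props(2)[OF that(1)]])
    finally show ?thesis unfolding F_eq[of c] TL_scale_fun .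
  qed
  note s = face_subset[OF c(1)] and s' = face_subset[OF c(2)]
  have "F c x (F c' y t) = TL (support (face_perm G) (start c)) t (\<lambda>w r.
      TL (support (face_perm G) (start c')) r (\<lambda>z s. fscale (zeta y z) (fscale (zeta x w) s)))"
    unfolding 1[OF c(1,2) t] by (rule TL_commute[OF s' s _ t]) (use face_disjoint[OF c] in blast)
  also have "\<dots> = F c' y (F c x t)"
    unfolding 1[OF c(2,1) t] by (simp add: mult.commute)
  finally show ?thesis .
qed

section \<open>The tensor power of H and its double acting on the Hilbert space\<close>

abbreviation "Vs cs x \<equiv> fold (\<lambda>c. V c (x c)) cs"
abbreviation "Fs cs \<beta> \<equiv> fold (\<lambda>c. F c (\<beta> c)) cs"
abbreviation "cil \<equiv> sorted_list_of_set (cilia G)"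

lemma set_cil [simp]: "set cil = cilia G" "distinct cil"
  using finite_cilia by simp_all

lemma Vs_in: "t \<in> W \<Longrightarrow> set cs \<subseteq> cilia G \<Longrightarrow> Vs cs x t \<in> W"
  by (rule fold_in) (use V_props in blast)+

lemma Vs_wlin: "set cs \<subseteq> cilia G \<Longrightarrow> wlin (Vs cs x)"
  by (rule fold_lin_on) (use V_props in blast)+

lemma Fs_in: "t \<in> W \<Longrightarrow> set cs \<subseteq> cilia G \<Longrightarrow> Fs cs \<beta> t \<in> W"
  by (rule fold_in) (use F_props in blast)+

lemma Fs_wlin: "set cs \<subseteq> cilia G \<Longrightarrow> wlin (Fs cs \<beta>)"
  by (rule fold_lin_on) (use F_props in blast)+

text \<open>Each cilium occurs exactly once in the list, so as a function of one variable the
  composite is a linear action between two fixed operators.\<close>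

lemma mlin_Vs:
  assumes t: "t \<in> W"
  shows "mlin fscale (hforms H G) (\<lambda>x. Vs cil x t)"
proof (intro mlin_multilinearI vector_space_fscale)
  fix x x' :: "nat \<Rightarrow> 'h" assume "\<And>c. c \<in> cilia G \<Longrightarrow> x c = x' c"
  then show "Vs cil x t = Vs cil x' t" by (intro fold_cong) auto
next
  fix i and x :: "nat \<Rightarrow> 'h" assume i: "i \<in> cilia G"
  then obtain ys zs where l: "cil = ys @ i # zs" by (metis set_cil(1) split_list)
  have d: "i \<notin> set ys" "i \<notin> set zs" "set ys \<subseteq> cilia G" "set zs \<subseteq> cilia G"
    using set_cil[unfolded l] by auto
  have y: "Vs ys (x(i := v)) t = Vs ys x t" for v
    using d(1) by (intro fold_cong) auto
  have z: "Vs zs (x(i := v)) s = Vs zs x s" for v s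
    using d(2) by (intro fold_cong) auto
  have eq: "Vs cil (x(i := v)) t = Vs zs x (V i v (Vs ys x t))" for v
    by (simp only: l fold_append fold_simps o_apply y z fun_upd_same)
  have h: "hlin fscale (\<lambda>v. V i v (Vs ys x t))" by (rule V_props(3)[OF i Vs_in[OF t d(3)]])
  have w: "V i v (Vs ys x t) \<in> W" for v by (rule V_props(1)[OF i Vs_in[OF t d(3)]])
  show "hlin fscale (\<lambda>v. Vs cil (x(i := v)) t)"
    unfolding eq using h w Vs_wlin[OF d(4)] by (simp add: lin_on_def)
qed

lemma gauge_act_pure: "t \<in> W \<Longrightarrow> gauge_act H M G (ptens (hforms H G) x) t = Vs cil x t"
  unfolding gauge_act_def by (rule lin_ext_pure[OF vector_space_fscale mlin_Vs])

lemma gauge_act_in: "t \<in> W \<Longrightarrow> a \<in> gauge H G \<Longrightarrow> gauge_act H M G a t \<in> W"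
  unfolding gauge_act_def gauge_def hilb_def
  by (rule lin_ext_in_tensor_space[OF _ mlin_Vs]) (use Vs_in in \<open>auto simp: hilb_def\<close>)

lemma gauge_act_lin: "t \<in> W \<Longrightarrow> lin_on fscale fscale (gauge H G) (\<lambda>a. gauge_act H M G a t)"
  unfolding gauge_act_def gauge_def by (rule lin_ext_lin_on[OF vector_space_fscale mlin_Vs])

lemma gauge_pure: "ptens (hforms H G) x \<in> gauge H G"
  unfolding gauge_def by (rule tensor_space_pure) simp

text \<open>The dual part of the double: \<alpha> applied to the coaction of the tensor power, whose
  basis is indexed by the functions from cilia to \<open>B\<close>.\<close>

definition dact :: "(('h, 'k) htensor \<Rightarrow> 'k) \<Rightarrow> ('m, 'k) mtensor \<Rightarrow> ('m, 'k) mtensor" where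
  "dact \<alpha> t = (\<Sum>\<beta> \<in> cilia G \<rightarrow>\<^sub>E B. fscale (\<alpha> (ptens (hforms H G) \<beta>)) (Fs cil \<beta> t))"

lemma gauge_coact_eval:
  assumes t: "t \<in> W" and \<alpha>: "\<alpha> \<in> dual_on fscale (gauge H G)"
  shows "lin_ext fscale (\<lambda>(x, u). fscale (\<alpha> x) u) (gauge_coact H B M G t) = dact \<alpha> t"
proof -
  let ?F = "bilinear_forms fscale (gauge H G) fscale (hilb M G)"
  have al: "lin_on fscale (*) (gauge H G) \<alpha>"
    using \<alpha> by (simp add: dual_on_def linear_form_on_lin_on)
  have m: "mlin fscale ?F (\<lambda>(x, u). fscale (\<alpha> x) u)"
    using al by (intro mlin_bilinearI vector_space_fscale)
      (auto simp: lin_on_def fs.scale_left_distrib fs.scale_right_distrib mult.commute)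
  show ?thesis
    unfolding gauge_coact_def dact_def
    by (subst lin_on_tensor_sum[OF vector_space_fscale lin_ext_lin_on[OF vector_space_fscale m, where P = UNIV]])
      (auto intro!: tensor_space_pure simp: lin_ext_pure[OF vector_space_fscale m])
qed

lemma dact_lin: "wlin (dact \<alpha>)"
  unfolding dact_def
  by (intro lin_on_sum_fun lin_on_scale_fun vector_space_fscale Fs_wlin) simp

lemma dact_in: "t \<in> W \<Longrightarrow> dact \<alpha> t \<in> W"
  unfolding dact_def by (intro W_closed Fs_in) simp_all

lemma dact_add: "dact (\<alpha> + \<beta>) t = dact \<alpha> t + dact \<beta> t"
  by (simp add: dact_def plus_fun_apply fs.scale_left_distrib sum.distrib)

lemma dact_scale: "dact (fscale c \<alpha>) t = fscale c (dact \<alpha> t)"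
  by (simp add: dact_def fs.scale_sum_right) (simp add: fscale_def)

definition dpair :: "('m, 'k) mtensor \<Rightarrow> (('h, 'k) htensor \<Rightarrow> 'k) \<times> ('h, 'k) htensor \<Rightarrow> ('m, 'k) mtensor" where
  "dpair t = (\<lambda>(\<alpha>, a). lin_ext fscale (\<lambda>(x, u). fscale (\<alpha> x) u) (gauge_coact H B M G (gauge_act H M G a t)))"

lemma dpair_eq:
  "t \<in> W \<Longrightarrow> \<alpha> \<in> dual_on fscale (gauge H G) \<Longrightarrow> a \<in> gauge H G \<Longrightarrow>
    dpair t (\<alpha>, a) = dact \<alpha> (gauge_act H M G a t)"
  unfolding dpair_def by (simp add: gauge_coact_eval gauge_act_in)

lemma dual_on_closed:
  "\<alpha> \<in> dual_on fscale U \<Longrightarrow> \<beta> \<in> dual_on fscale U \<Longrightarrow> \<alpha> + \<beta> \<in> dual_on fscale U"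
  "\<alpha> \<in> dual_on fscale U \<Longrightarrow> fscale c \<alpha> \<in> dual_on fscale U"
  by (auto simp: dual_on_def linear_form_on_def plus_fun_apply fscale_def algebra_simps)

lemma gauge_closed:
  "a \<in> gauge H G \<Longrightarrow> b \<in> gauge H G \<Longrightarrow> a + b \<in> gauge H G" "a \<in> gauge H G \<Longrightarrow> fscale c a \<in> gauge H G"
  unfolding gauge_def by auto

lemma mlin_dpair:
  assumes t: "t \<in> W"
  shows "mlin fscale (dforms H G) (dpair t)"
proof (intro mlin_bilinearI vector_space_fscale)
  fix a assume a: "a \<in> gauge H G"
  show "lin_on fscale fscale (dual_on fscale (gauge H G)) (\<lambda>\<alpha>. dpair t (\<alpha>, a))"
    using a t by (intro lin_onI) (simp_all add: dpair_eq dual_on_closed dact_add dact_scale)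
next
  fix \<alpha> assume \<alpha>: "\<alpha> \<in> dual_on fscale (gauge H G)"
  show "lin_on fscale fscale (gauge H G) (\<lambda>a. dpair t (\<alpha>, a))"
    using \<alpha> t lin_on_add[OF gauge_act_lin[OF t]] lin_on_scale[OF gauge_act_lin[OF t]]
      lin_on_add[OF dact_lin] lin_on_scale[OF dact_lin]
    by (intro lin_onI) (simp_all add: dpair_eq gauge_closed gauge_act_in)
qed

lemma double_act_eq: "double_act H B M G d t = lin_ext fscale (dpair t) d"
  by (simp add: double_act_def dpair_def)

lemma double_act_pure:
  assumes "t \<in> W" "\<alpha> \<in> dual_on fscale (gauge H G)" "a \<in> gauge H G"
  shows "double_act H B M G (ptens (dforms H G) (\<alpha>, a)) t = dact \<alpha> (gauge_act H M G a t)"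
  unfolding double_act_eq lin_ext_pure[OF vector_space_fscale mlin_dpair[OF assms(1)]]
  by (rule dpair_eq[OF assms])

lemma double_act_lin:
  "t \<in> W \<Longrightarrow> lin_on fscale fscale (tensor_space (dforms H G) P) (\<lambda>d. double_act H B M G d t)"
  unfolding double_act_eq by (rule lin_ext_lin_on[OF vector_space_fscale mlin_dpair])

lemma double_act_in:
  assumes "t \<in> W" "d \<in> double H G" shows "double_act H B M G d t \<in> W"
proof -
  have d: "d \<in> tensor_space (dforms H G) (dual_on fscale (gauge H G) \<times> gauge H G)"
    using assms(2) by (simp add: double_def)
  show ?thesis
    unfolding double_act_eq hilb_def
    by (rule lin_ext_in_tensor_space[OF d mlin_dpair[OF assms(1)]])
      (use assms(1) in \<open>auto simp: dpair_eq dact_in gauge_act_in simp flip: hilb_def\<close>)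
qed

end

section \<open>Maps that intertwine vertex actions and face coactions\<close>

context fd_involutive_hopf_bimodule
begin

text \<open>Equivariance cilium by cilium. It is stable under composition, hence checkable on
  generators, and it implies equivariance under the doubles
  (\<open>double_equivariant\<close>).\<close>

definition intertwines ::
  "nat kitaev \<Rightarrow> nat kitaev \<Rightarrow> (nat \<Rightarrow> nat) \<Rightarrow> (('m, 'k) mtensor \<Rightarrow> ('m, 'k) mtensor) \<Rightarrow> bool" where
  "intertwines G G' f \<Phi> \<longleftrightarrow> bij_betw f (cilia G) (cilia G') \<and> (\<forall>t\<in>hilb M G. \<Phi> t \<in> hilb M G') \<and>
     lin_on fscale fscale (hilb M G) \<Phi> \<and>
     (\<forall>c\<in>cilia G. \<forall>x. \<forall>t\<in>hilb M G.
        \<Phi> (vertex_act H M G c x t) = vertex_act H M G' (f c) x (\<Phi> t) \<and>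
        \<Phi> (face_coact_by H B M G c (zeta x) t) = face_coact_by H B M G' (f c) (zeta x) (\<Phi> t))"

lemma intertwines_id: "intertwines G G id (\<lambda>t. t)"
  by (simp add: intertwines_def lin_on_def)

lemma intertwines_comp:
  assumes "intertwines G G' f \<Phi>" "intertwines G' G'' f' \<Phi>'"
  shows "intertwines G G'' (f' \<circ> f) (\<Phi>' \<circ> \<Phi>)"
  using assms bij_betw_trans[of f "cilia G" "cilia G'" f' "cilia G''"] bij_betwE[of f "cilia G" "cilia G'"]
  by (simp add: intertwines_def lin_on_def)

text \<open>Serves Condition 2, whose operator is the inverse of one for Condition 1.\<close>

lemma intertwines_inverse:
  assumes i: "intertwines G G' f \<Phi>" and G: "G \<in> RK"
    and inv: "\<And>t. t \<in> hilb M G' \<Longrightarrow> \<Psi> t \<in> hilb M G" "\<And>t. t \<in> hilb M G' \<Longrightarrow> \<Phi> (\<Psi> t) = t"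
    "\<And>t. t \<in> hilb M G \<Longrightarrow> \<Psi> (\<Phi> t) = t"
    and f: "\<And>x. f' (f x) = x" "\<And>x. f (f' x) = x"
  shows "intertwines G' G f' \<Psi>"
proof -
  interpret g: graph_hilbert H M B G by unfold_locales (rule G)
  have c: "f' c \<in> cilia G" if "c \<in> cilia G'" for c
    using i that f unfolding intertwines_def bij_betw_def by (metis imageE)
  have "bij_betw f' (cilia G') (cilia G)"
  proof (rule bij_betw_byWitness[where f' = f])
    show "f ` cilia G \<subseteq> cilia G'" using i by (auto simp: intertwines_def bij_betw_def)
  qed (use f c in auto)
  moreover have "lin_on fscale fscale (hilb M G') \<Psi>"
  proof (rule lin_onI)
    note l = i[unfolded intertwines_def lin_on_def]
    fix s t assume st: "s \<in> hilb M G'" "t \<in> hilb M G'"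
    then have "\<Phi> (\<Psi> s + \<Psi> t) = s + t" using l inv by simp
    then show "\<Psi> (s + t) = \<Psi> s + \<Psi> t" using st inv by (metis g.W_closed(2))
  next
    note l = i[unfolded intertwines_def lin_on_def]
    fix c t assume t: "t \<in> hilb M G'"
    then have "\<Phi> (fscale c (\<Psi> t)) = fscale c t" using l inv by simp
    then show "\<Psi> (fscale c t) = fscale c (\<Psi> t)" using t inv by (metis g.W_closed(3))
  qed
  moreover have "\<Psi> (vertex_act H M G' c x t) = vertex_act H M G (f' c) x (\<Psi> t)"
    "\<Psi> (face_coact_by H B M G' c (zeta x) t) = face_coact_by H B M G (f' c) (zeta x) (\<Psi> t)"
    if "c \<in> cilia G'" "t \<in> hilb M G'" for c x t
  proof -
    note p = c[OF that(1)] inv(1)[OF that(2)]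
    have "\<Phi> (vertex_act H M G (f' c) x (\<Psi> t)) = vertex_act H M G' c x t"
      "\<Phi> (face_coact_by H B M G (f' c) (zeta x) (\<Psi> t)) = face_coact_by H B M G' c (zeta x) t"
      using i p that inv(2) f by (simp_all add: intertwines_def)
    then show "\<Psi> (vertex_act H M G' c x t) = vertex_act H M G (f' c) x (\<Psi> t)"
      "\<Psi> (face_coact_by H B M G' c (zeta x) t) = face_coact_by H B M G (f' c) (zeta x) (\<Psi> t)"
      using inv(3) g.V_props(1)[OF p] g.F_props(1)[OF p] by metis+
  qed
  ultimately show ?thesis using inv(1) by (simp add: intertwines_def)
qed

lemma gauge_perm_factorwise:
  "gauge_perm H G G' f = factorwise (hscale H) (cilia G') (inv_into (cilia G) f) (\<lambda>_. id)"
  by (simp add: gauge_perm_def factorwise_def)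

text \<open>The double is spanned by elements \<open>\<alpha> \<otimes> a\<close>, which act by
  \<open>gauge_act\<close> followed by \<open>dact\<close>. On pure tensors and basis elements both
  are composites over the cilia, and these are carried from one graph to the other factor by
  factor.\<close>

lemma double_equivariant:
  assumes i: "intertwines G G' f \<Phi>" and RK: "G \<in> RK" "G' \<in> RK"
    and d: "d \<in> double H G" and t: "t \<in> hilb M G"
  shows "\<Phi> (double_act H B M G d t) = double_act H B M G' (double_perm H G G' f d) (\<Phi> t)"
proof -
  interpret g: graph_hilbert H M B G by unfold_locales (rule RK)
  interpret g': graph_hilbert H M B G' by unfold_locales (rule RK)
  note i' = i[unfolded intertwines_def]
  have bij: "bij_betw f (cilia G) (cilia G')" and in': "\<And>t. t \<in> hilb M G \<Longrightarrow> \<Phi> t \<in> hilb M G'"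
    and lin: "lin_on fscale fscale (hilb M G) \<Phi>" using i' by auto
  let ?j = "inv_into (cilia G) f"
  have bij': "bij_betw ?j (cilia G') (cilia G)" by (rule bij_betw_inv_into[OF bij])
  have j: "?j (f c) = c" if "c \<in> cilia G" for c using bij that by (simp add: bij_betw_def inv_into_f_f)
  have j': "f (?j c) = c" if "c \<in> cilia G'" for c using bij that by (metis bij_betw_inv_into_right)
  have fc: "f c \<in> cilia G'" if "c \<in> cilia G" for c using bij that by (auto simp: bij_betw_def)
  have jc: "?j c \<in> cilia G" if "c \<in> cilia G'" for c using bij' that by (auto simp: bij_betw_def)
  have jj: "inv_into (cilia G') ?j c = f c" if "c \<in> cilia G" for c
    using bij' that j fc[OF that] by (metis bij_betw_def inv_into_f_f)
  have perm: "mset (map f g.cil) = mset g'.cil"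
    using bij mset_set_set[OF g.set_cil(2)] mset_set_set[OF g'.set_cil(2)]
    by (simp add: bij_betw_def) (metis image_mset_mset_set)
  \<comment> \<open>In either graph the cilia are processed in increasing order, and
    \<open>f\<close> need not be monotone. Commutativity for distinct cilia compensates for the
    change of order.\<close>
  have fold_eq: "\<Phi> (fold A g.cil s) = fold A' g'.cil (\<Phi> s)"
    if A: "\<And>c s. c \<in> cilia G \<Longrightarrow> s \<in> hilb M G \<Longrightarrow> A c s \<in> hilb M G"
      "\<And>c s. c \<in> cilia G' \<Longrightarrow> s \<in> hilb M G' \<Longrightarrow> A' c s \<in> hilb M G'"
      "\<And>c s. c \<in> cilia G \<Longrightarrow> s \<in> hilb M G \<Longrightarrow> \<Phi> (A c s) = A' (f c) (\<Phi> s)"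
      "\<And>c c' s. c \<in> cilia G' \<Longrightarrow> c' \<in> cilia G' \<Longrightarrow> c \<noteq> c' \<Longrightarrow> s \<in> hilb M G' \<Longrightarrow> A' c (A' c' s) = A' c' (A' c s)"
      and s: "s \<in> hilb M G" for A A' s
  proof -
    have "\<Phi> (fold A cs s) = fold A' (map f cs) (\<Phi> s)" if "set cs \<subseteq> cilia G" "s \<in> hilb M G" for cs s
      using that
    proof (induction cs arbitrary: s)
      case (Cons c cs)
      then show ?case using A(1,3)[of c s] by simp
    qed simp
    then have "\<Phi> (fold A g.cil s) = fold A' (map f g.cil) (\<Phi> s)" using s by simp
    also have "\<dots> = fold A' g'.cil (\<Phi> s)"
    proof (rule fold_commuting_permute[where W = "hilb M G'", OF _ _ perm in'[OF s]])
      fix c s assume "c \<in> set (map f g.cil)" "s \<in> hilb M G'"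
      then show "A' c s \<in> hilb M G'" using A(2) fc by auto
    next
      fix c c' s assume "c \<in> set (map f g.cil)" "c' \<in> set (map f g.cil)" "s \<in> hilb M G'"
      then show "A' c (A' c' s) = A' c' (A' c s)" using A(4)[of c c' s] fc by (cases "c = c'") auto
    qed
    finally show ?thesis .
  qed
  let ?P = "gauge_perm H G G' f" and ?P' = "gauge_perm H G' G ?j"
  have P_pure: "?P (ptens (hforms H G) x) = ptens (hforms H G') (\<lambda>c. x (?j c))" for x
    unfolding gauge_perm_factorwise by (subst factorwise_pure[OF bij']) (auto simp: lin_on_def)
  have P_lin: "lin_on fscale fscale (gauge H G) ?P"
    unfolding gauge_perm_factorwise gauge_def by (rule factorwise_lin_on[OF bij']) (simp add: lin_on_def)
  have P_in: "?P a \<in> gauge H G'" if "a \<in> gauge H G" for a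
    using that unfolding gauge_perm_factorwise gauge_def by (intro factorwise_in[OF bij']) (auto simp: lin_on_def)
  have bij'': "bij_betw (inv_into (cilia G') ?j) (cilia G) (cilia G')" by (rule bij_betw_inv_into[OF bij'])
  have P'_pure: "?P' (ptens (hforms H G') x) = ptens (hforms H G) (\<lambda>c. x (f c))" for x
  proof -
    have "?P' (ptens (hforms H G') x) = ptens (hforms H G) (\<lambda>c. x (inv_into (cilia G') ?j c))"
      unfolding gauge_perm_factorwise by (subst factorwise_pure[OF bij'']) (auto simp: lin_on_def)
    also have "\<dots> = ptens (hforms H G) (\<lambda>c. x (f c))"
      by (rule ptens_multilinear_cong) (simp add: jj)
    finally show ?thesis .
  qed
  have P'_lin: "lin_on fscale fscale (gauge H G') ?P'"
    unfolding gauge_perm_factorwise gauge_def by (rule factorwise_lin_on[OF bij'']) (simp add: lin_on_def)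
  have P'_in: "?P' a \<in> gauge H G" if "a \<in> gauge H G'" for a
    using that unfolding gauge_perm_factorwise gauge_def by (intro factorwise_in[OF bij'']) (auto simp: lin_on_def)
  have act: "\<Phi> (gauge_act H M G a t) = gauge_act H M G' (?P a) (\<Phi> t)" if "a \<in> gauge H G" for a
  proof (rule lin_on_tensor_eqI[of a "hforms H G" UNIV])
    show "a \<in> tensor_space (hforms H G) UNIV" using that by (simp add: gauge_def)
    have gg: "tensor_space (hforms H G) UNIV = gauge H G" by (simp add: gauge_def)
    show "lin_on fscale fscale (tensor_space (hforms H G) UNIV) (\<lambda>a. \<Phi> (gauge_act H M G a t))"
      unfolding gg using g.gauge_act_lin[OF t] lin g.gauge_act_in[OF t] by (simp add: lin_on_def)
    show "lin_on fscale fscale (tensor_space (hforms H G) UNIV) (\<lambda>a. gauge_act H M G' (?P a) (\<Phi> t))"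
      unfolding gg using g'.gauge_act_lin[OF in'[OF t]] P_lin P_in by (simp add: lin_on_def)
    fix x
    show "\<Phi> (gauge_act H M G (ptens (hforms H G) x) t) =
        gauge_act H M G' (?P (ptens (hforms H G) x)) (\<Phi> t)"
      unfolding P_pure g.gauge_act_pure[OF t] g'.gauge_act_pure[OF in'[OF t]]
      by (rule fold_eq[OF _ _ _ _ t])
        (use i' j g.V_props(1) g'.V_props(1) in \<open>simp_all, auto intro: g'.V_commute\<close>)
  qed (rule vector_space_fscale)
  \<comment> \<open>The functional \<alpha> transported along the inverse permutation of the
    factors, with value 0 outside the tensor power as required by \<open>dual_on\<close>.\<close>
  define Q where "Q \<alpha> = (\<lambda>y. if y \<in> gauge H G' then \<alpha> (?P' y) else 0)" for \<alpha> :: "('h, 'k) htensor \<Rightarrow> 'k"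
  have Q_in: "Q \<alpha> \<in> dual_on fscale (gauge H G')" if "\<alpha> \<in> dual_on fscale (gauge H G)" for \<alpha>
    using that P'_lin P'_in g'.gauge_closed
    by (auto simp: dual_on_def Q_def linear_form_on_def lin_on_def)
  have Q_add: "Q (\<alpha> + \<beta>) = Q \<alpha> + Q \<beta>" "Q (fscale c \<alpha>) = fscale c (Q \<alpha>)" for \<alpha> \<beta> c
    by (auto simp: Q_def plus_fun_apply fscale_def)
  have mQ: "mlin fscale (dforms H G) (\<lambda>(\<alpha>, a). ptens (dforms H G') (Q \<alpha>, ?P a))"
  proof (intro mlin_bilinearI vector_space_fscale)
    fix a assume "a \<in> gauge H G"
    have l: "lin_on fscale fscale (dual_on fscale (gauge H G')) (\<lambda>v. ptens (dforms H G') (v, ?P a))"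
      by (rule ptens_bilinear_lin_on(1)[OF P_in[OF \<open>a \<in> gauge H G\<close>]])
    show "lin_on fscale fscale (dual_on fscale (gauge H G))
        (\<lambda>\<alpha>. case (\<alpha>, a) of (\<alpha>, a) \<Rightarrow> ptens (dforms H G') (Q \<alpha>, ?P a))"
      using lin_on_add[OF l] lin_on_scale[OF l] Q_in by (simp add: lin_on_def Q_add)
  next
    fix \<alpha> assume "\<alpha> \<in> dual_on fscale (gauge H G)"
    then have l: "lin_on fscale fscale (gauge H G') (\<lambda>w. ptens (dforms H G') (Q \<alpha>, w))"
      by (rule ptens_bilinear_lin_on(2)[OF Q_in])
    show "lin_on fscale fscale (gauge H G)
        (\<lambda>a. case (\<alpha>, a) of (\<alpha>, a) \<Rightarrow> ptens (dforms H G') (Q \<alpha>, ?P a))"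
      using lin_on_add[OF l] lin_on_scale[OF l] P_in P_lin by (simp add: lin_on_def)
  qed
  have dperm: "double_perm H G G' f = lin_ext fscale (\<lambda>(\<alpha>, a). ptens (dforms H G') (Q \<alpha>, ?P a))"
    by (simp add: double_perm_def Q_def)
  let ?D = "dual_on fscale (gauge H G) \<times> gauge H G" and ?D' = "dual_on fscale (gauge H G') \<times> gauge H G'"
  have D: "d \<in> tensor_space (dforms H G) ?D" using d by (simp add: double_def)
  have dperm_in: "double_perm H G G' f d \<in> tensor_space (dforms H G') ?D'"
    if "d \<in> tensor_space (dforms H G) ?D" for d
    unfolding dperm by (rule lin_ext_in_tensor_space[OF that mQ]) (use Q_in P_in in \<open>auto intro!: tensor_space_pure\<close>)
  have dperm_lin: "lin_on fscale fscale (tensor_space (dforms H G) ?D) (double_perm H G G' f)"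
    unfolding dperm by (rule lin_ext_lin_on[OF vector_space_fscale mQ])
  have dact: "\<Phi> (g.dact \<alpha> s) = g'.dact (Q \<alpha>) (\<Phi> s)" if s: "s \<in> hilb M G" for \<alpha> s
  proof -
    have w: "g.Fs g.cil \<beta> s \<in> hilb M G" for \<beta> by (rule g.Fs_in[OF s]) simp
    have "\<Phi> (g.dact \<alpha> s) = (\<Sum>\<beta> \<in> cilia G \<rightarrow>\<^sub>E B. fscale (\<alpha> (ptens (hforms H G) \<beta>)) (\<Phi> (g.Fs g.cil \<beta> s)))"
      unfolding g.dact_def by (subst g.wlin_sum[OF lin]) (simp_all add: w lin_on_scale[OF lin w])
    also have "\<dots> = (\<Sum>\<beta> \<in> cilia G' \<rightarrow>\<^sub>E B. fscale (Q \<alpha> (ptens (hforms H G') \<beta>)) (g'.Fs g'.cil \<beta> (\<Phi> s)))"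
    \<comment> \<open>The basis functions on the cilia of the two graphs correspond under
      composition with \<open>f\<close> and its inverse; \<open>restrict\<close> keeps them
      extensional.\<close>
    proof (rule sum.reindex_bij_witness[where i = "\<lambda>\<beta>. restrict (\<lambda>c. \<beta> (f c)) (cilia G)"
          and j = "\<lambda>\<beta>. restrict (\<lambda>c. \<beta> (?j c)) (cilia G')"])
      fix \<beta> assume \<beta>: "\<beta> \<in> cilia G \<rightarrow>\<^sub>E B"
      show "restrict (\<lambda>c. restrict (\<lambda>c. \<beta> (?j c)) (cilia G') (f c)) (cilia G) = \<beta>"
        using \<beta> fc j by (auto simp: fun_eq_iff PiE_def extensional_def)
      show "restrict (\<lambda>c. \<beta> (?j c)) (cilia G') \<in> cilia G' \<rightarrow>\<^sub>E B" using \<beta> jc by auto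
      have "Q \<alpha> (ptens (hforms H G') (restrict (\<lambda>c. \<beta> (?j c)) (cilia G'))) = \<alpha> (ptens (hforms H G) \<beta>)"
      proof -
        have "ptens (hforms H G) (\<lambda>c. restrict (\<lambda>c. \<beta> (?j c)) (cilia G') (f c)) = ptens (hforms H G) \<beta>"
          by (rule ptens_multilinear_cong) (simp add: fc j)
        then show ?thesis using g'.gauge_pure by (simp add: Q_def P'_pure)
      qed
      moreover have "\<Phi> (g.Fs g.cil \<beta> s) = g'.Fs g'.cil (restrict (\<lambda>c. \<beta> (?j c)) (cilia G')) (\<Phi> s)"
        by (rule fold_eq[OF _ _ _ _ s])
          (use i' j fc g.F_props(1) g'.F_props(1) in \<open>simp_all, auto intro: g'.F_commute\<close>)
      ultimately show "fscale (Q \<alpha> (ptens (hforms H G') (restrict (\<lambda>c. \<beta> (?j c)) (cilia G'))))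
          (g'.Fs g'.cil (restrict (\<lambda>c. \<beta> (?j c)) (cilia G')) (\<Phi> s)) =
          fscale (\<alpha> (ptens (hforms H G) \<beta>)) (\<Phi> (g.Fs g.cil \<beta> s))" by simp
    next
      fix \<beta> assume \<beta>: "\<beta> \<in> cilia G' \<rightarrow>\<^sub>E B"
      show "restrict (\<lambda>c. restrict (\<lambda>c. \<beta> (f c)) (cilia G) (?j c)) (cilia G') = \<beta>"
        using \<beta> jc j' by (auto simp: fun_eq_iff PiE_def extensional_def)
      show "restrict (\<lambda>c. \<beta> (f c)) (cilia G) \<in> cilia G \<rightarrow>\<^sub>E B" using \<beta> fc by auto
    qed
    finally show ?thesis by (simp add: g'.dact_def)
  qed
  show ?thesis
  proof (rule lin_on_tensor_eqI[OF D vector_space_fscale])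
    have dd: "tensor_space (dforms H G) ?D = double H G" by (simp add: double_def)
    show "lin_on fscale fscale (tensor_space (dforms H G) ?D) (\<lambda>d. \<Phi> (double_act H B M G d t))"
      using g.double_act_lin[OF t, of ?D] lin g.double_act_in[OF t] unfolding dd by (simp add: lin_on_def)
    show "lin_on fscale fscale (tensor_space (dforms H G) ?D)
        (\<lambda>d. double_act H B M G' (double_perm H G G' f d) (\<Phi> t))"
      using g'.double_act_lin[OF in'[OF t], of ?D'] dperm_lin dperm_in by (simp add: lin_on_def)
  next
    fix p assume "p \<in> ?D"
    then obtain \<alpha> a where p: "p = (\<alpha>, a)" "\<alpha> \<in> dual_on fscale (gauge H G)" "a \<in> gauge H G" by blast
    have "double_perm H G G' f (ptens (dforms H G) p) = ptens (dforms H G') (Q \<alpha>, ?P a)"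
      unfolding dperm lin_ext_pure[OF vector_space_fscale mQ] by (simp add: p)
    then show "\<Phi> (double_act H B M G (ptens (dforms H G) p) t) =
        double_act H B M G' (double_perm H G G' f (ptens (dforms H G) p)) (\<Phi> t)"
      using p t by (simp add: g.double_act_pure g'.double_act_pure in' Q_in P_in dact g.gauge_act_in act)
  qed
qed

end

section \<open>The group \<open>\<RR>\<close>\<close>

lemma group_frakR: "group frakR"
proof (rule groupI)
  show "\<sigma> \<otimes>\<^bsub>frakR\<^esub> \<tau> \<in> carrier frakR" if "\<sigma> \<in> carrier frakR" "\<tau> \<in> carrier frakR" for \<sigma> \<tau>
  proof -
    have "{n. \<sigma> (\<tau> n) \<noteq> n} \<subseteq> {n. \<sigma> n \<noteq> n} \<union> {n. \<tau> n \<noteq> n}" by auto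
    then have "finite {n. \<sigma> (\<tau> n) \<noteq> n}"
      using that finite_subset by (auto simp: frakR_iff S_inf_def)
    then have "\<sigma> \<circ> \<tau> \<in> carrier frakR"
      using that permutes_compose[of \<tau> "{1..}" \<sigma>] unfolding frakR_iff S_inf_def by simp
    then show ?thesis by (simp add: frakR_def)
  qed
  show "\<one>\<^bsub>frakR\<^esub> \<in> carrier frakR"
  proof -
    have "id \<in> carrier frakR" by (simp add: frakR_iff S_inf_def permutes_id)
    then show ?thesis by (simp add: frakR_def)
  qed
  show "\<exists>\<tau>\<in>carrier frakR. \<tau> \<otimes>\<^bsub>frakR\<^esub> \<sigma> = \<one>\<^bsub>frakR\<^esub>" if \<sigma>: "\<sigma> \<in> carrier frakR" for \<sigma>
  proof (intro bexI)
    have bij: "bij \<sigma>" by (rule frakR_bij[OF \<sigma>])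
    then have ii: "inv_into UNIV \<sigma> (\<sigma> x) = x" "\<sigma> (inv_into UNIV \<sigma> x) = x" for x
      by (simp_all add: bij_is_inj bij_is_surj surj_f_inv_f)
    show "inv_into UNIV \<sigma> \<otimes>\<^bsub>frakR\<^esub> \<sigma> = \<one>\<^bsub>frakR\<^esub>"
      using ii by (simp add: frakR_def fun_eq_iff)
    have "{n. inv_into UNIV \<sigma> n \<noteq> n} = {n. \<sigma> n \<noteq> n}" using ii by metis
    then have "finite {n. inv_into UNIV \<sigma> n \<noteq> n}" using \<sigma> by (simp add: frakR_iff S_inf_def)
    moreover have "inv_into UNIV \<sigma> permutes {1..}"
      using \<sigma> permutes_inv by (auto simp: frakR_iff S_inf_def)
    moreover have "inv_into UNIV \<sigma> (kappa x) = kappa (inv_into UNIV \<sigma> x)" for x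
      using frakR_kappa[OF \<sigma>] ii by metis
    ultimately show "inv_into UNIV \<sigma> \<in> carrier frakR" by (simp add: frakR_iff S_inf_def)
  qed
qed (auto simp: frakR_def)

lemma frakR_mult: "\<sigma> \<otimes>\<^bsub>frakR\<^esub> \<tau> = \<sigma> \<circ> \<tau>" and frakR_one: "\<one>\<^bsub>frakR\<^esub> = id"
  by (simp_all add: frakR_def)

lemma frakR_comp: "\<sigma> \<in> carrier frakR \<Longrightarrow> \<tau> \<in> carrier frakR \<Longrightarrow> \<sigma> \<circ> \<tau> \<in> carrier frakR"
  using group.is_monoid[OF group_frakR] monoid.m_closed frakR_mult by metis

lemma frakR_id: "id \<in> carrier frakR"
  using group.is_monoid[OF group_frakR] monoid.one_closed frakR_one by metis

lemma tau_frakR: "i \<ge> 1 \<Longrightarrow> tau i \<in> carrier frakR"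
proof -
  assume i: "i \<ge> 1"
  have "tau i permutes {1..}" unfolding tau_def by (rule permutes_swap_id) (use i in auto)
  moreover have "finite {n. tau i n \<noteq> n}"
    by (rule finite_subset[of _ "{2 * i - 1, 2 * i}"]) (auto simp: tau_def transpose_def)
  moreover have "tau i (kappa x) = kappa (tau i x)" for x
  proof -
    have k: "kappa (2 * i - 1) = 2 * i" "kappa (2 * i) = 2 * i - 1" using i by (auto simp: kappa_def)
    consider "x = 2 * i - 1" | "x = 2 * i" | "x \<noteq> 2 * i - 1" "x \<noteq> 2 * i" by blast
    then show ?thesis
    proof cases
      case 3
      have "kappa x \<noteq> 2 * i" "kappa x \<noteq> 2 * i - 1" using 3 k by (metis kappa_kappa)+
      then show ?thesis using 3 by (simp add: tau_def transpose_apply_other)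
    qed (simp_all only: tau_def k transpose_apply_first transpose_apply_second)
  qed
  ultimately show ?thesis by (simp add: frakR_iff S_inf_def)
qed

text \<open>A generator interchanges two neighbouring pairs of \<kappa> by shifts of two. It
  therefore commutes with \<kappa>, and it preserves parity: sources go to sources and no edge is
  reversed.\<close>

lemma R_perm_generator:
  assumes "odd i"
  defines "g \<equiv> transpose i (i + 2) \<circ> transpose (i + 1) (i + 3)"
  shows "g \<in> carrier frakR" "g \<circ> g = id" "odd (g x) \<longleftrightarrow> odd (x :: nat)"
proof -
  have g: "g x = (if x = i then i + 2 else if x = i + 2 then i else
      if x = i + 1 then i + 3 else if x = i + 3 then i + 1 else x)" for x
    by (auto simp: g_def transpose_def)
  show "g \<circ> g = id" by (auto simp: fun_eq_iff g)
  show "odd (g x) \<longleftrightarrow> odd x" using assms(1) by (simp add: g)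
  have "g permutes {1..}"
    unfolding g_def by (intro permutes_compose permutes_swap_id) (use assms(1) odd_pos[of i] in auto)
  moreover have "finite {n. g n \<noteq> n}"
    by (rule finite_subset[of _ "{i, i + 1, i + 2, i + 3}"]) (auto simp: g)
  moreover have "g (kappa x) = kappa (g x)" for x
  proof -
    have i: "kappa i = i + 1" "kappa (i + 1) = i" "kappa (i + 2) = i + 3" "kappa (i + 3) = i + 2"
      using assms(1) by (auto simp: kappa_def elim!: oddE)
    have n: "kappa x = y \<longleftrightarrow> x = kappa y" for y using kappa_kappa by metis
    consider "x = i" | "x = i + 1" | "x = i + 2" | "x = i + 3" | "x \<notin> {i, i + 1, i + 2, i + 3}" by blast
    then show ?thesis
    proof cases
      case 5
      then have "kappa x \<notin> {i, i + 1, i + 2, i + 3}" by (simp add: n i[simplified])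
      then show ?thesis using 5 by (simp add: g)
    qed (simp_all only: i, simp_all add: g i[simplified])
  qed
  ultimately show "g \<in> carrier frakR" by (simp add: frakR_iff S_inf_def)
qed

lemma R_perm_props:
  assumes "\<sigma> \<in> R_perm"
  shows "\<sigma> \<in> carrier frakR \<and> (\<forall>x. odd (\<sigma> x) \<longleftrightarrow> odd x)"
  using assms unfolding R_perm_def
proof (induction rule: generate.induct)
  case one
  then show ?case using frakR_id by (simp add: frakR_one id_def)
next
  case (incl h)
  then show ?case using R_perm_generator by blast
next
  case (inv h)
  then obtain i where i: "odd i" "h = transpose i (i + 2) \<circ> transpose (i + 1) (i + 3)" by blast
  note g = R_perm_generator[OF i(1), folded i(2)]
  have "inv\<^bsub>frakR\<^esub> h = h"
    by (rule group.inv_equality[OF group_frakR]) (use g in \<open>auto simp: frakR_mult frakR_one\<close>)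
  then show ?case using g by simp
next
  case (eng h1 h2)
  then show ?case using frakR_comp[of h1 h2, unfolded o_def] by (simp add: frakR_mult o_def)
qed

section \<open>The maps \<open>\<mu>\<close> on the summands\<close>

lemma edges_RK: "G \<in> RK \<Longrightarrow> edges G = (\<lambda>h. {h, kappa h}) ` half_edges G"
  by (auto simp: edges_def edge_of_RK)

lemma half_edges_relabel:
  "\<sigma> \<in> carrier frakR \<Longrightarrow> G \<in> RK \<Longrightarrow> half_edges (relabel \<sigma> G) = \<sigma> ` half_edges G"
  using relabel_RK(1) by simp

lemma edges_relabel:
  assumes "\<sigma> \<in> carrier frakR" "G \<in> RK"
  shows "edges (relabel \<sigma> G) = (\<lambda>e. \<sigma> ` e) ` edges G"
  unfolding edges_RK[OF assms(2)] edges_RK[OF relabel_RK(2)[OF assms]] half_edges_relabel[OF assms]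
  by (simp add: image_image frakR_kappa[OF assms(1)])

lemma bij_edges_relabel:
  assumes "\<sigma> \<in> carrier frakR" "G \<in> RK"
  shows "bij_betw (\<lambda>e. inv_into UNIV \<sigma> ` e) (edges (relabel \<sigma> G)) (edges G)"
proof (rule bij_betw_byWitness[where f' = "\<lambda>e. \<sigma> ` e"])
  have ii: "inv_into UNIV \<sigma> (\<sigma> x) = x" "\<sigma> (inv_into UNIV \<sigma> x) = x" for x
    using frakR_bij[OF assms(1)] by (simp_all add: bij_is_inj bij_is_surj surj_f_inv_f)
  show "\<forall>e\<in>edges (relabel \<sigma> G). \<sigma> ` inv_into UNIV \<sigma> ` e = e" by (simp add: image_image ii)
  show "\<forall>e\<in>edges G. inv_into UNIV \<sigma> ` \<sigma> ` e = e" by (simp add: image_image ii)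
  show "(\<lambda>e. inv_into UNIV \<sigma> ` e) ` edges (relabel \<sigma> G) \<subseteq> edges G"
    unfolding edges_relabel[OF assms] by (auto simp: image_image ii)
  show "(\<lambda>e. \<sigma> ` e) ` edges G \<subseteq> edges (relabel \<sigma> G)"
    unfolding edges_relabel[OF assms] by simp
qed

text \<open>
  For a permutation \<open>\<sigma>\<close> that commutes with \<open>\<kappa>\<close>.  The source of an edge is its odd element, hence its
  minimum; so this says that \<open>\<sigma>\<close> maps a target to the source of \<open>e\<close>.
\<close>

definition flips :: "(nat \<Rightarrow> nat) \<Rightarrow> nat set \<Rightarrow> bool" where
  "flips \<sigma> e \<longleftrightarrow> even (inv_into UNIV \<sigma> (Min e))"

text \<open>Sources are the odd half-edges, so an edge is reversed iff \<sigma> changes the parity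
  of one of its half-edges; either of the two may be used for the test.\<close>

lemma flips_edge:
  assumes \<sigma>: "\<sigma> \<in> carrier frakR" and h: "h \<ge> 1"
  shows "flips \<sigma> {\<sigma> h, kappa (\<sigma> h)} \<longleftrightarrow> odd h \<noteq> odd (\<sigma> h)"
proof -
  have ii: "inv_into UNIV \<sigma> (\<sigma> x) = x" for x
    using frakR_bij[OF \<sigma>] by (simp add: bij_is_inj)
  have s: "\<sigma> h \<ge> 1" using frakR_ge[OF \<sigma>] h by blast
  show ?thesis
  proof (cases "odd (\<sigma> h)")
    case True
    then have "Min {\<sigma> h, kappa (\<sigma> h)} = \<sigma> h" by (simp add: kappa_def)
    then show ?thesis using True by (simp add: flips_def ii)
  next
    case False
    then have "kappa (\<sigma> h) \<le> \<sigma> h" using s by (simp add: kappa_def)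
    then have "Min {\<sigma> h, kappa (\<sigma> h)} = \<sigma> (kappa h)"
      by (simp add: min_absorb2 frakR_kappa[OF \<sigma>])
    then show ?thesis using False odd_kappa[OF h] by (auto simp: flips_def ii)
  qed
qed

lemma relabel_face_perm:
  assumes "\<sigma> \<in> carrier frakR" "G \<in> RK"
  shows "face_perm (relabel \<sigma> G) = \<sigma> \<circ> face_perm G \<circ> inv_into UNIV \<sigma>"
    "inv_into UNIV (rho (relabel \<sigma> G)) (\<sigma> c) = \<sigma> (inv_into UNIV (rho G) c)"
proof -
  have ii: "inv_into UNIV \<sigma> (\<sigma> x) = x" "\<sigma> (inv_into UNIV \<sigma> x) = x" for x
    using frakR_bij[OF assms(1)] by (simp_all add: bij_is_inj bij_is_surj surj_f_inv_f)
  have inv': "inv_into UNIV (rho (relabel \<sigma> G)) = \<sigma> \<circ> inv_into UNIV (rho G) \<circ> inv_into UNIV \<sigma>"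
    unfolding relabel_RK(1)[OF assms] kgraph_sel
    by (rule inv_equality) (use RK_facts(5)[OF assms(2)] ii in \<open>auto simp: permutes_inverses\<close>)
  then show "inv_into UNIV (rho (relabel \<sigma> G)) (\<sigma> c) = \<sigma> (inv_into UNIV (rho G) c)"
    by (simp add: ii)
  have "inv_into UNIV \<sigma> (perm_restrict kappa (\<sigma> ` half_edges G) x) =
      perm_restrict kappa (half_edges G) (inv_into UNIV \<sigma> x)" for x
  proof -
    have "x \<in> \<sigma> ` half_edges G \<longleftrightarrow> inv_into UNIV \<sigma> x \<in> half_edges G" using ii by (metis image_iff)
    moreover have "inv_into UNIV \<sigma> (kappa x) = kappa (inv_into UNIV \<sigma> x)"
      using frakR_kappa[OF assms(1)] ii by metis
    ultimately show ?thesis by (simp add: perm_restrict_def)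
  qed
  moreover have "iota (relabel \<sigma> G) = perm_restrict kappa (\<sigma> ` half_edges G)"
    unfolding relabel_RK(1)[OF assms] by simp
  ultimately show "face_perm (relabel \<sigma> G) = \<sigma> \<circ> face_perm G \<circ> inv_into UNIV \<sigma>"
    unfolding face_perm_def inv' by (simp add: RK_facts(13)[OF assms(2)] fun_eq_iff)
qed

context fd_involutive_hopf_bimodule
begin

text \<open>
  \<open>\<mu>(\<sigma>)\<close>, without decomposing \<open>\<sigma>\<close> into reversals and a permutation of the edges.
\<close>

definition relabel_map :: "(nat \<Rightarrow> nat) \<Rightarrow> nat kitaev \<Rightarrow> ('m, 'k) mtensor \<Rightarrow> ('m, 'k) mtensor" where
  "relabel_map \<sigma> G = factorwise (mscale M) (edges (relabel \<sigma> G)) (\<lambda>e. inv_into UNIV \<sigma> ` e)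
     (\<lambda>e. if flips \<sigma> e then invol M else id)"

lemma mlinear_flip: "mlinear (if P then invol M else id)"
  using mlinear_invol by (auto simp: lin_on_def)

context
  fixes \<sigma> G
  assumes \<sigma>: "\<sigma> \<in> carrier frakR" and G: "G \<in> RK"
begin

lemma relabel_map_in: "t \<in> hilb M G \<Longrightarrow> relabel_map \<sigma> G t \<in> hilb M (relabel \<sigma> G)"
  unfolding relabel_map_def hilb_def by (rule factorwise_in[OF bij_edges_relabel[OF \<sigma> G] mlinear_flip])

lemma relabel_map_lin: "lin_on fscale fscale (hilb M G) (relabel_map \<sigma> G)"
  unfolding relabel_map_def hilb_def by (rule factorwise_lin_on[OF bij_edges_relabel[OF \<sigma> G] mlinear_flip])

text \<open>An operator on the edge of \<open>h\<close> is carried to the edge of \<sigma>(h), with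
  \<psi> in between when the edge is reversed. The last hypothesis is the exchange rule of the
  operator with \<psi>, supplied later by \<open>hact_invol\<close> and
  \<open>hco_invol\<close>.\<close>

lemma relabel_map_at_factor:
  assumes h: "h \<in> half_edges G" and t: "t \<in> hilb M G"
    and f: "mlinear f" "mlinear f'"
    and eq: "\<And>m. (if odd h \<noteq> odd (\<sigma> h) then invol M else id) (f m) =
      f' ((if odd h \<noteq> odd (\<sigma> h) then invol M else id) m)"
  shows "relabel_map \<sigma> G (at_factor (mscale M) (edges G) {h, kappa h} f t) =
    at_factor (mscale M) (edges (relabel \<sigma> G)) {\<sigma> h, kappa (\<sigma> h)} f' (relabel_map \<sigma> G t)"
proof -
  note bij = bij_edges_relabel[OF \<sigma> G]
  have t': "t \<in> tensor_space (mforms M G) UNIV" using t by (simp add: hilb_def)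
  have ii: "inv_into UNIV \<sigma> (\<sigma> x) = x" "\<sigma> (inv_into UNIV \<sigma> x) = x" for x
    using frakR_bij[OF \<sigma>] by (simp_all add: bij_is_inj bij_is_surj surj_f_inv_f)
  let ?\<pi> = "\<lambda>e. inv_into UNIV \<sigma> ` e" and ?f = "\<lambda>e. if flips \<sigma> e then invol M else id"
  let ?g = "\<lambda>e. ?f e \<circ> (if ?\<pi> e = {h, kappa h} then f else id)"
  have "relabel_map \<sigma> G (at_factor (mscale M) (edges G) {h, kappa h} f t) =
      factorwise (mscale M) (edges (relabel \<sigma> G)) ?\<pi> ?g t"
    unfolding relabel_map_def at_factor_def
    by (rule factorwise_comp[OF bij_betw_id lin_on_if[OF f(1)] bij mlinear_flip t']) simp_all
  moreover have "at_factor (mscale M) (edges (relabel \<sigma> G)) {\<sigma> h, kappa (\<sigma> h)} f' (relabel_map \<sigma> G t) =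
      factorwise (mscale M) (edges (relabel \<sigma> G)) ?\<pi> ?g t"
    unfolding relabel_map_def at_factor_def
  proof (rule factorwise_comp[OF bij mlinear_flip bij_betw_id lin_on_if[OF f(2)] t'])
    fix e assume e: "e \<in> edges (relabel \<sigma> G)"
    show "?g e = (if e = {\<sigma> h, kappa (\<sigma> h)} then f' else id) \<circ> ?f (id e)"
    proof (cases "e = {\<sigma> h, kappa (\<sigma> h)}")
      case True
      have "?\<pi> e = {h, kappa h}" using True by (simp add: frakR_kappa[OF \<sigma>, symmetric] ii)
      moreover have "flips \<sigma> e \<longleftrightarrow> odd h \<noteq> odd (\<sigma> h)"
        unfolding True by (rule flips_edge[OF \<sigma> RK_facts(2)[OF G h]])
      ultimately show ?thesis using True eq by (simp add: fun_eq_iff)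
    next
      case False
      have "?\<pi> e \<noteq> {h, kappa h}"
      proof
        assume "?\<pi> e = {h, kappa h}"
        then have "\<sigma> ` ?\<pi> e = {\<sigma> h, kappa (\<sigma> h)}" by (simp add: frakR_kappa[OF \<sigma>])
        then show False using False by (simp add: image_image ii)
      qed
      then show ?thesis using False by simp
    qed
  qed simp_all
  ultimately show ?thesis by simp
qed

lemma relabel_half: "h \<in> half_edges G \<Longrightarrow> \<sigma> h \<in> half_edges (relabel \<sigma> G)"
  unfolding relabel_RK(1)[OF \<sigma> G] by simp

lemma relabel_map_L:
  assumes h: "h \<in> half_edges G" and t: "t \<in> hilb M G"
  shows "relabel_map \<sigma> G (L_op H M G h a t) = L_op H M (relabel \<sigma> G) (\<sigma> h) a (relabel_map \<sigma> G t)"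
  unfolding L_op_eq[OF G h] L_op_eq[OF relabel_RK(2)[OF \<sigma> G] relabel_half[OF h]]
  by (rule relabel_map_at_factor[OF h t mlinear_hact mlinear_hact]) (auto simp: hact_invol)

lemma relabel_map_T:
  assumes h: "h \<in> half_edges G" and t: "t \<in> hilb M G"
  shows "relabel_map \<sigma> G (T_op H M G h (zeta x) t) = T_op H M (relabel \<sigma> G) (\<sigma> h) (zeta x) (relabel_map \<sigma> G t)"
  unfolding T_op_eq[OF G h] T_op_eq[OF relabel_RK(2)[OF \<sigma> G] relabel_half[OF h]]
  by (rule relabel_map_at_factor[OF h t mlinear_hco mlinear_hco]) (auto simp: hco_invol)

lemma relabel_map_intertwines: "intertwines G (relabel \<sigma> G) \<sigma> (relabel_map \<sigma> G)"
proof -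
  let ?G' = "relabel \<sigma> G" and ?R = "relabel_map \<sigma> G"
  note G' = relabel_RK(2)[OF \<sigma> G]
  interpret g: graph_hilbert H M B G by unfold_locales (rule G)
  interpret g': graph_hilbert H M B ?G' by unfold_locales (rule G')
  note bij = frakR_bij[OF \<sigma>]
  have LP: "?R (g.LP hs x t) = g'.LP (map \<sigma> hs) x (?R t)" if "set hs \<subseteq> half_edges G" "t \<in> hilb M G" for hs x t
    using that
  proof (induction hs arbitrary: x t)
    case Nil
    then show ?case using g.wlin_scale[OF relabel_map_lin] by simp
  next
    case (Cons h hs)
    have s: "set hs \<subseteq> half_edges G" "h \<in> half_edges G" using Cons.prems by auto
    have s': "set (map \<sigma> (h # hs)) \<subseteq> half_edges ?G'" using Cons.prems relabel_half by auto
    have "?R (g.LP (h # hs) x t) = ?R (cop fscale x (\<lambda>x1 x2. g.LP hs x2 (g.L h x1 t)))"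
      using g.LP_Cons[OF Cons.prems] by simp
    also have "\<dots> = cop fscale x (\<lambda>x1 x2. ?R (g.LP hs x2 (g.L h x1 t)))"
      using Cons.prems s by (intro g.wlin_cop relabel_map_lin g.LP_props(1)) simp_all
    also have "\<dots> = cop fscale x (\<lambda>x1 x2. g'.LP (map \<sigma> hs) x2 (g'.L (\<sigma> h) x1 (?R t)))"
      using Cons.prems s by (intro cop_cong) (simp add: Cons.IH relabel_map_L)
    also have "\<dots> = g'.LP (map \<sigma> (h # hs)) x (?R t)"
      using g'.LP_Cons[OF s'[unfolded list.map] relabel_map_in[OF Cons.prems(2)]] by simp
    finally show ?case .
  qed
  have TL: "g'.TL (map \<sigma> ks) (?R t) f = g.TL ks t (\<lambda>y r. f y (?R r))"
    if "set ks \<subseteq> half_edges G" "t \<in> hilb M G" for ks t f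
    using that
  proof (induction ks arbitrary: t f)
    case (Cons k ks)
    have s: "set ks \<subseteq> half_edges G" "k \<in> half_edges G" using Cons.prems by auto
    have "g'.TL (map \<sigma> (k # ks)) (?R t) f =
        (\<Sum>x\<in>B. g'.TL (map \<sigma> ks) (?R (g.T k x t)) (\<lambda>y r. f (y * x) r))"
      using Cons.prems s by (simp add: g'.dco_def relabel_map_T)
    also have "\<dots> = (\<Sum>x\<in>B. g.TL ks (g.T k x t) (\<lambda>y r. f (y * x) (?R r)))"
      using Cons.prems s by (intro sum.cong HOL.refl Cons.IH) simp_all
    finally show ?case by (simp add: g.dco_def)
  qed simp
  have "bij_betw \<sigma> (cilia G) (cilia ?G')"
    unfolding relabel_RK(1)[OF \<sigma> G] using bij by (auto simp: bij_betw_def intro: inj_on_subset)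
  moreover have "?R (g.V c x t) = g'.V (\<sigma> c) x (?R t)" if c: "c \<in> cilia G" and t: "t \<in> hilb M G" for c x t
  proof -
    have r: "rho ?G' = \<sigma> \<circ> rho G \<circ> inv_into UNIV \<sigma>"
      unfolding relabel_RK(1)[OF \<sigma> G] by simp
    show ?thesis
      unfolding g.V_eq g'.V_eq r support_conj[OF bij]
      by (rule LP[OF g.vertex_subset[OF c] t])
  qed
  moreover have "?R (g.F c x t) = g'.F (\<sigma> c) x (?R t)" if c: "c \<in> cilia G" and t: "t \<in> hilb M G" for c x t
  proof -
    note s = g.face_subset[OF c]
    have "?R (g.F c x t) = g.TL (support (face_perm G) (g.start c)) t (\<lambda>y r. ?R (fscale (zeta x y) r))"
      unfolding g.F_eq by (rule g.TL_map[OF s t relabel_map_lin]) simp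
    also have "\<dots> = g.TL (support (face_perm G) (g.start c)) t (\<lambda>y r. fscale (zeta x y) (?R r))"
      by (rule g.TL_cong[OF s t]) (rule g.wlin_scale[OF relabel_map_lin])
    also have "\<dots> = g'.F (\<sigma> c) x (?R t)"
      unfolding g'.F_eq relabel_face_perm[OF \<sigma> G] support_conj[OF bij]
      by (rule TL[OF s t, symmetric])
    finally show ?thesis .
  qed
  ultimately show ?thesis
    using relabel_map_in relabel_map_lin by (simp add: intertwines_def)
qed

end

text \<open>An edge is reversed by the composite iff exactly one of the two relabellings reverses
  it; since \<psi> is an involution, the operators on each factor compose accordingly.\<close>

lemma relabel_map_comp:
  assumes \<sigma>: "\<sigma> \<in> carrier frakR" and \<tau>: "\<tau> \<in> carrier frakR" and G: "G \<in> RK" and t: "t \<in> hilb M G"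
  shows "relabel_map \<sigma> (relabel \<tau> G) (relabel_map \<tau> G t) = relabel_map (\<sigma> \<circ> \<tau>) G t"
proof -
  note st = frakR_comp[OF \<sigma> \<tau>] and G' = relabel_RK(2)[OF \<tau> G]
  have rr: "relabel \<sigma> (relabel \<tau> G) = relabel (\<sigma> \<circ> \<tau>) G" by (rule relabel_relabel[OF \<sigma> \<tau> st G])
  have t': "t \<in> tensor_space (mforms M G) UNIV" using t by (simp add: hilb_def)
  have inv: "inv_into UNIV (\<sigma> \<circ> \<tau>) = inv_into UNIV \<tau> \<circ> inv_into UNIV \<sigma>"
    by (rule o_inv_distrib[OF frakR_bij[OF \<sigma>] frakR_bij[OF \<tau>]])
  have ii: "inv_into UNIV \<sigma> (\<sigma> x) = x" for x using frakR_bij[OF \<sigma>] by (simp add: bij_is_inj)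
  show ?thesis
    unfolding relabel_map_def rr[symmetric]
  proof (rule factorwise_comp[OF bij_edges_relabel[OF \<tau> G] mlinear_flip bij_edges_relabel[OF \<sigma> G'] mlinear_flip t'])
    fix e assume "e \<in> edges (relabel \<sigma> (relabel \<tau> G))"
    then obtain h where h: "h \<in> half_edges G" "e = {\<sigma> (\<tau> h), kappa (\<sigma> (\<tau> h))}"
      unfolding edges_RK[OF relabel_RK(2)[OF \<sigma> G']] half_edges_relabel[OF \<sigma> G'] half_edges_relabel[OF \<tau> G] by auto
    have h1: "h \<ge> 1" "\<tau> h \<ge> 1" using RK_facts(2)[OF G h(1)] frakR_ge[OF \<tau>] by auto
    have 1: "flips (\<sigma> \<circ> \<tau>) e \<longleftrightarrow> odd h \<noteq> odd (\<sigma> (\<tau> h))" using flips_edge[OF st h1(1)] by (simp add: h)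
    have 2: "flips \<sigma> e \<longleftrightarrow> odd (\<tau> h) \<noteq> odd (\<sigma> (\<tau> h))" using flips_edge[OF \<sigma> h1(2)] by (simp add: h)
    have "inv_into UNIV \<sigma> ` e = {\<tau> h, kappa (\<tau> h)}"
      by (simp add: h frakR_kappa[OF \<sigma>, symmetric] ii)
    then have 3: "flips \<tau> (inv_into UNIV \<sigma> ` e) \<longleftrightarrow> odd h \<noteq> odd (\<tau> h)"
      using flips_edge[OF \<tau> h1(1)] by simp
    show "(if flips (\<sigma> \<circ> \<tau>) e then invol M else id) =
        (if flips \<sigma> e then invol M else id) \<circ> (if flips \<tau> (inv_into UNIV \<sigma> ` e) then invol M else id)"
      unfolding 1 2 3 by (auto simp: fun_eq_iff invol_invol)
    show "inv_into UNIV (\<sigma> \<circ> \<tau>) ` e = inv_into UNIV \<tau> ` inv_into UNIV \<sigma> ` e"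
      by (simp add: inv image_comp)
  qed
qed

lemma relabel_map_id:
  assumes G: "G \<in> RK" and t: "t \<in> hilb M G"
  shows "relabel_map id G t = t"
proof -
  have t': "t \<in> tensor_space (mforms M G) UNIV" using t by (simp add: hilb_def)
  show ?thesis
    unfolding relabel_map_def relabel_id[OF G]
  proof (rule factorwise_id[OF _ _ t'])
    fix e assume "e \<in> edges G"
    then obtain h where h: "h \<in> half_edges G" "e = {h, kappa h}" unfolding edges_RK[OF G] by blast
    show "(if flips id e then invol M else id) = id"
      using flips_edge[OF frakR_id RK_facts(2)[OF G h(1)]] by (simp add: h)
  qed simp
qed

text \<open>The transposition maps every edge to itself as a set and changes parity only on {2i - 1,
  2i}.\<close>

lemma relabel_map_tau:
  assumes i: "i \<ge> 1" and G: "G \<in> RK" and t: "t \<in> hilb M G"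
  shows "relabel_map (tau i) G t =
    (if {2 * i - 1, 2 * i} \<in> edges G then on_edge M G {2 * i - 1, 2 * i} (invol M) t else t)"
proof -
  note \<sigma> = tau_frakR[OF i]
  have t': "t \<in> tensor_space (mforms M G) UNIV" using t by (simp add: hilb_def)
  have tt: "tau i (tau i x) = x" for x by (simp add: tau_def)
  have inv: "inv_into UNIV (tau i) = tau i" by (rule inv_equality) (simp_all add: tt)
  have e: "tau i ` {h, kappa h} = {h, kappa h} \<and> (flips (tau i) {h, kappa h} \<longleftrightarrow> {h, kappa h} = {2 * i - 1, 2 * i})"
    if h: "h \<ge> 1" for h
  proof -
    have k: "kappa (2 * i - 1) = 2 * i" "kappa (2 * i) = 2 * i - 1" using i by (auto simp: kappa_def)
    have fl: "flips (tau i) {h, kappa h} \<longleftrightarrow> odd (tau i h) \<noteq> odd h"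
    proof -
      have "flips (tau i) {tau i (tau i h), kappa (tau i (tau i h))} \<longleftrightarrow> odd (tau i h) \<noteq> odd (tau i (tau i h))"
        by (rule flips_edge[OF \<sigma>]) (use frakR_ge[OF \<sigma>] h in blast)
      then show ?thesis by (simp add: tt)
    qed
    consider "h = 2 * i - 1" | "h = 2 * i" | "h \<noteq> 2 * i - 1" "h \<noteq> 2 * i" by blast
    then show ?thesis
    proof cases
      case 1
      have t: "tau i h = 2 * i" "tau i (2 * i) = h" and kh: "kappa h = 2 * i"
        using 1 k by (simp_all add: tau_def)
      have "odd h" using 1 i by simp
      moreover have "tau i ` {h, kappa h} = {h, kappa h}"
        unfolding image_insert image_empty kh t by (rule insert_commute)
      moreover have "{h, kappa h} = {2 * i - 1, 2 * i}" using kh 1 by simp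
      ultimately show ?thesis unfolding fl t by simp
    next
      case 2
      have t: "tau i h = 2 * i - 1" "tau i (2 * i - 1) = h" and kh: "kappa h = 2 * i - 1"
        using 2 k by (simp_all add: tau_def)
      have "even h" "odd (2 * i - 1)" using 2 i by simp_all
      moreover have "tau i ` {h, kappa h} = {h, kappa h}"
        unfolding image_insert image_empty kh t by (rule insert_commute)
      moreover have "{h, kappa h} = {2 * i - 1, 2 * i}"
        using kh 2 by (simp add: insert_commute)
      ultimately show ?thesis unfolding fl t by simp
    next
      case 3
      have "kappa h \<noteq> 2 * i" "kappa h \<noteq> 2 * i - 1" using 3 k by (metis kappa_kappa)+
      then have "tau i h = h" "tau i (kappa h) = kappa h" using 3 by (simp_all add: tau_def transpose_def)
      moreover have "{h, kappa h} \<noteq> {2 * i - 1, 2 * i}" using 3 by (simp add: doubleton_eq_iff)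
      ultimately show ?thesis unfolding fl by simp
    qed
  qed
  have e': "tau i ` e = e" "flips (tau i) e \<longleftrightarrow> e = {2 * i - 1, 2 * i}" if "e \<in> edges G" for e
  proof -
    obtain h where "h \<in> half_edges G" and h: "e = {h, kappa h}"
      using \<open>e \<in> edges G\<close> unfolding edges_RK[OF G] by blast
    from e[OF RK_facts(2)[OF G this(1)]]
    show "tau i ` e = e" "flips (tau i) e \<longleftrightarrow> e = {2 * i - 1, 2 * i}" unfolding h by blast+
  qed
  have ee: "edges (relabel (tau i) G) = edges G"
    unfolding edges_relabel[OF \<sigma> G] using e'(1) by simp
  have 1: "relabel_map (tau i) G = factorwise (mscale M) (edges G) id
      (\<lambda>e. if e = {2 * i - 1, 2 * i} then invol M else id)"
    unfolding relabel_map_def ee inv by (rule factorwise_cong) (simp_all add: e')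
  show ?thesis
  proof (cases "{2 * i - 1, 2 * i} \<in> edges G")
    case True
    then show ?thesis unfolding 1 on_edge_at_factor at_factor_def by simp
  next
    case False
    then show ?thesis unfolding 1 by (simp, intro factorwise_id[OF _ _ t']) auto
  qed
qed

lemma relabel_map_R_perm:
  assumes \<sigma>: "\<sigma> \<in> R_perm" and G: "G \<in> RK"
  shows "relabel_map \<sigma> G = lin_ext fscale (\<lambda>m. ptens (mforms M (relabel \<sigma> G)) (\<lambda>e. m (inv_into UNIV \<sigma> ` e)))"
proof -
  have s: "\<sigma> \<in> carrier frakR" "\<And>x. odd (\<sigma> x) \<longleftrightarrow> odd x" using R_perm_props[OF \<sigma>] by auto
  have "\<not> flips \<sigma> e" if "e \<in> edges (relabel \<sigma> G)" for e
  proof -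
    obtain h where h: "h \<in> half_edges G" "e = {\<sigma> h, kappa (\<sigma> h)}"
      using \<open>e \<in> edges (relabel \<sigma> G)\<close>
      unfolding edges_RK[OF relabel_RK(2)[OF s(1) G]] half_edges_relabel[OF s(1) G] by auto
    show ?thesis using flips_edge[OF s(1) RK_facts(2)[OF G h(1)]] s(2) by (simp add: h)
  qed
  then have "relabel_map \<sigma> G = factorwise (mscale M) (edges (relabel \<sigma> G)) (\<lambda>e. inv_into UNIV \<sigma> ` e) (\<lambda>_. id)"
    unfolding relabel_map_def by (intro factorwise_cong) simp_all
  then show ?thesis by (simp add: factorwise_def)
qed

subsection \<open>Slides\<close>

definition slide_map :: "nat \<Rightarrow> nat \<Rightarrow> nat kitaev \<Rightarrow> ('m, 'k) mtensor \<Rightarrow> ('m, 'k) mtensor" where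
  "slide_map a b G t =
    (if cond1 a b G then
       \<Sum>h\<in>B. L_op H M G b h (T_op H M G a (dual_basis H B h) t)
     else if cond2 a b G then
       \<Sum>h\<in>B. L_op H M G b (antip_inv H h) (T_op H M G a (dual_basis H B h) t)
     else t)"

text \<open>A slide keeps the half-edges and the involution \<iota>. The Hilbert space and the
  operators of single half-edges therefore coincide for both graphs; only the lists along which they
  are composed differ.\<close>

lemma slid_ops:
  assumes "slid a b G G'"
  shows "edges G' = edges G" "hilb M G' = hilb M G" "L_op H M G' = L_op H M G"
    "T_op H M G' = T_op H M G" "L_prod H M G' = L_prod H M G" "T_prod H B M G' = T_prod H B M G"
proof -
  have h: "half_edges G' = half_edges G" "G \<in> RK" "G' \<in> RK" using assms by (auto simp: slid_def)
  then have i: "iota G' = iota G" using RK_facts(13) by metis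
  show e: "edges G' = edges G" by (simp add: edges_def edge_of_def i h)
  show "hilb M G' = hilb M G" by (simp add: hilb_def e)
  show l: "L_op H M G' = L_op H M G"
    by (simp add: L_op_def on_edge_def edge_of_def is_source_def e i fun_eq_iff)
  show t: "T_op H M G' = T_op H M G"
    by (simp add: T_op_def on_edge_def edge_of_def is_source_def e i fun_eq_iff)
  have "L_prod H M G' hs a t = L_prod H M G hs a t" for hs a t
    by (induction hs arbitrary: a t) (simp_all add: l)
  then show "L_prod H M G' = L_prod H M G" by blast
  show "T_prod H B M G' = T_prod H B M G" by (simp add: T_prod_def t fun_eq_iff)
qed

lemma slid_distinct:
  assumes "slid a b G G'"
  shows "a \<in> half_edges G" "b \<in> half_edges G" "a \<noteq> b" "kappa a \<noteq> b"
  using assms by (auto simp: slid_def moves_to_def)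

lemma slid_face_moves_to:
  assumes "slid a b G G'"
  shows "moves_to (kappa b) a b (face_perm G) (face_perm G')"
    "c \<noteq> b \<Longrightarrow> inv_into UNIV (rho G') (transpose (kappa a) b c) = transpose b a (inv_into UNIV (rho G) c)"
proof -
  have s: "G \<in> RK" "G' \<in> RK" "half_edges G' = half_edges G" "moves_to a b (kappa a) (rho G) (rho G')"
    using assms by (auto simp: slid_def)
  note f = RK_facts[OF s(1)] and f' = RK_facts[OF s(2), unfolded s(3)]
  have k: "kappa ` half_edges G \<subseteq> half_edges G" "half_edges G \<subseteq> {1..}" using f(2,3) by auto
  show "moves_to (kappa b) a b (face_perm G) (face_perm G')"
    unfolding face_perm_def f(13) f'(13)
    by (rule face_moves_to[OF s(4) f(5) f'(5) slid_distinct(1,2)[OF assms] k])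
  note i = moves_to_inv[OF s(4) permutes_bij[OF f(5)] permutes_bij[OF f'(5)]]
  assume c: "c \<noteq> b"
  show "inv_into UNIV (rho G') (transpose (kappa a) b c) = transpose b a (inv_into UNIV (rho G) c)"
  proof (cases "c = kappa a")
    case True
    then show ?thesis using i by (simp add: transpose_def)
  next
    case False
    then show ?thesis using i(3)[OF c] c by (simp add: transpose_apply_other)
  qed
qed

text \<open>The half-edge lists of vertices and faces are related by \<open>move\<close>, so
  \<open>N_LP\<close> and \<open>N_TL\<close> apply. As \<open>b\<close> is no cilium, no vertex
  list starts at \<open>b\<close> and no face list at \<open>a\<close>, which
  \<open>support_move\<close> presupposes.\<close>

lemma slid_intertwines:
  assumes s: "slid a b G G'"
  shows "intertwines G G' (transpose (kappa a) b) (graph_hilbert.N H M B G a b)"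
proof -
  note s' = s[unfolded slid_def]
  have G: "G \<in> RK" "G' \<in> RK" using s' by auto
  interpret g: graph_hilbert H M B G by unfold_locales (rule G)
  note ab = slid_distinct[OF s] and ops = slid_ops[OF s]
  note Nw = g.N_wlin[OF ab] and Nin = g.N_in[OF ab]
  let ?t = "transpose (kappa a) b"
  have cil: "cilia G' = ?t ` cilia G" and bc: "b \<notin> cilia G"
    and m: "moves_to a b (kappa a) (rho G) (rho G')" using s' by auto
  have "bij_betw ?t (cilia G) (cilia G')"
    unfolding cil by (rule bij_betw_imageI) (auto intro: inj_on_subset[OF inj_transpose])
  moreover have "g.N a b (g.V c x t) = vertex_act H M G' (?t c) x (g.N a b t)"
    if c: "c \<in> cilia G" and t: "t \<in> hilb M G" for c x t
  proof -
    have "c \<noteq> b" using c bc by blast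
    from g.N_LP[OF ab support_move[OF m RK_facts(8)[OF G(1)] this] g.vertex_subset[OF c] t]
    show ?thesis by (simp add: vertex_act_def ops)
  qed
  moreover have "g.N a b (g.F c x t) = face_coact_by H B M G' (?t c) (zeta x) (g.N a b t)"
    if c: "c \<in> cilia G" and t: "t \<in> hilb M G" for c x t
  proof -
    have cb: "c \<noteq> b" using c bc by blast
    \<comment> \<open>A face list starting at \<open>a\<close> would belong to the cilium
      \<open>\<rho> a = b\<close>.\<close>
    have ca: "g.start c \<noteq> a"
    proof
      assume "g.start c = a"
      then have "rho G a = c" using permutes_inverses(1)[OF RK_facts(5)[OF G(1)], of c] by simp
      then show False using m cb by (simp add: moves_to_def)
    qed
    note mv = support_move[OF slid_face_moves_to(1)[OF s] RK_facts(9)[OF G(1)] ca]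
    note sub = g.face_subset[OF c]
    have "g.N a b (g.F c x t) = g.TL (support (face_perm G) (g.start c)) t (\<lambda>y r. g.N a b (fscale (zeta x y) r))"
      unfolding g.F_eq by (rule g.TL_map[OF sub t Nw]) simp
    also have "\<dots> = g.TL (support (face_perm G) (g.start c)) t (\<lambda>y r. fscale (zeta x y) (g.N a b r))"
      by (rule g.TL_cong[OF sub t]) (rule g.wlin_scale[OF Nw])
    also have "\<dots> = g.TL (support (face_perm G') (transpose b a (g.start c))) (g.N a b t) (\<lambda>y r. fscale (zeta x y) r)"
      by (rule g.N_TL[OF ab mv sub t g.dlin_fscale[OF zeta_lin], symmetric])
    also have "\<dots> = T_prod H B M G' (support (face_perm G') (inv_into UNIV (rho G') (?t c))) (zeta x) (g.N a b t)"
      unfolding slid_face_moves_to(2)[OF s cb] ops g.T_prod_TL ..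
    finally show ?thesis by (simp add: face_coact_by_def)
  qed
  ultimately show ?thesis
    using Nw Nin by (simp add: intertwines_def ops)
qed

lemma slide_map_slid:
  assumes s: "slid a b G G'"
  shows "slide_map a b G = graph_hilbert.N H M B G a b" "slide_map a b G' = graph_hilbert.N' H M B G a b"
proof -
  have G: "G \<in> RK" using s by (simp add: slid_def)
  interpret g: graph_hilbert H M B G by unfold_locales (rule G)
  note ab = slid_distinct[OF s]
  show "slide_map a b G = g.N a b"
    using slid_conds(1)[OF s] by (simp add: fun_eq_iff slide_map_def g.N_def[OF ab] g.dco_def)
  show "slide_map a b G' = g.N' a b"
    using slid_conds(2,3)[OF s]
    by (intro ext) (simp add: slide_map_def g.N'_def[OF ab] g.dco_def slid_ops(3,4)[OF s])
qed

lemma slide_map_intertwines: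
  assumes G: "G \<in> RK"
  shows "intertwines G (slide a b G) (slide_cilia a b G) (slide_map a b G)"
proof (cases rule: slide_cases[OF G, of a b])
  case 1
  then show ?thesis using slid_intertwines[OF 1(1)] slide_map_slid[OF 1(1)] by (simp add: slide_cilia_def)
next
  case 2
  have G': "slide a b G \<in> RK" by (rule slide_RK[OF G])
  interpret g: graph_hilbert H M B "slide a b G" by unfold_locales (rule G')
  note ab = slid_distinct[OF 2(1)] and ops = slid_ops[OF 2(1)]
  have "intertwines G (slide a b G) (transpose (kappa a) b) (g.N' a b)"
    by (rule intertwines_inverse[OF slid_intertwines[OF 2(1)] G'])
      (simp_all add: ops g.N'_in[OF ab] g.N_N'[OF ab] g.N'_N[OF ab])
  then show ?thesis using 2 slide_map_slid[OF 2(1)] by (simp add: slide_cilia_def)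
next
  case 3
  have "slide_map a b G = (\<lambda>t. t)" using 3 by (simp add: fun_eq_iff slide_map_def)
  then show ?thesis using 3 intertwines_id[of G] by (simp add: slide_cilia_def)
qed

lemma slide_map_slide_map:
  assumes G: "G \<in> RK" and t: "t \<in> hilb M G"
  shows "slide_map a b (slide a b G) (slide_map a b G t) = t"
proof (cases rule: slide_cases[OF G, of a b])
  case 1
  interpret g: graph_hilbert H M B G by unfold_locales (rule G)
  show ?thesis unfolding slide_map_slid[OF 1(1)] by (rule g.N'_N[OF slid_distinct[OF 1(1)] t])
next
  case 2
  interpret g: graph_hilbert H M B "slide a b G" by unfold_locales (rule slide_RK[OF G])
  have "t \<in> g.W" using t slid_ops(2)[OF 2(1)] by simp
  then show ?thesis unfolding slide_map_slid[OF 2(1)] by (rule g.N_N'[OF slid_distinct[OF 2(1)]])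
next
  case 3
  then show ?thesis by (simp add: slide_map_def)
qed

text \<open>The relabelling carries \<open>L\<close> and \<open>T\<close> of each half-edge to those
  of its image, term by term in the sum over the basis, and preserves the two conditions.\<close>

lemma relabel_map_slide_map:
  assumes \<sigma>: "\<sigma> \<in> carrier frakR" and G: "G \<in> RK" and t: "t \<in> hilb M G"
  shows "relabel_map \<sigma> (slide a b G) (slide_map a b G t) = slide_map (\<sigma> a) (\<sigma> b) (relabel \<sigma> G) (relabel_map \<sigma> G t)"
proof -
  note c = relabel_slide[OF \<sigma> G, of a b]
  interpret g: graph_hilbert H M B G by unfold_locales (rule G)
  have R: "relabel_map \<sigma> (slide a b G) = relabel_map \<sigma> G"
  proof -
    have "edges (slide a b G) = edges G"
      by (cases rule: slide_cases[OF G, of a b]) (auto dest: slid_ops(1))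
    then show ?thesis
      unfolding relabel_map_def edges_relabel[OF \<sigma> G] edges_relabel[OF \<sigma> slide_RK[OF G]] by simp
  qed
  have main: "relabel_map \<sigma> G (\<Sum>h\<in>B. g.L b (k h) (g.T a h t)) =
      (\<Sum>h\<in>B. L_op H M (relabel \<sigma> G) (\<sigma> b) (k h) (T_op H M (relabel \<sigma> G) (\<sigma> a) (zeta h) (relabel_map \<sigma> G t)))"
    if "a \<in> half_edges G" "b \<in> half_edges G" for k
    using that t by (subst g.wlin_sum[OF relabel_map_lin[OF \<sigma> G]]) (simp_all add: relabel_map_L[OF \<sigma> G] relabel_map_T[OF \<sigma> G])
  show ?thesis
    unfolding R slide_map_def c(2,3)
    using main[of "\<lambda>h. h"] main[of "antip_inv H"] by (auto simp: cond1_def cond2_def)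
qed

end

section \<open>The representation\<close>

definition slide_step :: "nat \<times> nat \<Rightarrow> nat kitaev \<times> (nat \<Rightarrow> nat) \<Rightarrow> nat kitaev \<times> (nat \<Rightarrow> nat)" where
  "slide_step = (\<lambda>(a, b) (G, f). (slide a b G, slide_cilia a b G \<circ> f))"

definition word_transport :: "word \<Rightarrow> (nat \<Rightarrow> nat) \<Rightarrow> nat kitaev \<Rightarrow> nat kitaev \<times> (nat \<Rightarrow> nat)" where
  "word_transport w \<sigma> G = foldr slide_step w (relabel \<sigma> G, \<sigma>)"

lemma word_transport_simps:
  "word_transport [] \<sigma> G = (relabel \<sigma> G, \<sigma>)"
  "word_transport ((a, b) # w) \<sigma> G =
     (slide a b (fst (word_transport w \<sigma> G)), slide_cilia a b (fst (word_transport w \<sigma> G)) \<circ> snd (word_transport w \<sigma> G))"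
  by (simp_all add: word_transport_def slide_step_def case_prod_unfold)

lemma word_transport_RK: "\<sigma> \<in> carrier frakR \<Longrightarrow> G \<in> RK \<Longrightarrow> fst (word_transport w \<sigma> G) \<in> RK"
proof (induction w)
  case (Cons s w)
  then show ?case using slide_RK by (cases s) (simp add: word_transport_simps)
qed (simp add: word_transport_simps relabel_RK(2))

lemma slide_cilia_involution:
  assumes "G \<in> RK"
  shows "slide_cilia a b (slide a b G) \<circ> slide_cilia a b G = id"
  unfolding slide_cilia_slide[OF assms] by (simp add: slide_cilia_def fun_eq_iff)

lemma word_transport_cancel:
  assumes \<sigma>: "\<sigma> \<in> carrier frakR" and G: "G \<in> RK"
  shows "word_transport (u @ [s, s] @ v) \<sigma> G = word_transport (u @ v) \<sigma> G"
proof (induction u)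
  case Nil
  obtain a b where s: "s = (a, b)" by (cases s)
  show ?case
    using slide_slide[OF word_transport_RK[OF \<sigma> G], of a b v] slide_cilia_involution[OF word_transport_RK[OF \<sigma> G], of a b v]
    by (simp add: s word_transport_simps o_assoc)
next
  case (Cons r u)
  then show ?case by (cases r) (simp add: word_transport_simps)
qed

lemma word_transport_word_eq:
  assumes "word_eq u v" and \<sigma>: "\<sigma> \<in> carrier frakR" and G: "G \<in> RK"
  shows "word_transport u \<sigma> G = word_transport v \<sigma> G"
  using assms(1) by (induction rule: word_eq.induct) (simp_all only: word_transport_cancel[OF \<sigma> G])

lemma slide_cilia_relabel:
  assumes "\<sigma> \<in> carrier frakR" "G \<in> RK"
  shows "slide_cilia (\<sigma> a) (\<sigma> b) (relabel \<sigma> G) \<circ> \<sigma> = \<sigma> \<circ> slide_cilia a b G"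
proof -
  have "inj \<sigma>" using frakR_bij[OF assms(1)] by (rule bij_is_inj)
  then show ?thesis
    unfolding slide_cilia_def relabel_slide(2,3)[OF assms]
    by (auto simp: fun_eq_iff transpose_def frakR_kappa[OF assms(1), symmetric] inj_eq)
qed

text \<open>In the semidirect product \<open>(w \<sigma>) (v \<tau>) = w \<vartheta>(\<sigma>)(v)
  \<sigma> \<tau>\<close>: the relabelling \<sigma> is moved past the letters of \<open>v\<close>
  one at a time by \<open>relabel_slide\<close>.\<close>

lemma word_transport_semidirect:
  assumes \<sigma>: "\<sigma> \<in> carrier frakR" and \<tau>: "\<tau> \<in> carrier frakR" and G: "G \<in> RK"
  shows "word_transport (w @ map (map_prod \<sigma> \<sigma>) v) (\<sigma> \<circ> \<tau>) G =
    (fst (word_transport w \<sigma> (fst (word_transport v \<tau> G))), snd (word_transport w \<sigma> (fst (word_transport v \<tau> G))) \<circ> snd (word_transport v \<tau> G))"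
proof (induction w)
  case Nil
  define \<rho> where "\<rho> = \<sigma> \<circ> \<tau>"
  have "word_transport (map (map_prod \<sigma> \<sigma>) v) \<rho> G = (relabel \<sigma> (fst (word_transport v \<tau> G)), \<sigma> \<circ> snd (word_transport v \<tau> G))"
  proof (induction v)
    case Nil
    show ?case
      using relabel_relabel[OF \<sigma> \<tau> frakR_comp[OF \<sigma> \<tau>] G] by (simp only: \<rho>_def list.map word_transport_simps fst_conv snd_conv)
  next
    case (Cons s v)
    obtain a b where s: "s = (a, b)" by (cases s)
    have "slide_cilia (\<sigma> a) (\<sigma> b) (relabel \<sigma> (fst (word_transport v \<tau> G))) \<circ> (\<sigma> \<circ> snd (word_transport v \<tau> G)) =
        \<sigma> \<circ> (slide_cilia a b (fst (word_transport v \<tau> G)) \<circ> snd (word_transport v \<tau> G))"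
      unfolding o_assoc by (simp only: slide_cilia_relabel[OF \<sigma> word_transport_RK[OF \<tau> G]])
    then show ?case
      using relabel_slide(1)[OF \<sigma> word_transport_RK[OF \<tau> G]]
      by (simp only: s list.map map_prod_simp word_transport_simps fst_conv snd_conv Cons)
  qed
  then show ?case by (simp only: \<rho>_def append_Nil word_transport_simps fst_conv snd_conv)
next
  case (Cons s w)
  then show ?case by (cases s) (simp add: word_transport_simps o_def)
qed

lemma word_eq_words: "word_eq u v \<Longrightarrow> u \<in> words \<and> v \<in> words"
  by (induction rule: word_eq.induct) (auto simp: words_def)

lemma frakS_carrier:
  assumes "X \<in> carrier frakS"
  obtains w where "w \<in> X" "\<And>u. u \<in> X \<longleftrightarrow> word_eq w u"
proof -
  obtain w where w: "w \<in> words" "X = word_rel `` {w}"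
    using assms by (auto simp: frakS_def elim!: quotientE)
  then show ?thesis using that[of w] word_eq.refl[of w] by (auto simp: word_rel_def)
qed

section \<open>Words acting on the summands\<close>

context fd_involutive_hopf_bimodule
begin

primrec word_map :: "word \<Rightarrow> (nat \<Rightarrow> nat) \<Rightarrow> nat kitaev \<Rightarrow> ('m, 'k) mtensor \<Rightarrow> ('m, 'k) mtensor" where
  "word_map [] \<sigma> G = relabel_map \<sigma> G"
| "word_map (s # w) \<sigma> G = slide_map (fst s) (snd s) (fst (word_transport w \<sigma> G)) \<circ> word_map w \<sigma> G"

lemma word_map_intertwines:
  assumes "\<sigma> \<in> carrier frakR" "G \<in> RK"
  shows "intertwines G (fst (word_transport w \<sigma> G)) (snd (word_transport w \<sigma> G)) (word_map w \<sigma> G)"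
proof (induction w)
  case Nil
  show ?case using relabel_map_intertwines[OF assms] by (simp add: word_transport_simps)
next
  case (Cons s w)
  obtain a b where s: "s = (a, b)" by (cases s)
  from intertwines_comp[OF Cons slide_map_intertwines[OF word_transport_RK[OF assms]], of a b]
  show ?case by (simp only: s word_transport_simps word_map.simps fst_conv snd_conv)
qed

lemma word_map_in: "\<sigma> \<in> carrier frakR \<Longrightarrow> G \<in> RK \<Longrightarrow> t \<in> hilb M G \<Longrightarrow> word_map w \<sigma> G t \<in> hilb M (fst (word_transport w \<sigma> G))"
  using word_map_intertwines[of \<sigma> G w] by (simp add: intertwines_def)

text \<open>The only relation with content is the cancellation of a repeated letter, which is
  \<open>slide_map_slide_map\<close> at the graph reached so far.\<close>

lemma word_map_word_eq:
  assumes "word_eq u v" and \<sigma>: "\<sigma> \<in> carrier frakR" and G: "G \<in> RK" and t: "t \<in> hilb M G"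
  shows "word_map u \<sigma> G t = word_map v \<sigma> G t"
  using assms(1)
proof (induction rule: word_eq.induct)
  case (cancel u s v)
  obtain a b where s: "s = (a, b)" by (cases s)
  show ?case
  proof (induction u)
    case Nil
    show ?case
      using slide_map_slide_map[OF word_transport_RK[OF \<sigma> G] word_map_in[OF \<sigma> G t], of a b v]
      by (simp add: s word_transport_simps)
  next
    case (Cons r u)
    then show ?case using word_transport_cancel[OF \<sigma> G, of u s v] by simp
  qed
qed simp_all

text \<open>The counterpart of \<open>word_transport_semidirect\<close> on states, with
  \<open>relabel_map_slide_map\<close> for each letter and \<open>relabel_map_comp\<close> at the
  end of the word.\<close>

lemma word_map_semidirect:
  assumes \<sigma>: "\<sigma> \<in> carrier frakR" and \<tau>: "\<tau> \<in> carrier frakR" and G: "G \<in> RK" and t: "t \<in> hilb M G"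
  shows "word_map (w @ map (map_prod \<sigma> \<sigma>) v) (\<sigma> \<circ> \<tau>) G t = word_map w \<sigma> (fst (word_transport v \<tau> G)) (word_map v \<tau> G t)"
proof (induction w)
  case Nil
  define \<rho> where "\<rho> = \<sigma> \<circ> \<tau>"
  have "word_map (map (map_prod \<sigma> \<sigma>) v) \<rho> G t = relabel_map \<sigma> (fst (word_transport v \<tau> G)) (word_map v \<tau> G t)"
  proof (induction v)
    case Nil
    show ?case
      unfolding \<rho>_def list.map word_map.simps word_transport_simps fst_conv by (rule relabel_map_comp[OF \<sigma> \<tau> G t, symmetric])
  next
    case (Cons s v)
    obtain a b where s: "s = (a, b)" by (cases s)
    have "fst (word_transport (map (map_prod \<sigma> \<sigma>) v) \<rho> G) = relabel \<sigma> (fst (word_transport v \<tau> G))"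
      using word_transport_semidirect[OF \<sigma> \<tau> G, of "[]" v] by (simp only: \<rho>_def append_Nil word_transport_simps fst_conv)
    then show ?case
      using Cons relabel_map_slide_map[OF \<sigma> word_transport_RK[OF \<tau> G] word_map_in[OF \<tau> G t]] by (simp add: s word_transport_simps)
  qed
  then show ?case by (simp only: \<rho>_def append_Nil word_map.simps)
next
  case (Cons s w)
  then show ?case using word_transport_semidirect[OF \<sigma> \<tau> G, of w v] by (simp add: o_def)
qed

subsection \<open>Automorphisms of the direct sum\<close>

definition rkmap :: "(nat kitaev \<Rightarrow> nat kitaev) \<Rightarrow> (nat kitaev \<Rightarrow> ('m, 'k) mtensor \<Rightarrow> ('m, 'k) mtensor) \<Rightarrow> bool"
  where "rkmap p f \<longleftrightarrow> (\<forall>G\<in>RK. p G \<in> RK \<and> lin_on fscale fscale (hilb M G) (f G) \<and>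
     (\<forall>t\<in>hilb M G. f G t \<in> hilb M (p G)))"

text \<open>A family of maps together with its inverse. Bijectivity of \<open>p\<close> on
  \<open>RK\<close> makes every fibre in the sum of \<open>dsum\<close> a single graph, and the
  inverse family yields the inverse of the direct sum.\<close>

definition rkinv where
  "rkinv p f q g \<longleftrightarrow> rkmap p f \<and> rkmap q g \<and>
     (\<forall>G\<in>RK. q (p G) = G \<and> p (q G) = G \<and> (\<forall>t\<in>hilb M G. g (p G) (f G t) = t \<and> f (q G) (g G t) = t))"

lemma rkinv_sym: "rkinv p f q g \<Longrightarrow> rkinv q g p f"
  by (auto simp: rkinv_def)

lemma rkinv_comp:
  assumes 1: "rkinv p f q g" and 2: "rkinv p' f' q' g'"
  shows "rkinv (\<lambda>G. p' (p G)) (\<lambda>G. f' (p G) \<circ> f G) (\<lambda>G. q (q' G)) (\<lambda>G. g (q' G) \<circ> g' G)"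
  using assms by (simp add: rkinv_def rkmap_def lin_on_def)

lemma hilb_closed [simp]:
  "0 \<in> hilb M G" "s \<in> hilb M G \<Longrightarrow> t \<in> hilb M G \<Longrightarrow> s + t \<in> hilb M G" "t \<in> hilb M G \<Longrightarrow> fscale c t \<in> hilb M G"
  unfolding hilb_def by auto

lemma hilb_lin_0: "lin_on fscale fscale (hilb M G) f \<Longrightarrow> f 0 = 0"
  using lin_on_zero[OF vector_space_fscale vector_space_fscale, of "hilb M G" f 0] by simp

context
  fixes p f q g
  assumes inv: "rkinv p f q g"
begin

text \<open>The sum over the fibre of \<open>p G\<close> has the single term \<open>G\<close>, or
  none if the component at \<open>G\<close> is zero; the formula then holds because
  \<open>f G\<close> sends 0 to 0.\<close>

lemma dsum_at:
  assumes u: "u \<in> hilb_RK M" and G: "G \<in> RK"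
  shows "dsum M p f u (p G) = f G (u G)"
proof -
  have inj: "G' = G" if "u G' \<noteq> 0" "p G' = p G" for G'
  proof -
    have "G' \<in> RK" using u that(1) by (auto simp: hilb_RK_def)
    then show ?thesis using inv G that(2) unfolding rkinv_def by metis
  qed
  have f0: "f G 0 = 0" using hilb_lin_0[of G "f G"] inv G by (simp add: rkinv_def rkmap_def)
  have "(\<Sum>G' | u G' \<noteq> 0 \<and> p G' = p G. f G' (u G')) = (\<Sum>G' \<in> (if u G = 0 then {} else {G}). f G' (u G'))"
    by (rule sum.cong) (use inj in auto)
  then show ?thesis using u f0 by (simp add: dsum_def)
qed

lemma dsum_outside:
  assumes u: "u \<in> hilb_RK M" and G: "G \<notin> RK"
  shows "dsum M p f u G = 0"
proof -
  have "(\<Sum>G' | u G' \<noteq> 0 \<and> p G' = G. f G' (u G')) = (\<Sum>G' \<in> {}. f G' (u G'))"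
    by (rule sum.cong) (use u G inv in \<open>auto simp: rkinv_def rkmap_def hilb_RK_def\<close>)
  then show ?thesis using u by (simp add: dsum_def)
qed

lemma RK_image: "G \<in> RK \<Longrightarrow> \<exists>G'\<in>RK. G = p G'"
  using inv unfolding rkinv_def rkmap_def by metis

lemma dsum_in:
  assumes u: "u \<in> hilb_RK M"
  shows "dsum M p f u \<in> hilb_RK M"
proof -
  have 1: "dsum M p f u G \<in> hilb M G" if "G \<in> RK" for G
  proof -
    obtain G' where G': "G' \<in> RK" "G = p G'" using RK_image[OF \<open>G \<in> RK\<close>] by blast
    then show ?thesis using dsum_at[OF u G'(1)] inv u by (simp add: rkinv_def rkmap_def hilb_RK_def)
  qed
  have "{G. dsum M p f u G \<noteq> 0} \<subseteq> p ` {G. u G \<noteq> 0}"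
  proof
    fix G assume "G \<in> {G. dsum M p f u G \<noteq> 0}"
    then have ne: "dsum M p f u G \<noteq> 0" by simp
    then have "G \<in> RK" using dsum_outside[OF u] by blast
    then obtain G' where G': "G' \<in> RK" "G = p G'" using RK_image by blast
    have "u G' \<noteq> 0"
      using ne dsum_at[OF u G'(1)] G' hilb_lin_0[of G' "f G'"] inv by (auto simp: rkinv_def rkmap_def)
    then show "G \<in> p ` {G. u G \<noteq> 0}" using G'(2) by blast
  qed
  moreover have "finite {G. u G \<noteq> 0}" using u by (simp add: hilb_RK_def)
  ultimately have "finite {G. dsum M p f u G \<noteq> 0}" using finite_surj by blast
  then show ?thesis using 1 dsum_outside[OF u] by (simp add: hilb_RK_def)
qed

lemma incl_in: "G \<in> RK \<Longrightarrow> t \<in> hilb M G \<Longrightarrow> incl G t \<in> hilb_RK M"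
  by (auto simp: hilb_RK_def incl_def)

lemma dsum_incl:
  assumes G: "G \<in> RK" and t: "t \<in> hilb M G"
  shows "dsum M p f (incl G t) = incl (p G) (f G t)"
proof
  fix G'
  note i = incl_in[OF G t]
  show "dsum M p f (incl G t) G' = incl (p G) (f G t) G'"
  proof (cases "G' \<in> RK")
    case True
    then obtain G1 where G1: "G1 \<in> RK" "G' = p G1" using RK_image by blast
    have "p G1 = p G \<longleftrightarrow> G1 = G" using inv G G1(1) unfolding rkinv_def by metis
    then show ?thesis
      using dsum_at[OF i G1(1)] G1 hilb_lin_0[of G1 "f G1"] inv
      by (auto simp: incl_def rkinv_def rkmap_def)
  next
    case False
    then show ?thesis using dsum_outside[OF i False] inv G by (auto simp: incl_def rkinv_def rkmap_def)
  qed
qed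

end

lemma dsum_comp:
  assumes 1: "rkinv p f q g" and 2: "rkinv p' f' q' g'"
  shows "compose (hilb_RK M) (dsum M p' f') (dsum M p f) = dsum M (\<lambda>G. p' (p G)) (\<lambda>G. f' (p G) \<circ> f G)"
proof
  fix u
  show "compose (hilb_RK M) (dsum M p' f') (dsum M p f) u = dsum M (\<lambda>G. p' (p G)) (\<lambda>G. f' (p G) \<circ> f G) u"
  proof (cases "u \<in> hilb_RK M")
    case u: True
    note c = rkinv_comp[OF 1 2] and d = dsum_in[OF 1 u]
    show ?thesis
    proof
      fix G'
      show "compose (hilb_RK M) (dsum M p' f') (dsum M p f) u G' =
          dsum M (\<lambda>G. p' (p G)) (\<lambda>G. f' (p G) \<circ> f G) u G'"
      proof (cases "G' \<in> RK")
        case True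
        then obtain G where G: "G \<in> RK" "G' = p' (p G)" using RK_image[OF c] by blast
        have "p G \<in> RK" using 1 G(1) by (simp add: rkinv_def rkmap_def)
        then show ?thesis
          using dsum_at[OF c u G(1)] dsum_at[OF 2 d, of "p G"] dsum_at[OF 1 u G(1)] u
          by (simp add: G compose_def)
      next
        case False
        then show ?thesis
          using dsum_outside[OF c u False] dsum_outside[OF 2 d False] u by (simp add: compose_def)
      qed
    qed
  qed (simp add: compose_def dsum_def)
qed

lemma dsum_cong:
  assumes "\<And>G. G \<in> RK \<Longrightarrow> p G = q G" "\<And>G t. G \<in> RK \<Longrightarrow> t \<in> hilb M G \<Longrightarrow> f G t = g G t"
  shows "dsum M p f = dsum M q g"
proof
  fix u
  show "dsum M p f u = dsum M q g u"
  proof (cases "u \<in> hilb_RK M")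
    case True
    then have RK: "G \<in> RK \<and> u G \<in> hilb M G" if "u G \<noteq> 0" for G
      using that by (auto simp: hilb_RK_def)
    have "(\<Sum>G | u G \<noteq> 0 \<and> p G = G'. f G (u G)) = (\<Sum>G | u G \<noteq> 0 \<and> q G = G'. g G (u G))" for G'
      by (rule sum.cong) (use RK assms in auto)
    then show ?thesis using True by (simp add: dsum_def)
  qed (simp add: dsum_def)
qed

lemma dsum_id: "dsum M (\<lambda>G. G) (\<lambda>G t. t) u = u" if "u \<in> hilb_RK M"
proof
  fix G
  have "(\<Sum>G' | u G' \<noteq> 0 \<and> G' = G. u G') = (\<Sum>G' \<in> (if u G = 0 then {} else {G}). u G')"
    by (rule sum.cong) auto
  then show "dsum M (\<lambda>G. G) (\<lambda>G t. t) u G = u G" using that by (simp add: dsum_def)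
qed

lemma dsum_inverse:
  assumes i: "rkinv p f q g" and u: "u \<in> hilb_RK M"
  shows "dsum M q g (dsum M p f u) = u"
proof -
  have "dsum M q g (dsum M p f u) = compose (hilb_RK M) (dsum M q g) (dsum M p f) u"
    using u by (simp add: compose_def)
  also have "\<dots> = dsum M (\<lambda>G. q (p G)) (\<lambda>G. g (p G) \<circ> f G) u"
    by (simp add: dsum_comp[OF i rkinv_sym[OF i]])
  also have "dsum M (\<lambda>G. q (p G)) (\<lambda>G. g (p G) \<circ> f G) = dsum M (\<lambda>G. G) (\<lambda>G t. t)"
    by (rule dsum_cong) (use i in \<open>auto simp: rkinv_def\<close>)
  finally show ?thesis by (simp add: dsum_id[OF u])
qed

lemma dsum_Aut:
  assumes i: "rkinv p f q g"
  shows "dsum M p f \<in> carrier (Aut_RK M)"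
proof -
  note j = rkinv_sym[OF i]
  have "bij_betw (dsum M p f) (hilb_RK M) (hilb_RK M)"
    by (rule bij_betw_byWitness[where f' = "dsum M q g"])
      (use dsum_inverse[OF i] dsum_inverse[OF j] dsum_in[OF i] dsum_in[OF j] in auto)
  moreover have "dsum M p f \<in> extensional (hilb_RK M)" by (simp add: dsum_def)
  moreover have "dsum M p f (u + v) = dsum M p f u + dsum M p f v"
    if u: "u \<in> hilb_RK M" and v: "v \<in> hilb_RK M" for u v
  proof
    fix G
    have "{G. (u + v) G \<noteq> 0} \<subseteq> {G. u G \<noteq> 0} \<union> {G. v G \<noteq> 0}" by (auto simp: plus_fun_apply)
    then have "finite {G. (u + v) G \<noteq> 0}" using u v finite_subset by (auto simp: hilb_RK_def)
    then have uv: "u + v \<in> hilb_RK M" using u v by (simp add: hilb_RK_def plus_fun_apply)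
    show "dsum M p f (u + v) G = (dsum M p f u + dsum M p f v) G"
    proof (cases "G \<in> RK")
      case True
      then obtain G' where G': "G' \<in> RK" "G = p G'" using RK_image[OF i] by blast
      have "lin_on fscale fscale (hilb M G') (f G')" "u G' \<in> hilb M G'" "v G' \<in> hilb M G'"
        using i u v G'(1) by (simp_all add: rkinv_def rkmap_def hilb_RK_def)
      then show ?thesis
        unfolding G'(2) plus_fun_apply[of "dsum M p f u"] dsum_at[OF i uv G'(1)] dsum_at[OF i u G'(1)] dsum_at[OF i v G'(1)]
        by (simp add: plus_fun_apply[of u] lin_on_add)
    next
      case False
      then show ?thesis
        unfolding plus_fun_apply[of "dsum M p f u"] dsum_outside[OF i uv False] dsum_outside[OF i u False] dsum_outside[OF i v False]
        by simp
    qed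
  qed
  moreover have "dsum M p f (\<lambda>G. fscale c (u G)) = (\<lambda>G. fscale c (dsum M p f u G))"
    if u: "u \<in> hilb_RK M" for c u
  proof
    fix G
    have "{G. fscale c (u G) \<noteq> 0} \<subseteq> {G. u G \<noteq> 0}" by auto
    then have "finite {G. fscale c (u G) \<noteq> 0}" using u finite_subset by (auto simp: hilb_RK_def)
    then have cu: "(\<lambda>G. fscale c (u G)) \<in> hilb_RK M" using u by (simp add: hilb_RK_def)
    show "dsum M p f (\<lambda>G. fscale c (u G)) G = fscale c (dsum M p f u G)"
    proof (cases "G \<in> RK")
      case True
      then obtain G' where G': "G' \<in> RK" "G = p G'" using RK_image[OF i] by blast
      have "lin_on fscale fscale (hilb M G') (f G')" "u G' \<in> hilb M G'"
        using i u G'(1) by (simp_all add: rkinv_def rkmap_def hilb_RK_def)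
      then show ?thesis
        unfolding G'(2) dsum_at[OF i cu G'(1)] dsum_at[OF i u G'(1)] by (simp add: lin_on_scale)
    next
      case False
      then show ?thesis unfolding dsum_outside[OF i cu False] dsum_outside[OF i u False] by simp
    qed
  qed
  ultimately show ?thesis by (simp add: Aut_RK_def Bij_def)
qed

section \<open>Relabellings, slides and words act by automorphisms\<close>

lemma rkinv_relabel:
  assumes \<sigma>: "\<sigma> \<in> carrier frakR"
  shows "\<exists>q g. rkinv (relabel \<sigma>) (relabel_map \<sigma>) q g"
proof -
  define \<tau> where "\<tau> = inv\<^bsub>frakR\<^esub> \<sigma>"
  have \<tau>: "\<tau> \<in> carrier frakR" unfolding \<tau>_def by (rule group.inv_closed[OF group_frakR \<sigma>])
  have 1: "\<sigma> \<circ> \<tau> = id" "\<tau> \<circ> \<sigma> = id"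
    using group.r_inv[OF group_frakR \<sigma>] group.l_inv[OF group_frakR \<sigma>] by (simp_all add: \<tau>_def frakR_mult frakR_one)
  have m: "rkmap (relabel \<rho>) (relabel_map \<rho>)" if "\<rho> \<in> carrier frakR" for \<rho>
    using that by (simp add: rkmap_def relabel_RK(2) relabel_map_in relabel_map_lin)
  have 2: "relabel \<tau> (relabel \<sigma> G) = G" "relabel \<sigma> (relabel \<tau> G) = G" if "G \<in> RK" for G
    using relabel_relabel[OF \<tau> \<sigma> _ that] relabel_relabel[OF \<sigma> \<tau> _ that] frakR_id relabel_id[OF that]
    by (simp_all add: 1)
  have "rkinv (relabel \<sigma>) (relabel_map \<sigma>) (relabel \<tau>) (relabel_map \<tau>)"
    using m[OF \<sigma>] m[OF \<tau>] 2 by (simp add: rkinv_def relabel_map_comp[OF \<tau> \<sigma>] relabel_map_comp[OF \<sigma> \<tau>] 1 relabel_map_id)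
  then show ?thesis by blast
qed

lemma rkinv_slide_map: "rkinv (slide a b) (slide_map a b) (slide a b) (slide_map a b)"
proof -
  have "rkmap (slide a b) (slide_map a b)"
    using slide_map_intertwines[of _ a b] by (simp add: rkmap_def slide_RK intertwines_def)
  then show ?thesis by (simp add: rkinv_def slide_slide slide_map_slide_map)
qed

lemma rkinv_word_map:
  assumes \<sigma>: "\<sigma> \<in> carrier frakR"
  shows "\<exists>q g. rkinv (\<lambda>G. fst (word_transport w \<sigma> G)) (word_map w \<sigma>) q g"
proof (induction w)
  case Nil
  obtain q g where "rkinv (relabel \<sigma>) (relabel_map \<sigma>) q g" using rkinv_relabel[OF \<sigma>] by blast
  then have "rkinv (\<lambda>G. fst (word_transport [] \<sigma> G)) (word_map [] \<sigma>) q g"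
    by (simp add: word_transport_simps rkinv_def rkmap_def)
  then show ?case by blast
next
  case (Cons s w)
  then obtain q g where i: "rkinv (\<lambda>G. fst (word_transport w \<sigma> G)) (word_map w \<sigma>) q g" by blast
  obtain a b where s: "s = (a, b)" by (cases s)
  from rkinv_comp[OF i rkinv_slide_map[of a b]] show ?case
    unfolding s by (simp add: word_transport_simps o_def) blast
qed

text \<open>The word \<open>w\<close> stands for the class \<open>X\<close> through its effect on
  graphs and states. This form passes to products by concatenating words.\<close>

definition represents :: "word set \<Rightarrow> (nat \<Rightarrow> nat) \<Rightarrow> word \<Rightarrow> bool" where
  "represents X \<sigma> w \<longleftrightarrow> X \<noteq> {} \<and> (\<forall>u\<in>X. \<forall>G\<in>RK. word_transport u \<sigma> G = word_transport w \<sigma> G \<and>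
     (\<forall>t\<in>hilb M G. word_map u \<sigma> G t = word_map w \<sigma> G t))"

text \<open>Some word of the class is chosen; by \<open>mu_eq\<close> every word representing the
  class gives the same map.\<close>

definition mu :: "word set \<times> (nat \<Rightarrow> nat) \<Rightarrow> ('m, 'k) msum \<Rightarrow> ('m, 'k) msum" where
  "mu x = (let w = SOME w. w \<in> fst x in dsum M (\<lambda>G. fst (word_transport w (snd x) G)) (word_map w (snd x)))"

lemma mu_eq:
  assumes "represents X \<sigma> w"
  shows "mu (X, \<sigma>) = dsum M (\<lambda>G. fst (word_transport w \<sigma> G)) (word_map w \<sigma>)"
proof -
  have "(SOME w. w \<in> X) \<in> X" using assms some_in_eq by (auto simp: represents_def)
  then show ?thesis
    unfolding mu_def Let_def fst_conv snd_conv
    using assms by (intro dsum_cong) (simp_all add: represents_def)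
qed

lemma transport_eq:
  assumes "represents X \<sigma> w" "G \<in> RK"
  shows "transport (X, \<sigma>) G = word_transport w \<sigma> G"
proof -
  have "(\<lambda>u. word_transport u \<sigma> G) ` X = {word_transport w \<sigma> G}" using assms by (auto simp: represents_def)
  then show ?thesis
    by (simp add: transport_def word_transport_def slide_step_def)
qed

lemma represents_word:
  assumes "\<And>u. u \<in> X \<Longrightarrow> word_eq w u" "X \<noteq> {}" "\<sigma> \<in> carrier frakR"
  shows "represents X \<sigma> w"
proof -
  have "word_transport u \<sigma> G = word_transport w \<sigma> G" "\<forall>t\<in>hilb M G. word_map u \<sigma> G t = word_map w \<sigma> G t" if "u \<in> X" "G \<in> RK" for u G
    using word_transport_word_eq[OF assms(1)[OF that(1)] assms(3) that(2)]
      word_map_word_eq[OF assms(1)[OF that(1)] assms(3) that(2)] by simp_all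
  then show ?thesis using assms(2) by (simp add: represents_def)
qed

text \<open>The product class consists of the words equivalent to concatenations of members.
  Concatenations have the required effect by the two semidirect lemmas, and equivalent words have
  equal effect.\<close>

lemma represents_mult:
  assumes X: "X \<in> carrier frakS" "represents X \<sigma> w" and Y: "Y \<in> carrier frakS" "represents Y \<tau> v"
    and \<sigma>: "\<sigma> \<in> carrier frakR" and \<tau>: "\<tau> \<in> carrier frakR"
  shows "represents (X \<otimes>\<^bsub>frakS\<^esub> vartheta \<sigma> Y) (\<sigma> \<circ> \<tau>) (w @ map (map_prod \<sigma> \<sigma>) v)"
proof -
  have mult: "X \<otimes>\<^bsub>frakS\<^esub> vartheta \<sigma> Y =
      {z. \<exists>x\<in>X. \<exists>y\<in>Y. word_eq (x @ map (map_prod \<sigma> \<sigma>) y) z}"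
    by (auto simp: frakS_def vartheta_def word_rel_def)
  have words: "x \<in> words" if "x \<in> X \<or> x \<in> Y" for x
    using that X(1) Y(1) word_eq_words by (elim disjE) (metis frakS_carrier)+
  have "represents {x @ map (map_prod \<sigma> \<sigma>) y} (\<sigma> \<circ> \<tau>) (w @ map (map_prod \<sigma> \<sigma>) v)"
    if "x \<in> X" "y \<in> Y" for x y
  proof -
    have "word_transport (x @ map (map_prod \<sigma> \<sigma>) y) (\<sigma> \<circ> \<tau>) G = word_transport (w @ map (map_prod \<sigma> \<sigma>) v) (\<sigma> \<circ> \<tau>) G"
      if "G \<in> RK" for G
      using X(2) Y(2) \<open>x \<in> X\<close> \<open>y \<in> Y\<close> that word_transport_RK[OF \<tau> that]
      by (simp add: word_transport_semidirect[OF \<sigma> \<tau> that] represents_def)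
    moreover have "word_map (x @ map (map_prod \<sigma> \<sigma>) y) (\<sigma> \<circ> \<tau>) G t = word_map (w @ map (map_prod \<sigma> \<sigma>) v) (\<sigma> \<circ> \<tau>) G t"
      if "G \<in> RK" "t \<in> hilb M G" for G t
      using X(2) Y(2) \<open>x \<in> X\<close> \<open>y \<in> Y\<close> that word_transport_RK[OF \<tau> that(1)] word_map_in[OF \<tau> that]
      by (simp add: word_map_semidirect[OF \<sigma> \<tau> that] represents_def)
    ultimately show ?thesis by (simp add: represents_def)
  qed
  moreover have "represents {x @ map (map_prod \<sigma> \<sigma>) y} (\<sigma> \<circ> \<tau>) z"
    if "word_eq (x @ map (map_prod \<sigma> \<sigma>) y) z" for x y z
    using word_eq.sym[OF that] by (intro represents_word frakR_comp \<sigma> \<tau>) auto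
  \<comment> \<open>A concatenation is again a word with positive indices, since \<sigma> permutes
    the positive numbers; so the product class contains a word.\<close>
  moreover have "X \<otimes>\<^bsub>frakS\<^esub> vartheta \<sigma> Y \<noteq> {}"
  proof -
    obtain x y where xy: "x \<in> X" "y \<in> Y" using X(2) Y(2) by (auto simp: represents_def)
    have "x @ map (map_prod \<sigma> \<sigma>) y \<in> words"
      using words[of x] words[of y] xy frakR_ge[OF \<sigma>] by (fastforce simp: words_def)
    then show ?thesis unfolding mult using xy word_eq.refl by blast
  qed
  ultimately show ?thesis
    unfolding mult represents_def mem_Collect_eq Ball_def insert_iff empty_iff by (simp only: ) (metis (no_types, lifting))
qed

lemma mu_hom: "mu \<in> hom frakG (Aut_RK M)"
proof (rule homI)
  have rep: "\<exists>w. represents X \<sigma> w" if "X \<in> carrier frakS" "\<sigma> \<in> carrier frakR" for X \<sigma>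
  proof -
    obtain w where w: "w \<in> X" "\<And>u. u \<in> X \<longleftrightarrow> word_eq w u"
      using frakS_carrier[OF \<open>X \<in> carrier frakS\<close>] by blast
    have "represents X \<sigma> w" by (rule represents_word) (use w that(2) in auto)
    then show ?thesis by blast
  qed
  show Aut: "mu x \<in> carrier (Aut_RK M)" if "x \<in> carrier frakG" for x
  proof -
    obtain X \<sigma> where x: "x = (X, \<sigma>)" "X \<in> carrier frakS" "\<sigma> \<in> carrier frakR"
      using \<open>x \<in> carrier frakG\<close> by (auto simp: frakG_def)
    obtain w where "represents X \<sigma> w" using rep[OF x(2,3)] by blast
    from mu_eq[OF this] show ?thesis using rkinv_word_map[OF x(3), of w] dsum_Aut x(1) by metis
  qed
  fix x y assume xy: "x \<in> carrier frakG" "y \<in> carrier frakG"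
  obtain X \<sigma> where x: "x = (X, \<sigma>)" "X \<in> carrier frakS" "\<sigma> \<in> carrier frakR"
    using xy(1) by (auto simp: frakG_def)
  obtain Y \<tau> where y: "y = (Y, \<tau>)" "Y \<in> carrier frakS" "\<tau> \<in> carrier frakR"
    using xy(2) by (auto simp: frakG_def)
  obtain w where w: "represents X \<sigma> w" using rep[OF x(2,3)] by blast
  obtain v where v: "represents Y \<tau> v" using rep[OF y(2,3)] by blast
  obtain q g where i: "rkinv (\<lambda>G. fst (word_transport v \<tau> G)) (word_map v \<tau>) q g" using rkinv_word_map[OF y(3)] by blast
  obtain q' g' where j: "rkinv (\<lambda>G. fst (word_transport w \<sigma> G)) (word_map w \<sigma>) q' g'" using rkinv_word_map[OF x(3)] by blast
  have "x \<otimes>\<^bsub>frakG\<^esub> y = (X \<otimes>\<^bsub>frakS\<^esub> vartheta \<sigma> Y, \<sigma> \<circ> \<tau>)"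
    by (simp add: x(1) y(1) frakG_def frakR_mult)
  then have "mu (x \<otimes>\<^bsub>frakG\<^esub> y) = dsum M (\<lambda>G. fst (word_transport (w @ map (map_prod \<sigma> \<sigma>) v) (\<sigma> \<circ> \<tau>) G))
      (word_map (w @ map (map_prod \<sigma> \<sigma>) v) (\<sigma> \<circ> \<tau>))"
    using mu_eq[OF represents_mult[OF x(2) w y(2) v x(3) y(3)]] by simp
  also have "\<dots> = dsum M (\<lambda>G. fst (word_transport w \<sigma> (fst (word_transport v \<tau> G)))) (\<lambda>G. word_map w \<sigma> (fst (word_transport v \<tau> G)) \<circ> word_map v \<tau> G)"
    by (rule dsum_cong) (simp_all add: word_transport_semidirect word_map_semidirect x(3) y(3))
  also have "\<dots> = compose (hilb_RK M) (mu x) (mu y)"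
    unfolding x(1) y(1) mu_eq[OF w] mu_eq[OF v] by (rule dsum_comp[OF i j, symmetric])
  also have "\<dots> = mu x \<otimes>\<^bsub>Aut_RK M\<^esub> mu y"
    using Aut[OF xy(1)] Aut[OF xy(2)] by (simp add: Aut_RK_def BijGroup_def)
  finally show "mu (x \<otimes>\<^bsub>frakG\<^esub> y) = mu x \<otimes>\<^bsub>Aut_RK M\<^esub> mu y" .
qed

lemma mu_gen_R:
  assumes "\<sigma> \<in> carrier frakR"
  shows "mu (gen_R \<sigma>) = dsum M (relabel \<sigma>) (relabel_map \<sigma>)"
proof -
  have "[] \<in> words" by (simp add: words_def)
  then have "represents (\<one>\<^bsub>frakS\<^esub>) \<sigma> []"
    using word_eq.refl[of "[]"] by (intro represents_word assms) (auto simp: frakS_def word_rel_def)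
  from mu_eq[OF this] show ?thesis
    unfolding gen_R_def by (simp only: word_transport_simps word_map.simps fst_conv) (simp only: dsum_def word_map.simps)
qed

lemma mu_gen_s:
  assumes "a \<ge> 1" "b \<ge> 1"
  shows "mu (gen_s a b) = mu_slide H B M a b"
proof -
  have "[(a, b)] \<in> words" using assms by (simp add: words_def)
  then have "represents (word_rel `` {[(a, b)]}) id [(a, b)]"
    using word_eq.refl[of "[(a, b)]"] by (intro represents_word frakR_id) (auto simp: word_rel_def)
  then have "mu (gen_s a b) = dsum M (\<lambda>G. fst (word_transport [(a, b)] id G)) (word_map [(a, b)] id)"
    unfolding gen_s_def by (rule mu_eq)
  also have "\<dots> = dsum M (slide a b) (slide_map a b)"
    by (rule dsum_cong) (simp_all add: word_transport_simps relabel_id relabel_map_id)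
  also have "\<dots> = mu_slide H B M a b"
    unfolding mu_slide_def by (rule dsum_cong) (simp_all add: slide_map_def)
  finally show ?thesis .
qed

text \<open>Restricted to one summand, the automorphism is the map of a representing word, which
  lands in a single summand and intertwines along the bijection of cilia given by
  \<open>transport\<close>.\<close>

lemma mu_component:
  assumes G: "G \<in> RK" and x: "x \<in> carrier frakG"
  obtains \<Phi> where "act x G \<in> RK" "intertwines G (act x G) (cilia_map x G) \<Phi>"
    "\<And>t. t \<in> hilb M G \<Longrightarrow> mu x (incl G t) = incl (act x G) (\<Phi> t)"
proof -
  obtain X \<sigma> where X: "x = (X, \<sigma>)" "X \<in> carrier frakS" "\<sigma> \<in> carrier frakR"
    using x by (auto simp: frakG_def)
  obtain w where w: "w \<in> X" "\<And>u. u \<in> X \<longleftrightarrow> word_eq w u" using frakS_carrier[OF X(2)] by blast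
  have r: "represents X \<sigma> w" by (rule represents_word) (use w X(3) in auto)
  have t: "transport x G = word_transport w \<sigma> G" unfolding X(1) by (rule transport_eq[OF r G])
  obtain q g where i: "rkinv (\<lambda>G. fst (word_transport w \<sigma> G)) (word_map w \<sigma>) q g" using rkinv_word_map[OF X(3)] by blast
  show ?thesis
  proof (rule that[of "word_map w \<sigma> G"])
    show "act x G \<in> RK" unfolding act_def t by (rule word_transport_RK[OF X(3) G])
    show "intertwines G (act x G) (cilia_map x G) (word_map w \<sigma> G)"
      unfolding act_def cilia_map_def t by (rule word_map_intertwines[OF X(3) G])
    show "mu x (incl G t) = incl (act x G) (word_map w \<sigma> G t)" if "t \<in> hilb M G" for t
      unfolding act_def t X(1) mu_eq[OF r]
      using dsum_incl[OF i G that] \<open>transport x G = word_transport w \<sigma> G\<close> X(1) by simp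
  qed
qed

end

theorem theorem6p9:
  fixes H :: "('k::field, 'h::ring_1) hopf"
    and B :: "'h set"
    and M :: "('k, 'h, 'm::ab_group_add) bimod"
  assumes "hopf_algebra H"
    and "finite_dimensional_vector_space (hscale H) B"
    and "involutive_hopf_bimodule H M"
  shows "\<exists>\<mu> \<in> hom frakG (Aut_RK M).
    (\<forall>i\<ge>1. \<mu> (gen_R (tau i)) = mu_tau M i) \<and>
    (\<forall>\<sigma>\<in>R_perm. \<mu> (gen_R \<sigma>) = mu_perm M \<sigma>) \<and>
    (\<forall>a\<ge>1. \<forall>b\<ge>1. \<mu> (gen_s a b) = mu_slide H B M a b) \<and>
    (\<forall>G\<in>RK. \<forall>x\<in>carrier frakG.
      act x G \<in> RK \<and>
      (\<forall>m\<in>hilb M G. \<mu> x (incl G m) \<in> incl (act x G) ` hilb M (act x G)) \<and>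
      (\<forall>d\<in>double H G. \<forall>m\<in>hilb M G.
        component \<mu> x G (double_act H B M G d m) =
        double_act H B M (act x G) (muhat H x G d) (component \<mu> x G m)))"
proof -
  interpret fd_involutive_hopf_bimodule H M B
    using assms by (simp add: fd_involutive_hopf_bimodule_def fd_hopf_algebra_def fd_hopf_algebra_axioms_def)
  have "mu (gen_R (tau i)) = mu_tau M i" if "i \<ge> 1" for i
    unfolding mu_gen_R[OF tau_frakR[OF that]] mu_tau_def
    by (rule dsum_cong) (simp_all only: relabel_map_tau[OF that])
  moreover have "mu (gen_R \<sigma>) = mu_perm M \<sigma>" if "\<sigma> \<in> R_perm" for \<sigma>
    unfolding mu_gen_R[OF R_perm_props[OF that, THEN conjunct1]] mu_perm_def
    by (rule dsum_cong) (simp_all only: relabel_map_R_perm[OF that])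
  moreover have "act x G \<in> RK \<and>
      (\<forall>m\<in>hilb M G. mu x (incl G m) \<in> incl (act x G) ` hilb M (act x G)) \<and>
      (\<forall>d\<in>double H G. \<forall>m\<in>hilb M G. component mu x G (double_act H B M G d m) =
        double_act H B M (act x G) (muhat H x G d) (component mu x G m))"
    if G: "G \<in> RK" and x: "x \<in> carrier frakG" for G x
  proof -
    interpret g: graph_hilbert H M B G by unfold_locales (rule G)
    obtain \<Phi> where \<Phi>: "act x G \<in> RK" "intertwines G (act x G) (cilia_map x G) \<Phi>"
      "\<And>t. t \<in> hilb M G \<Longrightarrow> mu x (incl G t) = incl (act x G) (\<Phi> t)"
      using mu_component[OF G x] by blast
    \<comment> \<open>\<open>component\<close> reads off the entry at \<open>act x G\<close>, where
      the whole image of the summand is supported.\<close>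
    have c: "component mu x G t = \<Phi> t" if "t \<in> hilb M G" for t
      by (simp only: component_def \<Phi>(3)[OF that]) (simp add: incl_def)
    have "\<Phi> t \<in> hilb M (act x G)" if "t \<in> hilb M G" for t
      using \<Phi>(2) that by (simp add: intertwines_def)
    then show ?thesis
      using \<Phi>(1,3) double_equivariant[OF \<Phi>(2) G \<Phi>(1)] g.double_act_in
      by (simp add: c muhat_def)
  qed
  ultimately show ?thesis using mu_hom mu_gen_s by (intro bexI[of _ mu]) simp_all
qed

end
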